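(* Let $G$ be a Lie group with Lie algebra $\mathfrak g$. Consider the action of the Abelian group $\mathfrak g$ on the symplectic manifold ${}^{1}T^*TG=(G\circledS\mathfrak g_1)\circledS(\mathfrak g_2^*\times\mathfrak g_3^* )$ given by $(\eta;(g,\xi,\mu,\nu))\mapsto(g,\eta+\xi,\mu+ad^*_\eta\nu,\nu)$. With the momentum mapping $$\mathbf J:{}^{1}T^*TG\to\mathfrak g_3^*,\qquad (g,\xi,\mu,\nu)\mapsto\nu,$$ the Marsden–Weinstein reduction of ${}^{1}T^*TG$ by this action, at any $\nu\in\mathfrak g_3^*$, results in a reduced symplectic space $\mathbf J^{-1}(\nu)/\mathfrak g$ isomorphic to $G\circledS\mathfrak g_2^*$ with its canonical symplectic two-form $\Omega_{G\circledS\mathfrak g_2^*}$.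
   Context: Conventions. $G$ is a (finite-dimensional) Lie group with identity $e$, $\mathfrak g=T_eG$, $\mathfrak g^*$ its dual. $R_g$ is right translation. $Ad_g$ is the tangent map at $e$ of $h\mapsto g^{-1}hg$; the Lie bracket is $[\xi,\eta]=ad_\xi\eta=\frac{d}{dt}|_{t=0}Ad_{\exp(t\xi)}\eta$ (the bracket of right invariant vector fields). $ad^*_\xi$ is defined by $\langle ad^*_\xi\mu,\eta\rangle=\langle\mu,[\xi,\eta]\rangle$. Hamiltonian convention: $i_{X_H}\Omega=-dH$. Subscripts on copies of $\mathfrak g,\mathfrak g^*$ are only labels. As a manifold ${}^{1}T^*TG=G\times\mathfrak g\times\mathfrak g^*\times\mathfrak g^*$. For $(\eta,\zeta,\lambda_1,\lambda_2)\in\mathfrak g\times\mathfrak g\times\mathfrak g^*\times\mathfrak g^*$ let $$X_{(\eta,\zeta,\lambda_1,\lambda_2)}(g,\xi,\mu,\nu)=(T_eR_g\eta,\ \zeta+[\xi,\eta],\ \lambda_1+ad^*_\eta\mu+ad^*_\zeta\nu,\ \lambda_2+ad^*_\eta\nu).$$ The symplectic form on ${}^{1}T^*TG$ is determined by $$\Omega(X_{(\eta,\zeta,\lambda_1,\lambda_2)},X_{(\bar\eta,\bar\zeta,\bar\lambda_1,\bar\lambda_2)})=\langle\lambda_1,\bar\eta\rangle+\langle\lambda_2,\bar\zeta\rangle-\langle\bar\lambda_1,\eta\rangle-\langle\bar\lambda_2,\zeta\rangle+\langle\mu,[\eta,\bar\eta]\rangle+\langle\nu,[\eta,\bar\zeta]-[\bar\eta,\zeta]\rangle.$$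 $G\circledS\mathfrak g^*$ (right trivialization of $T^*G$) is $G\times\mathfrak g^*$ as a manifold. With $X_{(\xi,\nu)}(g,\mu)=(T_eR_g\xi,\nu+ad^*_\xi\mu)$ for $(\xi,\nu)\in\mathfrak g\times\mathfrak g^*$, its canonical symplectic form is determined by $$\Omega_{G\circledS\mathfrak g^*}(X_{(\xi,\nu)},X_{(\eta,\lambda)})(g,\mu)=\langle\nu,\eta\rangle-\langle\lambda,\xi\rangle+\langle\mu,[\xi,\eta]\rangle.$$ *)

theory Defs
  imports "HOL-Analysis.Analysis" "HOL-Algebra.Group"
begin

section \<open>Smooth manifolds\<close>

text \<open>Iterated directional derivatives; on an open subset of a finite-dimensional space
  \<open>smooth_on\<close> is the usual notion of a \<open>C\<^sup>\<infinity>\<close> map.\<close>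

primrec times_differentiable_on ::
    "nat \<Rightarrow> 'a::real_normed_vector set \<Rightarrow> ('a \<Rightarrow> 'b::real_normed_vector) \<Rightarrow> bool" where
  "times_differentiable_on 0 S f \<longleftrightarrow> continuous_on S f"
| "times_differentiable_on (Suc n) S f \<longleftrightarrow>
     (\<forall>x\<in>S. f differentiable (at x)) \<and>
     (\<forall>v. times_differentiable_on n S (\<lambda>x. frechet_derivative f (at x) v))"

definition smooth_on ::
    "'a::real_normed_vector set \<Rightarrow> ('a \<Rightarrow> 'b::real_normed_vector) \<Rightarrow> bool" where
  "smooth_on S f \<longleftrightarrow> (\<forall>n. times_differentiable_on n S f)"

text \<open>A chart is a domain together with a coordinate map, which is relevant on the domain only.
  The model space is a normed space, required in \<open>smooth_manifold\<close> to be finite-dimensional.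
  (The class \<open>euclidean_space\<close> would exclude dimension 0 and the type of linear functionals.)\<close>

type_synonym ('a, 'e) chart = "'a set \<times> ('a \<Rightarrow> 'e)"

record ('a, 'e) manifold =
  mtop :: "'a topology"
  atlas :: "('a, 'e) chart set"

abbreviation points :: "('a, 'e) manifold \<Rightarrow> 'a set" where
  "points M \<equiv> topspace (mtop M)"

definition chart_inv :: "('a, 'e) chart \<Rightarrow> 'e \<Rightarrow> 'a" where
  "chart_inv c = inv_into (fst c) (snd c)"

definition charts_at :: "('a, 'e) manifold \<Rightarrow> 'a \<Rightarrow> ('a, 'e) chart set" where
  "charts_at M p = {c \<in> atlas M. p \<in> fst c}"

definition smooth_manifold :: "('a, 'e::real_normed_vector) manifold \<Rightarrow> bool" where
  "smooth_manifold M \<longleftrightarrow>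
     (\<exists>B. finite B \<and> span B = (UNIV :: 'e set)) \<and>
     Hausdorff_space (mtop M) \<and> second_countable (mtop M) \<and>
     (\<Union>c\<in>atlas M. fst c) = points M \<and>
     (\<forall>c\<in>atlas M. openin (mtop M) (fst c) \<and> open (snd c ` fst c) \<and>
        homeomorphic_map (subtopology (mtop M) (fst c)) (top_of_set (snd c ` fst c)) (snd c)) \<and>
     (\<forall>c\<in>atlas M. \<forall>d\<in>atlas M. smooth_on (snd c ` (fst c \<inter> fst d)) (snd d \<circ> chart_inv c))"

definition smooth_map ::
    "('a, 'e::real_normed_vector) manifold \<Rightarrow> ('b, 'f::real_normed_vector) manifold \<Rightarrow>
     ('a \<Rightarrow> 'b) \<Rightarrow> bool" where
  "smooth_map M N f \<longleftrightarrow> continuous_map (mtop M) (mtop N) f \<and>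
     (\<forall>c\<in>atlas M. \<forall>d\<in>atlas N.
        smooth_on (snd c ` (fst c \<inter> f -` fst d)) (snd d \<circ> f \<circ> chart_inv c))"

definition diffeomorphism ::
    "('a, 'e::real_normed_vector) manifold \<Rightarrow> ('b, 'f::real_normed_vector) manifold \<Rightarrow>
     ('a \<Rightarrow> 'b) \<Rightarrow> bool" where
  "diffeomorphism M N f \<longleftrightarrow> bij_betw f (points M) (points N) \<and>
     smooth_map M N f \<and> smooth_map N M (inv_into (points M) f)"

definition vec_chart :: "('v, 'v) chart" where
  "vec_chart = (UNIV, id)"

definition vec_mfd :: "('v::real_normed_vector, 'v) manifold" where
  "vec_mfd = \<lparr>mtop = euclidean, atlas = {vec_chart}\<rparr>"

definition prod_chart :: "('a, 'e) chart \<Rightarrow> ('b, 'f) chart \<Rightarrow> ('a \<times> 'b, 'e \<times> 'f) chart" where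
  "prod_chart c d = (fst c \<times> fst d, map_prod (snd c) (snd d))"

definition prod_mfd ::
    "('a, 'e) manifold \<Rightarrow> ('b, 'f) manifold \<Rightarrow> ('a \<times> 'b, 'e \<times> 'f) manifold" where
  "prod_mfd M N =
     \<lparr>mtop = prod_topology (mtop M) (mtop N),
      atlas = (\<lambda>(c, d). prod_chart c d) ` (atlas M \<times> atlas N)\<rparr>"


section \<open>Tangent vectors\<close>

text \<open>A tangent vector at \<open>p\<close> is the family of its coordinate vectors in the charts at \<open>p\<close>,
  related to each other by the derivatives of the coordinate changes.\<close>

type_synonym ('a, 'e) tvec = "('a, 'e) chart \<Rightarrow> 'e"

definition chart_change ::
    "'a \<Rightarrow> ('a, 'e::real_normed_vector) chart \<Rightarrow> ('a, 'e) chart \<Rightarrow> 'e \<Rightarrow> 'e" where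
  "chart_change p c d = frechet_derivative (snd d \<circ> chart_inv c) (at (snd c p))"

definition tangent_space ::
    "('a, 'e::real_normed_vector) manifold \<Rightarrow> 'a \<Rightarrow> ('a, 'e) tvec set" where
  "tangent_space M p =
     {v. (\<forall>c\<in>charts_at M p. \<forall>d\<in>charts_at M p. v d = chart_change p c d (v c)) \<and>
         (\<forall>c. c \<notin> charts_at M p \<longrightarrow> v c = 0)}"

text \<open>The tangent vector at \<open>p\<close> with coordinates \<open>x\<close> in the chart \<open>c\<close>.\<close>

definition tvec_of ::
    "('a, 'e::real_normed_vector) manifold \<Rightarrow> ('a, 'e) chart \<Rightarrow> 'a \<Rightarrow> 'e \<Rightarrow> ('a, 'e) tvec" where
  "tvec_of M c p x = (\<lambda>d. if d \<in> charts_at M p then chart_change p c d x else 0)"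

text \<open>The result does not depend on the chart \<open>c\<close> at \<open>p\<close> that is selected.\<close>

definition tangent_map ::
    "('a, 'e::real_normed_vector) manifold \<Rightarrow> ('b, 'f::real_normed_vector) manifold \<Rightarrow>
     ('a \<Rightarrow> 'b) \<Rightarrow> 'a \<Rightarrow> ('a, 'e) tvec \<Rightarrow> ('b, 'f) tvec" where
  "tangent_map M N f p v =
     (let c = (SOME c. c \<in> charts_at M p)
      in (\<lambda>d. if d \<in> charts_at N (f p)
              then frechet_derivative (snd d \<circ> f \<circ> chart_inv c) (at (snd c p)) (v c) else 0))"

definition velocity ::
    "('a, 'e::real_normed_vector) manifold \<Rightarrow> (real \<Rightarrow> 'a) \<Rightarrow> real \<Rightarrow> ('a, 'e) tvec" where
  "velocity M \<gamma> t =
     (\<lambda>c. if c \<in> charts_at M (\<gamma> t) then vector_derivative (snd c \<circ> \<gamma>) (at t) else 0)"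

definition differential ::
    "('a, 'e::real_normed_vector) manifold \<Rightarrow> ('a \<Rightarrow> real) \<Rightarrow> 'a \<Rightarrow> ('a, 'e) tvec \<Rightarrow> real" where
  "differential M H p v = tangent_map M vec_mfd H p v vec_chart"

text \<open>The pair \<open>(v, w)\<close> with \<open>v\<close> tangent to \<open>M\<close> at \<open>p\<close> and \<open>w\<close> in the vector space \<open>'v\<close>, as a
  tangent vector of \<open>M \<times> 'v\<close> at \<open>(p, q)\<close>; again independent of the selected chart.\<close>

definition tvec_pair ::
    "('a, 'e::real_normed_vector) manifold \<Rightarrow> 'a \<Rightarrow> 'v::real_normed_vector \<Rightarrow>
     ('a, 'e) tvec \<Rightarrow> 'v \<Rightarrow> ('a \<times> 'v, 'e \<times> 'v) tvec" where
  "tvec_pair M p q v w =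
     (let c = (SOME c. c \<in> charts_at M p)
      in tvec_of (prod_mfd M vec_mfd) (prod_chart c vec_chart) (p, q) (v c, w))"


section \<open>Symplectic manifolds\<close>

type_synonym ('a, 'e) two_form = "'a \<Rightarrow> ('a, 'e) tvec \<Rightarrow> ('a, 'e) tvec \<Rightarrow> real"

definition form_coords ::
    "('a, 'e::real_normed_vector) manifold \<Rightarrow> ('a, 'e) two_form \<Rightarrow> ('a, 'e) chart \<Rightarrow>
     'e \<Rightarrow> 'e \<Rightarrow> 'e \<Rightarrow> real" where
  "form_coords M \<Omega> c u x y =
     \<Omega> (chart_inv c u) (tvec_of M c (chart_inv c u) x) (tvec_of M c (chart_inv c u) y)"

definition smooth_two_form ::
    "('a, 'e::real_normed_vector) manifold \<Rightarrow> ('a, 'e) two_form \<Rightarrow> bool" where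
  "smooth_two_form M \<Omega> \<longleftrightarrow>
     (\<forall>c\<in>atlas M.
        (\<forall>u\<in>snd c ` fst c. bilinear (form_coords M \<Omega> c u) \<and> (\<forall>x. form_coords M \<Omega> c u x x = 0)) \<and>
        (\<forall>x y. smooth_on (snd c ` fst c) (\<lambda>u. form_coords M \<Omega> c u x y)))"

definition closed_two_form ::
    "('a, 'e::real_normed_vector) manifold \<Rightarrow> ('a, 'e) two_form \<Rightarrow> bool" where
  "closed_two_form M \<Omega> \<longleftrightarrow>
     (\<forall>c\<in>atlas M. \<forall>u\<in>snd c ` fst c. \<forall>x y z.
        frechet_derivative (\<lambda>u. form_coords M \<Omega> c u y z) (at u) x
      + frechet_derivative (\<lambda>u. form_coords M \<Omega> c u z x) (at u) y
      + frechet_derivative (\<lambda>u. form_coords M \<Omega> c u x y) (at u) z = 0)"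

definition nondegenerate_two_form ::
    "('a, 'e::real_normed_vector) manifold \<Rightarrow> ('a, 'e) two_form \<Rightarrow> bool" where
  "nondegenerate_two_form M \<Omega> \<longleftrightarrow>
     (\<forall>p\<in>points M. \<forall>v\<in>tangent_space M p.
        (\<forall>w\<in>tangent_space M p. \<Omega> p v w = 0) \<longrightarrow> v = (\<lambda>_. 0))"

definition symplectic_manifold ::
    "('a, 'e::real_normed_vector) manifold \<Rightarrow> ('a, 'e) two_form \<Rightarrow> bool" where
  "symplectic_manifold M \<Omega> \<longleftrightarrow> smooth_manifold M \<and> smooth_two_form M \<Omega> \<and>
     closed_two_form M \<Omega> \<and> nondegenerate_two_form M \<Omega>"

text \<open>\<open>f\<^sup>*\<omega> = \<Omega>\<close>\<close>

definition pulls_back_to ::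
    "('a, 'e::real_normed_vector) manifold \<Rightarrow> ('b, 'f::real_normed_vector) manifold \<Rightarrow>
     ('a \<Rightarrow> 'b) \<Rightarrow> ('b, 'f) two_form \<Rightarrow> ('a, 'e) two_form \<Rightarrow> bool" where
  "pulls_back_to M N f \<omega> \<Omega> \<longleftrightarrow>
     (\<forall>p\<in>points M. \<forall>v\<in>tangent_space M p. \<forall>w\<in>tangent_space M p.
        \<omega> (f p) (tangent_map M N f p v) (tangent_map M N f p w) = \<Omega> p v w)"

definition symplectomorphic ::
    "('a, 'e::real_normed_vector) manifold \<Rightarrow> ('a, 'e) two_form \<Rightarrow>
     ('b, 'f::real_normed_vector) manifold \<Rightarrow> ('b, 'f) two_form \<Rightarrow> bool" where
  "symplectomorphic M \<Omega> N \<omega> \<longleftrightarrow> (\<exists>f. diffeomorphism M N f \<and> pulls_back_to M N f \<omega> \<Omega>)"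


section \<open>Reduction by actions of vector groups\<close>

text \<open>The acting group is a vector space \<open>'v\<close> under addition. It is its own Lie algebra, with
  exponential map the identity and trivial coadjoint action. Hence the generator of \<open>\<eta>\<close> is the
  velocity of \<open>t \<mapsto> t\<eta> \<cdot> p\<close>, equivariance of a momentum map is invariance, and the isotropy group
  of every momentum value is the whole group.\<close>

definition symplectic_action ::
    "('a, 'e::real_normed_vector) manifold \<Rightarrow> ('a, 'e) two_form \<Rightarrow>
     ('v::real_normed_vector \<Rightarrow> 'a \<Rightarrow> 'a) \<Rightarrow> bool" where
  "symplectic_action M \<Omega> act \<longleftrightarrow>
     smooth_map (prod_mfd vec_mfd M) M (\<lambda>(\<eta>, p). act \<eta> p) \<and>
     (\<forall>p\<in>points M. act 0 p = p) \<and>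
     (\<forall>\<eta> \<zeta>. \<forall>p\<in>points M. act (\<eta> + \<zeta>) p = act \<eta> (act \<zeta> p)) \<and>
     (\<forall>\<eta>. pulls_back_to M M (act \<eta>) \<Omega> \<Omega>)"

definition generator ::
    "('a, 'e::real_normed_vector) manifold \<Rightarrow> ('v::real_normed_vector \<Rightarrow> 'a \<Rightarrow> 'a) \<Rightarrow>
     'v \<Rightarrow> 'a \<Rightarrow> ('a, 'e) tvec" where
  "generator M act \<eta> p = velocity M (\<lambda>t. act (t *\<^sub>R \<eta>) p) 0"

text \<open>Sign convention: the generator of \<open>\<eta>\<close> is the Hamiltonian vector field of
  \<open>H = \<langle>J, \<eta>\<rangle>\<close>, where \<open>\<Omega>(X\<^sub>H, \<cdot>) = - dH\<close>.\<close>

definition momentum_map ::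
    "('a, 'e::real_normed_vector) manifold \<Rightarrow> ('a, 'e) two_form \<Rightarrow>
     ('v::real_normed_vector \<Rightarrow> 'a \<Rightarrow> 'a) \<Rightarrow> ('a \<Rightarrow> ('v \<Rightarrow>\<^sub>L real)) \<Rightarrow> bool" where
  "momentum_map M \<Omega> act J \<longleftrightarrow> smooth_map M vec_mfd J \<and>
     (\<forall>\<eta>. \<forall>p\<in>points M. \<forall>v\<in>tangent_space M p.
        \<Omega> p (generator M act \<eta> p) v = - differential M (\<lambda>q. blinfun_apply (J q) \<eta>) p v) \<and>
     (\<forall>\<eta>. \<forall>p\<in>points M. J (act \<eta> p) = J p)"

definition regular_value ::
    "('a, 'e::real_normed_vector) manifold \<Rightarrow> ('b, 'f::real_normed_vector) manifold \<Rightarrow>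
     ('a \<Rightarrow> 'b) \<Rightarrow> 'b \<Rightarrow> bool" where
  "regular_value M N f y \<longleftrightarrow>
     (\<forall>p\<in>points M. f p = y \<longrightarrow> tangent_map M N f p ` tangent_space M p = tangent_space N y)"

definition embedded_submanifold ::
    "('a, 'e::real_normed_vector) manifold \<Rightarrow> ('a, 'f::real_normed_vector) manifold \<Rightarrow> bool" where
  "embedded_submanifold M N \<longleftrightarrow> smooth_manifold N \<and> points N \<subseteq> points M \<and>
     mtop N = subtopology (mtop M) (points N) \<and> smooth_map N M id \<and>
     (\<forall>p\<in>points N. inj_on (tangent_map N M id p) (tangent_space N p))"

definition submersion ::
    "('a, 'e::real_normed_vector) manifold \<Rightarrow> ('b, 'f::real_normed_vector) manifold \<Rightarrow>
     ('a \<Rightarrow> 'b) \<Rightarrow> bool" where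
  "submersion M N f \<longleftrightarrow> smooth_map M N f \<and>
     (\<forall>p\<in>points M. tangent_map M N f p ` tangent_space M p = tangent_space N (f p))"

definition orbit :: "('v \<Rightarrow> 'a \<Rightarrow> 'a) \<Rightarrow> 'a \<Rightarrow> 'a set" where
  "orbit act p = range (\<lambda>\<eta>. act \<eta> p)"

text \<open>\<open>(P, \<omega>)\<close> is the Marsden-Weinstein reduced space of \<open>M\<close> at \<open>\<nu>\<close>: \<open>N\<close> is the level set
  \<open>J\<^sup>-\<^sup>1(\<nu>)\<close> as an embedded submanifold, \<open>P\<close> is its orbit space with the manifold structure making the
  projection \<open>\<pi>\<close> a submersion, and \<open>\<omega>\<close> is the symplectic form with \<open>\<pi>\<^sup>*\<omega> = i\<^sup>*\<Omega>\<close> for the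
  inclusion \<open>i\<close> of \<open>N\<close> in \<open>M\<close>.\<close>

definition marsden_weinstein_reduction ::
    "('a, 'e::real_normed_vector) manifold \<Rightarrow> ('a, 'e) two_form \<Rightarrow>
     ('v::real_normed_vector \<Rightarrow> 'a \<Rightarrow> 'a) \<Rightarrow> ('a \<Rightarrow> ('v \<Rightarrow>\<^sub>L real)) \<Rightarrow> ('v \<Rightarrow>\<^sub>L real) \<Rightarrow>
     ('a, 'f::real_normed_vector) manifold \<Rightarrow>
     ('a set, 'h::real_normed_vector) manifold \<Rightarrow> ('a set, 'h) two_form \<Rightarrow> bool" where
  "marsden_weinstein_reduction M \<Omega> act J \<nu> N P \<omega> \<longleftrightarrow>
     regular_value M vec_mfd J \<nu> \<and>
     embedded_submanifold M N \<and> points N = {p \<in> points M. J p = \<nu>} \<and>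
     symplectic_manifold P \<omega> \<and> points P = orbit act ` points N \<and>
     submersion N P (orbit act) \<and>
     pulls_back_to N P (orbit act) \<omega>
       (\<lambda>p v w. \<Omega> p (tangent_map N M id p v) (tangent_map N M id p w))"


section \<open>Lie groups\<close>

record ('g, 'e) lie_group_data = "'g monoid" +
  mfd :: "('g, 'e) manifold"

definition lie_group :: "('g, 'e::real_normed_vector) lie_group_data \<Rightarrow> bool" where
  "lie_group G \<longleftrightarrow> group G \<and> smooth_manifold (mfd G) \<and> points (mfd G) = carrier G \<and>
     smooth_map (prod_mfd (mfd G) (mfd G)) (mfd G) (\<lambda>(g, h). g \<otimes>\<^bsub>G\<^esub> h) \<and>
     smooth_map (mfd G) (mfd G) (\<lambda>g. inv\<^bsub>G\<^esub> g)"

text \<open>Throughout, \<open>c\<^sub>0\<close> is a chart at the identity. The Lie algebra \<open>T\<^sub>eG\<close> is identified with the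
  model space \<open>'e\<close> by taking coordinates in \<open>c\<^sub>0\<close>, and its dual is \<open>'e \<Rightarrow>\<^sub>L real\<close> (every linear
  functional is bounded because \<open>'e\<close> is finite-dimensional).\<close>

context
  fixes G :: "('g, 'e::real_normed_vector) lie_group_data" (structure)
    and c\<^sub>0 :: "('g, 'e) chart"
begin

definition lie_tvec :: "'e \<Rightarrow> ('g, 'e) tvec" where
  "lie_tvec \<xi> = tvec_of (mfd G) c\<^sub>0 \<one> \<xi>"

text \<open>\<open>T\<^sub>eR\<^sub>g \<eta>\<close>\<close>

definition right_transl :: "'g \<Rightarrow> 'e \<Rightarrow> ('g, 'e) tvec" where
  "right_transl g \<eta> = tangent_map (mfd G) (mfd G) (\<lambda>h. h \<otimes> g) \<one> (lie_tvec \<eta>)"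

definition lie_Ad :: "'g \<Rightarrow> 'e \<Rightarrow> 'e" where
  "lie_Ad g \<eta> = tangent_map (mfd G) (mfd G) (\<lambda>h. inv g \<otimes> h \<otimes> g) \<one> (lie_tvec \<eta>) c\<^sub>0"

definition one_param_subgroup :: "(real \<Rightarrow> 'g) \<Rightarrow> 'e \<Rightarrow> bool" where
  "one_param_subgroup \<gamma> \<xi> \<longleftrightarrow> smooth_map vec_mfd (mfd G) \<gamma> \<and>
     (\<forall>s t. \<gamma> (s + t) = \<gamma> s \<otimes> \<gamma> t) \<and> velocity (mfd G) \<gamma> 0 = lie_tvec \<xi>"

definition lie_exp :: "'e \<Rightarrow> 'g" where
  "lie_exp \<xi> = (THE \<gamma>. one_param_subgroup \<gamma> \<xi>) 1"

definition bracket :: "'e \<Rightarrow> 'e \<Rightarrow> 'e" where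
  "bracket \<xi> \<eta> = vector_derivative (\<lambda>t. lie_Ad (lie_exp (t *\<^sub>R \<xi>)) \<eta>) (at 0)"

definition ad_star :: "'e \<Rightarrow> ('e \<Rightarrow>\<^sub>L real) \<Rightarrow> ('e \<Rightarrow>\<^sub>L real)" where
  "ad_star \<xi> \<mu> = Blinfun (\<lambda>\<eta>. blinfun_apply \<mu> (bracket \<xi> \<eta>))"


subsection \<open>The symplectic manifold \<open>G \<circledS> \<gg>\<^sup>*\<close>\<close>

definition TG_dual :: "('g \<times> ('e \<Rightarrow>\<^sub>L real), 'e \<times> ('e \<Rightarrow>\<^sub>L real)) manifold" where
  "TG_dual = prod_mfd (mfd G) vec_mfd"

fun TG_dual_frame :: "'e \<times> ('e \<Rightarrow>\<^sub>L real) \<Rightarrow> 'g \<times> ('e \<Rightarrow>\<^sub>L real) \<Rightarrow>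
    ('g \<times> ('e \<Rightarrow>\<^sub>L real), 'e \<times> ('e \<Rightarrow>\<^sub>L real)) tvec" where
  "TG_dual_frame (\<xi>, \<nu>) (g, \<mu>) = tvec_pair (mfd G) g \<mu> (right_transl g \<xi>) (\<nu> + ad_star \<xi> \<mu>)"

fun TG_dual_form_frame :: "'g \<times> ('e \<Rightarrow>\<^sub>L real) \<Rightarrow>
    'e \<times> ('e \<Rightarrow>\<^sub>L real) \<Rightarrow> 'e \<times> ('e \<Rightarrow>\<^sub>L real) \<Rightarrow> real" where
  "TG_dual_form_frame (g, \<mu>) (\<xi>, \<nu>) (\<eta>, l) =
     blinfun_apply \<nu> \<eta> - blinfun_apply l \<xi> + blinfun_apply \<mu> (bracket \<xi> \<eta>)"

text \<open>At every point the frame is a linear isomorphism onto the tangent space, so the values on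
  frame vectors determine the form.\<close>

definition TG_dual_form :: "('g \<times> ('e \<Rightarrow>\<^sub>L real), 'e \<times> ('e \<Rightarrow>\<^sub>L real)) two_form" where
  "TG_dual_form z v w = TG_dual_form_frame z
     (THE a. TG_dual_frame a z = v) (THE b. TG_dual_frame b z = w)"


subsection \<open>The symplectic manifold \<open>\<^sup>1T\<^sup>*TG = (G \<circledS> \<gg>) \<circledS> (\<gg>\<^sup>* \<times> \<gg>\<^sup>*)\<close>\<close>

definition T1 :: "('g \<times> 'e \<times> ('e \<Rightarrow>\<^sub>L real) \<times> ('e \<Rightarrow>\<^sub>L real),
    'e \<times> 'e \<times> ('e \<Rightarrow>\<^sub>L real) \<times> ('e \<Rightarrow>\<^sub>L real)) manifold" where
  "T1 = prod_mfd (mfd G) vec_mfd"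

fun T1_frame :: "'e \<times> 'e \<times> ('e \<Rightarrow>\<^sub>L real) \<times> ('e \<Rightarrow>\<^sub>L real) \<Rightarrow>
    'g \<times> 'e \<times> ('e \<Rightarrow>\<^sub>L real) \<times> ('e \<Rightarrow>\<^sub>L real) \<Rightarrow>
    ('g \<times> 'e \<times> ('e \<Rightarrow>\<^sub>L real) \<times> ('e \<Rightarrow>\<^sub>L real),
     'e \<times> 'e \<times> ('e \<Rightarrow>\<^sub>L real) \<times> ('e \<Rightarrow>\<^sub>L real)) tvec" where
  "T1_frame (\<eta>, \<zeta>, l1, l2) (g, \<xi>, \<mu>, \<nu>) =
     tvec_pair (mfd G) g (\<xi>, \<mu>, \<nu>) (right_transl g \<eta>)
       (\<zeta> + bracket \<xi> \<eta>, l1 + ad_star \<eta> \<mu> + ad_star \<zeta> \<nu>, l2 + ad_star \<eta> \<nu>)"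

fun T1_form_frame :: "'g \<times> 'e \<times> ('e \<Rightarrow>\<^sub>L real) \<times> ('e \<Rightarrow>\<^sub>L real) \<Rightarrow>
    'e \<times> 'e \<times> ('e \<Rightarrow>\<^sub>L real) \<times> ('e \<Rightarrow>\<^sub>L real) \<Rightarrow>
    'e \<times> 'e \<times> ('e \<Rightarrow>\<^sub>L real) \<times> ('e \<Rightarrow>\<^sub>L real) \<Rightarrow> real" where
  "T1_form_frame (g, \<xi>, \<mu>, \<nu>) (\<eta>, \<zeta>, l1, l2) (\<eta>', \<zeta>', l1', l2') =
     blinfun_apply l1 \<eta>' + blinfun_apply l2 \<zeta>' - blinfun_apply l1' \<eta> - blinfun_apply l2' \<zeta>
     + blinfun_apply \<mu> (bracket \<eta> \<eta>') + blinfun_apply \<nu> (bracket \<eta> \<zeta>' - bracket \<eta>' \<zeta>)"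

definition T1_form :: "('g \<times> 'e \<times> ('e \<Rightarrow>\<^sub>L real) \<times> ('e \<Rightarrow>\<^sub>L real),
    'e \<times> 'e \<times> ('e \<Rightarrow>\<^sub>L real) \<times> ('e \<Rightarrow>\<^sub>L real)) two_form" where
  "T1_form z v w = T1_form_frame z (THE a. T1_frame a z = v) (THE b. T1_frame b z = w)"

fun T1_action :: "'e \<Rightarrow> 'g \<times> 'e \<times> ('e \<Rightarrow>\<^sub>L real) \<times> ('e \<Rightarrow>\<^sub>L real) \<Rightarrow>
    'g \<times> 'e \<times> ('e \<Rightarrow>\<^sub>L real) \<times> ('e \<Rightarrow>\<^sub>L real)" where
  "T1_action \<eta> (g, \<xi>, \<mu>, \<nu>) = (g, \<eta> + \<xi>, \<mu> + ad_star \<eta> \<nu>, \<nu>)"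

fun T1_momentum :: "'g \<times> 'e \<times> ('e \<Rightarrow>\<^sub>L real) \<times> ('e \<Rightarrow>\<^sub>L real) \<Rightarrow> ('e \<Rightarrow>\<^sub>L real)" where
  "T1_momentum (g, \<xi>, \<mu>, \<nu>) = \<nu>"

end

end

theory Submission
  imports Defs
begin

text \<open>In the right trivialization all the forms have constant coefficients along the group up to
the Maurer-Cartan form \<open>\<rho>\<close>. For \<open>w = (\<xi>, \<mu>, \<nu>)\<close> and tangent vectors with components
\<open>(\<eta>, z, m, n)\<close> the form on \<open>\<^sup>1T\<^sup>*TG\<close> is
\<open>\<langle>m, \<eta>'\<rangle> - \<langle>m', \<eta>\<rangle> + \<langle>n, z' - [\<xi>, \<eta>']\<rangle> - \<langle>n', z - [\<xi>, \<eta>]\<rangle> - \<langle>\<mu>, [\<eta>, \<eta>']\<rangle> - \<langle>\<nu>, [z, \<eta>']\<rangle>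
  + \<langle>\<nu>, [z', \<eta>]\<rangle> + \<langle>\<nu>, [\<xi>, [\<eta>, \<eta>']]\<rangle>\<close>,
so closedness reduces to the Maurer-Cartan equation
\<open>d\<rho>(x, y) = - [\<rho> x, \<rho> y]\<close> and the Jacobi identity. On \<open>J\<^sup>-\<^sup>1(\<nu>)\<close> the substitution
\<open>\<mu> \<mapsto> \<mu> - ad\<^sup>*\<^sub>\<xi> \<nu>\<close> separates the orbits and carries the form to that of \<open>G \<times> \<gg>\<^sup>*\<close>, since \<open>n = 0\<close> there.

The bracket is given by one-parameter subgroups, whose existence needs the Picard-Lindeloef theorem. If
\<open>x\<close> and \<open>y\<close> are integral curves of one right-invariant vector field, then \<open>x\<inverse> y\<close> is constant; this
makes integral curves one-parameter subgroups and yields uniqueness. In a chart at the identity,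
\<open>[\<xi>, \<eta>] = B(\<eta>, \<xi>) - B(\<xi>, \<eta>)\<close> for the mixed second derivative \<open>B\<close> of the multiplication.\<close>

section \<open>Finite-dimensional normed spaces\<close>

text \<open>Finite-dimensionality is a hypothesis on normed spaces, so boundedness of linear maps,
  second countability and the solution of differential equations all rest on one fact: coordinates
  along a basis are bounded functionals. The same coordinates carry the calculus.
  \<open>smooth_on\<close> iterates derivatives in fixed directions, while the chain rule yields
  derivatives in directions that move with the point; expanding such a direction along a basis
  restores fixed ones. The reduced space has orbits, that is sets, as points, and the level set is
  cut out by an equation. Both receive their manifold structure by transport along explicit
  injections from products of the group with a vector space. Sections and retractions written down
  by hand then give embedding, regularity and submersion through the chain rule, and the form on the
  orbit space is the transported canonical form. What remains is to identify its pullback to the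
  level set with the restriction of the form on the large space.\<close>

definition findim :: "'a::real_normed_vector itself \<Rightarrow> bool" where
  "findim _ \<longleftrightarrow> (\<exists>B::'a set. finite B \<and> span B = UNIV)"

lemma findim_independent:
  assumes "findim TYPE('a::real_normed_vector)"
  obtains B :: "'a::real_normed_vector set" where "finite B" "independent B" "span B = UNIV"
proof -
  obtain B :: "'a set" where B: "finite B" "span B = UNIV"
    using assms by (auto simp: findim_def)
  obtain C where "C \<subseteq> B" "independent C" "B \<subseteq> span C"
    using maximal_independent_subset[of B] by blast
  then show thesis
    using that[of C] B by (metis UNIV_I finite_subset span_mono span_span subset_antisym subset_UNIV)
qed

text \<open>On the compact set of coefficients with absolute sum 1 the norm of the combination
  attains a minimum. Independence makes it positive, and scaling extends the bound to all
  coefficients.\<close>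

lemma norm_combination_bounded_below:
  fixes B :: "'a::real_normed_vector set"
  assumes "finite B" "independent B"
  obtains K where "K > 0" "\<And>u b. b \<in> B \<Longrightarrow> \<bar>u b\<bar> \<le> K * norm (\<Sum>b\<in>B. u b *\<^sub>R b)"
proof (cases "B = {}")
  case True
  then show thesis using that[of 1] by auto
next
  case False
  \<comment> \<open>Coefficients are functions on the whole type that vanish outside
    \<open>B\<close>. The ambient space is then a full product of copies of the reals, and
    compactness of \<open>Q\<close> is Tychonoff's theorem.\<close>
  define Q where "Q = PiE UNIV (\<lambda>b. if b \<in> B then {-1..1} else {0::real})"
  define S where "S = Q \<inter> {u. (\<Sum>b\<in>B. \<bar>u b\<bar>) = 1}"
  have "compactin (product_topology (\<lambda>i. euclidean) UNIV) Q"
    unfolding Q_def by (subst compactin_PiE) auto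
  then have cQ: "compact Q" by (simp add: euclidean_product_topology)
  have cont: "continuous_on UNIV (\<lambda>u::'a\<Rightarrow>real. u b)" for b
    by (intro continuous_on_product_coordinates)
  have "closed {u::'a\<Rightarrow>real. (\<Sum>b\<in>B. \<bar>u b\<bar>) = 1}"
    by (intro closed_Collect_eq continuous_intros cont)
  with cQ have cS: "compact S" unfolding S_def by blast
  obtain b0 where "b0 \<in> B" using False by auto
  have "(\<lambda>b. if b = b0 then 1 else 0) \<in> S"
    unfolding S_def Q_def using \<open>b0 \<in> B\<close> assms(1)
    by (simp add: PiE_iff if_distrib[of abs] cong: if_cong)
  then have ne: "S \<noteq> {}" by auto
  have "continuous_on S (\<lambda>u. norm (\<Sum>b\<in>B. u b *\<^sub>R b))"
    by (intro continuous_intros continuous_on_subset[OF cont]) auto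
  from continuous_attains_inf[OF cS ne this]
  obtain v where v: "v \<in> S" "\<And>u. u \<in> S \<Longrightarrow> norm (\<Sum>b\<in>B. v b *\<^sub>R b) \<le> norm (\<Sum>b\<in>B. u b *\<^sub>R b)"
    by blast
  define m where "m = norm (\<Sum>b\<in>B. v b *\<^sub>R b)"
  have "m \<noteq> 0"
  proof
    assume "m = 0"
    then have "(\<Sum>b\<in>B. v b *\<^sub>R b) = 0" by (simp add: m_def)
    then have "\<forall>b\<in>B. v b = 0" using assms independentD by blast
    then show False using v(1) by (auto simp: S_def)
  qed
  then have m: "m > 0" by (simp add: m_def)
  have "\<bar>u b\<bar> \<le> (1/m) * norm (\<Sum>b\<in>B. u b *\<^sub>R b)" if b: "b \<in> B" for u b
  proof -
    define s where "s = (\<Sum>b\<in>B. \<bar>u b\<bar>)"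
    have le: "\<bar>u b\<bar> \<le> s" if "b \<in> B" for b
      unfolding s_def using assms(1) that by (intro member_le_sum) auto
    show ?thesis
    proof (cases "s = 0")
      case True
      then show ?thesis using le[OF b] m by simp
    next
      case False
      then have s: "s > 0" by (simp add: s_def sum_nonneg less_le)
      define w where "w = (\<lambda>b. if b \<in> B then u b / s else 0)"
      have "\<bar>w b\<bar> \<le> 1" for b using s le[of b] by (simp add: w_def)
      then have "-1 \<le> w b \<and> w b \<le> 1" for b by (simp add: abs_le_iff minus_le_iff)
      moreover have "w b = 0" if "b \<notin> B" for b using that by (simp add: w_def)
      ultimately have "w \<in> Q" by (simp add: Q_def PiE_iff)
      moreover have "(\<Sum>b\<in>B. \<bar>w b\<bar>) = (\<Sum>b\<in>B. \<bar>u b\<bar> / s)"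
        using s by (intro sum.cong) (auto simp: w_def)
      then have "(\<Sum>b\<in>B. \<bar>w b\<bar>) = 1"
        using s by (simp add: s_def sum_divide_distrib[symmetric])
      ultimately have "w \<in> S" by (simp add: S_def)
      then have "m \<le> norm (\<Sum>b\<in>B. w b *\<^sub>R b)" using v(2) by (simp add: m_def)
      also have "(\<Sum>b\<in>B. w b *\<^sub>R b) = (1/s) *\<^sub>R (\<Sum>b\<in>B. u b *\<^sub>R b)"
        by (simp add: w_def scaleR_sum_right)
      finally have "m * s \<le> norm (\<Sum>b\<in>B. u b *\<^sub>R b)" using s by (simp add: field_simps)
      then have "m * \<bar>u b\<bar> \<le> norm (\<Sum>b\<in>B. u b *\<^sub>R b)"
        using mult_left_mono[OF le[OF b], of m] m by linarith
      then show ?thesis using m by (simp add: field_simps)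
    qed
  qed
  then show thesis using that[of "1/m"] m by auto
qed

text \<open>\<open>representation\<close> supplies the coordinates and the preceding bound makes
  them continuous. For \<open>b\<close> outside \<open>B\<close> the functional is zero, so
  boundedness holds for every \<open>b\<close> and carries no side condition.\<close>

lemma findim_coordinates:
  assumes "findim TYPE('a::real_normed_vector)"
  obtains B :: "'a::real_normed_vector set" and coord :: "'a::real_normed_vector \<Rightarrow> 'a \<Rightarrow> real"
  where "finite B" "\<And>b. bounded_linear (coord b)" "\<And>x. x = (\<Sum>b\<in>B. coord b x *\<^sub>R b)"
proof -
  obtain B :: "'a set" where B: "finite B" "independent B" "span B = UNIV"
    using findim_independent[OF assms] by blast
  obtain K where K: "K > 0" "\<And>u b. b \<in> B \<Longrightarrow> \<bar>u b\<bar> \<le> K * norm (\<Sum>b\<in>B. u b *\<^sub>R b)"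
    using norm_combination_bounded_below[OF B(1,2)] by metis
  define coord where "coord = (\<lambda>b x. representation B x b)"
  have eq: "x = (\<Sum>b\<in>B. coord b x *\<^sub>R b)" for x
    unfolding coord_def using B by (simp add: sum_representation_eq)
  have "bounded_linear (coord b)" for b
  proof (rule bounded_linear_intro[where K=K])
    show "coord b (x + y) = coord b x + coord b y" for x y
      unfolding coord_def using B by (simp add: representation_add)
    show "coord b (r *\<^sub>R x) = r *\<^sub>R coord b x" for r x
      unfolding coord_def using B by (simp add: representation_scale)
    show "norm (coord b x) \<le> norm x * K" for x
    proof (cases "b \<in> B")
      case True
      then show ?thesis using K(2)[OF True, of "\<lambda>b. coord b x"] eq[of x] by (simp add: mult.commute)
    next
      case False
      then have "coord b x = 0"
        unfolding coord_def using representation_ne_zero by blast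
      then show ?thesis using K by simp
    qed
  qed
  then show thesis using that B(1) eq by blast
qed

lemma linear_imp_bounded_linear:
  fixes f :: "'a::real_normed_vector \<Rightarrow> 'b::real_normed_vector"
  assumes "findim TYPE('a::real_normed_vector)" "linear f"
  shows "bounded_linear f"
proof -
  obtain B :: "'a set" and coord where B: "finite B" "\<And>b. bounded_linear (coord b)"
    "\<And>x. x = (\<Sum>b\<in>B. coord b x *\<^sub>R b)"
    using findim_coordinates[OF assms(1)] by metis
  have "f x = (\<Sum>b\<in>B. coord b x *\<^sub>R f b)" for x
    by (subst B(3)[of x]) (simp add: linear_sum[OF assms(2)] linear_scale[OF assms(2)])
  then have "f = (\<lambda>x. \<Sum>b\<in>B. coord b x *\<^sub>R f b)" by (rule ext)
  moreover have "bounded_linear (\<lambda>x. \<Sum>b\<in>B. coord b x *\<^sub>R f b)"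
    by (intro bounded_linear_sum bounded_linear_scaleR_const B(2))
  ultimately show ?thesis by simp
qed

lemma bilinear_imp_bounded_bilinear:
  fixes f :: "'a::real_normed_vector \<Rightarrow> 'b::real_normed_vector \<Rightarrow> 'c::real_normed_vector"
  assumes fa: "findim TYPE('a::real_normed_vector)" and fb: "findim TYPE('b::real_normed_vector)" and f: "bilinear f"
  shows "bounded_bilinear f"
proof -
  obtain B :: "'a set" and coord where B: "finite B" "\<And>b. bounded_linear (coord b)"
    "\<And>x. x = (\<Sum>b\<in>B. coord b x *\<^sub>R b)"
    using findim_coordinates[OF fa] by metis
  have "bounded_linear (f b)" for b
    using linear_imp_bounded_linear[OF fb] f by (auto simp: bilinear_def)
  then have "\<exists>K\<ge>0. \<forall>y. norm (f b y) \<le> norm y * K" for b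
    using bounded_linear.nonneg_bounded by blast
  then obtain K where K: "\<And>b. K b \<ge> 0" "\<And>b y. norm (f b y) \<le> norm y * K b" by metis
  have "\<exists>K\<ge>0. \<forall>y. norm (coord b y) \<le> norm y * K" for b
    using bounded_linear.nonneg_bounded[OF B(2)] by blast
  then obtain L where L: "\<And>b. L b \<ge> 0" "\<And>b y. norm (coord b y) \<le> norm y * L b" by metis
  have lf: "linear (\<lambda>x. f x y)" for y using f by (auto simp: bilinear_def)
  have eq: "f x y = (\<Sum>b\<in>B. coord b x *\<^sub>R f b y)" for x y
    by (subst B(3)[of x]) (simp add: linear_sum[OF lf] linear_scale[OF lf])
  show ?thesis
  proof
    show "\<exists>K. \<forall>a b. norm (f a b) \<le> norm a * norm b * K"
    proof (intro exI allI)
      fix x y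
      have "norm (f x y) \<le> (\<Sum>b\<in>B. norm (coord b x *\<^sub>R f b y))" by (subst eq) (rule norm_sum)
      also have "\<dots> \<le> (\<Sum>b\<in>B. (norm x * L b) * (norm y * K b))"
        unfolding norm_scaleR using K L by (intro sum_mono mult_mono) (auto simp: )
      also have "\<dots> = norm x * norm y * (\<Sum>b\<in>B. L b * K b)"
        by (simp add: sum_distrib_left mult_ac)
      finally show "norm (f x y) \<le> norm x * norm y * (\<Sum>b\<in>B. L b * K b)" .
    qed
  qed (use f in \<open>simp_all add: bilinear_ladd bilinear_radd bilinear_lmul bilinear_rmul\<close>)
qed

lemma findimI: "finite B \<Longrightarrow> (\<And>x. x \<in> span B) \<Longrightarrow> findim TYPE('a::real_normed_vector)"
  for B :: "'a::real_normed_vector set"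
  by (auto simp: findim_def)

lemma findim_real: "findim TYPE(real)"
proof (rule findimI[of "{1}"])
  show "x \<in> span {1}" for x :: real
    by (metis insertI1 mult.right_neutral real_scaleR_def span_base span_scale)
qed simp

lemma findim_prod:
  assumes "findim TYPE('a::real_normed_vector)" "findim TYPE('b::real_normed_vector)"
  shows "findim TYPE('a \<times> 'b)"
proof -
  obtain A :: "'a set" where A: "finite A" "span A = UNIV" using assms(1) by (auto simp: findim_def)
  obtain B :: "'b set" where B: "finite B" "span B = UNIV" using assms(2) by (auto simp: findim_def)
  let ?C = "(\<lambda>a. (a, 0)) ` A \<union> (\<lambda>b. (0, b)) ` B"
  have l1: "linear (\<lambda>a::'a. (a, 0::'b))" and l2: "linear (\<lambda>b::'b. (0::'a, b))"
    by (auto intro!: linearI)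
  show ?thesis
  proof (rule findimI[of ?C])
    fix x :: "'a \<times> 'b"
    have "(fst x, 0) \<in> span ((\<lambda>a. (a, 0::'b)) ` A)"
      using linear_span_image[OF l1, of A] A(2) by auto
    moreover have "(0, snd x) \<in> span ((\<lambda>b. (0::'a, b)) ` B)"
      using linear_span_image[OF l2, of B] B(2) by auto
    ultimately have "(fst x, 0) + (0, snd x) \<in> span ?C"
      by (meson Un_upper1 Un_upper2 span_add span_mono subsetD)
    then show "x \<in> span ?C" by simp
  qed (use A B in auto)
qed

text \<open>The coordinate functionals span the dual: the coefficients of \<open>f\<close> are its
  values on the elements of \<open>B\<close>.\<close>

lemma findim_dual:
  assumes "findim TYPE('a::real_normed_vector)"
  shows "findim TYPE('a \<Rightarrow>\<^sub>L real)"
proof -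
  obtain B :: "'a set" and coord where B: "finite B" "\<And>b. bounded_linear (coord b)"
    "\<And>x. x = (\<Sum>b\<in>B. coord b x *\<^sub>R b)"
    using findim_coordinates[OF assms] by metis
  show ?thesis
  proof (rule findimI[of "(\<lambda>b. Blinfun (coord b)) ` B"])
    fix f :: "'a \<Rightarrow>\<^sub>L real"
    have "f = (\<Sum>b\<in>B. f b *\<^sub>R Blinfun (coord b))"
    proof (rule blinfun_eqI)
      fix x
      have "f x = f (\<Sum>b\<in>B. coord b x *\<^sub>R b)" using B(3)[of x] by simp
      then show "f x = (\<Sum>b\<in>B. f b *\<^sub>R Blinfun (coord b)) x"
        by (simp add: blinfun.sum_left blinfun.sum_right blinfun.scaleR_left blinfun.scaleR_right
            bounded_linear_Blinfun_apply[OF B(2)] mult.commute)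
    qed
    moreover have "(\<Sum>b\<in>B. f b *\<^sub>R Blinfun (coord b)) \<in> span ((\<lambda>b. Blinfun (coord b)) ` B)"
      by (intro span_sum span_scale span_base) auto
    ultimately show "f \<in> span ((\<lambda>b. Blinfun (coord b)) ` B)" by simp
  qed (use B in auto)
qed

text \<open>Combinations of the spanning vectors with rational coefficients are countable and dense,
  and the balls of radius \<open>1 / Suc n\<close> around them form a countable base.\<close>

lemma second_countable_findim:
  assumes "findim TYPE('a::real_normed_vector)"
  shows "second_countable (euclidean :: 'a topology)"
proof -
  obtain B :: "'a set" and coord where B: "finite B" "\<And>b. bounded_linear (coord b)"
    "\<And>x. x = (\<Sum>b\<in>B. coord b x *\<^sub>R b)"
    using findim_coordinates[OF assms] by metis
  define C where "C = (\<lambda>u. \<Sum>b\<in>B. u b *\<^sub>R b) ` (PiE B (\<lambda>_. \<rat> :: real set))"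
  have cC: "countable C" unfolding C_def by (intro countable_image countable_PiE B(1) countable_rat)
  have dense: "\<exists>y\<in>C. dist y x < e" if "e > 0" for x and e :: real
  proof -
    \<comment> \<open>The summand 1 keeps \<open>M\<close> positive and leaves room: the error is at
      most \<open>(e / M) * (M - 1)\<close>, which is strictly below \<open>e\<close>.\<close>
    define M where "M = (\<Sum>b\<in>B. norm b) + 1"
    have M: "M > 0" unfolding M_def by (smt (verit) norm_ge_zero sum_nonneg)
    have "\<exists>q\<in>\<rat>. \<bar>q - coord b x\<bar> < e / M" for b
    proof -
      have "e / M > 0" using M \<open>e > 0\<close> by simp
      then obtain q where "q \<in> \<rat>" "coord b x - e/M < q" "q < coord b x + e/M"
        using Rats_dense_in_real[of "coord b x - e/M" "coord b x + e/M"] by auto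
      then show ?thesis by (intro bexI[of _ q]) auto
    qed
    then obtain q where q: "\<And>b. q b \<in> \<rat>" "\<And>b. \<bar>q b - coord b x\<bar> < e / M" by metis
    let ?y = "\<Sum>b\<in>B. restrict q B b *\<^sub>R b"
    have "?y \<in> C" unfolding C_def using q by (intro imageI) auto
    moreover have "dist ?y x < e"
    proof -
      have "?y - x = (\<Sum>b\<in>B. (q b - coord b x) *\<^sub>R b)"
        by (subst B(3)[of x]) (simp add: sum_subtractf scaleR_diff_left)
      then have "norm (?y - x) \<le> (\<Sum>b\<in>B. \<bar>q b - coord b x\<bar> * norm b)"
        using norm_sum[of "\<lambda>b. (q b - coord b x) *\<^sub>R b" B] by simp
      also have "\<dots> \<le> (\<Sum>b\<in>B. (e/M) * norm b)"
        using q(2) by (intro sum_mono mult_right_mono) (auto intro: less_imp_le)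
      also have "\<dots> = (e/M) * (M - 1)" by (simp add: M_def sum_distrib_left)
      also have "\<dots> < e" using M \<open>e > 0\<close> by (simp add: field_simps)
      finally show ?thesis by (simp add: dist_norm)
    qed
    ultimately show ?thesis by blast
  qed
  define \<B> where "\<B> = (\<lambda>(y, n). ball y (1 / real (Suc n))) ` (C \<times> UNIV)"
  have "countable \<B>" unfolding \<B>_def using cC by (intro countable_image countable_SIGMA) auto
  moreover have "\<exists>V\<in>\<B>. x \<in> V \<and> V \<subseteq> U" if U: "open U" "x \<in> U" for U and x :: 'a
  proof -
    obtain e where e: "e > 0" "ball x e \<subseteq> U" using U open_contains_ball by blast
    obtain n where n: "1 / real (Suc n) < e / 2"
      using e reals_Archimedean[of "e/2"] by (auto simp: inverse_eq_divide)
    obtain y where y: "y \<in> C" "dist y x < 1 / real (Suc n)" using dense[of "1 / real (Suc n)"] by auto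
    have "ball y (1 / real (Suc n)) \<subseteq> ball x e"
    proof
      fix z assume "z \<in> ball y (1 / real (Suc n))"
      then have "dist x z < 1 / real (Suc n) + 1 / real (Suc n)"
        using y(2) dist_triangle[of x z y] by (auto simp: dist_commute)
      then show "z \<in> ball x e" using n by auto
    qed
    then show ?thesis using y e unfolding \<B>_def
      by (intro bexI[of _ "ball y (1 / real (Suc n))"]) auto
  qed
  moreover have "\<forall>V\<in>\<B>. openin euclidean V" by (auto simp: \<B>_def)
  ultimately show ?thesis unfolding second_countable_def by (intro exI[of _ \<B>]) auto
qed

section \<open>Smooth maps between normed spaces\<close>

abbreviation D :: "('a::real_normed_vector \<Rightarrow> 'b::real_normed_vector) \<Rightarrow> 'a \<Rightarrow> 'a \<Rightarrow> 'b" where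
  "D f x \<equiv> frechet_derivative f (at x)"

text \<open>The vector \<open>v\<close> is the direction of the inner derivative and
  \<open>w\<close> that of the outer one; the order matters until symmetry is proved.\<close>

abbreviation D2 :: "('a::real_normed_vector \<Rightarrow> 'b::real_normed_vector) \<Rightarrow> 'a \<Rightarrow> 'a \<Rightarrow> 'a \<Rightarrow> 'b" where
  "D2 f x v w \<equiv> D (\<lambda>y. D f y v) x w"

abbreviation "td \<equiv> times_differentiable_on"

lemma D_eq: "(f has_derivative f') (at x) \<Longrightarrow> D f x = f'"
  by (rule frechet_derivative_at[symmetric])

lemma frechet_derivative_worksI:
  "f differentiable F \<Longrightarrow> (f has_derivative frechet_derivative f F) F"
  by (simp add: frechet_derivative_works)

lemma D_cong:
  assumes "open S" "x \<in> S" "\<And>y. y \<in> S \<Longrightarrow> f y = g y" "g differentiable (at x)"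
  shows "D f x = D g x"
  using frechet_derivative_transform_within_open[OF assms(4,1,2)] assms(3) by metis

lemma differentiable_cong:
  assumes "open S" "x \<in> S" "\<And>y. y \<in> S \<Longrightarrow> f y = g y" "g differentiable (at x)"
  shows "f differentiable (at x)"
  using assms(4) has_derivative_transform_within_open[OF _ assms(1,2)] assms(3)
  unfolding differentiable_def by metis

text \<open>Derivatives are taken in the ambient space, so agreement on an open set passes to every
  directional derivative and the induction goes through.\<close>

lemma td_cong:
  assumes "open S" "\<And>x. x \<in> S \<Longrightarrow> f x = g x" "td n S g"
  shows "td n S f"
  using assms(2,3)
proof (induction n arbitrary: f g)
  case 0
  then show ?case by (simp cong: continuous_on_cong)
next
  case (Suc n)
  have d: "g differentiable (at x)" if "x \<in> S" for x using Suc.prems that by simp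
  show ?case
  proof (simp, intro conjI ballI allI)
    show "f differentiable (at x)" if "x \<in> S" for x
      using differentiable_cong[OF assms(1) that Suc.prems(1) d[OF that]] by blast
    show "td n S (\<lambda>x. D f x v)" for v
    proof (rule Suc.IH)
      show "D f x v = D g x v" if "x \<in> S" for x
        using D_cong[OF assms(1) that Suc.prems(1) d[OF that]] by simp
      show "td n S (\<lambda>x. D g x v)" using Suc.prems(2) by simp
    qed
  qed
qed

lemma td_subset: "td n S f \<Longrightarrow> T \<subseteq> S \<Longrightarrow> td n T f"
  by (induction n arbitrary: f) (auto intro: continuous_on_subset)

lemma td_Suc_imp: "td (Suc n) S f \<Longrightarrow> td n S f"
proof (induction n arbitrary: f)
  case 0
  then show ?case
    by (auto intro!: continuous_at_imp_continuous_on differentiable_imp_continuous_within)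
next
  case (Suc n)
  then show ?case using times_differentiable_on.simps(2) by blast
qed

lemma td_local:
  assumes "\<And>x. x \<in> S \<Longrightarrow> \<exists>T. open T \<and> x \<in> T \<and> td n T f"
  shows "td n S f"
  using assms
proof (induction n arbitrary: f)
  case 0
  then show ?case
    by (metis continuous_at_imp_continuous_on continuous_on_eq_continuous_at times_differentiable_on.simps(1))
next
  case (Suc n)
  then show ?case by (simp) (meson Suc.IH)
qed

lemma td_const: "td n S (\<lambda>x. c)"
  by (induction n arbitrary: c) auto

lemma td_linear_comp:
  assumes L: "bounded_linear L" and "open S" "td n S f"
  shows "td n S (\<lambda>x. L (f x))"
  using assms(3)
proof (induction n arbitrary: f)
  case 0
  then show ?case by (simp add: bounded_linear.continuous_on[OF L])
next
  case (Suc n)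
  have d: "((\<lambda>x. L (f x)) has_derivative (\<lambda>v. L (D f x v))) (at x)" if "x \<in> S" for x
    using Suc.prems that by (intro bounded_linear.has_derivative[OF L]) (simp add: frechet_derivative_worksI)
  show ?case
  proof (simp, intro conjI ballI allI)
    show "(\<lambda>x. L (f x)) differentiable (at x)" if "x \<in> S" for x
      using d[OF that] differentiable_def by blast
    show "td n S (\<lambda>x. D (\<lambda>x. L (f x)) x v)" for v
    proof (rule td_cong[OF assms(2)])
      show "D (\<lambda>x. L (f x)) x v = L (D f x v)" if "x \<in> S" for x by (simp add: D_eq[OF d[OF that]])
      show "td n S (\<lambda>x. L (D f x v))" by (rule Suc.IH) (use Suc.prems in simp)
    qed
  qed
qed

lemma td_add:
  assumes "open S" "td n S f" "td n S g"
  shows "td n S (\<lambda>x. f x + g x)"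
  using assms(2,3)
proof (induction n arbitrary: f g)
  case 0
  then show ?case by (simp add: continuous_on_add)
next
  case (Suc n)
  have d: "((\<lambda>x. f x + g x) has_derivative (\<lambda>v. D f x v + D g x v)) (at x)" if "x \<in> S" for x
    using Suc.prems that by (intro has_derivative_add) (simp_all add: frechet_derivative_worksI)
  show ?case
  proof (simp, intro conjI ballI allI)
    show "(\<lambda>x. f x + g x) differentiable (at x)" if "x \<in> S" for x
      using d[OF that] differentiable_def by blast
    show "td n S (\<lambda>x. D (\<lambda>x. f x + g x) x v)" for v
    proof (rule td_cong[OF assms(1)])
      show "D (\<lambda>x. f x + g x) x v = D f x v + D g x v" if "x \<in> S" for x by (simp add: D_eq[OF d[OF that]])
      show "td n S (\<lambda>x. D f x v + D g x v)" by (rule Suc.IH) (use Suc.prems in simp_all)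
    qed
  qed
qed

text \<open>The product rule yields two products of the same kind; \<open>td_Suc_imp\<close> lowers
  the order of the factor that stays underived.\<close>

lemma td_bilinear:
  assumes B: "bounded_bilinear B" and "open S" "td n S f" "td n S g"
  shows "td n S (\<lambda>x. B (f x) (g x))"
  using assms(3,4)
proof (induction n arbitrary: f g)
  case 0
  then show ?case by (simp add: bounded_bilinear.continuous_on[OF B])
next
  case (Suc n)
  have d: "((\<lambda>x. B (f x) (g x)) has_derivative (\<lambda>v. B (f x) (D g x v) + B (D f x v) (g x))) (at x)" if "x \<in> S" for x
    using Suc.prems that by (intro bounded_bilinear.FDERIV[OF B]) (simp_all add: frechet_derivative_worksI)
  show ?case
  proof (simp, intro conjI ballI allI)
    show "(\<lambda>x. B (f x) (g x)) differentiable (at x)" if "x \<in> S" for x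
      using d[OF that] differentiable_def by blast
    show "td n S (\<lambda>x. D (\<lambda>x. B (f x) (g x)) x v)" for v
    proof (rule td_cong[OF assms(2), of _ "\<lambda>x. B (f x) (D g x v) + B (D f x v) (g x)"])
      show "td n S (\<lambda>x. B (f x) (D g x v) + B (D f x v) (g x))"
        using Suc.prems td_Suc_imp[OF Suc.prems(1)] td_Suc_imp[OF Suc.prems(2)]
        by (intro td_add[OF assms(2)] Suc.IH) simp_all
    qed (simp add: D_eq[OF d])
  qed
qed

lemma td_sum:
  assumes "open S" "\<And>i. i \<in> I \<Longrightarrow> td n S (f i)"
  shows "td n S (\<lambda>x. \<Sum>i\<in>I. f i x)"
  using assms(2)
  by (induction I rule: infinite_finite_induct) (auto intro: td_const td_add[OF assms(1)])

lemma linear_basis_expansion: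
  assumes "linear f" "x = (\<Sum>b\<in>B. coord b x *\<^sub>R b)"
  shows "f x = (\<Sum>b\<in>B. coord b x *\<^sub>R f b)"
  by (subst assms(2)) (simp add: linear_sum[OF assms(1)] linear_scale[OF assms(1)])

lemma linear_D: "f differentiable (at x) \<Longrightarrow> linear (D f x)"
  by (rule linear_frechet_derivative)

text \<open>The derivative \<open>D g (f x) (D f x v)\<close> has a direction that varies with
  \<open>x\<close>, whereas \<open>td\<close> speaks of fixed directions. Expanding it along a basis
  gives a finite sum of coordinates of \<open>D f x v\<close> times \<open>D g (f x) b\<close>, and
  the induction hypothesis applies to the second factors.\<close>

lemma td_compose:
  fixes f :: "'a::real_normed_vector \<Rightarrow> 'b::real_normed_vector"
  assumes fd: "findim TYPE('b)" and "open S" "open T" "f ` S \<subseteq> T" "td n S f" "td n T g"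
  shows "td n S (\<lambda>x. g (f x))"
  using assms(5,6)
proof (induction n arbitrary: g)
  case 0
  then show ?case using assms(4) by (auto intro: continuous_on_compose2)
next
  case (Suc n)
  obtain B :: "'b set" and coord where B: "finite B" "\<And>b. bounded_linear (coord b)"
    "\<And>x. x = (\<Sum>b\<in>B. coord b x *\<^sub>R b)"
    using findim_coordinates[OF fd] by metis
  have d: "((\<lambda>x. g (f x)) has_derivative (\<lambda>v. D g (f x) (D f x v))) (at x)" if "x \<in> S" for x
    using Suc.prems that assms(4)
    by (intro has_derivative_compose[of f _ _ _ g]) (auto simp add: frechet_derivative_worksI)
  show ?case
  proof (simp, intro conjI ballI allI)
    show "(\<lambda>x. g (f x)) differentiable (at x)" if "x \<in> S" for x
      using d[OF that] differentiable_def by blast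
    fix v
    show "td n S (\<lambda>x. D (\<lambda>x. g (f x)) x v)"
    proof (rule td_cong[OF assms(2)])
      fix x assume x: "x \<in> S"
      then have "f x \<in> T" using assms(4) by auto
      then have "linear (D g (f x))" using Suc.prems(2) by (simp add: linear_D)
      then show "D (\<lambda>x. g (f x)) x v = (\<Sum>b\<in>B. coord b (D f x v) *\<^sub>R D g (f x) b)"
        unfolding D_eq[OF d[OF x]] by (rule linear_basis_expansion) (rule B(3))
    next
      have "td n S (\<lambda>x. D g (f x) b)" for b
        using Suc.prems(2) td_Suc_imp[OF Suc.prems(1)] by (intro Suc.IH) simp_all
      moreover have "td n S (\<lambda>x. coord b (D f x v))" for b
        using Suc.prems(1) by (intro td_linear_comp[OF B(2) assms(2)]) simp
      ultimately show "td n S (\<lambda>x. \<Sum>b\<in>B. coord b (D f x v) *\<^sub>R D g (f x) b)"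
        by (intro td_sum[OF assms(2)] td_bilinear[OF bounded_bilinear_scaleR assms(2)])
    qed
  qed
qed

lemma smooth_on_cong: "open S \<Longrightarrow> smooth_on S g \<Longrightarrow> (\<And>x. x \<in> S \<Longrightarrow> f x = g x) \<Longrightarrow> smooth_on S f"
  unfolding smooth_on_def using td_cong by blast

lemma smooth_on_subset: "smooth_on S f \<Longrightarrow> T \<subseteq> S \<Longrightarrow> smooth_on T f"
  unfolding smooth_on_def using td_subset by blast

lemma smooth_on_local:
  "(\<And>x. x \<in> S \<Longrightarrow> \<exists>T. open T \<and> x \<in> T \<and> smooth_on T f) \<Longrightarrow> smooth_on S f"
  unfolding smooth_on_def by (meson td_local)

lemma smooth_on_const: "smooth_on S (\<lambda>x. c)"
  unfolding smooth_on_def using td_const by blast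

lemma smooth_on_linear_comp:
  "bounded_linear L \<Longrightarrow> open S \<Longrightarrow> smooth_on S f \<Longrightarrow> smooth_on S (\<lambda>x. L (f x))"
  unfolding smooth_on_def using td_linear_comp by blast

lemma smooth_on_ident: "smooth_on S (\<lambda>x. x)"
proof -
  have "td n S (\<lambda>x. x)" for n by (cases n) (auto intro: td_const)
  then show ?thesis by (simp add: smooth_on_def)
qed

lemma smooth_on_add:
  "open S \<Longrightarrow> smooth_on S f \<Longrightarrow> smooth_on S g \<Longrightarrow> smooth_on S (\<lambda>x. f x + g x)"
  unfolding smooth_on_def using td_add by blast

lemma smooth_on_bilinear:
  "bounded_bilinear B \<Longrightarrow> open S \<Longrightarrow> smooth_on S f \<Longrightarrow> smooth_on S g \<Longrightarrow> smooth_on S (\<lambda>x. B (f x) (g x))"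
  unfolding smooth_on_def using td_bilinear by blast

lemma smooth_on_compose:
  "findim TYPE('b::real_normed_vector) \<Longrightarrow> open S \<Longrightarrow> open T \<Longrightarrow> f ` S \<subseteq> T \<Longrightarrow> smooth_on S f \<Longrightarrow> smooth_on T g
    \<Longrightarrow> smooth_on S (\<lambda>x. g (f x))" for f :: "'a::real_normed_vector \<Rightarrow> 'b::real_normed_vector"
  unfolding smooth_on_def using td_compose by blast

lemma smooth_on_Pair:
  assumes "open S" "smooth_on S f" "smooth_on S g"
  shows "smooth_on S (\<lambda>x. (f x, g x))"
proof -
  have "smooth_on S (\<lambda>x. (f x, 0) + (0, g x))"
    using assms
    by (intro smooth_on_add smooth_on_linear_comp[OF bounded_linear_Pair[OF bounded_linear_ident bounded_linear_zero]]
        smooth_on_linear_comp[OF bounded_linear_Pair[OF bounded_linear_zero bounded_linear_ident]])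
  then show ?thesis by simp
qed

lemma smooth_on_fst: "open S \<Longrightarrow> smooth_on S f \<Longrightarrow> smooth_on S (\<lambda>x. fst (f x))"
  by (rule smooth_on_linear_comp[OF bounded_linear_fst])

lemma smooth_on_snd: "open S \<Longrightarrow> smooth_on S f \<Longrightarrow> smooth_on S (\<lambda>x. snd (f x))"
  by (rule smooth_on_linear_comp[OF bounded_linear_snd])

lemma smooth_on_D: "smooth_on S f \<Longrightarrow> smooth_on S (\<lambda>x. D f x v)"
  unfolding smooth_on_def using times_differentiable_on.simps(2) by blast

lemma smooth_on_imp_continuous_on: "smooth_on S f \<Longrightarrow> continuous_on S f"
  unfolding smooth_on_def using times_differentiable_on.simps(1) by blast

lemma smooth_on_imp_differentiable: "smooth_on S f \<Longrightarrow> x \<in> S \<Longrightarrow> f differentiable (at x)"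
  unfolding smooth_on_def using times_differentiable_on.simps(2)[of 0] by blast

lemma smooth_on_has_derivative: "smooth_on S f \<Longrightarrow> x \<in> S \<Longrightarrow> (f has_derivative D f x) (at x)"
  using smooth_on_imp_differentiable frechet_derivative_worksI by blast

lemma smooth_on_linear_D: "smooth_on S f \<Longrightarrow> x \<in> S \<Longrightarrow> linear (D f x)"
  using smooth_on_imp_differentiable linear_D by blast

section \<open>Second derivatives and their symmetry\<close>

lemma smooth_on_D2_expand:
  assumes "open S" "smooth_on S f" "x \<in> S" "finite B" "v = (\<Sum>b\<in>B. u b *\<^sub>R b)"
  shows "D2 f x v w = (\<Sum>b\<in>B. u b *\<^sub>R D2 f x b w)"
proof -
  have "((\<lambda>y. \<Sum>b\<in>B. u b *\<^sub>R D f y b) has_derivative (\<lambda>w. \<Sum>b\<in>B. u b *\<^sub>R D2 f x b w)) (at x)"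
    by (intro has_derivative_sum has_derivative_scaleR_right smooth_on_has_derivative[OF smooth_on_D[OF assms(2)] assms(3)])
  then have "((\<lambda>y. D f y v) has_derivative (\<lambda>w. \<Sum>b\<in>B. u b *\<^sub>R D2 f x b w)) (at x)"
  proof (rule has_derivative_transform_within_open[OF _ assms(1,3)])
    fix y assume "y \<in> S"
    note l = smooth_on_linear_D[OF assms(2) this]
    show "(\<Sum>b\<in>B. u b *\<^sub>R D f y b) = D f y v"
      unfolding assms(5) by (simp add: linear_sum[OF l] linear_scale[OF l])
  qed
  then show ?thesis by (simp add: D_eq)
qed

text \<open>Linearity in the inner direction holds at every point of the open set \<open>S\<close>
  and therefore survives the outer differentiation.\<close>

lemma linear_D2_left:
  assumes "open S" "smooth_on S f" "x \<in> S"
  shows "linear (\<lambda>v. D2 f x v w)"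
proof (rule linearI)
  have d: "((\<lambda>y. D f y v) has_derivative D2 f x v) (at x)" for v
    by (rule smooth_on_has_derivative[OF smooth_on_D[OF assms(2)] assms(3)])
  show "D2 f x (v1 + v2) w = D2 f x v1 w + D2 f x v2 w" for v1 v2
  proof -
    have "((\<lambda>y. D f y (v1 + v2)) has_derivative (\<lambda>w. D2 f x v1 w + D2 f x v2 w)) (at x)"
      by (rule has_derivative_transform_within_open[OF has_derivative_add[OF d d] assms(1,3)])
        (simp add: linear_add[OF smooth_on_linear_D[OF assms(2)]])
    then show ?thesis by (simp add: D_eq)
  qed
  show "D2 f x (r *\<^sub>R v) w = r *\<^sub>R D2 f x v w" for r v
  proof -
    have "((\<lambda>y. D f y (r *\<^sub>R v)) has_derivative (\<lambda>w. r *\<^sub>R D2 f x v w)) (at x)"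
      by (rule has_derivative_transform_within_open[OF has_derivative_scaleR_right[OF d] assms(1,3)])
        (simp add: linear_scale[OF smooth_on_linear_D[OF assms(2)]])
    then show ?thesis by (simp add: D_eq)
  qed
qed

lemma linear_D2_right:
  "smooth_on S f \<Longrightarrow> x \<in> S \<Longrightarrow> linear (D2 f x v)"
  by (rule smooth_on_linear_D[OF smooth_on_D])

text \<open>Base point and direction both move with \<open>x\<close>. Expanding the direction along
  a basis gives scalar functions times derivatives in fixed directions, to which the product rule
  applies.\<close>

lemma has_derivative_D_apply:
  fixes f :: "'a::real_normed_vector \<Rightarrow> 'b::real_normed_vector"
  assumes fd: "findim TYPE('a)" and S: "open S" "smooth_on S f"
    and \<phi>: "(\<phi> has_derivative \<phi>') (at x)" "\<phi> x \<in> S" and \<psi>: "(\<psi> has_derivative \<psi>') (at x)"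
  shows "((\<lambda>x. D f (\<phi> x) (\<psi> x)) has_derivative
      (\<lambda>w. D2 f (\<phi> x) (\<psi> x) (\<phi>' w) + D f (\<phi> x) (\<psi>' w))) (at x)"
proof -
  obtain B :: "'a set" and coord where B: "finite B" "\<And>b. bounded_linear (coord b)"
    "\<And>x. x = (\<Sum>b\<in>B. coord b x *\<^sub>R b)"
    using findim_coordinates[OF fd] by metis
  have d1: "((\<lambda>x. D f (\<phi> x) b) has_derivative (\<lambda>w. D2 f (\<phi> x) b (\<phi>' w))) (at x)" for b
    using has_derivative_compose[OF \<phi>(1) smooth_on_has_derivative[OF smooth_on_D[OF S(2)] \<phi>(2)]] .
  have d2: "((\<lambda>x. coord b (\<psi> x)) has_derivative (\<lambda>w. coord b (\<psi>' w))) (at x)" for b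
    by (rule bounded_linear.has_derivative[OF B(2) \<psi>])
  have "((\<lambda>x. \<Sum>b\<in>B. coord b (\<psi> x) *\<^sub>R D f (\<phi> x) b) has_derivative
      (\<lambda>w. \<Sum>b\<in>B. coord b (\<psi> x) *\<^sub>R D2 f (\<phi> x) b (\<phi>' w) + coord b (\<psi>' w) *\<^sub>R D f (\<phi> x) b)) (at x)"
    by (intro has_derivative_sum has_derivative_scaleR d1 d2)
  moreover have "(\<lambda>w. \<Sum>b\<in>B. coord b (\<psi> x) *\<^sub>R D2 f (\<phi> x) b (\<phi>' w) + coord b (\<psi>' w) *\<^sub>R D f (\<phi> x) b)
     = (\<lambda>w. D2 f (\<phi> x) (\<psi> x) (\<phi>' w) + D f (\<phi> x) (\<psi>' w))"
  proof
    fix w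
    have "D f (\<phi> x) (\<psi>' w) = (\<Sum>b\<in>B. coord b (\<psi>' w) *\<^sub>R D f (\<phi> x) b)"
      by (rule linear_basis_expansion[OF smooth_on_linear_D[OF S(2) \<phi>(2)] B(3)])
    then show "(\<Sum>b\<in>B. coord b (\<psi> x) *\<^sub>R D2 f (\<phi> x) b (\<phi>' w) + coord b (\<psi>' w) *\<^sub>R D f (\<phi> x) b)
      = D2 f (\<phi> x) (\<psi> x) (\<phi>' w) + D f (\<phi> x) (\<psi>' w)"
      using smooth_on_D2_expand[OF S \<phi>(2) B(1) B(3)[of "\<psi> x"]] by (simp add: sum.distrib)
  qed
  moreover have "eventually (\<lambda>y. \<phi> y \<in> S) (at x)"
    using topological_tendstoD[OF _ S(1)] has_derivative_continuous[OF \<phi>(1)] \<phi>(2)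
    by (auto simp: continuous_within)
  then have "eventually (\<lambda>y. (\<Sum>b\<in>B. coord b (\<psi> y) *\<^sub>R D f (\<phi> y) b) = D f (\<phi> y) (\<psi> y)) (at x)"
    by (rule eventually_mono) (rule linear_basis_expansion[OF smooth_on_linear_D[OF S(2)] B(3), symmetric])
  moreover have "(\<Sum>b\<in>B. coord b (\<psi> x) *\<^sub>R D f (\<phi> x) b) = D f (\<phi> x) (\<psi> x)"
    by (rule linear_basis_expansion[OF smooth_on_linear_D[OF S(2) \<phi>(2)] B(3), symmetric])
  ultimately show ?thesis
    by (simp add: has_derivative_transform_eventually)
qed

text \<open>The mean value theorem in direction \<open>v\<close> turns the second difference into an
  increment of the first derivative \<open>g\<close>, and differentiability of \<open>g\<close> at
  \<open>x\<close> evaluates this increment up to a small multiple of \<open>s\<close>. The limit is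
  one-sided, which keeps \<open>s\<close> positive in the mean value theorem.\<close>

lemma second_difference_tendsto:
  fixes f :: "'a::real_normed_vector \<Rightarrow> real"
  assumes "open S" "smooth_on S f" "x \<in> S"
  shows "((\<lambda>s. (f (x + s *\<^sub>R v + s *\<^sub>R w) - f (x + s *\<^sub>R v) - f (x + s *\<^sub>R w) + f x) / s\<^sup>2)
     \<longlongrightarrow> D2 f x v w) (at_right 0)"
proof (rule tendstoI)
  fix e :: real assume e: "e > 0"
  define M where "M = norm v + norm w"
  have M: "M \<ge> 0" by (simp add: M_def)
  \<comment> \<open>The linear approximation of \<open>g\<close> is used twice, each time at a cost
    of \<open>\<epsilon> * (s * M)\<close>. The summand 1 covers the case
    \<open>M = 0\<close>.\<close>
  define \<epsilon> where "\<epsilon> = e / (2 * M + 1)"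
  have \<epsilon>: "\<epsilon> > 0" "2 * \<epsilon> * M < e"
    using e M by (auto simp: \<epsilon>_def field_simps intro!: divide_pos_pos add_nonneg_pos)
  define g where "g = (\<lambda>y. D f y v)"
  have dg: "(g has_derivative D2 f x v) (at x)"
    unfolding g_def by (rule smooth_on_has_derivative[OF smooth_on_D[OF assms(2)] assms(3)])
  have ld: "linear (D2 f x v)" by (rule linear_D2_right[OF assms(2,3)])
  obtain d1 where d1: "d1 > 0" "\<And>y. norm (y - x) < d1 \<Longrightarrow> norm (g y - g x - D2 f x v (y - x)) \<le> \<epsilon> * norm (y - x)"
    using dg \<epsilon>(1) unfolding has_derivative_at_alt by metis
  obtain d2 where d2: "d2 > 0" "ball x d2 \<subseteq> S" using assms open_contains_ball by blast
  define d where "d = min d1 d2"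
  have d: "d > 0" using d1 d2 by (simp add: d_def)
  have "\<bar>(f (x + s *\<^sub>R v + s *\<^sub>R w) - f (x + s *\<^sub>R v) - f (x + s *\<^sub>R w) + f x) / s\<^sup>2 - D2 f x v w\<bar> < e"
    if s: "0 < s" "s < d / (M + 1)" for s
  proof -
    have sM: "s * M < d"
    proof -
      have "s * M \<le> s * (M + 1)" using s by simp
      also have "\<dots> < d" using s(2) M by (simp add: pos_less_divide_eq)
      finally show ?thesis .
    qed
    have small: "norm (t *\<^sub>R v + r *\<^sub>R w) \<le> s * M" if "0 \<le> t" "t \<le> s" "0 \<le> r" "r \<le> s" for t r
    proof -
      have "norm (t *\<^sub>R v + r *\<^sub>R w) \<le> t * norm v + r * norm w"
        using that by (metis abs_of_nonneg norm_scaleR norm_triangle_ineq)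
      also have "\<dots> \<le> s * norm v + s * norm w" using that by (intro add_mono mult_right_mono) auto
      finally show ?thesis by (simp add: M_def algebra_simps)
    qed
    have inS: "x + t *\<^sub>R v + r *\<^sub>R w \<in> S" if "0 \<le> t" "t \<le> s" "0 \<le> r" "r \<le> s" for t r
    proof -
      have "norm (t *\<^sub>R v + r *\<^sub>R w) < d2" using small[OF that] sM d_def by linarith
      then have "x + t *\<^sub>R v + r *\<^sub>R w \<in> ball x d2"
        by (simp add: dist_norm add.assoc norm_minus_commute[of x]) (metis add_uminus_conv_diff minus_add_distrib norm_minus_cancel)
      then show ?thesis using d2 by blast
    qed
    \<comment> \<open>\<open>h\<close> is the increment in direction \<open>w\<close> after progress
      \<open>t\<close> in direction \<open>v\<close>, so the second difference is
      \<open>h s - h 0\<close>.\<close>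
    define h where "h = (\<lambda>t. f (x + t *\<^sub>R v + s *\<^sub>R w) - f (x + t *\<^sub>R v))"
    have df: "((\<lambda>t. f (x + t *\<^sub>R v + r *\<^sub>R w)) has_real_derivative g (x + t *\<^sub>R v + r *\<^sub>R w)) (at t)"
      if t: "0 \<le> t" "t \<le> s" "0 \<le> r" "r \<le> s" for t r
    proof -
      have "((\<lambda>t. x + t *\<^sub>R v + r *\<^sub>R w) has_derivative (\<lambda>h. h *\<^sub>R v)) (at t)"
        by (auto intro!: derivative_eq_intros)
      from has_derivative_compose[OF this smooth_on_has_derivative[OF assms(2) inS[OF t]]]
      show ?thesis unfolding has_field_derivative_def g_def
        by (simp add: linear_scale[OF smooth_on_linear_D[OF assms(2) inS[OF t]]] mult.commute[of _ "D f _ v"])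
    qed
    have "\<exists>t>0. t < s \<and> h s - h 0 = (s - 0) * (g (x + t *\<^sub>R v + s *\<^sub>R w) - g (x + t *\<^sub>R v))"
    proof (rule MVT2)
      show "0 < s" by fact
      fix t assume "0 \<le> t" "t \<le> s"
      then show "(h has_real_derivative g (x + t *\<^sub>R v + s *\<^sub>R w) - g (x + t *\<^sub>R v)) (at t)"
        unfolding h_def using s df[of t s] df[of t 0] by (intro DERIV_diff) auto
    qed
    then obtain t where t: "0 < t" "t < s" "h s - h 0 = s * (g (x + t *\<^sub>R v + s *\<^sub>R w) - g (x + t *\<^sub>R v))"
      by auto
    have A: "f (x + s *\<^sub>R v + s *\<^sub>R w) - f (x + s *\<^sub>R v) - f (x + s *\<^sub>R w) + f x
        = s * (g (x + t *\<^sub>R v + s *\<^sub>R w) - g (x + t *\<^sub>R v))"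
      using t(3) by (simp add: h_def)
    have e1: "\<bar>g (x + t *\<^sub>R v + r *\<^sub>R w) - g x - D2 f x v (t *\<^sub>R v + r *\<^sub>R w)\<bar> \<le> \<epsilon> * (s * M)"
      if "0 \<le> r" "r \<le> s" for r
    proof -
      have n: "norm (t *\<^sub>R v + r *\<^sub>R w) \<le> s * M" using small[of t r] t that by auto
      then have "norm (t *\<^sub>R v + r *\<^sub>R w) < d1" using sM d_def by linarith
      then have "norm (g (x + (t *\<^sub>R v + r *\<^sub>R w)) - g x - D2 f x v (t *\<^sub>R v + r *\<^sub>R w)) \<le> \<epsilon> * norm (t *\<^sub>R v + r *\<^sub>R w)"
        using d1(2)[of "x + (t *\<^sub>R v + r *\<^sub>R w)"] by simp
      also have "\<dots> \<le> \<epsilon> * (s * M)" using n \<epsilon>(1) by simp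
      finally show ?thesis by (simp add: add.assoc)
    qed
    have "\<bar>g (x + t *\<^sub>R v + s *\<^sub>R w) - g (x + t *\<^sub>R v) - s * D2 f x v w\<bar> \<le> 2 * \<epsilon> * M * s"
      using e1[of s] e1[of 0] s by (simp add: linear_add[OF ld] linear_scale[OF ld] algebra_simps)
    also have "\<dots> < e * s" using \<epsilon>(2) s by simp
    finally have "\<bar>(g (x + t *\<^sub>R v + s *\<^sub>R w) - g (x + t *\<^sub>R v)) / s - D2 f x v w\<bar> < e"
      using s by (simp add: field_simps abs_less_iff)
    then show ?thesis unfolding A using s by (simp add: power2_eq_square)
  qed
  moreover have "d / (M + 1) > 0" using d M by simp
  ultimately show "\<forall>\<^sub>F s in at_right 0. dist ((f (x + s *\<^sub>R v + s *\<^sub>R w) - f (x + s *\<^sub>R v) - f (x + s *\<^sub>R w) + f x) / s\<^sup>2) (D2 f x v w) < e"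
    unfolding eventually_at_right_field dist_real_def by (intro exI[of _ "d / (M + 1)"]) auto
qed

lemma D2_linear_comp:
  assumes "open S" "smooth_on S f" "x \<in> S" "bounded_linear L"
  shows "D2 (\<lambda>y. L (f y)) x v w = L (D2 f x v w)"
proof -
  have "D (\<lambda>y. L (f y)) y = (\<lambda>v. L (D f y v))" if "y \<in> S" for y
    by (intro D_eq bounded_linear.has_derivative[OF assms(4)] smooth_on_has_derivative[OF assms(2) that])
  moreover have d: "((\<lambda>y. L (D f y v)) has_derivative (\<lambda>w. L (D2 f x v w))) (at x)"
    by (intro bounded_linear.has_derivative[OF assms(4)] smooth_on_has_derivative[OF smooth_on_D[OF assms(2)] assms(3)])
  ultimately show ?thesis
    using D_eq[OF has_derivative_transform_within_open[OF d assms(1,3)], of "\<lambda>y. D (\<lambda>y. L (f y)) y v"] by simp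
qed

text \<open>The second difference is symmetric in \<open>v\<close> and \<open>w\<close>, so for
  real-valued maps the two limits coincide. Vector-valued maps are compared coordinate by
  coordinate.\<close>

lemma D2_symmetric:
  fixes f :: "'a::real_normed_vector \<Rightarrow> 'b::real_normed_vector"
  assumes fd: "findim TYPE('b)" and S: "open S" "smooth_on S f" "x \<in> S"
  shows "D2 f x v w = D2 f x w v"
proof -
  have real: "D2 g x v w = D2 g x w v" if g: "smooth_on S g" for g :: "'a \<Rightarrow> real"
  proof (rule tendsto_unique[OF _ second_difference_tendsto[OF S(1) g S(3)]])
    show "((\<lambda>s. (g (x + s *\<^sub>R v + s *\<^sub>R w) - g (x + s *\<^sub>R v) - g (x + s *\<^sub>R w) + g x) / s\<^sup>2)
     \<longlongrightarrow> D2 g x w v) (at_right 0)"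
      using second_difference_tendsto[OF S(1) g S(3), of w v] by (simp add: algebra_simps)
  qed simp
  obtain B :: "'b set" and coord where B: "finite B" "\<And>b. bounded_linear (coord b)"
    "\<And>x. x = (\<Sum>b\<in>B. coord b x *\<^sub>R b)"
    using findim_coordinates[OF fd] by metis
  have coord: "coord b (D2 f x v w) = coord b (D2 f x w v)" for b
    using real[OF smooth_on_linear_comp[OF B(2) S(1,2)]] by (simp add: D2_linear_comp[OF S B(2)])
  have "D2 f x v w = (\<Sum>b\<in>B. coord b (D2 f x v w) *\<^sub>R b)" by (rule B(3))
  also have "\<dots> = D2 f x w v" unfolding coord by (rule B(3)[symmetric])
  finally show ?thesis .
qed

lemma D_compose:
  assumes "open S" "open T" "\<phi> ` S \<subseteq> T" "smooth_on S \<phi>" "smooth_on T f" "x \<in> S"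
  shows "D (\<lambda>x. f (\<phi> x)) x v = D f (\<phi> x) (D \<phi> x v)"
  using D_eq[OF has_derivative_compose[OF smooth_on_has_derivative[OF assms(4,6)] smooth_on_has_derivative[OF assms(5)]]] assms
  by auto

lemma D2_compose:
  fixes f :: "'b::real_normed_vector \<Rightarrow> 'c::real_normed_vector"
  assumes fd: "findim TYPE('b)" and S: "open S" "open T" "\<phi> ` S \<subseteq> T" "smooth_on S \<phi>" "smooth_on T f" "x \<in> S"
  shows "D2 (\<lambda>x. f (\<phi> x)) x v w = D2 f (\<phi> x) (D \<phi> x v) (D \<phi> x w) + D f (\<phi> x) (D2 \<phi> x v w)"
proof -
  have "((\<lambda>y. D f (\<phi> y) (D \<phi> y v)) has_derivative
      (\<lambda>w. D2 f (\<phi> x) (D \<phi> x v) (D \<phi> x w) + D f (\<phi> x) (D2 \<phi> x v w))) (at x)"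
    using S by (intro has_derivative_D_apply[OF fd S(2,5)] smooth_on_has_derivative[OF S(4,6)]
        smooth_on_has_derivative[OF smooth_on_D[OF S(4)] S(6)]) auto
  from has_derivative_transform_within_open[OF this S(1,6)]
  have "((\<lambda>y. D (\<lambda>x. f (\<phi> x)) y v) has_derivative
      (\<lambda>w. D2 f (\<phi> x) (D \<phi> x v) (D \<phi> x w) + D f (\<phi> x) (D2 \<phi> x v w))) (at x)"
    using D_compose[OF S(1-5)] by auto
  then show ?thesis by (simp add: D_eq)
qed

section \<open>Local smoothness on manifolds\<close>

abbreviation cimg :: "('a, 'e) chart \<Rightarrow> 'e set" where
  "cimg c \<equiv> snd c ` fst c"

abbreviation local_rep :: "('a, 'e) chart \<Rightarrow> ('b, 'f) chart \<Rightarrow> ('a \<Rightarrow> 'b) \<Rightarrow> 'e \<Rightarrow> 'f" where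
  "local_rep c d f \<equiv> snd d \<circ> f \<circ> chart_inv c"

lemma open_preimage_in:
  assumes "open U" "continuous_on U h" "open W"
  shows "open {u \<in> U. h u \<in> W}"
  using continuous_open_preimage[OF assms(2,1,3)] by (simp add: vimage_def Int_def)

lemma findim_model: "smooth_manifold (M :: ('a, 'e::real_normed_vector) manifold) \<Longrightarrow> findim TYPE('e)"
  unfolding smooth_manifold_def findim_def by blast

lemma charts_at_iff: "c \<in> charts_at M p \<longleftrightarrow> c \<in> atlas M \<and> p \<in> fst c"
  by (simp add: charts_at_def)

lemma ex_chart_at: "smooth_manifold M \<Longrightarrow> p \<in> points M \<Longrightarrow> \<exists>c. c \<in> charts_at M p"
  unfolding smooth_manifold_def charts_at_def by blast

lemma chart_dom_subset: "smooth_manifold M \<Longrightarrow> c \<in> atlas M \<Longrightarrow> fst c \<subseteq> points M"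
  unfolding smooth_manifold_def by (meson openin_subset)

lemma chart_dom_open: "smooth_manifold M \<Longrightarrow> c \<in> atlas M \<Longrightarrow> openin (mtop M) (fst c)"
  unfolding smooth_manifold_def by blast

lemma cimg_open: "smooth_manifold M \<Longrightarrow> c \<in> atlas M \<Longrightarrow> open (cimg c)"
  unfolding smooth_manifold_def by blast

lemma chart_homeomorphic_map: "smooth_manifold M \<Longrightarrow> c \<in> atlas M \<Longrightarrow>
    homeomorphic_map (subtopology (mtop M) (fst c)) (top_of_set (cimg c)) (snd c)"
  unfolding smooth_manifold_def by blast

lemma chart_change_smooth: "smooth_manifold M \<Longrightarrow> c \<in> atlas M \<Longrightarrow> d \<in> atlas M \<Longrightarrow>
    smooth_on (snd c ` (fst c \<inter> fst d)) (snd d \<circ> chart_inv c)"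
  unfolding smooth_manifold_def by blast

lemma topspace_chart_dom: "smooth_manifold M \<Longrightarrow> c \<in> atlas M \<Longrightarrow>
    topspace (subtopology (mtop M) (fst c)) = fst c"
  using chart_dom_subset by fastforce

lemma chart_inj_on: "smooth_manifold M \<Longrightarrow> c \<in> atlas M \<Longrightarrow> inj_on (snd c) (fst c)"
  using homeomorphic_imp_injective_map[OF chart_homeomorphic_map] topspace_chart_dom by metis

lemma chart_inv_chart: "smooth_manifold M \<Longrightarrow> c \<in> atlas M \<Longrightarrow> p \<in> fst c \<Longrightarrow> chart_inv c (snd c p) = p"
  unfolding chart_inv_def by (rule inv_into_f_f[OF chart_inj_on])

lemma chart_chart_inv: "u \<in> cimg c \<Longrightarrow> snd c (chart_inv c u) = u"
  unfolding chart_inv_def by (rule f_inv_into_f)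

lemma chart_inv_in: "u \<in> cimg c \<Longrightarrow> chart_inv c u \<in> fst c"
  unfolding chart_inv_def by (rule inv_into_into)

lemma chart_in_cimg: "c \<in> charts_at M p \<Longrightarrow> snd c p \<in> cimg c"
  by (simp add: charts_at_iff)

text \<open>\<open>homeomorphic_map\<close> asserts some continuous inverse; on the chart image it
  must agree with \<open>chart_inv\<close>.\<close>

lemma chart_homeomorphic_maps:
  assumes "smooth_manifold M" "c \<in> atlas M"
  shows "homeomorphic_maps (subtopology (mtop M) (fst c)) (top_of_set (cimg c)) (snd c) (chart_inv c)"
proof -
  obtain g where g: "homeomorphic_maps (subtopology (mtop M) (fst c)) (top_of_set (cimg c)) (snd c) g"
    using chart_homeomorphic_map[OF assms] by (auto simp: homeomorphic_map_maps)
  have "g u = chart_inv c u" if u: "u \<in> cimg c" for u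
  proof -
    obtain p where p: "p \<in> fst c" "u = snd c p" using u by blast
    then have "g u = p"
      using g topspace_chart_dom[OF assms] by (auto simp: homeomorphic_maps_def)
    then show ?thesis using p chart_inv_chart[OF assms] by simp
  qed
  then show ?thesis using homeomorphic_maps_eq[OF g] by auto
qed

lemma chart_image_open:
  assumes "smooth_manifold M" "c \<in> atlas M" "openin (mtop M) V" "V \<subseteq> fst c"
  shows "open (snd c ` V)"
proof -
  have "openin (subtopology (mtop M) (fst c)) V"
    using assms by (simp add: openin_open_subtopology chart_dom_open)
  then have "openin (top_of_set (cimg c)) (snd c ` V)"
    using homeomorphic_imp_open_map[OF chart_homeomorphic_map[OF assms(1,2)]] by (simp add: open_map_def)
  then show ?thesis using cimg_open[OF assms(1,2)] openin_open_eq by blast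
qed

lemma chart_inv_image_open:
  assumes "smooth_manifold M" "c \<in> atlas M" "open W" "W \<subseteq> cimg c"
  shows "openin (mtop M) (chart_inv c ` W)"
proof -
  have "homeomorphic_map (top_of_set (cimg c)) (subtopology (mtop M) (fst c)) (chart_inv c)"
    using chart_homeomorphic_maps[OF assms(1,2)] homeomorphic_maps_map by blast
  moreover have "openin (top_of_set (cimg c)) W"
    using assms by (simp add: open_subset)
  ultimately have "openin (subtopology (mtop M) (fst c)) (chart_inv c ` W)"
    using homeomorphic_imp_open_map open_map_def by blast
  then show ?thesis
    using assms by (simp add: openin_open_subtopology chart_dom_open)
qed

lemma chart_overlap_open:
  "smooth_manifold M \<Longrightarrow> c \<in> atlas M \<Longrightarrow> d \<in> atlas M \<Longrightarrow> open (snd c ` (fst c \<inter> fst d))"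
  by (rule chart_image_open) (auto intro: chart_dom_open openin_Int)

lemma mem_chart_overlap:
  "u \<in> snd c ` (fst c \<inter> X) \<Longrightarrow> smooth_manifold M \<Longrightarrow> c \<in> atlas M \<Longrightarrow> u \<in> cimg c \<and> chart_inv c u \<in> X"
  using chart_inv_chart by fastforce

text \<open>One suitable pair of charts is demanded here, against all pairs and global continuity in
  \<open>smooth_map\<close>. That \<open>U\<close> is mapped into the domain of \<open>d\<close>
  builds local continuity into the notion, so it can be composed and localized freely.\<close>

definition smooth_at :: "('a, 'e::real_normed_vector) manifold \<Rightarrow> ('b, 'f::real_normed_vector) manifold \<Rightarrow>
    ('a \<Rightarrow> 'b) \<Rightarrow> 'a \<Rightarrow> bool" where
  "smooth_at M N f p \<longleftrightarrow> (\<exists>c\<in>charts_at M p. \<exists>d\<in>charts_at N (f p). \<exists>U.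
     open U \<and> snd c p \<in> U \<and> U \<subseteq> cimg c \<and> f ` chart_inv c ` U \<subseteq> fst d \<and> smooth_on U (local_rep c d f))"

text \<open>Independence of the charts: the given representative is composed with a coordinate
  change on either side. \<open>U1\<close> is where the change in the source lands in
  \<open>U\<close>, and \<open>U2\<close> is where the value lies in both charts of the
  target.\<close>

lemma smooth_atE:
  assumes M: "smooth_manifold M" and N: "smooth_manifold N" and f: "smooth_at M N f p"
    and c': "c' \<in> charts_at M p" and d': "d' \<in> charts_at N (f p)"
  obtains U where "open U" "snd c' p \<in> U" "U \<subseteq> cimg c'" "f ` chart_inv c' ` U \<subseteq> fst d'"
    "smooth_on U (local_rep c' d' f)"
proof -
  obtain c d U where c: "c \<in> charts_at M p" and d: "d \<in> charts_at N (f p)"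
    and U: "open U" "snd c p \<in> U" "U \<subseteq> cimg c" "f ` chart_inv c ` U \<subseteq> fst d" "smooth_on U (local_rep c d f)"
    using f unfolding smooth_at_def by metis
  have at: "c \<in> atlas M" "c' \<in> atlas M" "d \<in> atlas N" "d' \<in> atlas N" "p \<in> fst c" "p \<in> fst c'"
    "f p \<in> fst d" "f p \<in> fst d'"
    using c d c' d' by (auto simp: charts_at_iff)
  define \<tau> where "\<tau> = snd c \<circ> chart_inv c'"
  define V where "V = snd c' ` (fst c' \<inter> fst c)"
  have V: "open V" "smooth_on V \<tau>"
    unfolding V_def \<tau>_def using chart_overlap_open[OF M at(2,1)] chart_change_smooth[OF M at(2,1)] by auto
  define U1 where "U1 = {v \<in> V. \<tau> v \<in> U}"
  have U1: "open U1" unfolding U1_def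
    by (rule open_preimage_in[OF V(1) smooth_on_imp_continuous_on[OF V(2)] U(1)])
  define W where "W = snd d ` (fst d \<inter> fst d')"
  have W: "open W" "smooth_on W (snd d' \<circ> chart_inv d)"
    unfolding W_def using chart_overlap_open[OF N at(3,4)] chart_change_smooth[OF N at(3,4)] by auto
  define h where "h = (\<lambda>v. local_rep c d f (\<tau> v))"
  have sh: "smooth_on U1 h" unfolding h_def
    by (rule smooth_on_compose[OF findim_model[OF M] U1 U(1) _ smooth_on_subset[OF V(2)] U(5)])
      (auto simp: U1_def)
  define U2 where "U2 = {v \<in> U1. h v \<in> W}"
  have U2: "open U2" unfolding U2_def
    by (rule open_preimage_in[OF U1 smooth_on_imp_continuous_on[OF sh] W(1)])
  have U2V: "v \<in> V" "\<tau> v \<in> U" "h v \<in> W" if "v \<in> U2" for v using that by (auto simp: U2_def U1_def)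
  have ci: "chart_inv c (\<tau> v) = chart_inv c' v" if "v \<in> V" for v
    using mem_chart_overlap[OF that[unfolded V_def] M at(2)] chart_inv_chart[OF M at(1)]
    by (simp add: \<tau>_def)
  have fv: "f (chart_inv c' v) \<in> fst d \<inter> fst d'" "chart_inv d (h v) = f (chart_inv c' v)" if v: "v \<in> U2" for v
  proof -
    have 1: "f (chart_inv c' v) \<in> fst d" using U2V[OF v] U(4) ci by fastforce
    have 2: "h v = snd d (f (chart_inv c' v))" using U2V[OF v] ci by (simp add: h_def)
    then show 3: "chart_inv d (h v) = f (chart_inv c' v)"
      using chart_inv_chart[OF N at(3) 1] by simp
    show "f (chart_inv c' v) \<in> fst d \<inter> fst d'"
      using mem_chart_overlap[OF U2V(3)[OF v, unfolded W_def] N at(3)] 1 3 by simp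
  qed
  show thesis
  proof (rule that[OF U2])
    have \<tau>p: "\<tau> (snd c' p) = snd c p" using chart_inv_chart[OF M at(2,6)] by (simp add: \<tau>_def)
    have pV: "snd c' p \<in> V" using at by (auto simp: V_def)
    have "h (snd c' p) = snd d (f p)" using chart_inv_chart[OF M at(1,5)] by (simp add: h_def \<tau>p)
    then show "snd c' p \<in> U2" using pV \<tau>p U(2) at by (auto simp: U2_def U1_def W_def)
    show "U2 \<subseteq> cimg c'" using U2V(1) by (auto simp: V_def)
    show "f ` chart_inv c' ` U2 \<subseteq> fst d'" using fv(1) by auto
    have "smooth_on U2 (\<lambda>v. (snd d' \<circ> chart_inv d) (h v))"
      by (rule smooth_on_compose[OF findim_model[OF N] U2 W(1) _ smooth_on_subset[OF sh] W(2)])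
        (auto simp: U2_def)
    then show "smooth_on U2 (local_rep c' d' f)"
      by (rule smooth_on_cong[OF U2]) (simp add: fv(2))
  qed
qed

lemma smooth_atI:
  "c \<in> charts_at M p \<Longrightarrow> d \<in> charts_at N (f p) \<Longrightarrow> open U \<Longrightarrow> snd c p \<in> U \<Longrightarrow> U \<subseteq> cimg c \<Longrightarrow>
    (\<And>u. u \<in> U \<Longrightarrow> f (chart_inv c u) \<in> fst d) \<Longrightarrow> smooth_on U (local_rep c d f) \<Longrightarrow> smooth_at M N f p"
  unfolding smooth_at_def by blast

lemma smooth_at_charts:
  assumes "smooth_manifold M" "smooth_manifold N" "smooth_at M N f p"
  shows "p \<in> points M" "f p \<in> points N"
proof -
  obtain c d where "c \<in> charts_at M p" "d \<in> charts_at N (f p)"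
    using assms(3) unfolding smooth_at_def by metis
  then show "p \<in> points M" "f p \<in> points N"
    unfolding charts_at_iff using chart_dom_subset[OF assms(1)] chart_dom_subset[OF assms(2)] by blast+
qed

lemma smooth_at_cong:
  assumes M: "smooth_manifold M" and N: "smooth_manifold N" and "smooth_at M N g p"
    and V: "openin (mtop M) V" "p \<in> V" "\<And>q. q \<in> V \<Longrightarrow> f q = g q"
  shows "smooth_at M N f p"
proof -
  obtain c d U where c: "c \<in> charts_at M p" and d: "d \<in> charts_at N (g p)"
    and U: "open U" "snd c p \<in> U" "U \<subseteq> cimg c" "g ` chart_inv c ` U \<subseteq> fst d" "smooth_on U (local_rep c d g)"
    using assms(3) unfolding smooth_at_def by metis
  have at: "c \<in> atlas M" "p \<in> fst c" using c by (auto simp: charts_at_iff)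
  define U' where "U' = U \<inter> snd c ` (fst c \<inter> V)"
  have U': "open U'" unfolding U'_def
    by (intro open_Int U(1) chart_image_open[OF M at(1)] openin_Int V(1) chart_dom_open[OF M at(1)]) auto
  have eq: "f (chart_inv c u) = g (chart_inv c u)" if "u \<in> U'" for u
    using V(3) mem_chart_overlap[OF _ M at(1)] that by (auto simp: U'_def)
  show ?thesis
  proof (rule smooth_atI[OF c _ U'])
    show "d \<in> charts_at N (f p)" using d V by simp
    show "snd c p \<in> U'" using U(2) V(2) at by (auto simp: U'_def)
    show "U' \<subseteq> cimg c" by (auto simp: U'_def)
    show "f (chart_inv c u) \<in> fst d" if "u \<in> U'" for u using eq[OF that] U(4) that by (auto simp: U'_def)
    show "smooth_on U' (local_rep c d f)"
      by (rule smooth_on_cong[OF U' smooth_on_subset[OF U(5)]]) (auto simp: U'_def eq[unfolded U'_def])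
  qed
qed

lemma smooth_at_compose:
  assumes M: "smooth_manifold M" and N: "smooth_manifold N" and P: "smooth_manifold P"
    and f: "smooth_at M N f p" and g: "smooth_at N P g (f p)"
  shows "smooth_at M P (\<lambda>x. g (f x)) p"
proof -
  obtain c d U where c: "c \<in> charts_at M p" and d: "d \<in> charts_at N (f p)"
    and U: "open U" "snd c p \<in> U" "U \<subseteq> cimg c" "f ` chart_inv c ` U \<subseteq> fst d" "smooth_on U (local_rep c d f)"
    using f unfolding smooth_at_def by metis
  obtain e where e: "e \<in> charts_at P (g (f p))"
    using ex_chart_at[OF P] smooth_at_charts(2)[OF N P g] by blast
  obtain W where W: "open W" "snd d (f p) \<in> W" "W \<subseteq> cimg d" "g ` chart_inv d ` W \<subseteq> fst e"
    "smooth_on W (local_rep d e g)"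
    using smooth_atE[OF N P g d e] by metis
  have at: "c \<in> atlas M" "d \<in> atlas N" "p \<in> fst c" "f p \<in> fst d" using c d by (auto simp: charts_at_iff)
  define U' where "U' = {u \<in> U. local_rep c d f u \<in> W}"
  have U': "open U'" unfolding U'_def
    by (rule open_preimage_in[OF U(1) smooth_on_imp_continuous_on[OF U(5)] W(1)])
  have ci: "chart_inv d (local_rep c d f u) = f (chart_inv c u)" if "u \<in> U'" for u
    using U(4) that chart_inv_chart[OF N at(2)] by (auto simp: U'_def)
  show ?thesis
  proof (rule smooth_atI[where f="\<lambda>x. g (f x)", OF c e U'])
    show "snd c p \<in> U'" using U(2) W(2) chart_inv_chart[OF M at(1,3)] by (auto simp: U'_def)
    show "U' \<subseteq> cimg c" using U(3) by (auto simp: U'_def)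
    show "g (f (chart_inv c u)) \<in> fst e" if "u \<in> U'" for u
    proof -
      have "local_rep c d f u \<in> W" using that by (simp add: U'_def)
      then have "g (chart_inv d (local_rep c d f u)) \<in> fst e" using W(4) by blast
      then show ?thesis using ci[OF that] by simp
    qed
    have "smooth_on U' (\<lambda>u. local_rep d e g (local_rep c d f u))"
      by (rule smooth_on_compose[OF findim_model[OF N] U' W(1) _ smooth_on_subset[OF U(5)] W(5)])
        (auto simp: U'_def)
    then show "smooth_on U' (local_rep c e (\<lambda>x. g (f x)))"
      by (rule smooth_on_cong[OF U']) (use ci in simp)
  qed
qed

text \<open>Continuity, a separate clause of \<open>smooth_map\<close>, is recovered because a
  smooth representative is continuous and charts are homeomorphisms. The representatives in all
  pairs of charts come from independence of the charts.\<close>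

lemma smooth_map_iff_smooth_at:
  assumes M: "smooth_manifold M" and N: "smooth_manifold N"
  shows "smooth_map M N f \<longleftrightarrow> (\<forall>p\<in>points M. smooth_at M N f p)"
proof
  assume f: "smooth_map M N f"
  then have cont: "continuous_map (mtop M) (mtop N) f" by (simp add: smooth_map_def)
  show "\<forall>p\<in>points M. smooth_at M N f p"
  proof
    fix p assume p: "p \<in> points M"
    then have fp: "f p \<in> points N" using cont by (auto simp: continuous_map_def)
    obtain c where c: "c \<in> charts_at M p" using ex_chart_at[OF M p] by blast
    obtain d where d: "d \<in> charts_at N (f p)" using ex_chart_at[OF N fp] by blast
    have at: "c \<in> atlas M" "d \<in> atlas N" "p \<in> fst c" "f p \<in> fst d" using c d by (auto simp: charts_at_iff)
    have eq: "fst c \<inter> f -` fst d = fst c \<inter> {x \<in> points M. f x \<in> fst d}"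
      using chart_dom_subset[OF M at(1)] by auto
    have "openin (mtop M) (fst c \<inter> f -` fst d)"
      unfolding eq by (intro openin_Int chart_dom_open[OF M at(1)] openin_continuous_map_preimage[OF cont chart_dom_open[OF N at(2)]])
    then have o: "open (snd c ` (fst c \<inter> f -` fst d))" by (intro chart_image_open[OF M at(1)]) auto
    show "smooth_at M N f p"
    proof (rule smooth_atI[where f=f, OF c d o])
      show "f (chart_inv c u) \<in> fst d" if "u \<in> snd c ` (fst c \<inter> f -` fst d)" for u
        using mem_chart_overlap[OF that M at(1)] by auto
      show "smooth_on (snd c ` (fst c \<inter> f -` fst d)) (local_rep c d f)"
        using f at unfolding smooth_map_def by blast
    qed (use at in auto)
  qed
next
  assume f: "\<forall>p\<in>points M. smooth_at M N f p"
  have into: "f p \<in> points N" if "p \<in> points M" for p using f that smooth_at_charts(2)[OF M N] by blast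
  show "smooth_map M N f" unfolding smooth_map_def
  proof (intro conjI ballI)
    show "continuous_map (mtop M) (mtop N) f" unfolding continuous_map_def
    proof (intro conjI allI impI)
      show "f \<in> points M \<rightarrow> points N" using into by auto
      fix V assume V: "openin (mtop N) V"
      show "openin (mtop M) {x \<in> points M. f x \<in> V}"
      \<comment> \<open>Openness is checked point by point: the neighbourhood of \<open>p\<close> is
        the image under \<open>chart_inv c\<close> of the coordinates whose values lie in
        \<open>V\<close>.\<close>
      proof (subst openin_subopen, clarify)
        fix p assume p: "p \<in> points M" "f p \<in> V"
        obtain c d U where c: "c \<in> charts_at M p" and d: "d \<in> charts_at N (f p)"
          and U: "open U" "snd c p \<in> U" "U \<subseteq> cimg c" "f ` chart_inv c ` U \<subseteq> fst d" "smooth_on U (local_rep c d f)"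
          using f p(1) unfolding smooth_at_def by metis
        have at: "c \<in> atlas M" "d \<in> atlas N" "p \<in> fst c" "f p \<in> fst d" using c d by (auto simp: charts_at_iff)
        have W: "open (snd d ` (fst d \<inter> V))"
          by (intro chart_image_open[OF N at(2)] openin_Int chart_dom_open[OF N at(2)] V) auto
        define U' where "U' = {u \<in> U. local_rep c d f u \<in> snd d ` (fst d \<inter> V)}"
        have U': "open U'" unfolding U'_def
          by (rule open_preimage_in[OF U(1) smooth_on_imp_continuous_on[OF U(5)] W])
        have o: "openin (mtop M) (chart_inv c ` U')"
          using U(3) by (intro chart_inv_image_open[OF M at(1) U']) (auto simp: U'_def)
        have "snd c p \<in> U'" using U(2) p at chart_inv_chart[OF M at(1,3)] by (auto simp: U'_def)
        then have "p \<in> chart_inv c ` U'" using chart_inv_chart[OF M at(1,3)] by (metis imageI)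
        moreover have "chart_inv c ` U' \<subseteq> {x \<in> points M. f x \<in> V}"
        proof safe
          fix u assume u: "u \<in> U'"
          then have "u \<in> cimg c" using U(3) by (auto simp: U'_def)
          then show "chart_inv c u \<in> points M" by (rule subsetD[OF chart_dom_subset[OF M at(1)] chart_inv_in])
          have "f (chart_inv c u) \<in> fst d" using U(4) u by (auto simp: U'_def)
          moreover have "snd d (f (chart_inv c u)) \<in> snd d ` (fst d \<inter> V)" using u by (simp add: U'_def)
          ultimately show "f (chart_inv c u) \<in> V"
            using mem_chart_overlap[OF _ N at(2), of "snd d (f (chart_inv c u))" V]
              chart_inv_chart[OF N at(2), of "f (chart_inv c u)"] by simp
        qed
        ultimately show "\<exists>T. openin (mtop M) T \<and> p \<in> T \<and> T \<subseteq> {x \<in> points M. f x \<in> V}"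
          using o by blast
      qed
    qed
    fix c d assume at: "c \<in> atlas M" "d \<in> atlas N"
    show "smooth_on (snd c ` (fst c \<inter> f -` fst d)) (local_rep c d f)"
    proof (rule smooth_on_local)
      fix u assume "u \<in> snd c ` (fst c \<inter> f -` fst d)"
      then obtain p where p: "p \<in> fst c" "f p \<in> fst d" "u = snd c p" by auto
      have sp: "smooth_at M N f p" using f subsetD[OF chart_dom_subset[OF M at(1)] p(1)] by simp
      have "c \<in> charts_at M p" "d \<in> charts_at N (f p)" using p at by (auto simp: charts_at_iff)
      then show "\<exists>T. open T \<and> u \<in> T \<and> smooth_on T (local_rep c d f)"
        using smooth_atE[OF M N sp] p(3) by metis
    qed
  qed
qed

section \<open>Vector spaces as manifolds, and charts as smooth maps\<close>

lemma vec_chart_simps [simp]: "fst vec_chart = UNIV" "snd vec_chart = id" "chart_inv vec_chart = id"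
  by (auto simp: vec_chart_def chart_inv_def inv_id)

lemma vec_mfd_simps [simp]: "mtop vec_mfd = euclidean" "atlas vec_mfd = {vec_chart}" "charts_at vec_mfd p = {vec_chart}"
  by (auto simp: vec_mfd_def charts_at_def)

lemma vec_mfd_smooth_manifold:
  assumes "findim TYPE('v::real_normed_vector)"
  shows "smooth_manifold (vec_mfd :: ('v, 'v) manifold)"
  unfolding smooth_manifold_def
  using assms second_countable_findim[OF assms] smooth_on_ident[of UNIV]
  by (auto simp: findim_def id_def[symmetric] image_id)

lemma smooth_at_vec_iff:
  "smooth_at vec_mfd vec_mfd f x \<longleftrightarrow> (\<exists>U. open U \<and> x \<in> U \<and> smooth_on U f)"
  unfolding smooth_at_def by simp

lemma smooth_on_iff_smooth_at:
  assumes "open U"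
  shows "smooth_on U f \<longleftrightarrow> (\<forall>x\<in>U. smooth_at vec_mfd vec_mfd f x)"
  unfolding smooth_at_vec_iff using smooth_on_local assms by metis

lemma smooth_at_chart:
  assumes "smooth_manifold M" "c \<in> charts_at M p"
  shows "smooth_at M vec_mfd (snd c) p"
proof -
  have at: "c \<in> atlas M" using assms by (simp add: charts_at_iff)
  show ?thesis
  proof (rule smooth_atI[OF assms(2) _ cimg_open[OF assms(1) at]])
    show "smooth_on (cimg c) (local_rep c vec_chart (snd c))"
      by (rule smooth_on_cong[OF cimg_open[OF assms(1) at] smooth_on_ident]) (simp add: chart_chart_inv)
  qed (auto simp: chart_in_cimg[OF assms(2)])
qed

lemma smooth_at_chart_inv:
  assumes "smooth_manifold M" "c \<in> atlas M" "u \<in> cimg c"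
  shows "smooth_at vec_mfd M (chart_inv c) u"
proof -
  have "c \<in> charts_at M (chart_inv c u)" using assms(2) chart_inv_in[OF assms(3)] by (simp add: charts_at_iff)
  then show ?thesis
  proof (rule smooth_atI[of vec_chart, rotated, OF _ cimg_open[OF assms(1,2)]])
    show "smooth_on (cimg c) (local_rep vec_chart c (chart_inv c))"
      by (rule smooth_on_cong[OF cimg_open[OF assms(1,2)] smooth_on_ident]) (simp add: chart_chart_inv)
    show "chart_inv c (chart_inv vec_chart w) \<in> fst c" if "w \<in> cimg c" for w
      using chart_inv_in[OF that] by simp
  qed (use assms in simp_all)
qed

lemma smooth_at_const:
  assumes M: "smooth_manifold M" and N: "smooth_manifold N" and "p \<in> points M" "q \<in> points N"
  shows "smooth_at M N (\<lambda>x. q) p"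
proof -
  obtain c where c: "c \<in> charts_at M p" using ex_chart_at[OF M assms(3)] by blast
  obtain d where d: "d \<in> charts_at N q" using ex_chart_at[OF N assms(4)] by blast
  have at: "c \<in> atlas M" using c by (simp add: charts_at_iff)
  show ?thesis
  proof (rule smooth_atI[OF c d cimg_open[OF M at]])
    show "smooth_on (cimg c) (local_rep c d (\<lambda>x. q))"
      by (simp add: comp_def smooth_on_const)
  qed (use c d in \<open>auto simp: charts_at_iff\<close>)
qed

lemma smooth_at_ident:
  assumes M: "smooth_manifold M" and "p \<in> points M"
  shows "smooth_at M M (\<lambda>x. x) p"
proof -
  obtain c where c: "c \<in> charts_at M p" using ex_chart_at[OF M assms(2)] by blast
  have at: "c \<in> atlas M" using c by (simp add: charts_at_iff)
  show ?thesis
  proof (rule smooth_atI[where f="\<lambda>x. x", OF c c cimg_open[OF M at]])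
    show "smooth_on (cimg c) (local_rep c c (\<lambda>x. x))"
      by (rule smooth_on_cong[OF cimg_open[OF M at] smooth_on_ident]) (simp add: chart_chart_inv)
    show "chart_inv c w \<in> fst c" if "w \<in> cimg c" for w
      by (rule chart_inv_in[OF that])
  qed (use c in \<open>auto simp: charts_at_iff\<close>)
qed

section \<open>Products of manifolds\<close>

lemma prod_chart_simps [simp]:
  "fst (prod_chart c d) = fst c \<times> fst d" "snd (prod_chart c d) = map_prod (snd c) (snd d)"
  by (auto simp: prod_chart_def)

lemma cimg_prod_chart: "cimg (prod_chart c d) = cimg c \<times> cimg d"
  by (auto simp: map_prod_surj_on)

lemma prod_mfd_simps [simp]:
  "mtop (prod_mfd M N) = prod_topology (mtop M) (mtop N)"
  "atlas (prod_mfd M N) = (\<lambda>(c, d). prod_chart c d) ` (atlas M \<times> atlas N)"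
  by (auto simp: prod_mfd_def)

lemma prod_chart_in_charts_at:
  "c \<in> charts_at M p \<Longrightarrow> d \<in> charts_at N q \<Longrightarrow> prod_chart c d \<in> charts_at (prod_mfd M N) (p, q)"
  by (auto simp: charts_at_iff)

lemma chart_inv_prod_chart:
  assumes "smooth_manifold M" "smooth_manifold N" "c \<in> atlas M" "d \<in> atlas N" "u \<in> cimg c" "v \<in> cimg d"
  shows "chart_inv (prod_chart c d) (u, v) = (chart_inv c u, chart_inv d v)"
proof -
  have "inj_on (snd (prod_chart c d)) (fst (prod_chart c d))"
    using chart_inj_on[OF assms(1,3)] chart_inj_on[OF assms(2,4)] by (auto simp: inj_on_def)
  then show ?thesis unfolding chart_inv_def
    using chart_inv_in[OF assms(5)] chart_inv_in[OF assms(6)] chart_chart_inv[OF assms(5)] chart_chart_inv[OF assms(6)]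
    by (intro inv_into_f_eq) (auto simp: chart_inv_def)
qed

lemma second_countable_prod_topology:
  assumes "second_countable X" "second_countable Y"
  shows "second_countable (prod_topology X Y)"
proof -
  obtain \<B> where B: "countable \<B>" "\<And>V. V \<in> \<B> \<Longrightarrow> openin X V" "\<And>U x. openin X U \<Longrightarrow> x \<in> U \<Longrightarrow> \<exists>V\<in>\<B>. x \<in> V \<and> V \<subseteq> U"
    using assms(1) unfolding second_countable_def by metis
  obtain \<C> where C: "countable \<C>" "\<And>V. V \<in> \<C> \<Longrightarrow> openin Y V" "\<And>U x. openin Y U \<Longrightarrow> x \<in> U \<Longrightarrow> \<exists>V\<in>\<C>. x \<in> V \<and> V \<subseteq> U"
    using assms(2) unfolding second_countable_def by metis
  let ?D = "(\<lambda>(V, W). V \<times> W) ` (\<B> \<times> \<C>)"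
  have cD: "countable ?D" using B(1) C(1) by (intro countable_image countable_SIGMA) auto
  have oD: "openin (prod_topology X Y) V" if "V \<in> ?D" for V
    using that B(2) C(2) by (auto simp: openin_prod_Times_iff)
  have bD: "\<exists>V\<in>?D. z \<in> V \<and> V \<subseteq> U" if U: "openin (prod_topology X Y) U" "z \<in> U" for U z
  proof -
    obtain x y where z: "z = (x, y)" by (cases z)
    obtain V W where VW: "openin X V" "openin Y W" "x \<in> V" "y \<in> W" "V \<times> W \<subseteq> U"
      using U z unfolding openin_prod_topology_alt by metis
    obtain V' where V': "V' \<in> \<B>" "x \<in> V'" "V' \<subseteq> V" using B(3)[OF VW(1,3)] by blast
    obtain W' where W': "W' \<in> \<C>" "y \<in> W'" "W' \<subseteq> W" using C(3)[OF VW(2,4)] by blast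
    have "V' \<times> W' \<in> ?D" using V' W' by auto
    moreover have "z \<in> V' \<times> W'" "V' \<times> W' \<subseteq> U" using V' W' VW(5) z by auto
    ultimately show ?thesis by blast
  qed
  show ?thesis unfolding second_countable_def
  proof (intro exI[of _ ?D] conjI cD ballI allI impI)
    show "openin (prod_topology X Y) V" if "V \<in> ?D" for V by (rule oD[OF that])
    show "\<exists>V\<in>?D. z \<in> V \<and> V \<subseteq> U" if "openin (prod_topology X Y) U \<and> z \<in> U" for U z
      using bD that by (elim conjE)
  qed
qed

lemma prod_smooth_manifold:
  fixes M :: "('a, 'e::real_normed_vector) manifold" and N :: "('b, 'f::real_normed_vector) manifold"
  assumes M: "smooth_manifold M" and N: "smooth_manifold N"
  shows "smooth_manifold (prod_mfd M N)"
  unfolding smooth_manifold_def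
proof (intro conjI ballI)
  show "\<exists>B. finite B \<and> span B = (UNIV :: ('e \<times> 'f) set)"
    using findim_prod[OF findim_model[OF M] findim_model[OF N]] by (simp add: findim_def)
  have H: "Hausdorff_space (mtop M)" "Hausdorff_space (mtop N)" "second_countable (mtop M)" "second_countable (mtop N)"
    "(\<Union>c\<in>atlas M. fst c) = points M" "(\<Union>c\<in>atlas N. fst c) = points N"
    using M N unfolding smooth_manifold_def by auto
  show "Hausdorff_space (mtop (prod_mfd M N))" using H by (simp add: Hausdorff_space_prod_topology)
  show "second_countable (mtop (prod_mfd M N))" using H by (simp add: second_countable_prod_topology)
  show "(\<Union>c\<in>atlas (prod_mfd M N). fst c) = points (prod_mfd M N)"
    using H(5,6) by (simp add: set_eq_iff)
  fix e assume "e \<in> atlas (prod_mfd M N)"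
  then obtain c d where e: "e = prod_chart c d" "c \<in> atlas M" "d \<in> atlas N" by auto
  show "openin (mtop (prod_mfd M N)) (fst e)"
    using e chart_dom_open[OF M] chart_dom_open[OF N] by (simp add: openin_prod_Times_iff)
  show oe: "open (cimg e)" unfolding e(1) cimg_prod_chart
    by (intro open_Times cimg_open[OF M e(2)] cimg_open[OF N e(3)])
  have "homeomorphic_maps (prod_topology (subtopology (mtop M) (fst c)) (subtopology (mtop N) (fst d)))
     (prod_topology (top_of_set (cimg c)) (top_of_set (cimg d)))
     (\<lambda>(x,y). (snd c x, snd d y)) (\<lambda>(x,y). (chart_inv c x, chart_inv d y))"
    using chart_homeomorphic_maps[OF M e(2)] chart_homeomorphic_maps[OF N e(3)]
    by (subst homeomorphic_maps_prod) simp
  moreover have "prod_topology (top_of_set (cimg c)) (top_of_set (cimg d)) = top_of_set (cimg e)"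
    unfolding e(1) cimg_prod_chart by simp
  ultimately show "homeomorphic_map (subtopology (mtop (prod_mfd M N)) (fst e)) (top_of_set (cimg e)) (snd e)"
    using e(1) homeomorphic_maps_imp_map by (simp add: subtopology_Times map_prod_def)
  fix e' assume "e' \<in> atlas (prod_mfd M N)"
  then obtain c' d' where e': "e' = prod_chart c' d'" "c' \<in> atlas M" "d' \<in> atlas N" by auto
  have eq: "snd e ` (fst e \<inter> fst e') = (snd c ` (fst c \<inter> fst c')) \<times> (snd d ` (fst d \<inter> fst d'))"
    unfolding e e' by (simp add: Times_Int_Times map_prod_surj_on)
  have o1: "open (snd c ` (fst c \<inter> fst c'))" by (rule chart_overlap_open[OF M e(2) e'(2)])
  have o2: "open (snd d ` (fst d \<inter> fst d'))" by (rule chart_overlap_open[OF N e(3) e'(3)])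
  show "smooth_on (snd e ` (fst e \<inter> fst e')) (snd e' \<circ> chart_inv e)"
    unfolding eq
  proof (rule smooth_on_cong)
    let ?S = "(snd c ` (fst c \<inter> fst c')) \<times> (snd d ` (fst d \<inter> fst d'))"
    show oS: "open ?S" by (intro open_Times o1 o2)
    show "smooth_on ?S (\<lambda>z. ((snd c' \<circ> chart_inv c) (fst z), (snd d' \<circ> chart_inv d) (snd z)))"
      by (intro smooth_on_Pair oS smooth_on_compose[OF findim_model[OF M] oS o1 _ _ chart_change_smooth[OF M e(2) e'(2)]]
          smooth_on_compose[OF findim_model[OF N] oS o2 _ _ chart_change_smooth[OF N e(3) e'(3)]]
          smooth_on_fst smooth_on_snd smooth_on_ident) auto
    show "(snd e' \<circ> chart_inv e) z = ((snd c' \<circ> chart_inv c) (fst z), (snd d' \<circ> chart_inv d) (snd z))"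
      if "z \<in> ?S" for z
      using that chart_inv_prod_chart[OF M N e(2,3), of "fst z" "snd z"] by (auto simp: e e')
  qed
qed

lemma smooth_at_fst:
  assumes M: "smooth_manifold M" and N: "smooth_manifold N" and "p \<in> points (prod_mfd M N)"
  shows "smooth_at (prod_mfd M N) M fst p"
proof -
  obtain c where c: "c \<in> charts_at M (fst p)" using ex_chart_at[OF M, of "fst p"] assms(3) by auto
  obtain d where d: "d \<in> charts_at N (snd p)" using ex_chart_at[OF N, of "snd p"] assms(3) by auto
  have cd: "prod_chart c d \<in> charts_at (prod_mfd M N) p" using prod_chart_in_charts_at[OF c d] by simp
  have at: "c \<in> atlas M" "d \<in> atlas N" using c d by (auto simp: charts_at_iff)
  have o: "open (cimg (prod_chart c d))"
    unfolding cimg_prod_chart by (intro open_Times cimg_open[OF M at(1)] cimg_open[OF N at(2)])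
  have ci: "chart_inv (prod_chart c d) z = (chart_inv c (fst z), chart_inv d (snd z))" if "z \<in> cimg (prod_chart c d)" for z
    using chart_inv_prod_chart[OF M N at, of "fst z" "snd z"] that unfolding cimg_prod_chart by auto
  show ?thesis
  proof (rule smooth_atI[where f=fst, OF cd c o])
    show "smooth_on (cimg (prod_chart c d)) (local_rep (prod_chart c d) c fst)"
    proof (rule smooth_on_cong[OF o])
      show "smooth_on (cimg (prod_chart c d)) (\<lambda>z. fst z)" by (intro smooth_on_fst smooth_on_ident o)
      show "local_rep (prod_chart c d) c fst z = fst z" if z: "z \<in> cimg (prod_chart c d)" for z
        using ci[OF z] z chart_chart_inv[of "fst z" c] unfolding cimg_prod_chart by auto
    qed
    show "fst (chart_inv (prod_chart c d) z) \<in> fst c" if z: "z \<in> cimg (prod_chart c d)" for z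
      using ci[OF z] z chart_inv_in[of "fst z" c] unfolding cimg_prod_chart by auto
  qed (use cd in \<open>auto simp: charts_at_iff\<close>)
qed

lemma smooth_at_snd:
  assumes M: "smooth_manifold M" and N: "smooth_manifold N" and "p \<in> points (prod_mfd M N)"
  shows "smooth_at (prod_mfd M N) N snd p"
proof -
  obtain c where c: "c \<in> charts_at M (fst p)" using ex_chart_at[OF M, of "fst p"] assms(3) by auto
  obtain d where d: "d \<in> charts_at N (snd p)" using ex_chart_at[OF N, of "snd p"] assms(3) by auto
  have cd: "prod_chart c d \<in> charts_at (prod_mfd M N) p" using prod_chart_in_charts_at[OF c d] by simp
  have at: "c \<in> atlas M" "d \<in> atlas N" using c d by (auto simp: charts_at_iff)
  have o: "open (cimg (prod_chart c d))"
    unfolding cimg_prod_chart by (intro open_Times cimg_open[OF M at(1)] cimg_open[OF N at(2)])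
  have ci: "chart_inv (prod_chart c d) z = (chart_inv c (fst z), chart_inv d (snd z))" if "z \<in> cimg (prod_chart c d)" for z
    using chart_inv_prod_chart[OF M N at, of "fst z" "snd z"] that unfolding cimg_prod_chart by auto
  show ?thesis
  proof (rule smooth_atI[where f=snd, OF cd d o])
    show "smooth_on (cimg (prod_chart c d)) (local_rep (prod_chart c d) d snd)"
    proof (rule smooth_on_cong[OF o])
      show "smooth_on (cimg (prod_chart c d)) (\<lambda>z. snd z)" by (intro smooth_on_snd smooth_on_ident o)
      show "local_rep (prod_chart c d) d snd z = snd z" if z: "z \<in> cimg (prod_chart c d)" for z
        using ci[OF z] z chart_chart_inv[of "snd z" d] unfolding cimg_prod_chart by auto
    qed
    show "snd (chart_inv (prod_chart c d) z) \<in> fst d" if z: "z \<in> cimg (prod_chart c d)" for z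
      using ci[OF z] z chart_inv_in[of "snd z" d] unfolding cimg_prod_chart by auto
  qed (use cd in \<open>auto simp: charts_at_iff\<close>)
qed

lemma smooth_at_Pair:
  assumes L: "smooth_manifold L" and M: "smooth_manifold M" and N: "smooth_manifold N"
    and f: "smooth_at L M f p" and g: "smooth_at L N g p"
  shows "smooth_at L (prod_mfd M N) (\<lambda>x. (f x, g x)) p"
proof -
  obtain b where b: "b \<in> charts_at L p" using ex_chart_at[OF L] smooth_at_charts(1)[OF L M f] by blast
  obtain c where c: "c \<in> charts_at M (f p)" using ex_chart_at[OF M] smooth_at_charts(2)[OF L M f] by blast
  obtain d where d: "d \<in> charts_at N (g p)" using ex_chart_at[OF N] smooth_at_charts(2)[OF L N g] by blast
  obtain U where U: "open U" "snd b p \<in> U" "U \<subseteq> cimg b" "f ` chart_inv b ` U \<subseteq> fst c" "smooth_on U (local_rep b c f)"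
    using smooth_atE[OF L M f b c] by metis
  obtain W where W: "open W" "snd b p \<in> W" "W \<subseteq> cimg b" "g ` chart_inv b ` W \<subseteq> fst d" "smooth_on W (local_rep b d g)"
    using smooth_atE[OF L N g b d] by metis
  show ?thesis
  proof (rule smooth_atI[where f="\<lambda>x. (f x, g x)", OF b prod_chart_in_charts_at[OF c d] open_Int[OF U(1) W(1)]])
    have "smooth_on (U \<inter> W) (\<lambda>u. (local_rep b c f u, local_rep b d g u))"
      by (intro smooth_on_Pair smooth_on_subset[OF U(5)] smooth_on_subset[OF W(5)] open_Int U(1) W(1)) auto
    then show "smooth_on (U \<inter> W) (local_rep b (prod_chart c d) (\<lambda>x. (f x, g x)))"
      by (simp add: comp_def)
  qed (use U W in auto)
qed

section \<open>Tangent maps\<close>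

lemma local_rep_differentiable:
  assumes "smooth_manifold M" "smooth_manifold N" "smooth_at M N f p" "c \<in> charts_at M p" "d \<in> charts_at N (f p)"
  shows "local_rep c d f differentiable (at (snd c p))"
  using smooth_atE[OF assms] smooth_on_imp_differentiable by metis

lemma local_rep_linear:
  assumes "smooth_manifold M" "smooth_manifold N" "smooth_at M N f p" "c \<in> charts_at M p" "d \<in> charts_at N (f p)"
  shows "linear (D (local_rep c d f) (snd c p))"
  by (rule linear_D[OF local_rep_differentiable[OF assms]])

text \<open>The chain rule in coordinates. Inserting the identity for \<open>f\<close> or
  \<open>g\<close> makes it the rule for a change of chart, so the facts on tangent maps below are
  instances of it.\<close>

lemma D_local_rep_compose:
  assumes M: "smooth_manifold M" and N: "smooth_manifold N" and P: "smooth_manifold P"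
    and f: "smooth_at M N f p" and g: "smooth_at N P g (f p)"
    and c: "c \<in> charts_at M p" and d: "d \<in> charts_at N (f p)" and e: "e \<in> charts_at P (g (f p))"
  shows "D (local_rep c e (\<lambda>x. g (f x))) (snd c p) x
    = D (local_rep d e g) (snd d (f p)) (D (local_rep c d f) (snd c p) x)"
proof -
  have at: "c \<in> atlas M" "d \<in> atlas N" "p \<in> fst c" "f p \<in> fst d" using c d by (auto simp: charts_at_iff)
  obtain U where U: "open U" "snd c p \<in> U" "U \<subseteq> cimg c" "f ` chart_inv c ` U \<subseteq> fst d" "smooth_on U (local_rep c d f)"
    using smooth_atE[OF M N f c d] by metis
  have eq: "local_rep c d f (snd c p) = snd d (f p)" using chart_inv_chart[OF M at(1,3)] by simp
  have "((\<lambda>u. local_rep d e g (local_rep c d f u)) has_derivative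
     (\<lambda>x. D (local_rep d e g) (snd d (f p)) (D (local_rep c d f) (snd c p) x))) (at (snd c p))"
    by (rule has_derivative_compose[OF frechet_derivative_worksI[OF local_rep_differentiable[OF M N f c d]]])
      (unfold eq, rule frechet_derivative_worksI[OF local_rep_differentiable[OF N P g d e]])
  then have "(local_rep c e (\<lambda>x. g (f x)) has_derivative
     (\<lambda>x. D (local_rep d e g) (snd d (f p)) (D (local_rep c d f) (snd c p) x))) (at (snd c p))"
  proof (rule has_derivative_transform_within_open[OF _ U(1,2)])
    fix u assume "u \<in> U"
    then have "f (chart_inv c u) \<in> fst d" using U(4) by blast
    then show "local_rep d e g (local_rep c d f u) = local_rep c e (\<lambda>x. g (f x)) u"
      using chart_inv_chart[OF N at(2)] by simp
  qed
  then show ?thesis by (simp add: D_eq)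
qed

lemma D_local_rep_cong:
  assumes M: "smooth_manifold M" and N: "smooth_manifold N"
    and f: "smooth_at M N f p" and V: "openin (mtop M) V" "p \<in> V" "\<And>q. q \<in> V \<Longrightarrow> f q = g q"
    and c: "c \<in> charts_at M p" and d: "d \<in> charts_at N (f p)"
  shows "D (local_rep c d g) (snd c p) = D (local_rep c d f) (snd c p)"
proof -
  have at: "c \<in> atlas M" "p \<in> fst c" using c by (auto simp: charts_at_iff)
  have o: "open (snd c ` (fst c \<inter> V))"
    by (intro chart_image_open[OF M at(1)] openin_Int V(1) chart_dom_open[OF M at(1)]) auto
  show ?thesis
  proof (rule D_cong[OF o])
    show "snd c p \<in> snd c ` (fst c \<inter> V)" using at V by auto
    show "local_rep c d g u = local_rep c d f u" if "u \<in> snd c ` (fst c \<inter> V)" for u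
      using mem_chart_overlap[OF that M at(1)] V(3) by simp
  qed (rule local_rep_differentiable[OF M N f c d])
qed

text \<open>A change of chart is the local representative of the identity map, which brings it under
  the chain rule.\<close>

lemma chart_change_eq: "chart_change p c d = D (local_rep c d (\<lambda>x. x)) (snd c p)"
  by (simp add: chart_change_def comp_def)

lemma charts_at_points: "smooth_manifold M \<Longrightarrow> c \<in> charts_at M p \<Longrightarrow> p \<in> points M"
  using chart_dom_subset[of M c] by (auto simp: charts_at_iff)

lemma chart_change_compose:
  assumes M: "smooth_manifold M" and "c \<in> charts_at M p" "d \<in> charts_at M p" "e \<in> charts_at M p"
  shows "chart_change p d e (chart_change p c d x) = chart_change p c e x"
  using D_local_rep_compose[OF M M M smooth_at_ident smooth_at_ident assms(2-4)] charts_at_points[OF assms(1,2)]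
  by (simp add: chart_change_eq M)

lemma chart_change_self:
  assumes M: "smooth_manifold M" and c: "c \<in> charts_at M p"
  shows "chart_change p c c x = x"
proof -
  have at: "c \<in> atlas M" using c by (simp add: charts_at_iff)
  have "D (snd c \<circ> chart_inv c) (snd c p) = D (\<lambda>x. x) (snd c p)"
    by (rule D_cong[OF cimg_open[OF M at] chart_in_cimg[OF c]]) (simp_all add: chart_chart_inv)
  then show ?thesis by (simp add: chart_change_def)
qed

lemma chart_change_linear:
  assumes M: "smooth_manifold M" and "c \<in> charts_at M p" "d \<in> charts_at M p"
  shows "linear (chart_change p c d)"
  unfolding chart_change_eq using assms charts_at_points[OF assms(1,2)]
  by (intro local_rep_linear[OF M M smooth_at_ident]) auto

lemma tvec_of_apply: "smooth_manifold M \<Longrightarrow> c \<in> charts_at M p \<Longrightarrow> tvec_of M c p x c = x"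
  by (simp add: tvec_of_def chart_change_self)

lemma tvec_of_in_tangent_space:
  "smooth_manifold M \<Longrightarrow> c \<in> charts_at M p \<Longrightarrow> tvec_of M c p x \<in> tangent_space M p"
  by (simp add: tvec_of_def tangent_space_def chart_change_compose)

lemma tangent_space_change:
  "v \<in> tangent_space M p \<Longrightarrow> c \<in> charts_at M p \<Longrightarrow> d \<in> charts_at M p \<Longrightarrow> v d = chart_change p c d (v c)"
  unfolding tangent_space_def by blast

lemma tvec_of_coord:
  assumes "v \<in> tangent_space M p" "c \<in> charts_at M p"
  shows "tvec_of M c p (v c) = v"
proof
  fix d
  show "tvec_of M c p (v c) d = v d"
  proof (cases "d \<in> charts_at M p")
    case True
    then show ?thesis using tangent_space_change[OF assms True] by (simp add: tvec_of_def)
  next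
    case False
    moreover have "v d = 0" using assms(1) False unfolding tangent_space_def by blast
    ultimately show ?thesis by (simp add: tvec_of_def)
  qed
qed

lemma tangent_spaceE:
  assumes "v \<in> tangent_space M p" "c \<in> charts_at M p"
  obtains x where "v = tvec_of M c p x"
  using tvec_of_coord[OF assms] by metis

lemma tangent_eqI:
  "v \<in> tangent_space M p \<Longrightarrow> w \<in> tangent_space M p \<Longrightarrow> c \<in> charts_at M p \<Longrightarrow> v c = w c \<Longrightarrow> v = w"
  using tvec_of_coord by metis

text \<open>\<open>tangent_map\<close> selects one chart by choice; the chain rule through the
  identity shows that every chart at \<open>p\<close> gives the same coordinates.\<close>

lemma tangent_map_apply:
  assumes M: "smooth_manifold M" and N: "smooth_manifold N"
    and f: "smooth_at M N f p" and v: "v \<in> tangent_space M p"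
    and c: "c \<in> charts_at M p" and d: "d \<in> charts_at N (f p)"
  shows "tangent_map M N f p v d = D (local_rep c d f) (snd c p) (v c)"
proof -
  define c' where "c' = (SOME c. c \<in> charts_at M p)"
  have c': "c' \<in> charts_at M p" unfolding c'_def using c by (rule someI)
  have "v c = D (local_rep c' c (\<lambda>x. x)) (snd c' p) (v c')"
    using tangent_space_change[OF v c' c] by (simp only: chart_change_eq)
  then show ?thesis
    using D_local_rep_compose[OF M M N smooth_at_ident[OF M charts_at_points[OF M c]] f c' c d] d
    by (simp add: tangent_map_def Let_def c'_def[symmetric])
qed

lemma tangent_map_in_tangent_space:
  assumes M: "smooth_manifold M" and N: "smooth_manifold N"
    and f: "smooth_at M N f p" and v: "v \<in> tangent_space M p"
  shows "tangent_map M N f p v \<in> tangent_space N (f p)"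
proof -
  have fp: "f p \<in> points N" and p: "p \<in> points M" by (rule smooth_at_charts[OF M N f])+
  obtain c where c: "c \<in> charts_at M p" using ex_chart_at[OF M p] by blast
  have "tangent_map M N f p v e = chart_change (f p) d e (tangent_map M N f p v d)"
    if d: "d \<in> charts_at N (f p)" and e: "e \<in> charts_at N (f p)" for d e
    using D_local_rep_compose[OF M N N f smooth_at_ident[OF N fp] c d e]
    by (simp add: tangent_map_apply[OF M N f v c] d e chart_change_eq)
  moreover have "tangent_map M N f p v e = 0" if "e \<notin> charts_at N (f p)" for e
    using that by (simp add: tangent_map_def Let_def)
  ultimately show ?thesis unfolding tangent_space_def by blast
qed

lemma tangent_map_tvec_of:
  assumes M: "smooth_manifold M" and N: "smooth_manifold N" and f: "smooth_at M N f p"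
    and c: "c \<in> charts_at M p" and d: "d \<in> charts_at N (f p)"
  shows "tangent_map M N f p (tvec_of M c p x) = tvec_of N d (f p) (D (local_rep c d f) (snd c p) x)"
  using tvec_of_coord[OF tangent_map_in_tangent_space[OF M N f tvec_of_in_tangent_space[OF M c]] d]
  by (simp add: tangent_map_apply[OF M N f tvec_of_in_tangent_space[OF M c] c d] tvec_of_apply[OF M c])

lemma tangent_map_compose:
  assumes M: "smooth_manifold M" and N: "smooth_manifold N" and P: "smooth_manifold P"
    and f: "smooth_at M N f p" and g: "smooth_at N P g (f p)" and v: "v \<in> tangent_space M p"
  shows "tangent_map N P g (f p) (tangent_map M N f p v) = tangent_map M P (\<lambda>x. g (f x)) p v"
proof -
  have gf: "smooth_at M P (\<lambda>x. g (f x)) p" by (rule smooth_at_compose[OF M N P f g])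
  have Tf: "tangent_map M N f p v \<in> tangent_space N (f p)" by (rule tangent_map_in_tangent_space[OF M N f v])
  obtain c where c: "c \<in> charts_at M p" using ex_chart_at[OF M] smooth_at_charts(1)[OF M N f] by blast
  obtain d where d: "d \<in> charts_at N (f p)" using ex_chart_at[OF N] smooth_at_charts(2)[OF M N f] by blast
  obtain e where e: "e \<in> charts_at P (g (f p))" using ex_chart_at[OF P] smooth_at_charts(2)[OF N P g] by blast
  show ?thesis
  proof (rule tangent_eqI[OF tangent_map_in_tangent_space[OF N P g Tf] tangent_map_in_tangent_space[OF M P gf v] e])
    show "tangent_map N P g (f p) (tangent_map M N f p v) e = tangent_map M P (\<lambda>x. g (f x)) p v e"
      by (simp only: tangent_map_apply[OF N P g Tf d e] tangent_map_apply[OF M N f v c d]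
          tangent_map_apply[OF M P gf v c e] D_local_rep_compose[OF M N P f g c d e])
  qed
qed

lemma tangent_map_cong:
  assumes M: "smooth_manifold M" and N: "smooth_manifold N"
    and f: "smooth_at M N f p" and V: "openin (mtop M) V" "p \<in> V" "\<And>q. q \<in> V \<Longrightarrow> f q = g q"
    and v: "v \<in> tangent_space M p"
  shows "tangent_map M N g p v = tangent_map M N f p v"
proof -
  have g: "smooth_at M N g p" by (rule smooth_at_cong[OF M N f V(1,2)]) (simp add: V(3))
  obtain c where c: "c \<in> charts_at M p" using ex_chart_at[OF M] smooth_at_charts(1)[OF M N f] by blast
  obtain d where d: "d \<in> charts_at N (f p)" using ex_chart_at[OF N] smooth_at_charts(2)[OF M N f] by blast
  have gp: "g p = f p" using V by simp
  show ?thesis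
  proof (rule tangent_eqI[OF _ tangent_map_in_tangent_space[OF M N f v] d])
    show "tangent_map M N g p v \<in> tangent_space N (f p)"
      using tangent_map_in_tangent_space[OF M N g v] gp by simp
    show "tangent_map M N g p v d = tangent_map M N f p v d"
      using tangent_map_apply[OF M N g v c] d gp
      by (simp only: tangent_map_apply[OF M N f v c d] D_local_rep_cong[OF M N f V c d])
  qed
qed

lemma tangent_map_ident:
  assumes M: "smooth_manifold M" and v: "v \<in> tangent_space M p" and p: "p \<in> points M"
  shows "tangent_map M M (\<lambda>x. x) p v = v"
proof -
  obtain c where c: "c \<in> charts_at M p" using ex_chart_at[OF M p] by blast
  show ?thesis
  proof (rule tangent_eqI[OF _ v c])
    show "tangent_map M M (\<lambda>x. x) p v \<in> tangent_space M p"
      using tangent_map_in_tangent_space[OF M M smooth_at_ident[OF M p] v] .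
    show "tangent_map M M (\<lambda>x. x) p v c = v c"
      using tangent_map_apply[OF M M smooth_at_ident[OF M p] v c c] chart_change_self[OF M c]
      by (simp add: chart_change_eq)
  qed
qed

text \<open>By the chain rule the tangent map of a section through \<open>p\<close> is a right
  inverse. This replaces rank computations for regular values and submersions.\<close>

lemma tangent_map_surj_if_section:
  assumes M: "smooth_manifold M" and N: "smooth_manifold N" and f: "smooth_at M N f p"
    and s: "smooth_at N M s (f p)" "s (f p) = p" "\<And>q. q \<in> points N \<Longrightarrow> f (s q) = q"
  shows "tangent_map M N f p ` tangent_space M p = tangent_space N (f p)"
proof (intro equalityI subsetI)
  have fp: "f p \<in> points N" by (rule smooth_at_charts[OF M N f])
  fix w assume w: "w \<in> tangent_space N (f p)"
  let ?v = "tangent_map N M s (f p) w"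
  have f': "smooth_at M N f (s (f p))" using f s(2) by simp
  have "tangent_map M N f p ?v = tangent_map N N (\<lambda>q. f (s q)) (f p) w"
    using tangent_map_compose[OF N M N s(1) f' w] s(2) by simp
  also have "\<dots> = tangent_map N N (\<lambda>q. q) (f p) w"
    by (rule tangent_map_cong[OF N N smooth_at_ident[OF N fp] openin_topspace fp _ w]) (simp add: s(3))
  also have "\<dots> = w" by (rule tangent_map_ident[OF N w fp])
  finally show "w \<in> tangent_map M N f p ` tangent_space M p"
    using tangent_map_in_tangent_space[OF N M s(1) w] s(2) by (metis imageI)
qed (use tangent_map_in_tangent_space[OF M N f] in auto)

text \<open>Dually, the tangent map of a retraction is a left inverse.\<close>

lemma tangent_map_inj_if_retraction:
  assumes M: "smooth_manifold M" and N: "smooth_manifold N" and f: "smooth_at M N f p"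
    and r: "smooth_at N M r (f p)" "\<And>q. q \<in> points M \<Longrightarrow> r (f q) = q"
  shows "inj_on (tangent_map M N f p) (tangent_space M p)"
proof (rule inj_on_inverseI)
  have p: "p \<in> points M" by (rule smooth_at_charts[OF M N f])
  fix v assume v: "v \<in> tangent_space M p"
  have "tangent_map N M r (f p) (tangent_map M N f p v) = tangent_map M M (\<lambda>q. r (f q)) p v"
    by (rule tangent_map_compose[OF M N M f r(1) v])
  also have "\<dots> = tangent_map M M (\<lambda>q. q) p v"
    by (rule tangent_map_cong[OF M M smooth_at_ident[OF M p] openin_topspace p _ v]) (simp add: r(2))
  also have "\<dots> = v" by (rule tangent_map_ident[OF M v p])
  finally show "tangent_map N M r (f p) (tangent_map M N f p v) = v" .
qed

lemma chart_change_prod: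
  assumes M: "smooth_manifold M" and N: "smooth_manifold N"
    and c: "c \<in> charts_at M p" "c' \<in> charts_at M p" and d: "d \<in> charts_at N q" "d' \<in> charts_at N q"
  shows "chart_change (p, q) (prod_chart c d) (prod_chart c' d') (x, y)
    = (chart_change p c c' x, chart_change q d d' y)"
proof -
  have at: "c \<in> atlas M" "d \<in> atlas N" using c d by (auto simp: charts_at_iff)
  have o: "open (cimg c \<times> cimg d)" by (intro open_Times cimg_open[OF M at(1)] cimg_open[OF N at(2)])
  have d1: "(snd c' \<circ> chart_inv c has_derivative chart_change p c c') (at (snd c p))"
    using local_rep_differentiable[OF M M smooth_at_ident[OF M charts_at_points[OF M c(1)]] c]
    by (simp add: chart_change_def comp_def frechet_derivative_worksI)
  have d2: "(snd d' \<circ> chart_inv d has_derivative chart_change q d d') (at (snd d q))"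
    using local_rep_differentiable[OF N N smooth_at_ident[OF N charts_at_points[OF N d(1)]] d]
    by (simp add: chart_change_def comp_def frechet_derivative_worksI)
  have e1: "((\<lambda>z. (snd c' \<circ> chart_inv c) (fst z)) has_derivative (\<lambda>z. chart_change p c c' (fst z)))
     (at (snd c p, snd d q))"
    by (rule has_derivative_compose[OF has_derivative_fst[OF has_derivative_ident]]) (unfold fst_conv, rule d1)
  have e2: "((\<lambda>z. (snd d' \<circ> chart_inv d) (snd z)) has_derivative (\<lambda>z. chart_change q d d' (snd z)))
     (at (snd c p, snd d q))"
    by (rule has_derivative_compose[OF has_derivative_snd[OF has_derivative_ident]]) (unfold snd_conv, rule d2)
  have "(snd (prod_chart c' d') \<circ> chart_inv (prod_chart c d) has_derivative
      (\<lambda>z. (chart_change p c c' (fst z), chart_change q d d' (snd z)))) (at (snd c p, snd d q))"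
  proof (rule has_derivative_transform_within_open[OF has_derivative_Pair[OF e1 e2] o])
    show "(snd c p, snd d q) \<in> cimg c \<times> cimg d" using chart_in_cimg[OF c(1)] chart_in_cimg[OF d(1)] by simp
    show "((snd c' \<circ> chart_inv c) (fst z), (snd d' \<circ> chart_inv d) (snd z)) = (snd (prod_chart c' d') \<circ> chart_inv (prod_chart c d)) z"
      if "z \<in> cimg c \<times> cimg d" for z
      using that chart_inv_prod_chart[OF M N at, of "fst z" "snd z"] by (cases z) auto
  qed
  then show ?thesis by (simp add: chart_change_def D_eq)
qed

lemma vec_chart_change: "chart_change q vec_chart vec_chart y = y"
  by (simp add: chart_change_def id_def[symmetric])

text \<open>The chart selected in \<open>tvec_pair\<close> may be exchanged for any other, because
  the coordinate change of a product acts blockwise and is the identity on the vector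
  factor.\<close>

lemma tvec_pair_eq:
  fixes q :: "'v::real_normed_vector"
  assumes M: "smooth_manifold M" and fv: "findim TYPE('v)"
    and v: "v \<in> tangent_space M p" and c: "c \<in> charts_at M p"
  shows "tvec_pair M p q v w = tvec_of (prod_mfd M vec_mfd) (prod_chart c vec_chart) (p, q) (v c, w)"
proof -
  define c' where "c' = (SOME c. c \<in> charts_at M p)"
  have c': "c' \<in> charts_at M p" unfolding c'_def using c by (rule someI)
  have V: "smooth_manifold (vec_mfd :: ('v, 'v) manifold)" by (rule vec_mfd_smooth_manifold[OF fv])
  note MV = prod_smooth_manifold[OF M V]
  have vc: "vec_chart \<in> charts_at vec_mfd q" by simp
  have pc: "prod_chart c vec_chart \<in> charts_at (prod_mfd M vec_mfd) (p, q)"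
    "prod_chart c' vec_chart \<in> charts_at (prod_mfd M vec_mfd) (p, q)"
    using prod_chart_in_charts_at[OF c vc] prod_chart_in_charts_at[OF c' vc] .
  have "tvec_pair M p q v w = tvec_of (prod_mfd M vec_mfd) (prod_chart c' vec_chart) (p, q) (v c', w)"
    by (simp add: tvec_pair_def Let_def c'_def)
  also have "\<dots> = tvec_of (prod_mfd M vec_mfd) (prod_chart c vec_chart) (p, q) (v c, w)"
  proof (rule tangent_eqI[OF tvec_of_in_tangent_space[OF MV pc(2)] tvec_of_in_tangent_space[OF MV pc(1)] pc(1)])
    have "v c = chart_change p c' c (v c')" by (rule tangent_space_change[OF v c' c])
    then show "tvec_of (prod_mfd M vec_mfd) (prod_chart c' vec_chart) (p, q) (v c', w) (prod_chart c vec_chart) =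
        tvec_of (prod_mfd M vec_mfd) (prod_chart c vec_chart) (p, q) (v c, w) (prod_chart c vec_chart)"
      unfolding tvec_of_apply[OF MV pc(1)]
      using chart_change_prod[OF M V c' c vc vc] pc(1) by (simp add: tvec_of_def vec_chart_change)
  qed
  finally show ?thesis .
qed

section \<open>Transport of a manifold structure along an injection\<close>

definition image_chart :: "('a \<Rightarrow> 'b) \<Rightarrow> ('a, 'e) manifold \<Rightarrow> ('a, 'e) chart \<Rightarrow> ('b, 'e) chart" where
  "image_chart \<phi> M c = (\<phi> ` fst c, snd c \<circ> inv_into (points M) \<phi>)"

text \<open>The structure on the image that makes \<open>\<phi>\<close> a diffeomorphism when it is
  injective; the topology is pulled back along the inverse map. The level set and the orbit space
  are both obtained in this way.\<close>

definition image_mfd :: "('a \<Rightarrow> 'b) \<Rightarrow> ('a, 'e) manifold \<Rightarrow> ('b, 'e) manifold" where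
  "image_mfd \<phi> M = \<lparr>mtop = pullback_topology (\<phi> ` points M) (inv_into (points M) \<phi>) (mtop M),
     atlas = image_chart \<phi> M ` atlas M\<rparr>"

context
  fixes M :: "('a, 'e::real_normed_vector) manifold" and \<phi> :: "'a \<Rightarrow> 'b"
  assumes M: "smooth_manifold M" and inj: "inj_on \<phi> (points M)"
begin

lemma points_image_mfd: "points (image_mfd \<phi> M) = \<phi> ` points M"
  using inj by (auto simp: image_mfd_def topspace_pullback_topology)

lemma image_mfd_inv [simp]: "p \<in> points M \<Longrightarrow> inv_into (points M) \<phi> (\<phi> p) = p"
  using inj by simp

lemma homeomorphic_maps_image_mfd:
  "homeomorphic_maps (mtop M) (mtop (image_mfd \<phi> M)) \<phi> (inv_into (points M) \<phi>)"
  unfolding homeomorphic_maps_def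
proof (intro conjI)
  show "continuous_map (mtop M) (mtop (image_mfd \<phi> M)) \<phi>"
    unfolding image_mfd_def manifold.simps
    by (rule continuous_map_pullback') (auto intro: continuous_map_eq[OF continuous_map_id])
  show "continuous_map (mtop (image_mfd \<phi> M)) (mtop M) (inv_into (points M) \<phi>)"
    using continuous_map_pullback[OF continuous_map_id[of "mtop M"], of "\<phi> ` points M" "inv_into (points M) \<phi>"]
    unfolding image_mfd_def manifold.simps by simp
qed (use points_image_mfd in auto)

lemma cimg_image_chart:
  assumes c: "c \<in> atlas M" shows "cimg (image_chart \<phi> M c) = cimg c"
proof -
  have "snd c (inv_into (points M) \<phi> (\<phi> p)) = snd c p" if "p \<in> fst c" for p
    using that chart_dom_subset[OF M c] by (simp add: subsetD)
  then show ?thesis by (simp add: image_chart_def image_image)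
qed

lemma chart_inv_image_chart:
  assumes c: "c \<in> atlas M" and u: "u \<in> cimg c"
  shows "chart_inv (image_chart \<phi> M c) u = \<phi> (chart_inv c u)"
proof -
  have sub: "fst c \<subseteq> points M" by (rule chart_dom_subset[OF M c])
  have *: "snd (image_chart \<phi> M c) (\<phi> p) = snd c p" if "p \<in> fst c" for p
    using that sub by (simp add: image_chart_def subsetD)
  have "inj_on (snd (image_chart \<phi> M c)) (fst (image_chart \<phi> M c))"
  proof (rule inj_onI)
    fix x y assume "x \<in> fst (image_chart \<phi> M c)" "y \<in> fst (image_chart \<phi> M c)"
      and eq: "snd (image_chart \<phi> M c) x = snd (image_chart \<phi> M c) y"
    then obtain p q where pq: "p \<in> fst c" "q \<in> fst c" "x = \<phi> p" "y = \<phi> q" by (auto simp: image_chart_def)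
    then have "snd c p = snd c q" using eq * by simp
    then show "x = y" using pq inj_onD[OF chart_inj_on[OF M c]] by blast
  qed
  then show ?thesis unfolding chart_inv_def[of "image_chart \<phi> M c"]
  proof (rule inv_into_f_eq)
    show "\<phi> (chart_inv c u) \<in> fst (image_chart \<phi> M c)" using chart_inv_in[OF u] by (simp add: image_chart_def)
    show "snd (image_chart \<phi> M c) (\<phi> (chart_inv c u)) = u" using *[OF chart_inv_in[OF u]] chart_chart_inv[OF u] by simp
  qed
qed

lemma snd_image_chart: "p \<in> points M \<Longrightarrow> snd (image_chart \<phi> M c) (\<phi> p) = snd c p"
  by (simp add: image_chart_def)

lemma image_mfd_smooth_manifold: "smooth_manifold (image_mfd \<phi> M)"
  unfolding smooth_manifold_def
proof (intro conjI ballI)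
  let ?I = "image_mfd \<phi> M"
  have hs: "mtop M homeomorphic_space mtop ?I"
    using homeomorphic_maps_image_mfd homeomorphic_maps_imp_homeomorphic_space by blast
  have MH: "Hausdorff_space (mtop M)" "second_countable (mtop M)" "(\<Union>c\<in>atlas M. fst c) = points M"
    "\<exists>B. finite B \<and> span B = (UNIV :: 'e set)"
    using M unfolding smooth_manifold_def by auto
  show "\<exists>B. finite B \<and> span B = (UNIV :: 'e set)" by (rule MH)
  show "Hausdorff_space (mtop ?I)" using hs MH homeomorphic_Hausdorff_space by blast
  show "second_countable (mtop ?I)" using hs MH homeomorphic_space_second_countability by blast
  have "(\<Union>c\<in>atlas ?I. fst c) = \<phi> ` (\<Union>c\<in>atlas M. fst c)"
    by (simp add: image_mfd_def image_chart_def image_UN)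
  then show "(\<Union>c\<in>atlas ?I. fst c) = points ?I"
    using MH(3) by (simp add: points_image_mfd)
  fix e assume "e \<in> atlas ?I"
  then obtain c where c: "c \<in> atlas M" and e: "e = image_chart \<phi> M c" by (auto simp: image_mfd_def)
  have hm: "homeomorphic_map (mtop M) (mtop ?I) \<phi>" "homeomorphic_map (mtop ?I) (mtop M) (inv_into (points M) \<phi>)"
    using homeomorphic_maps_image_mfd by (auto simp: homeomorphic_maps_map)
  have sub: "fst c \<subseteq> points M" by (rule chart_dom_subset[OF M c])
  have fe: "fst e = \<phi> ` fst c" by (simp add: e image_chart_def)
  show "openin (mtop ?I) (fst e)"
    unfolding fe using homeomorphic_map_openness[OF hm(1) sub] chart_dom_open[OF M c] by simp
  show "open (cimg e)" unfolding e cimg_image_chart[OF c] by (rule cimg_open[OF M c])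
  have "inv_into (points M) \<phi> ` fst e = fst c"
    unfolding fe image_image using sub by (simp add: subsetD cong: image_cong)
  then have "homeomorphic_map (subtopology (mtop ?I) (fst e)) (subtopology (mtop M) (fst c)) (inv_into (points M) \<phi>)"
  proof (intro homeomorphic_map_subtopologies[OF hm(2)])
    have "\<phi> ` points M \<inter> fst e = fst e" "points M \<inter> fst c = fst c" using sub fe by auto
    then show "inv_into (points M) \<phi> ` (points ?I \<inter> fst e) = points M \<inter> fst c"
      using \<open>inv_into (points M) \<phi> ` fst e = fst c\<close> by (simp add: points_image_mfd)
  qed
  from homeomorphic_map_compose[OF this chart_homeomorphic_map[OF M c]]
  show "homeomorphic_map (subtopology (mtop ?I) (fst e)) (top_of_set (cimg e)) (snd e)"
    unfolding e cimg_image_chart[OF c] by (simp add: image_chart_def)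
  fix e' assume "e' \<in> atlas ?I"
  then obtain c' where c': "c' \<in> atlas M" and e': "e' = image_chart \<phi> M c'" by (auto simp: image_mfd_def)
  have sub': "fst c' \<subseteq> points M" by (rule chart_dom_subset[OF M c'])
  have "fst e \<inter> fst e' = \<phi> ` (fst c \<inter> fst c')"
    unfolding e e' image_chart_def using inj_on_image_Int[OF inj sub sub'] by simp
  then have "snd e ` (fst e \<inter> fst e') = (\<lambda>p. snd e (\<phi> p)) ` (fst c \<inter> fst c')" by (simp add: image_image)
  also have "\<dots> = snd c ` (fst c \<inter> fst c')"
    using sub by (intro image_cong) (auto simp: e snd_image_chart)
  finally have eq: "snd e ` (fst e \<inter> fst e') = snd c ` (fst c \<inter> fst c')" .
  show "smooth_on (snd e ` (fst e \<inter> fst e')) (snd e' \<circ> chart_inv e)"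
    unfolding eq
  proof (rule smooth_on_cong[OF chart_overlap_open[OF M c c'] chart_change_smooth[OF M c c']])
    fix u assume u: "u \<in> snd c ` (fst c \<inter> fst c')"
    then have u': "u \<in> cimg c" by auto
    have "chart_inv c u \<in> points M" using subsetD[OF sub chart_inv_in[OF u']] .
    then show "(snd e' \<circ> chart_inv e) u = (snd c' \<circ> chart_inv c) u"
      unfolding e e' by (simp add: chart_inv_image_chart[OF c u'] snd_image_chart)
  qed
qed

lemma image_chart_in_charts_at:
  "c \<in> charts_at M p \<Longrightarrow> image_chart \<phi> M c \<in> charts_at (image_mfd \<phi> M) (\<phi> p)"
  by (auto simp: charts_at_iff image_mfd_def image_chart_def)

lemma smooth_at_image_inv:
  assumes p: "p \<in> points M"
  shows "smooth_at (image_mfd \<phi> M) M (inv_into (points M) \<phi>) (\<phi> p)"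
proof -
  obtain c where c: "c \<in> charts_at M p" using ex_chart_at[OF M p] by blast
  then have at: "c \<in> atlas M" by (simp add: charts_at_iff)
  have c': "c \<in> charts_at M (inv_into (points M) \<phi> (\<phi> p))" using c p by simp
  have in_points: "chart_inv c u \<in> points M" if "u \<in> cimg c" for u
    using chart_inv_in[OF that] chart_dom_subset[OF M at] by blast
  show ?thesis
  proof (rule smooth_atI[where f="inv_into (points M) \<phi>", OF image_chart_in_charts_at[OF c] c' cimg_open[OF M at]])
    show "snd (image_chart \<phi> M c) (\<phi> p) \<in> cimg c" using chart_in_cimg[OF c] snd_image_chart[OF p] by simp
    show "cimg c \<subseteq> cimg (image_chart \<phi> M c)" by (simp add: cimg_image_chart[OF at])
    show "inv_into (points M) \<phi> (chart_inv (image_chart \<phi> M c) u) \<in> fst c" if "u \<in> cimg c" for u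
      using that chart_inv_in[OF that] by (simp add: chart_inv_image_chart[OF at] in_points)
    show "smooth_on (cimg c) (local_rep (image_chart \<phi> M c) c (inv_into (points M) \<phi>))"
      by (rule smooth_on_cong[OF cimg_open[OF M at] smooth_on_ident])
        (simp add: chart_inv_image_chart[OF at] in_points chart_chart_inv)
  qed
qed

lemma smooth_at_image:
  assumes p: "p \<in> points M"
  shows "smooth_at M (image_mfd \<phi> M) \<phi> p"
proof -
  obtain c where c: "c \<in> charts_at M p" using ex_chart_at[OF M p] by blast
  then have at: "c \<in> atlas M" by (simp add: charts_at_iff)
  have in_points: "chart_inv c u \<in> points M" if "u \<in> cimg c" for u
    using chart_inv_in[OF that] chart_dom_subset[OF M at] by blast
  show ?thesis
  proof (rule smooth_atI[where f=\<phi>, OF c image_chart_in_charts_at[OF c] cimg_open[OF M at] chart_in_cimg[OF c]])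
    show "\<phi> (chart_inv c u) \<in> fst (image_chart \<phi> M c)" if "u \<in> cimg c" for u
      using chart_inv_in[OF that] by (simp add: image_chart_def)
    show "smooth_on (cimg c) (local_rep c (image_chart \<phi> M c) \<phi>)"
      by (rule smooth_on_cong[OF cimg_open[OF M at] smooth_on_ident])
        (simp add: in_points chart_chart_inv snd_image_chart)
  qed simp
qed

text \<open>Between \<open>image_chart \<phi> M c\<close> and \<open>c\<close> the inverse map is
  the identity in coordinates, so a tangent vector keeps its coordinate vector.\<close>

lemma tangent_map_image_inv:
  assumes p: "p \<in> points M" and c: "c \<in> charts_at M p"
  shows "tangent_map (image_mfd \<phi> M) M (inv_into (points M) \<phi>) (\<phi> p)
     (tvec_of (image_mfd \<phi> M) (image_chart \<phi> M c) (\<phi> p) x) = tvec_of M c p x"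
proof -
  have at: "c \<in> atlas M" using c by (simp add: charts_at_iff)
  have c': "c \<in> charts_at M (inv_into (points M) \<phi> (\<phi> p))" using c p by simp
  have in_points: "chart_inv c u \<in> points M" if "u \<in> cimg c" for u
    using chart_inv_in[OF that] chart_dom_subset[OF M at] by blast
  have "D (local_rep (image_chart \<phi> M c) c (inv_into (points M) \<phi>)) (snd c p) = D (\<lambda>x. x) (snd c p)"
    by (rule D_cong[OF cimg_open[OF M at] chart_in_cimg[OF c]])
      (simp_all add: chart_inv_image_chart[OF at] in_points chart_chart_inv)
  then show ?thesis
    using tangent_map_tvec_of[OF image_mfd_smooth_manifold M smooth_at_image_inv[OF p] image_chart_in_charts_at[OF c] c']
    by (simp add: p snd_image_chart)
qed

lemma inv_into_image_mfd: "p \<in> points M \<Longrightarrow> inv_into (points (image_mfd \<phi> M)) (inv_into (points M) \<phi>) p = \<phi> p"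
  by (rule inv_into_f_eq) (auto simp: points_image_mfd inj_on_inv_into)

lemma image_mfd_diffeomorphism: "diffeomorphism (image_mfd \<phi> M) M (inv_into (points M) \<phi>)"
  unfolding diffeomorphism_def
proof (intro conjI)
  show "bij_betw (inv_into (points M) \<phi>) (points (image_mfd \<phi> M)) (points M)"
    unfolding points_image_mfd using inj by (intro bij_betw_inv_into inj_on_imp_bij_betw)
  show "smooth_map (image_mfd \<phi> M) M (inv_into (points M) \<phi>)"
    using smooth_at_image_inv
    by (auto simp: smooth_map_iff_smooth_at[OF image_mfd_smooth_manifold M] points_image_mfd)
  show "smooth_map M (image_mfd \<phi> M) (inv_into (points (image_mfd \<phi> M)) (inv_into (points M) \<phi>))"
    unfolding smooth_map_iff_smooth_at[OF M image_mfd_smooth_manifold]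
  proof
    fix p assume p: "p \<in> points M"
    show "smooth_at M (image_mfd \<phi> M) (inv_into (points (image_mfd \<phi> M)) (inv_into (points M) \<phi>)) p"
      by (rule smooth_at_cong[OF M image_mfd_smooth_manifold smooth_at_image[OF p] openin_topspace p])
        (simp add: inv_into_image_mfd)
  qed
qed

text \<open>The coefficients of \<open>\<omega>\<close> in a transported chart coincide with those
  of \<open>\<Omega>\<close> on the open chart image, and hence so do their derivatives.\<close>

lemma image_mfd_symplectic:
  assumes S: "symplectic_manifold M \<Omega>"
  defines "\<omega> \<equiv> \<lambda>q v w. \<Omega> (inv_into (points M) \<phi> q)
     (tangent_map (image_mfd \<phi> M) M (inv_into (points M) \<phi>) q v)
     (tangent_map (image_mfd \<phi> M) M (inv_into (points M) \<phi>) q w)"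
  shows "symplectic_manifold (image_mfd \<phi> M) \<omega>"
proof -
  let ?I = "image_mfd \<phi> M"
  have atE: "\<exists>c\<in>atlas M. e = image_chart \<phi> M c" if "e \<in> atlas ?I" for e
    using that by (auto simp: image_mfd_def)
  have fc: "form_coords ?I \<omega> (image_chart \<phi> M c) u x y = form_coords M \<Omega> c u x y"
    if c: "c \<in> atlas M" and u: "u \<in> cimg c" for c u x y
  proof -
    have p: "chart_inv c u \<in> points M" using chart_inv_in[OF u] chart_dom_subset[OF M c] by blast
    have cp: "c \<in> charts_at M (chart_inv c u)" using c chart_inv_in[OF u] by (simp add: charts_at_iff)
    show ?thesis
      unfolding form_coords_def \<omega>_def chart_inv_image_chart[OF c u] tangent_map_image_inv[OF p cp]
      by (simp add: p)
  qed
  have fcD: "D (\<lambda>u. form_coords ?I \<omega> (image_chart \<phi> M c) u x y) u z = D (\<lambda>u. form_coords M \<Omega> c u x y) u z"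
    if c: "c \<in> atlas M" and u: "u \<in> cimg c" for c u x y z
  proof -
    have "smooth_on (cimg c) (\<lambda>u. form_coords M \<Omega> c u x y)"
      using S c by (auto simp: symplectic_manifold_def smooth_two_form_def)
    then have "(\<lambda>u. form_coords M \<Omega> c u x y) differentiable (at u)"
      using u smooth_on_imp_differentiable by blast
    from D_cong[OF cimg_open[OF M c] u _ this, of "\<lambda>u. form_coords ?I \<omega> (image_chart \<phi> M c) u x y"]
    show ?thesis using fc[OF c] by simp
  qed
  have "smooth_two_form ?I \<omega>"
    unfolding smooth_two_form_def
  proof (intro ballI conjI allI)
    fix e assume "e \<in> atlas ?I"
    then obtain c where c: "c \<in> atlas M" and e: "e = image_chart \<phi> M c" using atE by blast
    fix u assume "u \<in> cimg e"
    then have u: "u \<in> cimg c" by (simp add: e cimg_image_chart[OF c])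
    have "form_coords ?I \<omega> e u = form_coords M \<Omega> c u" unfolding e using fc[OF c u] by blast
    then show "bilinear (form_coords ?I \<omega> e u)" "form_coords ?I \<omega> e u x x = 0" for x
      using S c u by (auto simp: symplectic_manifold_def smooth_two_form_def)
  next
    fix e x y assume "e \<in> atlas ?I"
    then obtain c where c: "c \<in> atlas M" and e: "e = image_chart \<phi> M c" using atE by blast
    have s: "smooth_on (cimg c) (\<lambda>u. form_coords M \<Omega> c u x y)"
      using S c by (auto simp: symplectic_manifold_def smooth_two_form_def)
    show "smooth_on (cimg e) (\<lambda>u. form_coords ?I \<omega> e u x y)"
      unfolding e cimg_image_chart[OF c] by (rule smooth_on_cong[OF cimg_open[OF M c] s fc[OF c]])
  qed
  moreover have "closed_two_form ?I \<omega>"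
    unfolding closed_two_form_def
  proof (intro ballI allI)
    fix e u x y z assume "e \<in> atlas ?I" and ue: "u \<in> cimg e"
    then obtain c where c: "c \<in> atlas M" and e: "e = image_chart \<phi> M c" using atE by blast
    have u: "u \<in> cimg c" using ue by (simp add: e cimg_image_chart[OF c])
    show "D (\<lambda>u. form_coords ?I \<omega> e u y z) u x + D (\<lambda>u. form_coords ?I \<omega> e u z x) u y
        + D (\<lambda>u. form_coords ?I \<omega> e u x y) u z = 0"
      unfolding e fcD[OF c u] using S c u unfolding symplectic_manifold_def closed_two_form_def by blast
  qed
  moreover have "nondegenerate_two_form ?I \<omega>"
    unfolding nondegenerate_two_form_def points_image_mfd
  proof (intro ballI impI, elim imageE)
    fix q p v assume q: "q = \<phi> p" and p: "p \<in> points M" and v: "v \<in> tangent_space ?I q"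
      and 0: "\<forall>w\<in>tangent_space ?I q. \<omega> q v w = 0"
    obtain c where c: "c \<in> charts_at M p" using ex_chart_at[OF M p] by blast
    note c' = image_chart_in_charts_at[OF c]
    obtain x where x: "v = tvec_of ?I (image_chart \<phi> M c) q x" using tangent_spaceE[OF v] c' q by metis
    have "\<Omega> p (tvec_of M c p x) w = 0" if w: "w \<in> tangent_space M p" for w
    proof -
      obtain y where y: "w = tvec_of M c p y" using tangent_spaceE[OF w c] by metis
      have "\<omega> q v (tvec_of ?I (image_chart \<phi> M c) q y) = 0"
        using 0 tvec_of_in_tangent_space[OF image_mfd_smooth_manifold c'] q by simp
      then show ?thesis by (simp add: \<omega>_def x q y tangent_map_image_inv[OF p c] p)
    qed
    then have "tvec_of M c p x = (\<lambda>_. 0)"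
      using S p tvec_of_in_tangent_space[OF M c] by (auto simp: symplectic_manifold_def nondegenerate_two_form_def)
    then have "x = 0" using tvec_of_apply[OF M c, of x] by simp
    then show "v = (\<lambda>_. 0)"
      using linear_0[OF chart_change_linear[OF image_mfd_smooth_manifold c']] q
      by (auto simp: x tvec_of_def)
  qed
  ultimately show ?thesis
    using image_mfd_smooth_manifold by (simp add: symplectic_manifold_def)
qed

end

section \<open>Ordinary differential equations\<close>

text \<open>Smoothness in some neighbourhood of a point. It hides the open sets from the calculus,
  and as a case of \<open>smooth_at\<close> it combines directly with maps into manifolds.\<close>

abbreviation vsmooth :: "('a::real_normed_vector \<Rightarrow> 'b::real_normed_vector) \<Rightarrow> 'a \<Rightarrow> bool" where
  "vsmooth f x \<equiv> smooth_at vec_mfd vec_mfd f x"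

lemma vsmoothE:
  assumes "vsmooth f x"
  obtains U where "open U" "x \<in> U" "smooth_on U f"
  using assms unfolding smooth_at_vec_iff by blast

lemma vsmoothI: "open U \<Longrightarrow> x \<in> U \<Longrightarrow> smooth_on U f \<Longrightarrow> vsmooth f x"
  unfolding smooth_at_vec_iff by blast

lemma smooth_on_vsmooth: "smooth_on {x. vsmooth f x} f"
  by (rule smooth_on_local) (auto simp: smooth_at_vec_iff)

lemma open_vsmooth: "open {x. vsmooth f x}"
proof (subst open_subopen, clarify)
  fix x assume "vsmooth f x"
  then obtain U where U: "open U" "x \<in> U" "smooth_on U f" by (rule vsmoothE)
  then have "U \<subseteq> {x. vsmooth f x}" by (auto intro: vsmoothI)
  then show "\<exists>T. open T \<and> x \<in> T \<and> T \<subseteq> {x. vsmooth f x}" using U by blast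
qed

lemma vsmooth_has_derivative: "vsmooth f x \<Longrightarrow> (f has_derivative D f x) (at x)"
  by (rule smooth_on_has_derivative[OF smooth_on_vsmooth]) simp

lemma vsmooth_linear_D: "vsmooth f x \<Longrightarrow> linear (D f x)"
  by (rule smooth_on_linear_D[OF smooth_on_vsmooth]) simp

lemma vsmooth_D: "vsmooth f x \<Longrightarrow> vsmooth (\<lambda>y. D f y v) x"
  using smooth_on_D by (metis vsmoothE vsmoothI)

lemma vsmooth_D_cong:
  "vsmooth g x \<Longrightarrow> open V \<Longrightarrow> x \<in> V \<Longrightarrow> (\<And>y. y \<in> V \<Longrightarrow> f y = g y) \<Longrightarrow> D f x = D g x"
  by (rule D_cong[of V]) (auto intro: differentiableI vsmooth_has_derivative)

lemma vsmooth_D2_cong: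
  assumes g: "vsmooth g x" and V: "open V" "x \<in> V" "\<And>y. y \<in> V \<Longrightarrow> f y = g y"
  shows "D2 f x v w = D2 g x v w"
proof -
  obtain U where U: "open U" "x \<in> U" "smooth_on U g" using g by (rule vsmoothE)
  have "D f y v = D g y v" if "y \<in> U \<inter> V" for y
    using vsmooth_D_cong[of g y V f] V that vsmoothI[OF U(1) _ U(3)] by simp
  then have "D (\<lambda>y. D f y v) x = D (\<lambda>y. D g y v) x"
    by (rule vsmooth_D_cong[OF vsmooth_D[OF g] open_Int[OF U(1) V(1)] IntI[OF U(2) V(2)]])
  then show ?thesis by (rule fun_cong)
qed

lemma vsmooth_const: "vsmooth (\<lambda>x. c) x"
  using vsmoothI[OF open_UNIV _ smooth_on_const] by simp

lemma vsmooth_ident: "vsmooth (\<lambda>x. x) x"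
  using vsmoothI[OF open_UNIV _ smooth_on_ident] by simp

lemma vsmooth_linear_comp: "bounded_linear L \<Longrightarrow> vsmooth f x \<Longrightarrow> vsmooth (\<lambda>x. L (f x)) x"
  by (erule vsmoothE) (rule vsmoothI, auto intro: smooth_on_linear_comp)

lemma vsmooth_fst: "vsmooth f x \<Longrightarrow> vsmooth (\<lambda>x. fst (f x)) x"
  by (rule vsmooth_linear_comp[OF bounded_linear_fst])

lemma vsmooth_snd: "vsmooth f x \<Longrightarrow> vsmooth (\<lambda>x. snd (f x)) x"
  by (rule vsmooth_linear_comp[OF bounded_linear_snd])

lemma vsmooth_Pair: 
  assumes "vsmooth f x" "vsmooth g x" shows "vsmooth (\<lambda>x. (f x, g x)) x"
proof -
  obtain U where U: "open U" "x \<in> U" "smooth_on U f" using assms(1) by (rule vsmoothE)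
  obtain V where V: "open V" "x \<in> V" "smooth_on V g" using assms(2) by (rule vsmoothE)
  show ?thesis
    by (rule vsmoothI[of "U \<inter> V"])
      (use U V in \<open>auto intro!: smooth_on_Pair intro: smooth_on_subset\<close>)
qed

lemma vsmooth_add: "vsmooth f x \<Longrightarrow> vsmooth g x \<Longrightarrow> vsmooth (\<lambda>x. f x + g x) x"
  using vsmooth_linear_comp[OF bounded_linear_add[OF bounded_linear_fst bounded_linear_snd] vsmooth_Pair] by simp

lemma vsmooth_diff: "vsmooth f x \<Longrightarrow> vsmooth g x \<Longrightarrow> vsmooth (\<lambda>x. f x - g x) x"
  using vsmooth_linear_comp[OF bounded_linear_sub[OF bounded_linear_fst bounded_linear_snd] vsmooth_Pair] by simp

lemma vsmooth_bilinear:
  assumes B: "bounded_bilinear B" and "vsmooth f x" "vsmooth g x" shows "vsmooth (\<lambda>x. B (f x) (g x)) x"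
proof -
  obtain U where U: "open U" "x \<in> U" "smooth_on U f" using assms(2) by (rule vsmoothE)
  obtain V where V: "open V" "x \<in> V" "smooth_on V g" using assms(3) by (rule vsmoothE)
  show ?thesis
    by (rule vsmoothI[of "U \<inter> V"])
      (use U V in \<open>auto intro!: smooth_on_bilinear[OF B] intro: smooth_on_subset\<close>)
qed

lemma vsmooth_compose_sets:
  assumes "vsmooth \<phi> x" "vsmooth f (\<phi> x)"
  obtains S T where "open S" "open T" "\<phi> ` S \<subseteq> T" "smooth_on S \<phi>" "smooth_on T f" "x \<in> S"
proof
  let ?T = "{y. vsmooth f y}" and ?S = "{x \<in> {x. vsmooth \<phi> x}. \<phi> x \<in> {y. vsmooth f y}}"
  show "open ?S"
    by (rule open_preimage_in[OF open_vsmooth smooth_on_imp_continuous_on[OF smooth_on_vsmooth] open_vsmooth])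
  show "open ?T" by (rule open_vsmooth)
  show "smooth_on ?S \<phi>" by (rule smooth_on_subset[OF smooth_on_vsmooth]) auto
  show "smooth_on ?T f" by (rule smooth_on_vsmooth)
qed (use assms in auto)

lemma vsmooth_compose:
  fixes \<phi> :: "'a::real_normed_vector \<Rightarrow> 'b::real_normed_vector"
  assumes fd: "findim TYPE('b)" and "vsmooth \<phi> x" "vsmooth f (\<phi> x)"
  shows "vsmooth (\<lambda>x. f (\<phi> x)) x"
proof -
  obtain S T where ST: "open S" "open T" "\<phi> ` S \<subseteq> T" "smooth_on S \<phi>" "smooth_on T f" "x \<in> S"
    using vsmooth_compose_sets[OF assms(2,3)] by metis
  show ?thesis by (rule vsmoothI[OF ST(1,6) smooth_on_compose[OF fd ST(1-5)]])
qed

lemma vsmooth_D2_compose: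
  fixes f :: "'b::real_normed_vector \<Rightarrow> 'c::real_normed_vector"
  assumes fd: "findim TYPE('b)" and "vsmooth \<phi> x" "vsmooth f (\<phi> x)"
  shows "D2 (\<lambda>x. f (\<phi> x)) x v w = D2 f (\<phi> x) (D \<phi> x v) (D \<phi> x w) + D f (\<phi> x) (D2 \<phi> x v w)"
proof -
  obtain S T where "open S" "open T" "\<phi> ` S \<subseteq> T" "smooth_on S \<phi>" "smooth_on T f" "x \<in> S"
    using vsmooth_compose_sets[OF assms(2,3)] by metis
  then show ?thesis by (rule D2_compose[OF fd])
qed

lemma vsmooth_D2_symmetric:
  fixes f :: "'a::real_normed_vector \<Rightarrow> 'b::real_normed_vector"
  assumes "findim TYPE('b)" "vsmooth f x"
  shows "D2 f x v w = D2 f x w v"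
  by (rule D2_symmetric[OF assms(1) open_vsmooth smooth_on_vsmooth]) (simp add: assms)

lemma vsmooth_linear_D2_left: "vsmooth f x \<Longrightarrow> linear (\<lambda>v. D2 f x v w)"
  by (rule linear_D2_left[OF open_vsmooth smooth_on_vsmooth]) simp

lemma vsmooth_linear_D2_right: "vsmooth f x \<Longrightarrow> linear (D2 f x v)"
  by (rule vsmooth_linear_D[OF vsmooth_D])

text \<open>The integral operator is a contraction on bounded continuous functions from the whole
  real line into the ball around \<open>x0\<close>. Truncating time by \<open>cl\<close> confines
  integration to a short interval while the functions stay defined everywhere.\<close>

lemma picard_lindeloef:
  fixes F :: "'b::banach \<Rightarrow> 'b"
  assumes d: "d > 0" and K: "K \<ge> 0"
    and lip: "\<And>x y. x \<in> cball x0 d \<Longrightarrow> y \<in> cball x0 d \<Longrightarrow> norm (F x - F y) \<le> K * norm (x - y)"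
  obtains e x where "e > 0" "x 0 = x0" "\<And>t. \<bar>t\<bar> < e \<Longrightarrow> (x has_vector_derivative F (x t)) (at t)"
proof -
  define M where "M = norm (F x0) + K * d"
  have M0: "M \<ge> 0" using d K by (simp add: M_def)
  have M: "norm (F x) \<le> M" if "x \<in> cball x0 d" for x
  proof -
    have "norm (F x - F x0) \<le> K * norm (x - x0)" using lip[OF that, of x0] d by simp
    also have "\<dots> \<le> K * d" using that K by (intro mult_left_mono) (auto simp: dist_norm norm_minus_commute)
    finally have "norm (F x - F x0) \<le> K * d" .
    then show ?thesis unfolding M_def using norm_triangle_ineq2[of "F x" "F x0"] by linarith
  qed
  \<comment> \<open>The integrals up to \<open>cl t\<close> and up to 0 run over lengths at most
    \<open>2 * e\<close> and \<open>e\<close>. The first bound therefore gives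
    \<open>3 * e * M \<le> d\<close>, which keeps values in the ball, and the second gives the
    contraction constant \<open>3 * e * K \<le> 1 / 2\<close>.\<close>
  define e where "e = min (d / (3 * (M + 1))) (1 / (6 * (K + 1)))"
  have e: "e > 0" using d K M0 by (simp add: e_def)
  have eM: "3 * e * M \<le> d"
  proof -
    have "3 * e * M \<le> 3 * (d / (3 * (M + 1))) * M"
      using M0 by (intro mult_right_mono mult_left_mono) (auto simp: e_def)
    also have "\<dots> = d * (M / (M + 1))" using M0 by (simp add: field_simps)
    also have "\<dots> \<le> d * 1" using M0 d by (intro mult_left_mono) (auto simp: divide_le_eq_1)
    finally show ?thesis by simp
  qed
  have eK: "3 * e * K \<le> 1 / 2"
  proof -
    have "3 * e * K \<le> 3 * (1 / (6 * (K + 1))) * K"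
      using K by (intro mult_right_mono mult_left_mono) (auto simp: e_def)
    also have "\<dots> = (1/2) * (K / (K + 1))" using K by (simp add: field_simps)
    also have "\<dots> \<le> (1/2) * 1" using K by (intro mult_left_mono) (auto simp: divide_le_eq_1)
    finally show ?thesis by simp
  qed
  define cl where "cl = (\<lambda>t::real. max (-e) (min e t))"
  have cl: "cl t \<in> {-e..e}" "0 \<le> cl t + e" "cl t + e \<le> 2 * e" for t using e by (auto simp: cl_def)
  have cl_id: "cl t = t" if "\<bar>t\<bar> \<le> e" for t using that by (auto simp: cl_def)
  define S :: "(real \<Rightarrow>\<^sub>C 'b) set" where "S = PiC UNIV (\<lambda>_. cball x0 d)"
  have "closed S" unfolding S_def by (rule closed_PiC) simp
  then have cS: "complete S" by (simp add: complete_eq_closed)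
  have "const_bcontfun x0 \<in> S" unfolding S_def mem_PiC_iff using d by (simp add: const_bcontfun.rep_eq)
  then have neS: "S \<noteq> {}" by blast
  \<comment> \<open>Integration starts at \<open>-e\<close>, and subtracting the value at 0 yields
    the integral from 0 to \<open>cl t\<close> for either sign of \<open>t\<close>.\<close>
  define I where "I = (\<lambda>f t. integral {-e..cl t} (\<lambda>s. F (apply_bcontfun f s)))"
  define P where "P = (\<lambda>f t. x0 + I f t - I f 0)"
  have Fcont: "continuous_on (cball x0 d) F"
  proof (rule lipschitz_on_continuous_on)
    show "K-lipschitz_on (cball x0 d) F" using lip K by (intro lipschitz_onI) (auto simp: dist_norm)
  qed
  have inS: "apply_bcontfun f s \<in> cball x0 d" if "f \<in> S" for f s
    using that unfolding S_def mem_PiC_iff by auto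
  have cont: "continuous_on A (\<lambda>s. F (apply_bcontfun f s))" if "f \<in> S" for f A
    by (rule continuous_on_compose2[OF Fcont continuous_on_apply_bcontfun]) (use inS[OF that] in auto)
  have Ibound: "norm (I f t) \<le> M * (cl t + e)" if "f \<in> S" for f t
    using integral_bound[of "-e" "cl t" "\<lambda>s. F (apply_bcontfun f s)" M] cl(2)[of t] cont[OF that] M[OF inS[OF that]]
    unfolding I_def by simp
  have Idiff: "norm (I f t - I g t) \<le> (K * dist f g) * (cl t + e)" if f: "f \<in> S" and g: "g \<in> S" for f g t
  proof -
    have "I f t - I g t = integral {-e..cl t} (\<lambda>s. F (apply_bcontfun f s) - F (apply_bcontfun g s))"
      unfolding I_def
      by (rule Henstock_Kurzweil_Integration.integral_diff[symmetric])
        (intro integrable_continuous_real cont f g)+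
    moreover have "norm (F (apply_bcontfun f s) - F (apply_bcontfun g s)) \<le> K * dist f g" for s
    proof -
      have "norm (F (apply_bcontfun f s) - F (apply_bcontfun g s)) \<le> K * dist (apply_bcontfun f s) (apply_bcontfun g s)"
        using lip[OF inS[OF f] inS[OF g]] by (simp add: dist_norm)
      also have "\<dots> \<le> K * dist f g" using K by (intro mult_left_mono dist_bounded)
      finally show ?thesis .
    qed
    ultimately show ?thesis
      using integral_bound[of "-e" "cl t" "\<lambda>s. F (apply_bcontfun f s) - F (apply_bcontfun g s)" "K * dist f g"]
        cl(2)[of t] continuous_on_diff[OF cont[OF f] cont[OF g]] by simp
  qed
  have cl0: "cl 0 = 0" using e by (simp add: cl_def)
  have Pball: "P f t \<in> cball x0 d" if "f \<in> S" for f t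
  proof -
    have "norm (I f t - I f 0) \<le> M * (cl t + e) + M * e"
      using norm_triangle_ineq4[of "I f t" "I f 0"] Ibound[OF that, of t] Ibound[OF that, of 0] cl0 by simp
    also have "\<dots> \<le> M * (2 * e) + M * e" using cl(3)[of t] M0 by (intro add_right_mono mult_left_mono)
    also have "\<dots> \<le> d" using eM by (simp add: algebra_simps)
    finally have "norm (P f t - x0) \<le> d" by (simp add: P_def algebra_simps)
    then show ?thesis by (simp add: dist_norm norm_minus_commute)
  qed
  have vd: "((\<lambda>u. integral {-e..u} (\<lambda>s. F (apply_bcontfun f s))) has_vector_derivative F (apply_bcontfun f t)) (at t within {-e..e})"
    if "f \<in> S" "t \<in> {-e..e}" for f t
    by (rule integral_has_vector_derivative[OF cont[OF that(1)] that(2)])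
  have Pcont: "continuous_on UNIV (P f)" if "f \<in> S" for f
  proof -
    have "continuous_on {-e..e} (\<lambda>u. integral {-e..u} (\<lambda>s. F (apply_bcontfun f s)))"
      using vd[OF that] has_vector_derivative_continuous continuous_on_eq_continuous_within by blast
    moreover have "continuous_on UNIV cl" unfolding cl_def by (intro continuous_intros)
    ultimately have "continuous_on UNIV (I f)"
      unfolding I_def by (rule continuous_on_compose2) (use cl(1) in auto)
    then show ?thesis unfolding P_def by (intro continuous_intros)
  qed
  have Pb: "P f \<in> bcontfun" if "f \<in> S" for f
    unfolding bcontfun_def using Pcont[OF that] Pball[OF that] bounded_subset[OF bounded_cball] by blast
  define Q where "Q = (\<lambda>f. Bcontfun (P f))"
  have Q: "apply_bcontfun (Q f) = P f" if "f \<in> S" for f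
    unfolding Q_def using Bcontfun_inverse[OF Pb[OF that]] .
  have "\<exists>!f\<in>S. Q f = f"
  proof (rule Banach_fix[OF cS neS])
    show "0 \<le> (1/2::real)" "(1/2::real) < 1" by auto
    show "Q ` S \<subseteq> S" using Pball by (auto simp: S_def mem_PiC_iff Q[unfolded S_def])
    show "dist (Q f) (Q g) \<le> 1/2 * dist f g" if f: "f \<in> S" and g: "g \<in> S" for f g
    proof (rule dist_bound)
      fix t
      have "norm (P f t - P g t) \<le> norm (I f t - I g t) + norm (I f 0 - I g 0)"
        using norm_triangle_ineq4[of "I f t - I g t" "I f 0 - I g 0"] by (simp add: P_def algebra_simps)
      also have "\<dots> \<le> (K * dist f g) * (cl t + e) + (K * dist f g) * e"
        using Idiff[OF f g, of t] Idiff[OF f g, of 0] cl0 by simp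
      also have "\<dots> \<le> (K * dist f g) * (2 * e) + (K * dist f g) * e"
        using cl(3)[of t] K by (intro add_right_mono mult_left_mono) auto
      also have "\<dots> = (3 * e * K) * dist f g" by (simp add: algebra_simps)
      also have "\<dots> \<le> 1/2 * dist f g" by (rule mult_right_mono[OF eK]) simp
      finally show "dist (apply_bcontfun (Q f) t) (apply_bcontfun (Q g) t) \<le> 1/2 * dist f g"
        by (simp add: Q f g dist_norm)
    qed
  qed
  then obtain f where f: "f \<in> S" "Q f = f" by blast
  then have fP: "apply_bcontfun f = P f" using Q by metis
  show thesis
  proof (rule that[of e "apply_bcontfun f"])
    show "e > 0" by (rule e)
    show "apply_bcontfun f 0 = x0" unfolding fP by (simp add: P_def)
    fix t :: real assume t: "\<bar>t\<bar> < e"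
    then have t': "t \<in> {-e<..<e}" "t \<in> {-e..e}" by auto
    have "((\<lambda>u. integral {-e..u} (\<lambda>s. F (apply_bcontfun f s))) has_vector_derivative F (apply_bcontfun f t)) (at t)"
      using vd[OF f(1) t'(2)] at_within_interior[of t "{-e..e}"] t' by simp
    then have "((\<lambda>u. x0 + integral {-e..u} (\<lambda>s. F (apply_bcontfun f s)) - I f 0) has_vector_derivative F (apply_bcontfun f t)) (at t)"
      by (auto intro!: derivative_eq_intros)
    then show "(apply_bcontfun f has_vector_derivative F (apply_bcontfun f t)) (at t)"
    proof (rule has_vector_derivative_transform_within_open[OF _ open_greaterThanLessThan t'(1)])
      fix u assume "u \<in> {-e<..<e}"
      then have "cl u = u" by (intro cl_id) auto
      then show "x0 + integral {-e..u} (\<lambda>s. F (apply_bcontfun f s)) - I f 0 = apply_bcontfun f u"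
        unfolding fP[THEN fun_cong, of u] by (simp add: P_def I_def)
    qed
  qed
qed

text \<open>Near \<open>x0\<close> the derivatives in the finitely many basis directions are
  bounded, which bounds the operator norm of \<open>D F x\<close>; the mean value inequality on a
  ball finishes.\<close>

lemma vsmooth_locally_lipschitz:
  fixes F :: "'a::real_normed_vector \<Rightarrow> 'b::real_normed_vector"
  assumes fd: "findim TYPE('a)" and F: "vsmooth F x0"
  obtains d K where "d > 0" "K \<ge> 0"
    "\<And>x y. x \<in> cball x0 d \<Longrightarrow> y \<in> cball x0 d \<Longrightarrow> norm (F x - F y) \<le> K * norm (x - y)"
proof -
  obtain B :: "'a set" and coord where B: "finite B" "\<And>b. bounded_linear (coord b)"
    "\<And>x. x = (\<Sum>b\<in>B. coord b x *\<^sub>R b)"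
    using findim_coordinates[OF fd] by metis
  have "\<exists>L\<ge>0. \<forall>y. norm (coord b y) \<le> norm y * L" for b
    using bounded_linear.nonneg_bounded[OF B(2)] by blast
  then obtain L where L: "\<And>b. L b \<ge> 0" "\<And>b y. norm (coord b y) \<le> norm y * L b" by metis
  define S where "S = {x. vsmooth F x}"
  have S: "open S" "x0 \<in> S" unfolding S_def using open_vsmooth F by auto
  \<comment> \<open>Membership in \<open>V\<close> keeps each basis derivative within distance 1 of
    its value at \<open>x0\<close>, the source of the summand 1 in \<open>K\<close>.\<close>
  define V where "V = S \<inter> (\<Inter>b\<in>B. {x \<in> S. D F x b \<in> ball (D F x0 b) 1})"
  have "open V" unfolding V_def
  proof (intro open_Int S open_INT B(1) ballI)
    fix b
    show "open {x \<in> S. D F x b \<in> ball (D F x0 b) 1}"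
      unfolding S_def
      by (rule open_preimage_in[OF open_vsmooth smooth_on_imp_continuous_on[OF smooth_on_D[OF smooth_on_vsmooth]] open_ball])
  qed
  moreover have "x0 \<in> V" using S by (auto simp: V_def)
  ultimately obtain d where d: "d > 0" "cball x0 d \<subseteq> V" using open_contains_cball by blast
  define K where "K = (\<Sum>b\<in>B. L b * (norm (D F x0 b) + 1))"
  have K: "K \<ge> 0" unfolding K_def using L by (intro sum_nonneg mult_nonneg_nonneg) auto
  have on: "onorm (D F x) \<le> K" if x: "x \<in> cball x0 d" for x
  proof (rule onorm_bound[OF K])
    fix v
    have xV: "x \<in> V" using x d by blast
    then have l: "linear (D F x)" using vsmooth_linear_D by (auto simp: V_def S_def)
    have nb: "norm (D F x b) \<le> norm (D F x0 b) + 1" if "b \<in> B" for b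
    proof -
      have "norm (D F x0 b - D F x b) < 1" using xV that by (auto simp: V_def dist_norm)
      then show ?thesis using norm_triangle_ineq2[of "D F x b" "D F x0 b"] by (simp add: norm_minus_commute)
    qed
    have "norm (D F x v) \<le> (\<Sum>b\<in>B. norm (coord b v *\<^sub>R D F x b))"
      by (subst linear_basis_expansion[OF l, of v coord B]) (rule B(3), rule norm_sum)
    also have "\<dots> \<le> (\<Sum>b\<in>B. (norm v * L b) * (norm (D F x0 b) + 1))"
      unfolding norm_scaleR using L nb by (intro sum_mono mult_mono) (auto simp: )
    also have "\<dots> = K * norm v" by (simp add: K_def sum_distrib_left mult_ac)
    finally show "norm (D F x v) \<le> K * norm v" .
  qed
  show thesis
  proof (rule that[OF d(1) K])
    fix x y assume xy: "x \<in> cball x0 d" "y \<in> cball x0 d"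
    have "(F has_derivative D F z) (at z within cball x0 d)" if "z \<in> cball x0 d" for z
    proof -
      have "V \<subseteq> S" unfolding V_def by (rule Int_lower1)
      then have "z \<in> S" using d(2) that by blast
      then show ?thesis unfolding S_def by (simp add: has_derivative_at_withinI vsmooth_has_derivative)
    qed
    from differentiable_bound[OF convex_cball this on xy(2,1)]
    show "norm (F x - F y) \<le> K * norm (x - y)" by (simp add: norm_minus_commute)
  qed
qed

text \<open>The bidual is a Banach space that contains \<open>'a\<close> as a linear retract.\<close>

lemma vsmooth_ode_solution:
  fixes F :: "'a::real_normed_vector \<Rightarrow> 'a"
  assumes fd: "findim TYPE('a)" and F: "vsmooth F x0"
  obtains e x where "e > 0" "x 0 = x0" "\<And>t. \<bar>t\<bar> < e \<Longrightarrow> (x has_vector_derivative F (x t)) (at t)"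
proof -
  obtain B :: "'a set" and coord where B: "finite B" "\<And>b. bounded_linear (coord b)"
    "\<And>x. x = (\<Sum>b\<in>B. coord b x *\<^sub>R b)"
    using findim_coordinates[OF fd] by metis
  define J :: "'a \<Rightarrow> ('a \<Rightarrow>\<^sub>L real) \<Rightarrow>\<^sub>L real" where "J = (\<lambda>x. Blinfun (\<lambda>f. blinfun_apply f x))"
  have J: "blinfun_apply (J x) f = blinfun_apply f x" for x f
    unfolding J_def by (simp add: bounded_linear_Blinfun_apply bounded_linear_intros)
  have "linear J" by (intro linearI blinfun_eqI) (simp_all add: J blinfun.bilinear_simps)
  then have bJ: "bounded_linear J" by (rule linear_imp_bounded_linear[OF fd])
  define p where "p = (\<lambda>\<Phi> :: ('a \<Rightarrow>\<^sub>L real) \<Rightarrow>\<^sub>L real. \<Sum>b\<in>B. blinfun_apply \<Phi> (Blinfun (coord b)) *\<^sub>R b)"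
  have bp: "bounded_linear p" unfolding p_def
    by (intro bounded_linear_sum bounded_linear_scaleR_const) (intro bounded_linear_intros)
  have pJ: "p (J x) = x" for x
    unfolding p_def J bounded_linear_Blinfun_apply[OF B(2)] by (rule B(3)[symmetric])
  obtain d K where dK: "d > 0" "K \<ge> 0"
    "\<And>x y. x \<in> cball x0 d \<Longrightarrow> y \<in> cball x0 d \<Longrightarrow> norm (F x - F y) \<le> K * norm (x - y)"
    using vsmooth_locally_lipschitz[OF fd F] by metis
  obtain LJ where LJ: "LJ > 0" "\<And>x. norm (J x) \<le> norm x * LJ" using bounded_linear.pos_bounded[OF bJ] by blast
  obtain Lp where Lp: "Lp > 0" "\<And>x. norm (p x) \<le> norm x * Lp" using bounded_linear.pos_bounded[OF bp] by blast
  have pdiff: "p x - p y = p (x - y)" and Jdiff: "J x' - J y' = J (x' - y')" for x y x' y'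
    using linear_diff[OF bounded_linear.linear[OF bp]] linear_diff[OF bounded_linear.linear[OF bJ]] by auto
  define d' where "d' = d / Lp"
  have d': "d' > 0" using dK Lp by (simp add: d'_def)
  have pball: "p y \<in> cball x0 d" if "y \<in> cball (J x0) d'" for y
  proof -
    have "norm (p y - x0) \<le> norm (y - J x0) * Lp" using Lp(2)[of "y - J x0"] pdiff[of y "J x0"] pJ by simp
    also have "\<dots> \<le> d' * Lp" using that Lp(1) by (intro mult_right_mono) (auto simp: dist_norm norm_minus_commute)
    also have "\<dots> = d" using Lp by (simp add: d'_def)
    finally show ?thesis by (simp add: dist_norm norm_minus_commute)
  qed
  have lip: "norm (J (F (p x)) - J (F (p y))) \<le> (LJ * K * Lp) * norm (x - y)"
    if "x \<in> cball (J x0) d'" "y \<in> cball (J x0) d'" for x y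
  proof -
    have "norm (J (F (p x)) - J (F (p y))) \<le> norm (F (p x) - F (p y)) * LJ" unfolding Jdiff by (rule LJ)
    also have "\<dots> \<le> (K * norm (p x - p y)) * LJ"
      using dK(3)[OF pball pball] that LJ by (intro mult_right_mono) auto
    also have "\<dots> \<le> (K * (norm (x - y) * Lp)) * LJ"
      using Lp(2)[of "x - y"] dK LJ by (intro mult_right_mono mult_left_mono) (auto simp: pdiff)
    finally show ?thesis by (simp add: mult_ac)
  qed
  have K': "LJ * K * Lp \<ge> 0" using LJ dK Lp by simp
  \<comment> \<open>The equation is conjugated by \<open>J\<close> and \<open>p\<close> and solved
    in the bidual. Applying \<open>p\<close> to \<open>Y\<close> gives a solution of the original
    equation because \<open>p (J x) = x\<close>.\<close>
  obtain e Y where eY: "e > 0" "Y 0 = J x0"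
    "\<And>t. \<bar>t\<bar> < e \<Longrightarrow> (Y has_vector_derivative J (F (p (Y t)))) (at t)"
    using picard_lindeloef[OF d' K' lip] by metis
  show thesis
  proof (rule that[of e "\<lambda>t. p (Y t)"])
    show "e > 0" "p (Y 0) = x0" using eY pJ by auto
    show "((\<lambda>t. p (Y t)) has_vector_derivative F (p (Y t))) (at t)" if "\<bar>t\<bar> < e" for t
      using bounded_linear.has_vector_derivative[OF bp eY(3)[OF that]] by (simp add: pJ)
  qed
qed

text \<open>Bootstrapping: the derivative of \<open>x\<close> is the composite of \<open>F\<close>
  with \<open>x\<close>, so each order of differentiability of \<open>x\<close> gives the
  next.\<close>

lemma ode_solution_smooth:
  fixes F :: "'a::real_normed_vector \<Rightarrow> 'a" and x :: "real \<Rightarrow> 'a"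
  assumes fd: "findim TYPE('a)" and I: "open I"
    and x: "\<And>t. t \<in> I \<Longrightarrow> (x has_vector_derivative F (x t)) (at t)"
    and F: "\<And>t. t \<in> I \<Longrightarrow> vsmooth F (x t)"
  shows "smooth_on I x"
proof -
  have d: "(x has_derivative (\<lambda>h. h *\<^sub>R F (x t))) (at t)" if "t \<in> I" for t
    using x[OF that] by (simp add: has_vector_derivative_def)
  have "td n I x" for n
  proof (induction n)
    case 0
    have "isCont x t" if "t \<in> I" for t by (rule has_vector_derivative_continuous[OF x[OF that]])
    then show ?case by (simp add: continuous_at_imp_continuous_on)
  next
    case (Suc n)
    show ?case
    proof (simp, intro conjI ballI allI)
      show "x differentiable (at t)" if "t \<in> I" for t using d[OF that] by (rule differentiableI)
      fix v :: real
      have "td n I (\<lambda>t. F (x t))"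
      proof (rule td_compose[OF fd I open_vsmooth _ Suc.IH])
        show "td n {x. vsmooth F x} F" using smooth_on_vsmooth[of F] by (simp add: smooth_on_def)
      qed (use F in auto)
      then have "td n I (\<lambda>t. v *\<^sub>R F (x t))"
        by (rule td_linear_comp[OF bounded_linear_scaleR_right I])
      then show "td n I (\<lambda>t. D x t v)"
        by (rule td_cong[OF I, rotated]) (simp add: D_eq[OF d])
    qed
  qed
  then show ?thesis by (simp add: smooth_on_def)
qed

section \<open>The right Maurer-Cartan form of a Lie group\<close>

locale lie_group_chart = group G for G :: "('g, 'e::real_normed_vector) lie_group_data" (structure) +
  fixes c\<^sub>0 :: "('g, 'e) chart"
  assumes lie: "lie_group G" and c0: "c\<^sub>0 \<in> charts_at (mfd G) \<one>"
begin

abbreviation gsmooth :: "('x::real_normed_vector \<Rightarrow> 'g) \<Rightarrow> 'x \<Rightarrow> bool" where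
  "gsmooth e z \<equiv> smooth_at vec_mfd (mfd G) e z"

abbreviation e\<^sub>0 :: 'e where "e\<^sub>0 \<equiv> snd c\<^sub>0 \<one>"

lemma smooth_manifold_G: "smooth_manifold (mfd G)"
  using lie by (simp add: lie_group_def)

lemma points_G: "points (mfd G) = carrier G"
  using lie by (simp add: lie_group_def)

lemma findim_e: "findim TYPE('e)"
  by (rule findim_model[OF smooth_manifold_G])

lemmas findim_e2 = findim_prod[OF findim_e findim_e]
lemmas findim_e3 = findim_prod[OF findim_e findim_e2]

lemma c0_atlas: "c\<^sub>0 \<in> atlas (mfd G)" and one_c0: "\<one> \<in> fst c\<^sub>0"
  using c0 by (auto simp: charts_at_iff)

lemma e0_cimg: "e\<^sub>0 \<in> cimg c\<^sub>0"
  using one_c0 by simp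

lemma chart_dom_carrier: "c \<in> atlas (mfd G) \<Longrightarrow> g \<in> fst c \<Longrightarrow> g \<in> carrier G"
  using chart_dom_subset[OF smooth_manifold_G] points_G by blast

lemma chart_inv_carrier: "c \<in> atlas (mfd G) \<Longrightarrow> u \<in> cimg c \<Longrightarrow> chart_inv c u \<in> carrier G"
  by (rule chart_dom_carrier[OF _ chart_inv_in])

lemma chart_inv_e0 [simp]: "chart_inv c\<^sub>0 e\<^sub>0 = \<one>"
  by (rule chart_inv_chart[OF smooth_manifold_G c0_atlas one_c0])

lemma smooth_at_mult:
  assumes L: "smooth_manifold L" and f: "smooth_at L (mfd G) f p" and g: "smooth_at L (mfd G) g p"
  shows "smooth_at L (mfd G) (\<lambda>x. f x \<otimes> g x) p"
proof -
  note MM = prod_smooth_manifold[OF smooth_manifold_G smooth_manifold_G]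
  have "(f p, g p) \<in> points (prod_mfd (mfd G) (mfd G))"
    using smooth_at_charts(2)[OF L smooth_manifold_G] f g by simp
  then have "smooth_at (prod_mfd (mfd G) (mfd G)) (mfd G) (\<lambda>(g, h). g \<otimes> h) (f p, g p)"
    using lie smooth_map_iff_smooth_at[OF MM smooth_manifold_G] unfolding lie_group_def by blast
  from smooth_at_compose[OF L MM smooth_manifold_G smooth_at_Pair[OF L smooth_manifold_G smooth_manifold_G f g] this]
  show ?thesis by simp
qed

lemma smooth_at_inv:
  assumes L: "smooth_manifold L" and f: "smooth_at L (mfd G) f p"
  shows "smooth_at L (mfd G) (\<lambda>x. inv f x) p"
proof -
  have "f p \<in> points (mfd G)"
    using smooth_at_charts(2)[OF L smooth_manifold_G f] .
  then have "smooth_at (mfd G) (mfd G) (\<lambda>g. inv g) (f p)"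
    using lie smooth_map_iff_smooth_at[OF smooth_manifold_G smooth_manifold_G] unfolding lie_group_def by blast
  from smooth_at_compose[OF L smooth_manifold_G smooth_manifold_G f this]
  show ?thesis .
qed

lemma gsmooth_chart_inv:
  fixes h :: "'x::real_normed_vector \<Rightarrow> 'e"
  assumes "findim TYPE('x)" "vsmooth h z" "c \<in> atlas (mfd G)" "h z \<in> cimg c"
  shows "gsmooth (\<lambda>z. chart_inv c (h z)) z"
  by (rule smooth_at_compose[OF vec_mfd_smooth_manifold[OF assms(1)] vec_mfd_smooth_manifold[OF findim_e] smooth_manifold_G
        assms(2) smooth_at_chart_inv[OF smooth_manifold_G assms(3,4)]])

lemma vsmooth_chart:
  fixes e :: "'x::real_normed_vector \<Rightarrow> 'g"
  assumes "findim TYPE('x)" "gsmooth e z" "c \<in> atlas (mfd G)" "e z \<in> fst c"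
  shows "vsmooth (\<lambda>z. snd c (e z)) z"
proof -
  have "c \<in> charts_at (mfd G) (e z)" using assms by (simp add: charts_at_iff)
  from smooth_at_compose[OF vec_mfd_smooth_manifold[OF assms(1)] smooth_manifold_G vec_mfd_smooth_manifold[OF findim_e]
        assms(2) smooth_at_chart[OF smooth_manifold_G this]]
  show ?thesis .
qed

lemma gsmooth_const: "findim TYPE('x::real_normed_vector) \<Longrightarrow> g \<in> carrier G \<Longrightarrow> gsmooth (\<lambda>z::'x. g) z"
  by (rule smooth_at_const[OF vec_mfd_smooth_manifold smooth_manifold_G]) (simp_all add: points_G)

text \<open>Continuity in the form used below: parameters near \<open>z\<close> keep the value in
  the given chart domain, even when smoothness of \<open>e\<close> is witnessed in another
  chart.\<close>

lemma gsmooth_open_preimage: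
  fixes e :: "'x::real_normed_vector \<Rightarrow> 'g"
  assumes e: "gsmooth e z" and c: "c \<in> atlas (mfd G)" "e z \<in> fst c"
  obtains U where "open U" "z \<in> U" "\<And>y. y \<in> U \<Longrightarrow> e y \<in> fst c"
proof -
  obtain d U where d: "d \<in> charts_at (mfd G) (e z)" and U: "open U" "z \<in> U" "e ` U \<subseteq> fst d" "smooth_on U (snd d \<circ> e)"
    using e unfolding smooth_at_def by auto
  have dat: "d \<in> atlas (mfd G)" "e z \<in> fst d" using d by (auto simp: charts_at_iff)
  let ?W = "snd d ` (fst d \<inter> fst c)"
  let ?U = "{y \<in> U. (snd d \<circ> e) y \<in> ?W}"
  show thesis
  proof (rule that[of ?U])
    show "open ?U"
      by (rule open_preimage_in[OF U(1) smooth_on_imp_continuous_on[OF U(4)] chart_overlap_open[OF smooth_manifold_G dat(1) c(1)]])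
    show "z \<in> ?U" using U(2) dat(2) c(2) by auto
    show "e y \<in> fst c" if "y \<in> ?U" for y
    proof -
      have yd: "e y \<in> fst d" using that U(3) by auto
      have "snd d (e y) \<in> ?W" using that by simp
      from mem_chart_overlap[OF this smooth_manifold_G dat(1)]
      show ?thesis by (simp add: chart_inv_chart[OF smooth_manifold_G dat(1) yd])
    qed
  qed
qed

text \<open>Coordinates are meaningful only while the product stays in the domain of
  \<open>c\<^sub>0\<close>; every use below secures this.\<close>

definition mul :: "'e \<times> 'e \<Rightarrow> 'e" where
  "mul z = snd c\<^sub>0 (chart_inv c\<^sub>0 (fst z) \<otimes> chart_inv c\<^sub>0 (snd z))"

text \<open>Both points lie in one arbitrary chart \<open>c\<close>, while the quotient is read in
  \<open>c\<^sub>0\<close>. Near the diagonal it is close to the identity, so the single chart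
  \<open>c\<^sub>0\<close> serves at every point of the group.\<close>

definition quot :: "('g, 'e) chart \<Rightarrow> 'e \<times> 'e \<Rightarrow> 'e" where
  "quot c z = snd c\<^sub>0 (chart_inv c (fst z) \<otimes> inv (chart_inv c (snd z)))"

definition lquot :: "'e \<times> 'e \<Rightarrow> 'e" where
  "lquot z = snd c\<^sub>0 (inv (chart_inv c\<^sub>0 (fst z)) \<otimes> chart_inv c\<^sub>0 (snd z))"

lemma gsmooth_chart_inv_fst: "c \<in> atlas (mfd G) \<Longrightarrow> fst z \<in> cimg c \<Longrightarrow> gsmooth (\<lambda>z::'e \<times> 'e. chart_inv c (fst z)) z"
  by (rule gsmooth_chart_inv[OF findim_e2 vsmooth_fst[OF vsmooth_ident]])

lemma gsmooth_chart_inv_snd: "c \<in> atlas (mfd G) \<Longrightarrow> snd z \<in> cimg c \<Longrightarrow> gsmooth (\<lambda>z::'e \<times> 'e. chart_inv c (snd z)) z"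
  by (rule gsmooth_chart_inv[OF findim_e2 vsmooth_snd[OF vsmooth_ident]])

lemmas vec_e2 = vec_mfd_smooth_manifold[OF findim_e2]

lemma vsmooth_mul:
  assumes "x \<in> cimg c\<^sub>0" "y \<in> cimg c\<^sub>0" "chart_inv c\<^sub>0 x \<otimes> chart_inv c\<^sub>0 y \<in> fst c\<^sub>0"
  shows "vsmooth mul (x, y)"
proof -
  have "gsmooth (\<lambda>z. chart_inv c\<^sub>0 (fst z) \<otimes> chart_inv c\<^sub>0 (snd z)) (x, y)"
    using assms by (intro smooth_at_mult[OF vec_e2] gsmooth_chart_inv_fst gsmooth_chart_inv_snd c0_atlas) auto
  then show ?thesis unfolding mul_def[abs_def]
    by (rule vsmooth_chart[OF findim_e2 _ c0_atlas]) (simp add: assms)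
qed

lemma gsmooth_quot:
  assumes "c \<in> atlas (mfd G)" "q \<in> cimg c" "p \<in> cimg c"
  shows "gsmooth (\<lambda>z. chart_inv c (fst z) \<otimes> inv (chart_inv c (snd z))) (q, p)"
  using assms by (intro smooth_at_mult[OF vec_e2] smooth_at_inv[OF vec_e2] gsmooth_chart_inv_fst gsmooth_chart_inv_snd) auto

lemma vsmooth_quot:
  assumes "c \<in> atlas (mfd G)" "q \<in> cimg c" "p \<in> cimg c" "chart_inv c q \<otimes> inv (chart_inv c p) \<in> fst c\<^sub>0"
  shows "vsmooth (quot c) (q, p)"
  unfolding quot_def[abs_def]
  by (rule vsmooth_chart[OF findim_e2 gsmooth_quot[OF assms(1-3)] c0_atlas]) (simp add: assms)

lemma gsmooth_lquot:
  assumes "x \<in> cimg c\<^sub>0" "y \<in> cimg c\<^sub>0"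
  shows "gsmooth (\<lambda>z. inv (chart_inv c\<^sub>0 (fst z)) \<otimes> chart_inv c\<^sub>0 (snd z)) (x, y)"
  using assms by (intro smooth_at_mult[OF vec_e2] smooth_at_inv[OF vec_e2] gsmooth_chart_inv_fst gsmooth_chart_inv_snd c0_atlas) auto

lemma vsmooth_lquot:
  assumes "x \<in> cimg c\<^sub>0" "y \<in> cimg c\<^sub>0" "inv (chart_inv c\<^sub>0 x) \<otimes> chart_inv c\<^sub>0 y \<in> fst c\<^sub>0"
  shows "vsmooth lquot (x, y)"
  unfolding lquot_def[abs_def]
  by (rule vsmooth_chart[OF findim_e2 gsmooth_lquot[OF assms(1,2)] c0_atlas]) (simp add: assms)

text \<open>Continuity of the quotient at the diagonal point \<open>(u, u)\<close>, whose value is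
  the identity, cut down to a square neighbourhood.\<close>

lemma quot_nbhd:
  assumes c: "c \<in> atlas (mfd G)" and u: "u \<in> cimg c"
  obtains U where "open U" "u \<in> U" "U \<subseteq> cimg c"
    "\<And>q p. q \<in> U \<Longrightarrow> p \<in> U \<Longrightarrow> chart_inv c q \<otimes> inv (chart_inv c p) \<in> fst c\<^sub>0"
proof -
  let ?e = "\<lambda>z. chart_inv c (fst z) \<otimes> inv (chart_inv c (snd z))"
  have "?e (u, u) \<in> fst c\<^sub>0" using one_c0 chart_inv_carrier[OF c u] by simp
  then obtain V where V: "open V" "(u, u) \<in> V" "\<And>z. z \<in> V \<Longrightarrow> ?e z \<in> fst c\<^sub>0"
    using gsmooth_open_preimage[OF gsmooth_quot[OF c u u] c0_atlas] by metis
  obtain A B where AB: "open A" "open B" "(u, u) \<in> A \<times> B" "A \<times> B \<subseteq> V" using open_prod_elim[OF V(1,2)] by metis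
  show thesis
  proof (rule that[of "A \<inter> B \<inter> cimg c"])
    show "open (A \<inter> B \<inter> cimg c)" using AB cimg_open[OF smooth_manifold_G c] by blast
    fix q p assume "q \<in> A \<inter> B \<inter> cimg c" "p \<in> A \<inter> B \<inter> cimg c"
    then have "(q, p) \<in> V" using AB(4) by blast
    from V(3)[OF this] show "chart_inv c q \<otimes> inv (chart_inv c p) \<in> fst c\<^sub>0" by simp
  qed (use AB u in auto)
qed

lemma vsmooth_mul_e0: "x \<in> cimg c\<^sub>0 \<Longrightarrow> vsmooth mul (e\<^sub>0, x)"
  using chart_inv_in[of x c\<^sub>0] chart_inv_carrier[OF c0_atlas, of x] by (intro vsmooth_mul e0_cimg) auto

lemma mul_e0_right: "x \<in> cimg c\<^sub>0 \<Longrightarrow> mul (x, e\<^sub>0) = x"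
  using chart_inv_carrier[OF c0_atlas, of x] chart_chart_inv[of x c\<^sub>0] by (simp add: mul_def)

lemma mul_e0_left: "x \<in> cimg c\<^sub>0 \<Longrightarrow> mul (e\<^sub>0, x) = x"
  using chart_inv_carrier[OF c0_atlas, of x] chart_chart_inv[of x c\<^sub>0] by (simp add: mul_def)

lemma D_Pair_const:
  assumes f: "vsmooth f (x, y)"
  shows "D (\<lambda>x. f (x, y)) x v = D f (x, y) (v, 0)"
proof -
  have "((\<lambda>x. (x, y)) has_derivative (\<lambda>v. (v, 0))) (at x)"
    by (intro has_derivative_Pair has_derivative_ident has_derivative_const)
  from has_derivative_compose[OF this vsmooth_has_derivative[OF f]] show ?thesis by (simp add: D_eq)
qed

lemma D_mul_left: "D mul (e\<^sub>0, e\<^sub>0) (v, 0) = v"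
proof -
  have "D (\<lambda>x. mul (x, e\<^sub>0)) e\<^sub>0 = D (\<lambda>x. x) e\<^sub>0"
    by (rule D_cong[OF cimg_open[OF smooth_manifold_G c0_atlas] e0_cimg mul_e0_right]) simp_all
  then show ?thesis using D_Pair_const[OF vsmooth_mul_e0[OF e0_cimg]] by simp
qed

text \<open>On the diagonal the quotient is constantly the identity, so its two partial derivatives
  cancel.\<close>

lemma D_quot_diag:
  assumes c: "c \<in> atlas (mfd G)" and u: "u \<in> cimg c"
  shows "D (quot c) (u, u) (0, x) = - D (quot c) (u, u) (x, 0)"
proof -
  have vs: "vsmooth (quot c) (u, u)"
    using vsmooth_quot[OF c u u] chart_inv_carrier[OF c u] one_c0 by simp
  have "((\<lambda>u. (u, u)) has_derivative (\<lambda>v. (v, v))) (at u)"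
    by (intro has_derivative_Pair has_derivative_ident)
  from has_derivative_compose[OF this vsmooth_has_derivative[OF vs]]
  have "D (\<lambda>u. quot c (u, u)) u x = D (quot c) (u, u) (x, x)" by (simp add: D_eq)
  moreover have "D (\<lambda>u. quot c (u, u)) u = D (\<lambda>u. e\<^sub>0) u"
    by (rule D_cong[OF cimg_open[OF smooth_manifold_G c] u]) (simp_all add: quot_def chart_inv_carrier[OF c])
  ultimately have "D (quot c) (u, u) ((x, 0) + (0, x)) = 0" by simp
  then show ?thesis unfolding linear_add[OF vsmooth_linear_D[OF vs]] by (simp add: add_eq_0_iff)
qed

text \<open>\<open>rho c u\<close> is the right-invariant Maurer-Cartan form at \<open>u\<close> in the chart \<open>c\<close>: the
  derivative at \<open>q = u\<close> of the coordinates of \<open>q \<cdot> u\<inverse>\<close>.\<close>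

definition rho :: "('g, 'e) chart \<Rightarrow> 'e \<Rightarrow> 'e \<Rightarrow> 'e" where
  "rho c u x = D (quot c) (u, u) (x, 0)"

text \<open>The bilinear second-order term of the multiplication in \<open>c\<^sub>0\<close>. By
  itself it depends on the chart; only its antisymmetrization becomes the bracket.\<close>

definition mixed :: "'e \<Rightarrow> 'e \<Rightarrow> 'e" where
  "mixed v w = D2 mul (e\<^sub>0, e\<^sub>0) (v, 0) (0, w)"

lemma vsmooth_quot_diag: "c \<in> atlas (mfd G) \<Longrightarrow> u \<in> cimg c \<Longrightarrow> vsmooth (quot c) (u, u)"
  using vsmooth_quot[of c u u] chart_inv_carrier[of c u] one_c0 by simp

lemma linear_rho: "c \<in> atlas (mfd G) \<Longrightarrow> u \<in> cimg c \<Longrightarrow> linear (rho c u)"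
proof -
  assume "c \<in> atlas (mfd G)" "u \<in> cimg c"
  then have "linear (D (quot c) (u, u))" by (intro vsmooth_linear_D vsmooth_quot_diag)
  moreover have "linear (\<lambda>x::'e. (x, 0::'e))" by (intro linearI) auto
  ultimately have "linear (D (quot c) (u, u) \<circ> (\<lambda>x. (x, 0)))" by (rule linear_compose[rotated])
  then show "linear (rho c u)" by (simp add: rho_def[abs_def] comp_def)
qed

text \<open>\<open>rho\<close> is evaluated along the diagonal, so moving \<open>u\<close> moves
  both slots of \<open>quot\<close> and the outer direction is \<open>(x, x)\<close>.\<close>

lemma has_derivative_rho:
  assumes c: "c \<in> atlas (mfd G)" and u: "u \<in> cimg c"
  shows "vsmooth (\<lambda>u. rho c u y) u" "D (\<lambda>u. rho c u y) u x = D2 (quot c) (u, u) (y, 0) (x, x)"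
proof -
  have vs: "vsmooth (\<lambda>z. D (quot c) z (y, 0)) (u, u)" by (rule vsmooth_D[OF vsmooth_quot_diag[OF c u]])
  then show "vsmooth (\<lambda>u. rho c u y) u" unfolding rho_def
    by (rule vsmooth_compose[OF findim_e2 vsmooth_Pair[OF vsmooth_ident vsmooth_ident]])
  have "((\<lambda>u. (u, u)) has_derivative (\<lambda>v. (v, v))) (at u)"
    by (intro has_derivative_Pair has_derivative_ident)
  from has_derivative_compose[OF this vsmooth_has_derivative[OF vs]]
  show "D (\<lambda>u. rho c u y) u x = D2 (quot c) (u, u) (y, 0) (x, x)" by (simp add: D_eq rho_def)
qed

lemma linear_mixed_left: "linear (\<lambda>v. mixed v w)" and linear_mixed_right: "linear (mixed v)"
proof -
  have l1: "linear (\<lambda>x::'e. (x, 0::'e))" and l2: "linear (\<lambda>x::'e. (0::'e, x))" by (auto intro!: linearI)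
  note vs = vsmooth_mul_e0[OF e0_cimg]
  show "linear (\<lambda>v. mixed v w)"
    using linear_compose[OF l1 vsmooth_linear_D2_left[OF vs]] by (simp add: mixed_def comp_def)
  show "linear (mixed v)"
    using linear_compose[OF l2 vsmooth_linear_D2_right[OF vs]] by (simp add: mixed_def[abs_def] comp_def)
qed

text \<open>Differentiates \<open>q \<cdot> p\<inverse> = (q \<cdot> u\<inverse>) \<cdot> (u \<cdot> p\<inverse>)\<close> in \<open>q\<close> and \<open>p\<close>.\<close>

lemma D2_quot_mixed:
  assumes c: "c \<in> atlas (mfd G)" and u: "u \<in> cimg c"
  shows "D2 (quot c) (u, u) (y, 0) (0, x) = - mixed (rho c u y) (rho c u x)"
proof -
  obtain U where U: "open U" "u \<in> U" "U \<subseteq> cimg c"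
    "\<And>q p. q \<in> U \<Longrightarrow> p \<in> U \<Longrightarrow> chart_inv c q \<otimes> inv (chart_inv c p) \<in> fst c\<^sub>0"
    using quot_nbhd[OF c u] by metis
  define \<phi> where "\<phi> = (\<lambda>z. (quot c (fst z, u), quot c (u, snd z)))"
  have oU: "open (U \<times> U)" "(u, u) \<in> U \<times> U" using U open_Times by auto
  have vq: "vsmooth (quot c) (q, p)" if "q \<in> U" "p \<in> U" for q p
    using that U(3,4) by (intro vsmooth_quot[OF c]) auto
  have eq: "quot c z = mul (\<phi> z)" if z: "z \<in> U \<times> U" for z
  proof -
    obtain q p where qp: "z = (q, p)" "q \<in> U" "p \<in> U" using z by auto
    have carr: "chart_inv c q \<in> carrier G" "chart_inv c p \<in> carrier G" "chart_inv c u \<in> carrier G"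
      using qp U(2,3) by (auto intro!: chart_inv_carrier[OF c])
    have "chart_inv c\<^sub>0 (quot c (q, u)) = chart_inv c q \<otimes> inv (chart_inv c u)"
      "chart_inv c\<^sub>0 (quot c (u, p)) = chart_inv c u \<otimes> inv (chart_inv c p)"
      unfolding quot_def fst_conv snd_conv
      by (rule chart_inv_chart[OF smooth_manifold_G c0_atlas U(4)]; fact)+
    moreover have "(chart_inv c q \<otimes> inv (chart_inv c u)) \<otimes> (chart_inv c u \<otimes> inv (chart_inv c p))
        = chart_inv c q \<otimes> inv (chart_inv c p)"
      using carr by (simp add: m_assoc[symmetric] inv_solve_right) (simp add: m_assoc)
    ultimately show ?thesis by (simp add: mul_def \<phi>_def qp quot_def)
  qed
  have d1: "((\<lambda>z::'e \<times> 'e. quot c (fst z, u)) has_derivative (\<lambda>v. D (quot c) (fst z, u) (fst v, 0))) (at z)"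
    if "z \<in> U \<times> U" for z
    by (rule has_derivative_compose[OF has_derivative_Pair[OF has_derivative_fst[OF has_derivative_ident] has_derivative_const]
          vsmooth_has_derivative]) (use that U(2) in \<open>auto intro!: vq\<close>)
  have d2: "((\<lambda>z::'e \<times> 'e. quot c (u, snd z)) has_derivative (\<lambda>v. D (quot c) (u, snd z) (0, snd v))) (at z)"
    if "z \<in> U \<times> U" for z
    by (rule has_derivative_compose[OF has_derivative_Pair[OF has_derivative_const has_derivative_snd[OF has_derivative_ident]]
          vsmooth_has_derivative]) (use that U(2) in \<open>auto intro!: vq\<close>)
  have D\<phi>: "D \<phi> z v = (D (quot c) (fst z, u) (fst v, 0), D (quot c) (u, snd z) (0, snd v))" if "z \<in> U \<times> U" for z v
    unfolding \<phi>_def using D_eq[OF has_derivative_Pair[OF d1[OF that] d2[OF that]]] by simp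
  have vs\<phi>: "vsmooth \<phi> (u, u)" unfolding \<phi>_def
  proof (rule vsmooth_Pair)
    show "vsmooth (\<lambda>z. quot c (fst z, u)) (u, u)"
      by (rule vsmooth_compose[OF findim_e2 vsmooth_Pair[OF vsmooth_fst[OF vsmooth_ident] vsmooth_const]]) (simp add: vq U(2))
    show "vsmooth (\<lambda>z. quot c (u, snd z)) (u, u)"
      by (rule vsmooth_compose[OF findim_e2 vsmooth_Pair[OF vsmooth_const vsmooth_snd[OF vsmooth_ident]]]) (simp add: vq U(2))
  qed
  have \<phi>u: "\<phi> (u, u) = (e\<^sub>0, e\<^sub>0)" using chart_inv_carrier[OF c u] by (simp add: \<phi>_def quot_def)
  have vsm: "vsmooth mul (\<phi> (u, u))" unfolding \<phi>u by (rule vsmooth_mul_e0[OF e0_cimg])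
  \<comment> \<open>Each component of \<open>\<phi>\<close> depends on one of the two variables
    only, so its mixed derivative vanishes. The second-order chain rule then leaves just the term
    with \<open>D2 mul\<close>.\<close>
  have "D2 \<phi> (u, u) (y, 0) (0, x) = 0"
  proof -
    define g where "g = (\<lambda>q. D (quot c) (q, u) (y, 0))"
    have vg: "vsmooth g u" unfolding g_def
      by (rule vsmooth_compose[OF findim_e2 vsmooth_Pair[OF vsmooth_ident vsmooth_const] vsmooth_D[OF vq[OF U(2) U(2)]]])
    have dg: "((\<lambda>z::'e \<times> 'e. (g (fst z), 0::'e)) has_derivative (\<lambda>v. (D g u (fst v), 0))) (at (u, u))"
      by (rule has_derivative_Pair[OF _ has_derivative_const],
          rule has_derivative_compose[OF has_derivative_fst[OF has_derivative_ident]])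
        (unfold fst_conv, rule vsmooth_has_derivative[OF vg])
    have "((\<lambda>z. D \<phi> z (y, 0)) has_derivative (\<lambda>v. (D g u (fst v), 0))) (at (u, u))"
    proof (rule has_derivative_transform_within_open[OF dg oU])
      fix z assume z: "z \<in> U \<times> U"
      then have "vsmooth (quot c) (u, snd z)" using vq U(2) by auto
      from linear_0[OF vsmooth_linear_D[OF this]] have "D (quot c) (u, snd z) (0, 0) = 0"
        by (simp only: zero_prod_def)
      then show "(g (fst z), 0) = D \<phi> z (y, 0)" using D\<phi>[OF z] by (simp add: g_def)
    qed
    from D_eq[OF this] show ?thesis
      using linear_0[OF vsmooth_linear_D[OF vg]] by (simp add: zero_prod_def)
  qed
  then have "D2 (\<lambda>z. mul (\<phi> z)) (u, u) (y, 0) (0, x) = D2 mul (e\<^sub>0, e\<^sub>0) (D \<phi> (u, u) (y, 0)) (D \<phi> (u, u) (0, x))"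
    using vsmooth_D2_compose[OF findim_e2 vs\<phi> vsm] linear_0[OF vsmooth_linear_D[OF vsm]] by (simp add: \<phi>u)
  moreover have z0: "D (quot c) (u, u) (0, 0) = 0"
    using linear_0[OF vsmooth_linear_D[OF vq[OF U(2) U(2)]]] by (simp only: zero_prod_def)
  then have "D \<phi> (u, u) (y, 0) = (rho c u y, 0)"
    using D\<phi>[OF oU(2), of "(y, 0)"] by (simp add: rho_def)
  moreover have "D \<phi> (u, u) (0, x) = (0, - rho c u x)"
    using D\<phi>[OF oU(2), of "(0, x)"] z0 D_quot_diag[OF c u, of x] by (simp add: rho_def)
  moreover have "D2 (quot c) (u, u) (y, 0) (0, x) = D2 (\<lambda>z. mul (\<phi> z)) (u, u) (y, 0) (0, x)"
    by (rule vsmooth_D2_cong[OF vsmooth_compose[OF findim_e2 vs\<phi> vsm] oU eq])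
  ultimately show ?thesis
    using linear_neg[OF linear_mixed_right] by (simp add: mixed_def)
qed

text \<open>The direction \<open>(x, x)\<close> splits into a part in the first slot and a part in
  the second. The former is symmetric in \<open>x\<close> and \<open>y\<close> and drops out of the
  difference; the latter is expressed by \<open>mixed\<close>.\<close>

lemma maurer_cartan_mixed:
  assumes c: "c \<in> atlas (mfd G)" and u: "u \<in> cimg c"
  shows "D (\<lambda>u. rho c u y) u x - D (\<lambda>u. rho c u x) u y
    = mixed (rho c u x) (rho c u y) - mixed (rho c u y) (rho c u x)"
proof -
  note vs = vsmooth_quot_diag[OF c u]
  have split: "D2 (quot c) (u, u) (y, 0) (x, x) = D2 (quot c) (u, u) (y, 0) (x, 0) + D2 (quot c) (u, u) (y, 0) (0, x)" for x y
    using linear_add[OF vsmooth_linear_D2_right[OF vs], of "(y, 0)" "(x, 0)" "(0, x)"] by simp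
  have "D2 (quot c) (u, u) (y, 0) (x, 0) = D2 (quot c) (u, u) (x, 0) (y, 0)"
    by (rule vsmooth_D2_symmetric[OF findim_e vs])
  then show ?thesis
    unfolding has_derivative_rho(2)[OF c u] split D2_quot_mixed[OF c u] by simp
qed

lemma rho_e0: "rho c\<^sub>0 e\<^sub>0 x = x"
proof -
  have "D (\<lambda>q. quot c\<^sub>0 (q, e\<^sub>0)) e\<^sub>0 = D (\<lambda>q. q) e\<^sub>0"
    by (rule D_cong[OF cimg_open[OF smooth_manifold_G c0_atlas] e0_cimg])
      (simp_all add: quot_def chart_inv_carrier[OF c0_atlas] chart_chart_inv)
  then show ?thesis
    using D_Pair_const[OF vsmooth_quot_diag[OF c0_atlas e0_cimg]] by (simp add: rho_def)
qed

section \<open>Right translation in terms of the Maurer-Cartan form\<close>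

lemma smooth_at_right_mult: "g \<in> carrier G \<Longrightarrow> h \<in> carrier G \<Longrightarrow> smooth_at (mfd G) (mfd G) (\<lambda>x. x \<otimes> g) h"
  by (intro smooth_at_mult smooth_at_ident smooth_at_const smooth_manifold_G) (auto simp: points_G)

lemma lie_tvec_in: "lie_tvec G c\<^sub>0 \<eta> \<in> tangent_space (mfd G) \<one>"
  unfolding lie_tvec_def by (rule tvec_of_in_tangent_space[OF smooth_manifold_G c0])

lemma right_transl_in: "g \<in> carrier G \<Longrightarrow> right_transl G c\<^sub>0 g \<eta> \<in> tangent_space (mfd G) g"
  using tangent_map_in_tangent_space[OF smooth_manifold_G smooth_manifold_G smooth_at_right_mult lie_tvec_in, of g \<eta>]
  by (simp add: right_transl_def)

text \<open>Translations by \<open>g\<close> and by \<open>inv g\<close> have mutually inverse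
  tangent maps, and \<open>rho c\<close> at the coordinates of \<open>g\<close> is the coordinate
  expression of the translation back to the identity. This converts right-trivialized vectors to
  chart coordinates and makes \<open>rho\<close> surjective.\<close>

lemma right_transl_iff_rho:
  assumes c: "c \<in> charts_at (mfd G) g"
  shows "right_transl G c\<^sub>0 g \<eta> = tvec_of (mfd G) c g x \<longleftrightarrow> \<eta> = rho c (snd c g) x"
proof -
  note SM = smooth_manifold_G
  have at: "c \<in> atlas (mfd G)" "g \<in> fst c" using c by (auto simp: charts_at_iff)
  have g: "g \<in> carrier G" by (rule chart_dom_carrier[OF at])
  have inv_transl: "tangent_map (mfd G) (mfd G) (\<lambda>q. q \<otimes> inv g) g (right_transl G c\<^sub>0 g \<eta>) = lie_tvec G c\<^sub>0 \<eta>" for \<eta>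
  proof -
    have "tangent_map (mfd G) (mfd G) (\<lambda>q. q \<otimes> inv g) (\<one> \<otimes> g) (right_transl G c\<^sub>0 g \<eta>)
        = tangent_map (mfd G) (mfd G) (\<lambda>q. q \<otimes> g \<otimes> inv g) \<one> (lie_tvec G c\<^sub>0 \<eta>)"
      unfolding right_transl_def using g
      by (intro tangent_map_compose[OF SM SM SM] smooth_at_right_mult lie_tvec_in) auto
    also have "\<dots> = tangent_map (mfd G) (mfd G) (\<lambda>q. q) \<one> (lie_tvec G c\<^sub>0 \<eta>)"
      using g by (intro tangent_map_cong[OF SM SM _ openin_topspace] smooth_at_ident SM lie_tvec_in)
        (auto simp: points_G m_assoc)
    also have "\<dots> = lie_tvec G c\<^sub>0 \<eta>" by (intro tangent_map_ident SM lie_tvec_in) (simp add: points_G)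
    finally show ?thesis using g by simp
  qed
  have inv_tvec: "tangent_map (mfd G) (mfd G) (\<lambda>q. q \<otimes> inv g) g (tvec_of (mfd G) c g x) = lie_tvec G c\<^sub>0 (rho c (snd c g) x)" for x
  proof -
    have c0': "c\<^sub>0 \<in> charts_at (mfd G) (g \<otimes> inv g)" using g c0 by simp
    have lr: "local_rep c c\<^sub>0 (\<lambda>q. q \<otimes> inv g) = (\<lambda>q. quot c (q, snd c g))"
      by (auto simp: quot_def chart_inv_chart[OF SM at])
    have "D (local_rep c c\<^sub>0 (\<lambda>q. q \<otimes> inv g)) (snd c g) x = rho c (snd c g) x"
      unfolding lr rho_def using at by (intro D_Pair_const vsmooth_quot_diag) auto
    then show ?thesis
      using tangent_map_tvec_of[OF SM SM smooth_at_right_mult c c0'] g by (simp add: lie_tvec_def)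
  qed
  have inj: "lie_tvec G c\<^sub>0 \<eta> = lie_tvec G c\<^sub>0 \<eta>' \<Longrightarrow> \<eta> = \<eta>'" for \<eta> \<eta>'
    unfolding lie_tvec_def using tvec_of_apply[OF SM c0] by metis
  have 1: "\<eta> = rho c (snd c g) x" if "right_transl G c\<^sub>0 g \<eta> = tvec_of (mfd G) c g x" for \<eta> x
    using inv_transl[of \<eta>] inv_tvec[of x] that inj by simp
  have "right_transl G c\<^sub>0 g (rho c (snd c g) x) = tvec_of (mfd G) c g x" for x
  proof -
    have "right_transl G c\<^sub>0 g (rho c (snd c g) x)
        = tangent_map (mfd G) (mfd G) (\<lambda>h. h \<otimes> g) (g \<otimes> inv g) (tangent_map (mfd G) (mfd G) (\<lambda>q. q \<otimes> inv g) g (tvec_of (mfd G) c g x))"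
      unfolding inv_tvec right_transl_def using g by simp
    also have "\<dots> = tangent_map (mfd G) (mfd G) (\<lambda>q. q \<otimes> inv g \<otimes> g) g (tvec_of (mfd G) c g x)"
      using g by (intro tangent_map_compose[OF SM SM SM] smooth_at_right_mult tvec_of_in_tangent_space[OF SM c]) auto
    also have "\<dots> = tangent_map (mfd G) (mfd G) (\<lambda>q. q) g (tvec_of (mfd G) c g x)"
      using g by (intro tangent_map_cong[OF SM SM _ openin_topspace] smooth_at_ident SM tvec_of_in_tangent_space[OF SM c])
        (auto simp: points_G m_assoc)
    also have "\<dots> = tvec_of (mfd G) c g x"
      using g by (intro tangent_map_ident SM tvec_of_in_tangent_space[OF SM c]) (simp add: points_G)
    finally show ?thesis .
  qed
  then show ?thesis using 1 by blast
qed

lemma rho_surj: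
  assumes c: "c \<in> charts_at (mfd G) g"
  obtains x where "rho c (snd c g) x = \<eta>"
proof -
  have "g \<in> carrier G" using c charts_at_points[OF smooth_manifold_G c] points_G by simp
  then obtain x where "right_transl G c\<^sub>0 g \<eta> = tvec_of (mfd G) c g x"
    using tangent_spaceE[OF right_transl_in c] by metis
  then show thesis using right_transl_iff_rho[OF c] that by metis
qed

end

section \<open>One-parameter subgroups and the Lie bracket\<close>

lemma vector_derivative_eq_D: "h differentiable (at t) \<Longrightarrow> (h has_vector_derivative D h t 1) (at t)"
proof -
  assume h: "h differentiable (at t)"
  have "D h t = (\<lambda>s. s *\<^sub>R D h t 1)"
  proof
    fix s show "D h t s = s *\<^sub>R D h t 1" using linear_scale[OF linear_D[OF h], of s 1] by simp
  qed
  then show ?thesis using frechet_derivative_worksI[OF h] by (simp add: has_vector_derivative_def)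
qed

lemma velocity_eq:
  assumes M: "smooth_manifold M" and \<gamma>: "smooth_at vec_mfd M \<gamma> t" and c: "c \<in> charts_at M (\<gamma> t)"
  shows "velocity M \<gamma> t = tvec_of M c (\<gamma> t) (vector_derivative (snd c \<circ> \<gamma>) (at t))"
proof
  note V = vec_mfd_smooth_manifold[OF findim_real]
  have vd: "vector_derivative (snd d \<circ> \<gamma>) (at t) = D (local_rep vec_chart d \<gamma>) t 1" if d: "d \<in> charts_at M (\<gamma> t)" for d
    using vector_derivative_at[OF vector_derivative_eq_D] local_rep_differentiable[OF V M \<gamma> _ d] by simp
  fix d
  show "velocity M \<gamma> t d = tvec_of M c (\<gamma> t) (vector_derivative (snd c \<circ> \<gamma>) (at t)) d"
  proof (cases "d \<in> charts_at M (\<gamma> t)")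
    case True
    have p: "\<gamma> t \<in> points M" by (rule charts_at_points[OF M c])
    show ?thesis
      using D_local_rep_compose[OF V M M \<gamma> smooth_at_ident[OF M p] _ c True, of vec_chart 1] True
      by (simp add: velocity_def tvec_of_def vd[OF True] vd[OF c] chart_change_eq)
  qed (simp add: velocity_def tvec_of_def)
qed

context lie_group_chart
begin

text \<open>The right-invariant vector field with value \<open>\<xi>\<close> at the identity,
  obtained by differentiating multiplication by a factor on the left.\<close>

definition rfield :: "'e \<Rightarrow> 'e \<Rightarrow> 'e" where
  "rfield \<xi> x = D mul (e\<^sub>0, x) (\<xi>, 0)"

lemma vsmooth_rfield: "x \<in> cimg c\<^sub>0 \<Longrightarrow> vsmooth (rfield \<xi>) x"
  unfolding rfield_def[abs_def]
  by (rule vsmooth_compose[OF findim_e2 vsmooth_Pair[OF vsmooth_const vsmooth_ident] vsmooth_D[OF vsmooth_mul_e0]])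

lemma rfield_e0: "rfield \<xi> e\<^sub>0 = \<xi>"
  by (simp add: rfield_def D_mul_left)

lemma has_derivative_mul_left:
  "x \<in> cimg c\<^sub>0 \<Longrightarrow> ((\<lambda>h. mul (h, x)) has_derivative (\<lambda>v. D mul (e\<^sub>0, x) (v, 0))) (at e\<^sub>0)"
  by (rule has_derivative_compose[OF has_derivative_Pair[OF has_derivative_ident has_derivative_const]
        vsmooth_has_derivative[OF vsmooth_mul_e0]])

text \<open>The left quotient \<open>x\<inverse> \<cdot> y\<close> is unchanged when \<open>x\<close> and \<open>y\<close> are multiplied by
  the same group element from the left.\<close>

lemma lquot_rfield:
  assumes x: "x \<in> cimg c\<^sub>0" and y: "y \<in> cimg c\<^sub>0"
    and xy: "inv (chart_inv c\<^sub>0 x) \<otimes> chart_inv c\<^sub>0 y \<in> fst c\<^sub>0"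
  shows "D lquot (x, y) (rfield \<xi> x, rfield \<xi> y) = 0"
proof -
  have nb: "\<exists>U. open U \<and> e\<^sub>0 \<in> U \<and> (\<forall>h\<in>U. chart_inv c\<^sub>0 h \<otimes> chart_inv c\<^sub>0 x \<in> fst c\<^sub>0)" if x: "x \<in> cimg c\<^sub>0" for x
  proof -
    have "gsmooth (\<lambda>h. chart_inv c\<^sub>0 h \<otimes> chart_inv c\<^sub>0 x) e\<^sub>0"
      by (intro smooth_at_mult[OF vec_mfd_smooth_manifold[OF findim_e]] gsmooth_chart_inv findim_e vsmooth_ident
          c0_atlas e0_cimg gsmooth_const chart_inv_carrier x)
    moreover have "chart_inv c\<^sub>0 e\<^sub>0 \<otimes> chart_inv c\<^sub>0 x \<in> fst c\<^sub>0"
      using chart_inv_carrier[OF c0_atlas x] chart_inv_in[OF x] by simp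
    ultimately show ?thesis using gsmooth_open_preimage[OF _ c0_atlas] by metis
  qed
  obtain U where U: "open U" "e\<^sub>0 \<in> U" "\<And>h. h \<in> U \<Longrightarrow> chart_inv c\<^sub>0 h \<otimes> chart_inv c\<^sub>0 x \<in> fst c\<^sub>0" using nb[OF x] by metis
  obtain V where V: "open V" "e\<^sub>0 \<in> V" "\<And>h. h \<in> V \<Longrightarrow> chart_inv c\<^sub>0 h \<otimes> chart_inv c\<^sub>0 y \<in> fst c\<^sub>0" using nb[OF y] by metis
  define \<Phi> where "\<Phi> = (\<lambda>h. (mul (h, x), mul (h, y)))"
  have \<Phi>0: "\<Phi> e\<^sub>0 = (x, y)" by (simp add: \<Phi>_def mul_e0_left x y)
  have d\<Phi>: "(\<Phi> has_derivative (\<lambda>v. (D mul (e\<^sub>0, x) (v, 0), D mul (e\<^sub>0, y) (v, 0)))) (at e\<^sub>0)"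
    unfolding \<Phi>_def by (intro has_derivative_Pair has_derivative_mul_left x y)
  have dl: "(lquot has_derivative D lquot (x, y)) (at (\<Phi> e\<^sub>0))"
    unfolding \<Phi>0 by (rule vsmooth_has_derivative[OF vsmooth_lquot[OF x y xy]])
  \<comment> \<open>The derivative at the identity is computed twice: by the chain rule, which
    produces the two right-invariant fields, and then from the constancy of the quotient.\<close>
  have "((\<lambda>h. lquot (\<Phi> h)) has_derivative (\<lambda>v. D lquot (x, y) (D mul (e\<^sub>0, x) (v, 0), D mul (e\<^sub>0, y) (v, 0)))) (at e\<^sub>0)"
    by (rule has_derivative_compose[OF d\<Phi> dl])
  moreover have "((\<lambda>h. lquot (\<Phi> h)) has_derivative (\<lambda>v. 0)) (at e\<^sub>0)"
  proof (rule has_derivative_transform_within_open[OF has_derivative_const])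
    show "open (U \<inter> V \<inter> cimg c\<^sub>0)" using U V cimg_open[OF smooth_manifold_G c0_atlas] by blast
    show "e\<^sub>0 \<in> U \<inter> V \<inter> cimg c\<^sub>0" using U V e0_cimg by blast
    fix h assume h: "h \<in> U \<inter> V \<inter> cimg c\<^sub>0"
    let ?h = "chart_inv c\<^sub>0 h" and ?x = "chart_inv c\<^sub>0 x" and ?y = "chart_inv c\<^sub>0 y"
    have carr: "?h \<in> carrier G" "?x \<in> carrier G" "?y \<in> carrier G"
      using h x y by (auto intro!: chart_inv_carrier[OF c0_atlas])
    have e: "chart_inv c\<^sub>0 (mul (h, x)) = ?h \<otimes> ?x" "chart_inv c\<^sub>0 (mul (h, y)) = ?h \<otimes> ?y"
      using U(3)[of h] V(3)[of h] h chart_inv_chart[OF smooth_manifold_G c0_atlas] by (auto simp: mul_def)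
    have "inv (?h \<otimes> ?x) \<otimes> (?h \<otimes> ?y) = inv ?x \<otimes> (inv ?h \<otimes> (?h \<otimes> ?y))"
      using carr by (simp add: inv_mult_group m_assoc)
    also have "\<dots> = inv ?x \<otimes> ?y" using carr by (simp add: m_assoc[symmetric])
    finally show "snd c\<^sub>0 (inv ?x \<otimes> ?y) = lquot (\<Phi> h)"
      by (simp add: lquot_def \<Phi>_def e)
  qed
  ultimately have "(\<lambda>v. D lquot (x, y) (D mul (e\<^sub>0, x) (v, 0), D mul (e\<^sub>0, y) (v, 0))) = (\<lambda>v. 0)"
    by (rule has_derivative_unique)
  then show ?thesis unfolding rfield_def by (rule fun_cong)
qed

text \<open>The coordinates of the left quotient have derivative zero on a convex set. The quotient
  stays in the domain of \<open>c\<^sub>0\<close>, so constant coordinates mean a constant group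
  element.\<close>

lemma rfield_solutions_quotient:
  assumes I: "convex I" "open I" "s \<in> I" "t \<in> I"
    and x: "\<And>t. t \<in> I \<Longrightarrow> (x has_vector_derivative rfield \<xi> (x t)) (at t)" "\<And>t. t \<in> I \<Longrightarrow> x t \<in> cimg c\<^sub>0"
    and y: "\<And>t. t \<in> I \<Longrightarrow> (y has_vector_derivative rfield \<xi> (y t)) (at t)" "\<And>t. t \<in> I \<Longrightarrow> y t \<in> cimg c\<^sub>0"
    and xy: "\<And>t. t \<in> I \<Longrightarrow> inv (chart_inv c\<^sub>0 (x t)) \<otimes> chart_inv c\<^sub>0 (y t) \<in> fst c\<^sub>0"
  shows "inv (chart_inv c\<^sub>0 (x s)) \<otimes> chart_inv c\<^sub>0 (y s) = inv (chart_inv c\<^sub>0 (x t)) \<otimes> chart_inv c\<^sub>0 (y t)"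
proof -
  have "((\<lambda>t. lquot (x t, y t)) has_derivative (\<lambda>h. 0)) (at t within I)" if t: "t \<in> I" for t
  proof -
    note vs = vsmooth_lquot[OF x(2)[OF t] y(2)[OF t] xy[OF t]]
    have "((\<lambda>t. (x t, y t)) has_derivative (\<lambda>h. (h *\<^sub>R rfield \<xi> (x t), h *\<^sub>R rfield \<xi> (y t)))) (at t)"
      using x(1)[OF t] y(1)[OF t] by (intro has_derivative_Pair) (auto simp: has_vector_derivative_def)
    from has_derivative_compose[OF this vsmooth_has_derivative[OF vs]]
    have "((\<lambda>t. lquot (x t, y t)) has_derivative (\<lambda>h. D lquot (x t, y t) (h *\<^sub>R (rfield \<xi> (x t), rfield \<xi> (y t))))) (at t)"
      by simp
    then show ?thesis
      by (simp only: linear_scale[OF vsmooth_linear_D[OF vs]] lquot_rfield[OF x(2)[OF t] y(2)[OF t] xy[OF t]]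
          scaleR_zero_right has_derivative_at_withinI)
  qed
  from has_derivative_zero_constant[OF I(1) this]
  obtain k where k: "\<And>t. t \<in> I \<Longrightarrow> lquot (x t, y t) = k" by blast
  have q: "chart_inv c\<^sub>0 (lquot (x t, y t)) = inv (chart_inv c\<^sub>0 (x t)) \<otimes> chart_inv c\<^sub>0 (y t)" if "t \<in> I" for t
    using chart_inv_chart[OF smooth_manifold_G c0_atlas xy[OF that]] by (simp add: lquot_def)
  show ?thesis unfolding q[OF I(3), symmetric] q[OF I(4), symmetric] k[OF I(3)] k[OF I(4)] ..
qed

section \<open>One-parameter subgroups: characterization, uniqueness and existence\<close>

lemma one_param_subgroupI:
  assumes sm: "\<And>t. gsmooth \<gamma> t" and hom: "\<And>s t. \<gamma> (s + t) = \<gamma> s \<otimes> \<gamma> t" and one: "\<gamma> 0 = \<one>"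
    and d: "((\<lambda>t. snd c\<^sub>0 (\<gamma> t)) has_vector_derivative \<xi>) (at 0)"
  shows "one_param_subgroup G c\<^sub>0 \<gamma> \<xi>"
  unfolding one_param_subgroup_def
proof (intro conjI allI hom)
  show "smooth_map vec_mfd (mfd G) \<gamma>"
    using sm by (simp add: smooth_map_iff_smooth_at[OF vec_mfd_smooth_manifold[OF findim_real] smooth_manifold_G])
  show "velocity (mfd G) \<gamma> 0 = lie_tvec G c\<^sub>0 \<xi>"
    using velocity_eq[OF smooth_manifold_G sm, of c\<^sub>0 0] c0 vector_derivative_at[OF d]
    by (simp add: one lie_tvec_def comp_def)
qed

lemma one_param_subgroupD:
  assumes \<gamma>: "one_param_subgroup G c\<^sub>0 \<gamma> \<xi>"
  shows "\<gamma> (s + t) = \<gamma> s \<otimes> \<gamma> t" "gsmooth \<gamma> t" "\<gamma> t \<in> carrier G" "\<gamma> 0 = \<one>"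
    "((\<lambda>t. snd c\<^sub>0 (\<gamma> t)) has_vector_derivative \<xi>) (at 0)"
proof -
  note V = vec_mfd_smooth_manifold[OF findim_real]
  show hom: "\<gamma> (s + t) = \<gamma> s \<otimes> \<gamma> t" for s t using \<gamma> by (simp add: one_param_subgroup_def)
  show sm: "gsmooth \<gamma> t" for t
    using \<gamma> by (simp add: one_param_subgroup_def smooth_map_iff_smooth_at[OF V smooth_manifold_G])
  show carr: "\<gamma> t \<in> carrier G" for t using smooth_at_charts(2)[OF V smooth_manifold_G sm] by (simp add: points_G)
  have "\<gamma> 0 \<otimes> \<gamma> 0 = \<gamma> 0" using hom[of 0 0] by simp
  then show one: "\<gamma> 0 = \<one>" using carr[of 0] by (metis l_cancel_one)
  have "vsmooth (\<lambda>t. snd c\<^sub>0 (\<gamma> t)) 0"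
    by (rule vsmooth_chart[OF findim_real sm c0_atlas]) (simp add: one one_c0)
  then have "(\<lambda>t. snd c\<^sub>0 (\<gamma> t)) differentiable (at 0)"
    using vsmooth_has_derivative differentiableI by blast
  note hvd = vector_derivative_eq_D[OF this]
  have "velocity (mfd G) \<gamma> 0 = lie_tvec G c\<^sub>0 \<xi>" using \<gamma> by (simp add: one_param_subgroup_def)
  then have "tvec_of (mfd G) c\<^sub>0 \<one> (vector_derivative (snd c\<^sub>0 \<circ> \<gamma>) (at 0)) = tvec_of (mfd G) c\<^sub>0 \<one> \<xi>"
    using velocity_eq[OF smooth_manifold_G sm, of c\<^sub>0 0] c0 by (simp add: one lie_tvec_def)
  then have "vector_derivative (snd c\<^sub>0 \<circ> \<gamma>) (at 0) = \<xi>"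
    using tvec_of_apply[OF smooth_manifold_G c0] by metis
  then show "((\<lambda>t. snd c\<^sub>0 (\<gamma> t)) has_vector_derivative \<xi>) (at 0)"
    using hvd vector_derivative_at[OF hvd] by (simp add: comp_def)
qed

lemma has_derivative_shift:
  assumes "(f has_vector_derivative f') (at (t + s))"
  shows "((\<lambda>t::real. f (t + s)) has_vector_derivative f') (at t)"
proof -
  have "((\<lambda>t. t + s) has_derivative (\<lambda>h. h)) (at t)" by (auto intro!: derivative_eq_intros)
  from has_derivative_compose[OF this, of f] assms show ?thesis by (simp add: has_vector_derivative_def)
qed

text \<open>Near time \<open>t\<close> the curve is
  \<open>\<gamma> (s - t) \<otimes> \<gamma> t\<close>: a left factor that passes through the
  identity with velocity \<open>\<xi>\<close>, times a fixed element. Differentiating at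
  \<open>s = t\<close> gives the right-invariant field.\<close>

lemma one_param_subgroup_local_ode:
  assumes \<gamma>: "one_param_subgroup G c\<^sub>0 \<gamma> \<xi>"
  obtains \<delta> where "\<delta> > 0" "\<And>t. \<bar>t\<bar> < \<delta> \<Longrightarrow> \<gamma> t \<in> fst c\<^sub>0"
    "\<And>t. \<bar>t\<bar> < \<delta> \<Longrightarrow> ((\<lambda>t. snd c\<^sub>0 (\<gamma> t)) has_vector_derivative rfield \<xi> (snd c\<^sub>0 (\<gamma> t))) (at t)"
proof -
  note P = one_param_subgroupD[OF \<gamma>]
  have "\<gamma> 0 \<in> fst c\<^sub>0" by (simp add: P(4) one_c0)
  then obtain U where U: "open U" "0 \<in> U" "\<And>t. t \<in> U \<Longrightarrow> \<gamma> t \<in> fst c\<^sub>0"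
    using gsmooth_open_preimage[OF P(2) c0_atlas] by metis
  obtain \<delta> where \<delta>: "\<delta> > 0" "ball 0 \<delta> \<subseteq> U" using U(1,2) open_contains_ball by blast
  have inU: "t \<in> U" if "\<bar>t\<bar> < \<delta>" for t using \<delta>(2) that by (auto simp: subset_iff)
  show thesis
  proof (rule that[OF \<delta>(1)])
    show "\<gamma> t \<in> fst c\<^sub>0" if "\<bar>t\<bar> < \<delta>" for t using U(3)[OF inU[OF that]] .
    fix t assume t: "\<bar>t\<bar> < \<delta>"
    let ?x = "\<lambda>t. snd c\<^sub>0 (\<gamma> t)"
    have xt: "?x t \<in> cimg c\<^sub>0" using U(3)[OF inU[OF t]] by simp
    have "((\<lambda>s. ?x (s + - t)) has_vector_derivative \<xi>) (at t)"
      by (rule has_derivative_shift) (simp add: P(5))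
    then have "((\<lambda>s. ?x (s - t)) has_derivative (\<lambda>h. h *\<^sub>R \<xi>)) (at t)" by (simp add: has_vector_derivative_def)
    moreover have "?x (t - t) = e\<^sub>0" by (simp add: P(4))
    ultimately have "((\<lambda>s. mul (?x (s - t), ?x t)) has_derivative (\<lambda>h. D mul (e\<^sub>0, ?x t) (h *\<^sub>R \<xi>, 0))) (at t)"
      using has_derivative_compose[of "\<lambda>s. ?x (s - t)" "\<lambda>h. h *\<^sub>R \<xi>" t UNIV "\<lambda>h. mul (h, ?x t)"] has_derivative_mul_left[OF xt]
      by simp
    moreover have "D mul (e\<^sub>0, ?x t) (h *\<^sub>R \<xi>, 0) = h *\<^sub>R rfield \<xi> (?x t)" for h
      using linear_scale[OF vsmooth_linear_D[OF vsmooth_mul_e0[OF xt]], of h "(\<xi>, 0)"] by (simp add: rfield_def)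
    ultimately have d: "((\<lambda>s. mul (?x (s - t), ?x t)) has_vector_derivative rfield \<xi> (?x t)) (at t)"
      by (simp add: has_vector_derivative_def)
    have oV: "open ((\<lambda>s. s - t) -` U)" using U(1) by (intro open_vimage continuous_intros)
    show "(?x has_vector_derivative rfield \<xi> (?x t)) (at t)"
    proof (rule has_vector_derivative_transform_within_open[OF d oV])
      show "t \<in> (\<lambda>s. s - t) -` U" using U(2) by simp
      fix s assume "s \<in> (\<lambda>s. s - t) -` U"
      then have s: "\<gamma> (s - t) \<in> fst c\<^sub>0" using U(3) by simp
      show "mul (?x (s - t), ?x t) = ?x s"
        using chart_inv_chart[OF smooth_manifold_G c0_atlas s]
          chart_inv_chart[OF smooth_manifold_G c0_atlas U(3)[OF inU[OF t]]] P(1)[of "s - t" t]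
        by (simp add: mul_def)
    qed
  qed
qed

lemma one_param_subgroup_pow:
  assumes \<gamma>: "one_param_subgroup G c\<^sub>0 \<gamma> \<xi>"
  shows "\<gamma> (real n * s) = \<gamma> s [^] n"
proof (induction n)
  case (Suc n)
  have "\<gamma> (real (Suc n) * s) = \<gamma> (real n * s) \<otimes> \<gamma> s"
    using one_param_subgroupD(1)[OF \<gamma>, of "real n * s" s] by (simp add: algebra_simps)
  then show ?case using Suc by simp
qed (simp add: one_param_subgroupD(4)[OF \<gamma>])

text \<open>Any time becomes small after division by some \<open>n\<close>, so the
  \<open>n\<close>-th power carries local statements to all times.\<close>

lemma ex_small_fraction: "\<delta> > 0 \<Longrightarrow> \<exists>n>0. \<bar>t / real n\<bar> < (\<delta>::real)"
proof -
  assume \<delta>: "\<delta> > 0"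
  obtain n where n: "\<bar>t\<bar> / \<delta> < real n" using reals_Archimedean2 by blast
  have "0 \<le> \<bar>t\<bar> / \<delta>" using \<delta> by simp
  then have "n > 0" using n by (cases n) auto
  then show ?thesis using n \<delta> by (intro exI[of _ n]) (auto simp: field_simps)
qed

text \<open>For small times the left quotient of the two curves is constant and equals its value at
  0, the identity. Powers extend the equality to all times.\<close>

lemma one_param_subgroup_unique:
  assumes \<gamma>: "one_param_subgroup G c\<^sub>0 \<gamma> \<xi>" and \<gamma>': "one_param_subgroup G c\<^sub>0 \<gamma>' \<xi>"
  shows "\<gamma> = \<gamma>'"
proof -
  note P = one_param_subgroupD[OF \<gamma>] and P' = one_param_subgroupD[OF \<gamma>']
  note V = vec_mfd_smooth_manifold[OF findim_real]
  obtain d where d: "d > 0" "\<And>t. \<bar>t\<bar> < d \<Longrightarrow> \<gamma> t \<in> fst c\<^sub>0"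
    "\<And>t. \<bar>t\<bar> < d \<Longrightarrow> ((\<lambda>t. snd c\<^sub>0 (\<gamma> t)) has_vector_derivative rfield \<xi> (snd c\<^sub>0 (\<gamma> t))) (at t)"
    using one_param_subgroup_local_ode[OF \<gamma>] by metis
  obtain d' where d': "d' > 0" "\<And>t. \<bar>t\<bar> < d' \<Longrightarrow> \<gamma>' t \<in> fst c\<^sub>0"
    "\<And>t. \<bar>t\<bar> < d' \<Longrightarrow> ((\<lambda>t. snd c\<^sub>0 (\<gamma>' t)) has_vector_derivative rfield \<xi> (snd c\<^sub>0 (\<gamma>' t))) (at t)"
    using one_param_subgroup_local_ode[OF \<gamma>'] by metis
  have sm: "gsmooth (\<lambda>t. inv (\<gamma> t) \<otimes> \<gamma>' t) 0" by (intro smooth_at_mult[OF V] smooth_at_inv[OF V] P(2) P'(2))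
  have one: "inv (\<gamma> 0) \<otimes> \<gamma>' 0 \<in> fst c\<^sub>0" by (simp add: P(4) P'(4) one_c0)
  obtain U where U: "open U" "0 \<in> U" "\<And>t. t \<in> U \<Longrightarrow> inv (\<gamma> t) \<otimes> \<gamma>' t \<in> fst c\<^sub>0"
    using gsmooth_open_preimage[OF sm c0_atlas one] by metis
  obtain r where r: "r > 0" "ball 0 r \<subseteq> U" using U(1,2) open_contains_ball by blast
  define \<delta> where "\<delta> = min r (min d d')"
  have \<delta>: "\<delta> > 0" using r d d' by (simp add: \<delta>_def)
  let ?I = "{- \<delta> <..< \<delta>}"
  have I: "\<bar>t\<bar> < d" "\<bar>t\<bar> < d'" "t \<in> U" if "t \<in> ?I" for t
    using that r(2) by (auto simp: \<delta>_def subset_iff)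
  have ci: "chart_inv c\<^sub>0 (snd c\<^sub>0 (\<gamma> t)) = \<gamma> t" "chart_inv c\<^sub>0 (snd c\<^sub>0 (\<gamma>' t)) = \<gamma>' t" if "t \<in> ?I" for t
    using chart_inv_chart[OF smooth_manifold_G c0_atlas] d(2)[OF I(1)[OF that]] d'(2)[OF I(2)[OF that]] by auto
  have small: "\<gamma> t = \<gamma>' t" if t: "\<bar>t\<bar> < \<delta>" for t
  proof -
    have tI: "t \<in> ?I" "0 \<in> ?I" using t \<delta> by auto
    have "inv (chart_inv c\<^sub>0 (snd c\<^sub>0 (\<gamma> t))) \<otimes> chart_inv c\<^sub>0 (snd c\<^sub>0 (\<gamma>' t))
       = inv (chart_inv c\<^sub>0 (snd c\<^sub>0 (\<gamma> 0))) \<otimes> chart_inv c\<^sub>0 (snd c\<^sub>0 (\<gamma>' 0))"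
    proof (rule rfield_solutions_quotient[where I = ?I and \<xi> = \<xi> and x = "\<lambda>t. snd c\<^sub>0 (\<gamma> t)" and y = "\<lambda>t. snd c\<^sub>0 (\<gamma>' t)"])
      fix t assume t: "t \<in> ?I"
      show "((\<lambda>t. snd c\<^sub>0 (\<gamma> t)) has_vector_derivative rfield \<xi> (snd c\<^sub>0 (\<gamma> t))) (at t)" by (rule d(3)[OF I(1)[OF t]])
      show "((\<lambda>t. snd c\<^sub>0 (\<gamma>' t)) has_vector_derivative rfield \<xi> (snd c\<^sub>0 (\<gamma>' t))) (at t)" by (rule d'(3)[OF I(2)[OF t]])
      show "snd c\<^sub>0 (\<gamma> t) \<in> cimg c\<^sub>0" "snd c\<^sub>0 (\<gamma>' t) \<in> cimg c\<^sub>0" using d(2)[OF I(1)[OF t]] d'(2)[OF I(2)[OF t]] by auto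
      show "inv (chart_inv c\<^sub>0 (snd c\<^sub>0 (\<gamma> t))) \<otimes> chart_inv c\<^sub>0 (snd c\<^sub>0 (\<gamma>' t)) \<in> fst c\<^sub>0"
        unfolding ci[OF t] by (rule U(3)[OF I(3)[OF t]])
    qed (use tI in auto)
    then have "inv (\<gamma> t) \<otimes> \<gamma>' t = \<one>" unfolding ci[OF tI(1)] ci[OF tI(2)] by (simp add: P(4) P'(4))
    then show ?thesis using P(3) P'(3) by (metis inv_closed inv_equality inv_inv)
  qed
  show ?thesis
  proof
    fix t
    obtain n where n: "n > 0" "\<bar>t / real n\<bar> < \<delta>" using ex_small_fraction[OF \<delta>] by metis
    have "\<gamma> (real n * (t / real n)) = \<gamma>' (real n * (t / real n))"
      unfolding one_param_subgroup_pow[OF \<gamma>] one_param_subgroup_pow[OF \<gamma>'] small[OF n(2)] ..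
    then show "\<gamma> t = \<gamma>' t" using n by simp
  qed
qed

lemma lquot_nbhd:
  obtains U where "open U" "e\<^sub>0 \<in> U" "U \<subseteq> cimg c\<^sub>0"
    "\<And>p q. p \<in> U \<Longrightarrow> q \<in> U \<Longrightarrow> inv (chart_inv c\<^sub>0 p) \<otimes> chart_inv c\<^sub>0 q \<in> fst c\<^sub>0"
proof -
  let ?e = "\<lambda>z. inv (chart_inv c\<^sub>0 (fst z)) \<otimes> chart_inv c\<^sub>0 (snd z)"
  have "?e (e\<^sub>0, e\<^sub>0) \<in> fst c\<^sub>0" using one_c0 by simp
  then obtain V where V: "open V" "(e\<^sub>0, e\<^sub>0) \<in> V" "\<And>z. z \<in> V \<Longrightarrow> ?e z \<in> fst c\<^sub>0"
    using gsmooth_open_preimage[OF gsmooth_lquot[OF e0_cimg e0_cimg] c0_atlas] by metis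
  obtain A B where AB: "open A" "open B" "(e\<^sub>0, e\<^sub>0) \<in> A \<times> B" "A \<times> B \<subseteq> V" using open_prod_elim[OF V(1,2)] by metis
  show thesis
  proof (rule that[of "A \<inter> B \<inter> cimg c\<^sub>0"])
    show "open (A \<inter> B \<inter> cimg c\<^sub>0)" using AB cimg_open[OF smooth_manifold_G c0_atlas] by blast
    fix p q assume "p \<in> A \<inter> B \<inter> cimg c\<^sub>0" "q \<in> A \<inter> B \<inter> cimg c\<^sub>0"
    then have "(p, q) \<in> V" using AB(4) by blast
    from V(3)[OF this] show "inv (chart_inv c\<^sub>0 p) \<otimes> chart_inv c\<^sub>0 q \<in> fst c\<^sub>0" by simp
  qed (use AB e0_cimg in auto)
qed

text \<open>For fixed \<open>s\<close> the curves \<open>x t\<close> and \<open>x (t + s)\<close>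
  solve the same equation, so their left quotient keeps its value at \<open>t = 0\<close>; this is a
  local homomorphism law. The global curve is the \<open>n\<close>-th power of the local one at time
  \<open>t / n\<close>.\<close>

lemma one_param_subgroup_exists: "\<exists>\<gamma>. one_param_subgroup G c\<^sub>0 \<gamma> \<xi>"
proof -
  obtain d x where dx: "d > 0" "x 0 = e\<^sub>0" "\<And>t. \<bar>t\<bar> < d \<Longrightarrow> (x has_vector_derivative rfield \<xi> (x t)) (at t)"
    using vsmooth_ode_solution[OF findim_e vsmooth_rfield[OF e0_cimg]] by metis
  obtain U where U: "open U" "e\<^sub>0 \<in> U" "U \<subseteq> cimg c\<^sub>0"
    "\<And>p q. p \<in> U \<Longrightarrow> q \<in> U \<Longrightarrow> inv (chart_inv c\<^sub>0 p) \<otimes> chart_inv c\<^sub>0 q \<in> fst c\<^sub>0"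
    using lquot_nbhd by metis
  have "isCont x 0" using has_vector_derivative_continuous[OF dx(3)[of 0]] dx(1) by simp
  then have "(x \<longlongrightarrow> x 0) (nhds 0)" by (simp add: tendsto_at_iff_tendsto_nhds[symmetric] isCont_def)
  from topological_tendstoD[OF this U(1)] have "eventually (\<lambda>t. x t \<in> U) (nhds 0)" using U(2) dx(2) by simp
  then obtain r where r: "r > 0" "\<And>t. \<bar>t\<bar> < r \<Longrightarrow> x t \<in> U"
    by (auto simp: eventually_nhds_metric dist_real_def)
  define \<delta> where "\<delta> = min d r"
  have \<delta>: "\<delta> > 0" using dx r by (simp add: \<delta>_def)
  have xU: "x t \<in> U" and xd: "(x has_vector_derivative rfield \<xi> (x t)) (at t)" if "\<bar>t\<bar> < \<delta>" for t
    using that r(2) dx(3) by (auto simp: \<delta>_def)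
  have xC: "x t \<in> cimg c\<^sub>0" if "\<bar>t\<bar> < \<delta>" for t using xU[OF that] U(3) by blast
  define g where "g = (\<lambda>t. chart_inv c\<^sub>0 (x t))"
  have gc: "g t \<in> carrier G" if "\<bar>t\<bar> < \<delta>" for t unfolding g_def by (rule chart_inv_carrier[OF c0_atlas xC[OF that]])
  have g0: "g 0 = \<one>" by (simp add: g_def dx(2))
  have g_hom: "g (t + s) = g t \<otimes> g s" if s: "\<bar>s\<bar> < \<delta>" and t: "\<bar>t\<bar> < \<delta>" and ts: "\<bar>t + s\<bar> < \<delta>" for s t
  proof -
    \<comment> \<open>Both \<open>t\<close> and \<open>t + s\<close> must stay in the domain of the
      local solution. The intersection of two intervals is convex and contains 0 and the given
      \<open>t\<close>.\<close>
    let ?I = "{-\<delta><..<\<delta>} \<inter> {-\<delta> - s<..<\<delta> - s}"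
    have I: "\<bar>t\<bar> < \<delta>" "\<bar>t + s\<bar> < \<delta>" if "t \<in> ?I" for t using that by auto
    have "inv (chart_inv c\<^sub>0 (x t)) \<otimes> chart_inv c\<^sub>0 (x (t + s)) = inv (chart_inv c\<^sub>0 (x 0)) \<otimes> chart_inv c\<^sub>0 (x (0 + s))"
    proof (rule rfield_solutions_quotient[where I = ?I and \<xi> = \<xi> and x = x and y = "\<lambda>t. x (t + s)"])
      show "convex ?I" by (intro convex_Int convex_real_interval)
      show "t \<in> ?I" "0 \<in> ?I" using s t ts \<delta> by auto
      fix t assume t: "t \<in> ?I"
      show "(x has_vector_derivative rfield \<xi> (x t)) (at t)" by (rule xd[OF I(1)[OF t]])
      show "((\<lambda>t. x (t + s)) has_vector_derivative rfield \<xi> (x (t + s))) (at t)"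
        by (rule has_derivative_shift[OF xd[OF I(2)[OF t]]])
      show "x t \<in> cimg c\<^sub>0" by (rule xC[OF I(1)[OF t]])
      show "x (t + s) \<in> cimg c\<^sub>0" by (rule xC[OF I(2)[OF t]])
      show "inv (chart_inv c\<^sub>0 (x t)) \<otimes> chart_inv c\<^sub>0 (x (t + s)) \<in> fst c\<^sub>0"
        by (rule U(4)[OF xU[OF I(1)[OF t]] xU[OF I(2)[OF t]]])
    qed auto
    then have "inv (g t) \<otimes> g (t + s) = g s"
      using gc[OF s] unfolding g_def by (simp add: dx(2))
    then show ?thesis using gc[OF t] gc[OF ts] gc[OF s] by (metis inv_solve_left)
  qed
  have g_pow: "g (real n * s) = g s [^] n" if "\<bar>real n * s\<bar> < \<delta>" for n s
    using that
  proof (induction n)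
    case 0 then show ?case by (simp add: g0)
  next
    case (Suc n)
    have le: "\<bar>real n * s\<bar> \<le> \<bar>real (Suc n) * s\<bar>" "\<bar>s\<bar> \<le> \<bar>real (Suc n) * s\<bar>"
      by (auto simp: abs_mult mult_right_mono) (simp add: algebra_simps)
    have "g (real (Suc n) * s) = g (real n * s + s)" by (simp add: algebra_simps)
    also have "\<dots> = g (real n * s) \<otimes> g s"
      using Suc.prems le by (intro g_hom) (auto simp: algebra_simps)
    finally show ?case using Suc.IH Suc.prems le by simp
  qed
  have indep: "g (t / real n) [^] n = g (t / real k) [^] k"
    if n: "n > 0" "\<bar>t / real n\<bar> < \<delta>" and k: "k > 0" "\<bar>t / real k\<bar> < \<delta>" for t n k
  proof -
    \<comment> \<open>The step \<open>t / (n * k)\<close> refines both subdivisions, so both powers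
      equal \<open>g s\<close> raised to \<open>n * k\<close>.\<close>
    define s where "s = t / (real n * real k)"
    have e: "t / real n = real k * s" "t / real k = real n * s" using n k by (auto simp: s_def)
    have "1 \<le> real k" using k by simp
    then have "\<bar>s\<bar> \<le> \<bar>real k * s\<bar>" by (simp add: abs_mult mult_le_cancel_right1)
    then have gs: "g s \<in> carrier G" using n e by (intro gc) simp
    have "g (t / real n) = g s [^] k" "g (t / real k) = g s [^] n"
      using g_pow[of k s] g_pow[of n s] n k e by auto
    then show ?thesis using gs by (simp add: nat_pow_pow mult.commute)
  qed
  \<comment> \<open>Any admissible \<open>n\<close> gives the same value by \<open>indep\<close>, so
    the choice is harmless.\<close>
  define \<gamma> where "\<gamma> = (\<lambda>t. let n = (SOME n. n > 0 \<and> \<bar>t / real n\<bar> < \<delta>) in g (t / real n) [^] n)"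
  have \<gamma>: "\<gamma> t = g (t / real n) [^] n" if "n > 0" "\<bar>t / real n\<bar> < \<delta>" for t n
  proof -
    define k where "k = (SOME n. n > 0 \<and> \<bar>t / real n\<bar> < \<delta>)"
    have k: "k > 0 \<and> \<bar>t / real k\<bar> < \<delta>" unfolding k_def by (rule someI) (use that in simp)
    have "\<gamma> t = g (t / real k) [^] k" unfolding \<gamma>_def Let_def k_def ..
    then show ?thesis using indep[OF that conjunct1[OF k] conjunct2[OF k]] by simp
  qed
  have \<gamma>_small: "\<gamma> t = g t" if "\<bar>t\<bar> < \<delta>" for t using \<gamma>[of 1 t] that gc[OF that] by simp
  have hom: "\<gamma> (s + t) = \<gamma> s \<otimes> \<gamma> t" for s t
  proof -
    obtain n where n: "n > 0" "\<bar>(\<bar>s\<bar> + \<bar>t\<bar>) / real n\<bar> < \<delta>" using ex_small_fraction[OF \<delta>] by metis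
    have "\<bar>s\<bar> / real n + \<bar>t\<bar> / real n < \<delta>" using n by (simp add: add_divide_distrib)
    moreover have "0 \<le> \<bar>s\<bar> / real n" "0 \<le> \<bar>t\<bar> / real n" by auto
    moreover have "\<bar>s / real n + t / real n\<bar> \<le> \<bar>s\<bar> / real n + \<bar>t\<bar> / real n"
      using abs_triangle_ineq[of "s / real n" "t / real n"] by simp
    moreover have "\<bar>s / real n\<bar> = \<bar>s\<bar> / real n" "\<bar>t / real n\<bar> = \<bar>t\<bar> / real n" by simp_all
    ultimately have b: "\<bar>s / real n\<bar> < \<delta>" "\<bar>t / real n\<bar> < \<delta>" "\<bar>s / real n + t / real n\<bar> < \<delta>" by linarith+
    have h: "g (s / real n + t / real n) = g (s / real n) \<otimes> g (t / real n)" by (rule g_hom[OF b(2,1,3)])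
    \<comment> \<open>The local law in both orders shows that the two factors commute, which the
      power of a product requires.\<close>
    have "g (t / real n + s / real n) = g (t / real n) \<otimes> g (s / real n)"
      by (rule g_hom[OF b(1,2)]) (use b(3) in \<open>simp add: add.commute\<close>)
    then have comm: "g (s / real n) \<otimes> g (t / real n) = g (t / real n) \<otimes> g (s / real n)"
      using h by (simp add: add.commute)
    have "\<gamma> (s + t) = g (s / real n + t / real n) [^] n"
      using \<gamma>[of n "s + t"] n b(3) by (simp add: add_divide_distrib)
    also have "\<dots> = g (s / real n) [^] n \<otimes> g (t / real n) [^] n"
      unfolding h by (rule pow_mult_distrib[OF comm gc[OF b(1)] gc[OF b(2)]])
    finally show ?thesis using \<gamma>[OF n(1) b(1)] \<gamma>[OF n(1) b(2)] by simp
  qed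
  have \<gamma>c: "\<gamma> t \<in> carrier G" for t
  proof -
    obtain n where "n > 0" "\<bar>t / real n\<bar> < \<delta>" using ex_small_fraction[OF \<delta>] by metis
    then show ?thesis using \<gamma>[of n t] gc by simp
  qed
  note V = vec_mfd_smooth_manifold[OF findim_real]
  have "smooth_on {-\<delta><..<\<delta>} x"
    by (rule ode_solution_smooth[OF findim_e, of _ x "rfield \<xi>"]) (auto intro!: xd vsmooth_rfield xC)
  then have vx: "vsmooth x 0" using vsmoothI[of "{-\<delta><..<\<delta>}" 0] \<delta> by simp
  \<comment> \<open>Smoothness at an arbitrary time is moved to time 0: near \<open>t\<close> the
    curve is the fixed element \<open>\<gamma> t\<close> times \<open>g (s - t)\<close>.\<close>
  have sm: "gsmooth \<gamma> t" for t
  proof (rule smooth_at_cong[OF V smooth_manifold_G])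
    have vxt: "vsmooth (\<lambda>s. x (s - t)) t"
      by (rule vsmooth_compose[OF findim_real vsmooth_diff[OF vsmooth_ident vsmooth_const]]) (simp add: vx)
    have "gsmooth (\<lambda>s. chart_inv c\<^sub>0 (x (s - t))) t"
      by (rule gsmooth_chart_inv[OF findim_real vxt c0_atlas]) (use xC[of 0] \<delta> in simp)
    then have "gsmooth (\<lambda>s. g (s - t)) t" by (simp add: g_def)
    then show "gsmooth (\<lambda>s. \<gamma> t \<otimes> g (s - t)) t"
      by (intro smooth_at_mult[OF V] gsmooth_const[OF findim_real \<gamma>c])
    show "openin (mtop vec_mfd) {t - \<delta><..<t + \<delta>}" by simp
    show "t \<in> {t - \<delta><..<t + \<delta>}" using \<delta> by simp
    fix s assume "s \<in> {t - \<delta><..<t + \<delta>}"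
    then have "\<bar>s - t\<bar> < \<delta>" by auto
    from \<gamma>_small[OF this] show "\<gamma> s = \<gamma> t \<otimes> g (s - t)" using hom[of t "s - t"] by simp
  qed
  have one: "\<gamma> 0 = \<one>" using \<gamma>_small[of 0] \<delta> g0 by simp
  have "((\<lambda>t. snd c\<^sub>0 (\<gamma> t)) has_vector_derivative \<xi>) (at 0)"
  proof (rule has_vector_derivative_transform_within_open[of x])
    show "(x has_vector_derivative \<xi>) (at 0)" using xd[of 0] \<delta> by (simp add: dx(2) rfield_e0)
    show "open {-\<delta><..<\<delta>}" "0 \<in> {-\<delta><..<\<delta>}" using \<delta> by auto
    fix t assume "t \<in> {-\<delta><..<\<delta>}"
    then have t: "\<bar>t\<bar> < \<delta>" by auto
    show "x t = snd c\<^sub>0 (\<gamma> t)" unfolding \<gamma>_small[OF t] g_def by (rule chart_chart_inv[OF xC[OF t], symmetric])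
  qed
  from one_param_subgroupI[OF sm hom one this] show ?thesis by blast
qed

lemma lie_exp_eq: "one_param_subgroup G c\<^sub>0 \<gamma> \<xi> \<Longrightarrow> lie_exp G c\<^sub>0 \<xi> = \<gamma> 1"
  unfolding lie_exp_def using one_param_subgroup_unique by (metis the_equality)

text \<open>The curve \<open>t \<mapsto> \<gamma> (s * t)\<close> has initial velocity
  \<open>s \<xi>\<close>. Hence the bracket can be differentiated along the single curve
  \<open>\<gamma>\<close>.\<close>

lemma lie_exp_scale:
  assumes \<gamma>: "one_param_subgroup G c\<^sub>0 \<gamma> \<xi>"
  shows "lie_exp G c\<^sub>0 (s *\<^sub>R \<xi>) = \<gamma> s"
proof -
  note P = one_param_subgroupD[OF \<gamma>]
  note V = vec_mfd_smooth_manifold[OF findim_real]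
  have "one_param_subgroup G c\<^sub>0 (\<lambda>t. \<gamma> (s * t)) (s *\<^sub>R \<xi>)"
  proof (rule one_param_subgroupI)
    show "gsmooth (\<lambda>t. \<gamma> (s * t)) t" for t
      by (rule smooth_at_compose[OF V V smooth_manifold_G _ P(2)])
        (rule vsmooth_linear_comp[OF bounded_linear_mult_right vsmooth_ident])
    show "\<gamma> (s * (t + t')) = \<gamma> (s * t) \<otimes> \<gamma> (s * t')" for t t' by (simp add: distrib_left P(1))
    show "\<gamma> (s * 0) = \<one>" by (simp add: P(4))
    have "((\<lambda>t. s * t) has_derivative (\<lambda>h. s * h)) (at 0)" by (auto intro!: derivative_eq_intros)
    from has_derivative_compose[OF this, of "\<lambda>t. snd c\<^sub>0 (\<gamma> t)"] P(5)
    show "((\<lambda>t. snd c\<^sub>0 (\<gamma> (s * t))) has_vector_derivative s *\<^sub>R \<xi>) (at 0)"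
      by (simp add: has_vector_derivative_def mult.commute)
  qed
  from lie_exp_eq[OF this] show ?thesis by simp
qed

text \<open>Conjugation with both outer factors as independent variables; evaluated at
  \<open>(inv g, h, g)\<close> it expresses the map behind \<open>lie_Ad\<close>.\<close>

definition triple :: "'e \<times> 'e \<times> 'e \<Rightarrow> 'e" where
  "triple z = snd c\<^sub>0 (chart_inv c\<^sub>0 (fst z) \<otimes> chart_inv c\<^sub>0 (fst (snd z)) \<otimes> chart_inv c\<^sub>0 (snd (snd z)))"

lemma vsmooth_triple:
  assumes "x \<in> cimg c\<^sub>0" "y \<in> cimg c\<^sub>0" "z \<in> cimg c\<^sub>0"
    "chart_inv c\<^sub>0 x \<otimes> chart_inv c\<^sub>0 y \<otimes> chart_inv c\<^sub>0 z \<in> fst c\<^sub>0"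
  shows "vsmooth triple (x, y, z)"
proof -
  have "gsmooth (\<lambda>w. chart_inv c\<^sub>0 (fst w) \<otimes> chart_inv c\<^sub>0 (fst (snd w)) \<otimes> chart_inv c\<^sub>0 (snd (snd w))) (x, y, z)"
    using assms
    by (intro smooth_at_mult[OF vec_mfd_smooth_manifold[OF findim_e3]] gsmooth_chart_inv[OF findim_e3] c0_atlas
        vsmooth_fst vsmooth_snd vsmooth_ident) auto
  then show ?thesis unfolding triple_def[abs_def]
    by (rule vsmooth_chart[OF findim_e3 _ c0_atlas]) (simp add: assms)
qed

lemma vsmooth_triple_e0: "vsmooth triple (e\<^sub>0, e\<^sub>0, e\<^sub>0)"
  by (rule vsmooth_triple) (auto simp: e0_cimg one_c0)

lemma D2_affine:
  fixes f :: "'b::real_normed_vector \<Rightarrow> 'c::real_normed_vector" and L :: "'a::real_normed_vector \<Rightarrow> 'b"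
  assumes "findim TYPE('b)" "bounded_linear L" "vsmooth f (L x + b)"
  shows "D2 (\<lambda>x. f (L x + b)) x v w = D2 f (L x + b) (L v) (L w)"
proof -
  have d: "((\<lambda>x. L x + b) has_derivative L) (at x)" for x
    using has_derivative_add[OF bounded_linear_imp_has_derivative[OF assms(2)] has_derivative_const] by simp
  have "vsmooth (\<lambda>x. L x + b) x" by (intro vsmooth_add vsmooth_const vsmooth_linear_comp[OF assms(2)] vsmooth_ident)
  from vsmooth_D2_compose[OF assms(1) this assms(3)] show ?thesis
    using linear_0[OF vsmooth_linear_D[OF assms(3)]] by (simp add: D_eq[OF d])
qed

text \<open>Freezing one outer factor at the identity turns \<open>triple\<close> into
  \<open>mul\<close>. In the first equation the order of differentiation is then exchanged to match
  \<open>mixed\<close>, which varies the left factor first.\<close>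

lemma D2_triple:
  "D2 triple (e\<^sub>0, e\<^sub>0, e\<^sub>0) (0, \<eta>, 0) (\<xi>, 0, 0) = mixed \<xi> \<eta>"
  "D2 triple (e\<^sub>0, e\<^sub>0, e\<^sub>0) (0, \<eta>, 0) (0, 0, \<xi>) = mixed \<eta> \<xi>"
proof -
  note bl = bounded_linear_Pair bounded_linear_fst bounded_linear_snd bounded_linear_zero
  note oC = open_Times[OF cimg_open[OF smooth_manifold_G c0_atlas] cimg_open[OF smooth_manifold_G c0_atlas]]
  have e0C: "(e\<^sub>0, e\<^sub>0) \<in> cimg c\<^sub>0 \<times> cimg c\<^sub>0" using e0_cimg by simp
  let ?L = "\<lambda>z::'e \<times> 'e. (fst z, snd z, 0::'e)"
  have L: "bounded_linear ?L" by (intro bl)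
  have eq: "mul z = triple (?L z + (0, 0, e\<^sub>0))" if "z \<in> cimg c\<^sub>0 \<times> cimg c\<^sub>0" for z
    using that chart_inv_carrier[OF c0_atlas, of "fst z"] chart_inv_carrier[OF c0_atlas, of "snd z"]
    by (auto simp: mul_def triple_def)
  have v1: "vsmooth triple (?L (e\<^sub>0, e\<^sub>0) + (0, 0, e\<^sub>0))" using vsmooth_triple_e0 by simp
  have "vsmooth (\<lambda>z. triple (?L z + (0, 0, e\<^sub>0))) (e\<^sub>0, e\<^sub>0)"
    by (rule vsmooth_compose[OF findim_e3 vsmooth_add[OF vsmooth_linear_comp[OF L vsmooth_ident] vsmooth_const] v1])
  from vsmooth_D2_cong[OF this oC e0C eq] D2_affine[OF findim_e3 L v1, of "(0, \<eta>)" "(\<xi>, 0)"]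
  have "D2 mul (e\<^sub>0, e\<^sub>0) (0, \<eta>) (\<xi>, 0) = D2 triple (e\<^sub>0, e\<^sub>0, e\<^sub>0) (0, \<eta>, 0) (\<xi>, 0, 0)" by simp
  then show "D2 triple (e\<^sub>0, e\<^sub>0, e\<^sub>0) (0, \<eta>, 0) (\<xi>, 0, 0) = mixed \<xi> \<eta>"
    using vsmooth_D2_symmetric[OF findim_e vsmooth_mul_e0[OF e0_cimg], of "(0, \<eta>)" "(\<xi>, 0)"]
    by (simp add: mixed_def)
  let ?R = "\<lambda>z::'e \<times> 'e. (0::'e, fst z, snd z)"
  have R: "bounded_linear ?R" by (intro bl)
  have eq': "mul z = triple (?R z + (e\<^sub>0, 0, 0))" if "z \<in> cimg c\<^sub>0 \<times> cimg c\<^sub>0" for z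
    using that chart_inv_carrier[OF c0_atlas, of "fst z"] chart_inv_carrier[OF c0_atlas, of "snd z"]
    by (auto simp: mul_def triple_def)
  have v2: "vsmooth triple (?R (e\<^sub>0, e\<^sub>0) + (e\<^sub>0, 0, 0))" using vsmooth_triple_e0 by simp
  have "vsmooth (\<lambda>z. triple (?R z + (e\<^sub>0, 0, 0))) (e\<^sub>0, e\<^sub>0)"
    by (rule vsmooth_compose[OF findim_e3 vsmooth_add[OF vsmooth_linear_comp[OF R vsmooth_ident] vsmooth_const] v2])
  from vsmooth_D2_cong[OF this oC e0C eq'] D2_affine[OF findim_e3 R v2, of "(\<eta>, 0)" "(0, \<xi>)"]
  show "D2 triple (e\<^sub>0, e\<^sub>0, e\<^sub>0) (0, \<eta>, 0) (0, 0, \<xi>) = mixed \<eta> \<xi>" by (simp add: mixed_def)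
qed

text \<open>The coordinates \<open>y\<close> of the inverse enter as a separate argument, so the
  derivative along a one-parameter subgroup treats \<open>\<gamma> (- t)\<close> and
  \<open>\<gamma> t\<close> as two curves.\<close>

lemma lie_Ad_eq:
  assumes x: "x \<in> cimg c\<^sub>0" and y: "y \<in> cimg c\<^sub>0" and xy: "chart_inv c\<^sub>0 y = inv (chart_inv c\<^sub>0 x)"
  shows "lie_Ad G c\<^sub>0 (chart_inv c\<^sub>0 x) \<eta> = D triple (y, e\<^sub>0, x) (0, \<eta>, 0)"
proof -
  note SM = smooth_manifold_G
  let ?g = "chart_inv c\<^sub>0 x"
  have g: "?g \<in> carrier G" by (rule chart_inv_carrier[OF c0_atlas x])
  have sm: "smooth_at (mfd G) (mfd G) (\<lambda>h. inv ?g \<otimes> h \<otimes> ?g) \<one>"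
    by (intro smooth_at_mult[OF SM] smooth_at_const[OF SM SM] smooth_at_ident[OF SM]) (auto simp: points_G g)
  have one: "inv ?g \<otimes> \<one> \<otimes> ?g = \<one>" using g by simp
  have "lie_Ad G c\<^sub>0 ?g \<eta> = D (local_rep c\<^sub>0 c\<^sub>0 (\<lambda>h. inv ?g \<otimes> h \<otimes> ?g)) e\<^sub>0 (lie_tvec G c\<^sub>0 \<eta> c\<^sub>0)"
    unfolding lie_Ad_def by (rule tangent_map_apply[OF SM SM sm lie_tvec_in c0]) (simp only: one c0)
  also have "lie_tvec G c\<^sub>0 \<eta> c\<^sub>0 = \<eta>" unfolding lie_tvec_def by (rule tvec_of_apply[OF SM c0])
  also have "local_rep c\<^sub>0 c\<^sub>0 (\<lambda>h. inv ?g \<otimes> h \<otimes> ?g) = (\<lambda>h. triple (y, h, x))"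
    by (auto simp: triple_def xy)
  also have "D (\<lambda>h. triple (y, h, x)) e\<^sub>0 \<eta> = D triple (y, e\<^sub>0, x) (0, \<eta>, 0)"
  proof -
    have vs: "vsmooth triple (y, e\<^sub>0, x)" by (rule vsmooth_triple[OF y e0_cimg x]) (simp add: xy g one_c0)
    have "((\<lambda>h. (y, h, x)) has_derivative (\<lambda>v. (0, v, 0))) (at e\<^sub>0)"
      by (intro has_derivative_Pair has_derivative_ident has_derivative_const)
    from has_derivative_compose[OF this vsmooth_has_derivative[OF vs]] show ?thesis by (simp add: D_eq)
  qed
  finally show ?thesis .
qed

text \<open>Since \<open>\<gamma> (- t)\<close> is the inverse of \<open>\<gamma> t\<close>, the
  left factor of the conjugation moves with velocity \<open>- \<xi>\<close> and the right one with
  \<open>\<xi>\<close>. The two contributions are \<open>- mixed \<xi> \<eta>\<close> and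
  \<open>mixed \<eta> \<xi>\<close>.\<close>

lemma bracket_eq_mixed: "bracket G c\<^sub>0 \<xi> \<eta> = mixed \<eta> \<xi> - mixed \<xi> \<eta>"
proof -
  obtain \<gamma> where \<gamma>: "one_param_subgroup G c\<^sub>0 \<gamma> \<xi>" using one_param_subgroup_exists by blast
  note P = one_param_subgroupD[OF \<gamma>]
  obtain \<delta> where \<delta>: "\<delta> > 0" "\<And>t. \<bar>t\<bar> < \<delta> \<Longrightarrow> \<gamma> t \<in> fst c\<^sub>0"
    using one_param_subgroup_local_ode[OF \<gamma>] by metis
  let ?x = "\<lambda>t. snd c\<^sub>0 (\<gamma> t)"
  have dx: "(?x has_derivative (\<lambda>h. h *\<^sub>R \<xi>)) (at 0)" using P(5) by (simp add: has_vector_derivative_def)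
  have "((\<lambda>t::real. - t) has_derivative (\<lambda>h. - h)) (at 0)" by (auto intro!: derivative_eq_intros)
  from has_derivative_compose[OF this, of ?x "\<lambda>h. h *\<^sub>R \<xi>"] dx
  have dx': "((\<lambda>t. ?x (- t)) has_derivative (\<lambda>h. - (h *\<^sub>R \<xi>))) (at 0)" by simp
  have d\<phi>: "((\<lambda>t. (?x (- t), e\<^sub>0, ?x t)) has_derivative (\<lambda>h. (- (h *\<^sub>R \<xi>), 0, h *\<^sub>R \<xi>))) (at 0)"
    by (intro has_derivative_Pair dx dx' has_derivative_const)
  note vs = vsmooth_triple_e0
  have "((\<lambda>t. D triple (?x (- t), e\<^sub>0, ?x t) (0, \<eta>, 0)) has_derivative
      (\<lambda>h. D2 triple (e\<^sub>0, e\<^sub>0, e\<^sub>0) (0, \<eta>, 0) (- (h *\<^sub>R \<xi>), 0, h *\<^sub>R \<xi>))) (at 0)"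
    using has_derivative_compose[OF d\<phi>, of "\<lambda>z. D triple z (0, \<eta>, 0)"] vsmooth_has_derivative[OF vsmooth_D[OF vs]]
    by (simp add: P(4))
  moreover have "D2 triple (e\<^sub>0, e\<^sub>0, e\<^sub>0) (0, \<eta>, 0) (- (h *\<^sub>R \<xi>), 0, h *\<^sub>R \<xi>) = h *\<^sub>R (mixed \<eta> \<xi> - mixed \<xi> \<eta>)" for h
  proof -
    have e: "(- (h *\<^sub>R \<xi>), 0, h *\<^sub>R \<xi>) = h *\<^sub>R ((0, 0, \<xi>) - (\<xi>, 0, 0))" by simp
    show ?thesis
      unfolding e linear_scale[OF vsmooth_linear_D2_right[OF vs]] linear_diff[OF vsmooth_linear_D2_right[OF vs]] D2_triple ..
  qed
  ultimately have d: "((\<lambda>t. D triple (?x (- t), e\<^sub>0, ?x t) (0, \<eta>, 0)) has_vector_derivative (mixed \<eta> \<xi> - mixed \<xi> \<eta>)) (at 0)"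
    by (simp add: has_vector_derivative_def)
  have "((\<lambda>t. lie_Ad G c\<^sub>0 (lie_exp G c\<^sub>0 (t *\<^sub>R \<xi>)) \<eta>) has_vector_derivative (mixed \<eta> \<xi> - mixed \<xi> \<eta>)) (at 0)"
  proof (rule has_vector_derivative_transform_within_open[OF d])
    show "open {-\<delta><..<\<delta>}" "0 \<in> {-\<delta><..<\<delta>}" using \<delta> by auto
    fix t assume "t \<in> {-\<delta><..<\<delta>}"
    then have t: "\<gamma> t \<in> fst c\<^sub>0" "\<gamma> (- t) \<in> fst c\<^sub>0" using \<delta>(2)[of t] \<delta>(2)[of "- t"] by auto
    have "\<gamma> (- t) \<otimes> \<gamma> t = \<one>" using P(1)[of "- t" t] P(4) by simp
    then have "inv (\<gamma> t) = \<gamma> (- t)" using P(3) by (intro inv_equality)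
    then show "D triple (?x (- t), e\<^sub>0, ?x t) (0, \<eta>, 0) = lie_Ad G c\<^sub>0 (lie_exp G c\<^sub>0 (t *\<^sub>R \<xi>)) \<eta>"
      unfolding lie_exp_scale[OF \<gamma>]
      using lie_Ad_eq[of "?x t" "?x (- t)"] t
      by (simp add: chart_inv_chart[OF smooth_manifold_G c0_atlas])
  qed
  then show ?thesis unfolding bracket_def by (rule vector_derivative_at)
qed

abbreviation br :: "'e \<Rightarrow> 'e \<Rightarrow> 'e" where "br \<equiv> bracket G c\<^sub>0"

lemma linear_br_right: "linear (br \<xi>)" and linear_br_left: "linear (\<lambda>\<xi>. br \<xi> \<eta>)"
  unfolding bracket_eq_mixed[abs_def]
  by (intro linear_compose_sub linear_mixed_left linear_mixed_right)+

lemma bilinear_br: "bilinear br"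
  unfolding bilinear_def using linear_br_left linear_br_right by blast

lemma br_antisym: "br \<xi> \<eta> = - br \<eta> \<xi>"
  by (simp add: bracket_eq_mixed)

lemma br_self [simp]: "br \<xi> \<xi> = 0"
  by (simp add: bracket_eq_mixed)

lemma bounded_bilinear_br: "bounded_bilinear br"
  by (rule bilinear_imp_bounded_bilinear[OF findim_e findim_e bilinear_br])

lemma maurer_cartan:
  "c \<in> atlas (mfd G) \<Longrightarrow> u \<in> cimg c \<Longrightarrow>
    D (\<lambda>u. rho c u y) u x - D (\<lambda>u. rho c u x) u y = - br (rho c u x) (rho c u y)"
  by (simp add: maurer_cartan_mixed bracket_eq_mixed)

text \<open>The Jacobi identity is the exterior derivative of the Maurer-Cartan equation at the identity.\<close>

lemma br_jacobi: "br (br x y) z + br (br y z) x + br (br z x) y = 0"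
proof -
  interpret b: bounded_bilinear br by (rule bounded_bilinear_br)
  note cc = c0_atlas and oC = cimg_open[OF smooth_manifold_G c0_atlas]
  define R where "R = (\<lambda>y u. rho c\<^sub>0 u y)"
  have vR: "vsmooth (R y) u" if "u \<in> cimg c\<^sub>0" for y u unfolding R_def by (rule has_derivative_rho(1)[OF cc that])
  have R0: "R y e\<^sub>0 = y" for y by (simp add: R_def rho_e0)
  have mc: "D (R y) u x - D (R x) u y = - br (R x u) (R y u)" if "u \<in> cimg c\<^sub>0" for x y u
    using maurer_cartan[OF cc that] by (simp add: R_def)
  define A where "A = (\<lambda>x z. D (R x) e\<^sub>0 z)"
  \<comment> \<open>The Maurer-Cartan equation differentiated at the identity in direction
    \<open>z\<close>, where \<open>rho\<close> is the identity map.\<close>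
  have key: "D2 (R y) e\<^sub>0 x z - D2 (R x) e\<^sub>0 y z = - (br (A x z) y + br x (A y z))" for x y z
  proof -
    have "((\<lambda>u. D (R y) u x - D (R x) u y) has_derivative (\<lambda>z. D2 (R y) e\<^sub>0 x z - D2 (R x) e\<^sub>0 y z)) (at e\<^sub>0)"
      by (intro has_derivative_diff vsmooth_has_derivative vsmooth_D vR e0_cimg)
    moreover have "((\<lambda>u. D (R y) u x - D (R x) u y) has_derivative (\<lambda>z. - (br x (A y z) + br (A x z) y))) (at e\<^sub>0)"
    proof (rule has_derivative_transform_within_open[OF _ oC e0_cimg])
      have "((\<lambda>u. br (R x u) (R y u)) has_derivative (\<lambda>z. br (R x e\<^sub>0) (A y z) + br (A x z) (R y e\<^sub>0))) (at e\<^sub>0)"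
        unfolding A_def by (intro b.FDERIV vsmooth_has_derivative vR e0_cimg)
      then show "((\<lambda>u. - br (R x u) (R y u)) has_derivative (\<lambda>z. - (br x (A y z) + br (A x z) y))) (at e\<^sub>0)"
        unfolding R0 by (rule has_derivative_minus)
    qed (simp add: mc)
    ultimately have "(\<lambda>z. D2 (R y) e\<^sub>0 x z - D2 (R x) e\<^sub>0 y z) = (\<lambda>z. - (br x (A y z) + br (A x z) y))"
      by (rule has_derivative_unique)
    from fun_cong[OF this, of z] show ?thesis by (simp add: add.commute)
  qed
  have sym: "D2 (R x) e\<^sub>0 y z = D2 (R x) e\<^sub>0 z y" for x y z
    by (rule vsmooth_D2_symmetric[OF findim_e vR[OF e0_cimg]])
  have Adiff: "A y x - A x y = - br x y" for x y using mc[OF e0_cimg, of y x] by (simp add: A_def R0)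
  have T: "br (A x z) y + br x (A y z) = D2 (R x) e\<^sub>0 y z - D2 (R y) e\<^sub>0 x z" for x y z
    unfolding minus_diff_eq[of "D2 (R y) e\<^sub>0 x z", symmetric] key by (rule minus_minus[symmetric])
  \<comment> \<open>In the cyclic sum the second derivatives cancel by symmetry. Antisymmetry of the
    bracket then pairs the remaining terms into differences \<open>A y x - A x y\<close>, which are
    brackets by the same equation.\<close>
  have "(br (A x z) y + br x (A y z)) + (br (A y x) z + br y (A z x)) + (br (A z y) x + br z (A x y)) = 0"
    unfolding T by (simp add: sym[of x y z] sym[of y z x] sym[of z x y])
  moreover have "br x (A y z) = - br (A y z) x" "br y (A z x) = - br (A z x) y" "br z (A x y) = - br (A x y) z"
    by (rule br_antisym)+
  ultimately have "br (A x z - A z x) y + br (A y x - A x y) z + br (A z y - A y z) x = 0"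
    by (simp add: b.diff_left algebra_simps)
  then have "- (br (br x y) z + br (br y z) x + br (br z x) y) = 0"
    unfolding Adiff b.minus_left by (simp only: minus_add_distrib ac_simps)
  then show ?thesis by (simp only: neg_equal_0_iff_equal)
qed

end

section \<open>Right-trivialized two-forms\<close>

lemma vsmooth_sum: "(\<And>i. i \<in> I \<Longrightarrow> vsmooth (f i) x) \<Longrightarrow> vsmooth (\<lambda>x. \<Sum>i\<in>I. f i x) x"
  by (induction I rule: infinite_finite_induct) (auto intro: vsmooth_const vsmooth_add)

lemma vsmooth_linear: "bounded_linear L \<Longrightarrow> vsmooth L x"
  using vsmooth_linear_comp[OF _ vsmooth_ident] by blast

text \<open>Smoothness of \<open>\<beta>\<close> is known only with fixed vectors in its slots.
  Expanding both slots along a basis gives a sum of products, from which follow smoothness and the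
  product rule with all three arguments moving.\<close>

lemma parametrized_bilinear:
  fixes \<beta> :: "'w::real_normed_vector \<Rightarrow> 'y::real_normed_vector \<Rightarrow> 'y \<Rightarrow> real" and f :: "'x::real_normed_vector \<Rightarrow> 'w"
  assumes fw: "findim TYPE('w)" and fy: "findim TYPE('y)"
    and bil: "\<And>w. bilinear (\<beta> w)" and sm: "\<And>w Y Y'. vsmooth (\<lambda>w. \<beta> w Y Y') w"
    and f: "vsmooth f x" and g: "vsmooth g x" and h: "vsmooth h x"
  shows "vsmooth (\<lambda>x. \<beta> (f x) (g x) (h x)) x"
    "D (\<lambda>x. \<beta> (f x) (g x) (h x)) x v = D (\<lambda>w. \<beta> w (g x) (h x)) (f x) (D f x v)
      + \<beta> (f x) (D g x v) (h x) + \<beta> (f x) (g x) (D h x v)"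
proof -
  obtain B :: "'y set" and coord where B: "finite B" "\<And>b. bounded_linear (coord b)"
    "\<And>y. y = (\<Sum>b\<in>B. coord b y *\<^sub>R b)"
    using findim_coordinates[OF fy] by metis
  have expand: "\<beta> w Y Y' = (\<Sum>b\<in>B. \<Sum>b'\<in>B. coord b Y * coord b' Y' * \<beta> w b b')" for w Y Y'
  proof -
    have l: "linear (\<lambda>y. \<beta> w y Y')" and r: "linear (\<beta> w b)" for b using bil[of w] unfolding bilinear_def by blast+
    have 1: "\<beta> w Y Y' = (\<Sum>b\<in>B. coord b Y *\<^sub>R \<beta> w b Y')"
      by (rule linear_basis_expansion[OF l, where coord = coord]) (rule B(3))
    have 2: "\<beta> w b Y' = (\<Sum>b'\<in>B. coord b' Y' *\<^sub>R \<beta> w b b')" for b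
      by (rule linear_basis_expansion[OF r, where coord = coord]) (rule B(3))
    show ?thesis by (subst 1) (simp only: 2 real_scaleR_def sum_distrib_left mult.assoc)
  qed
  have eq: "(\<lambda>x. \<beta> (f x) (g x) (h x)) = (\<lambda>x. \<Sum>b\<in>B. \<Sum>b'\<in>B. coord b (g x) * coord b' (h x) * \<beta> (f x) b b')"
    by (rule ext) (rule expand)
  show "vsmooth (\<lambda>x. \<beta> (f x) (g x) (h x)) x"
    unfolding eq
    by (intro vsmooth_sum vsmooth_bilinear[OF bounded_bilinear_mult] vsmooth_linear_comp[OF B(2)] g h
        vsmooth_compose[OF fw f sm])
  have df: "((\<lambda>x. \<beta> (f x) b b') has_derivative (\<lambda>v. D (\<lambda>w. \<beta> w b b') (f x) (D f x v))) (at x)" for b b'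
    by (rule has_derivative_compose[OF vsmooth_has_derivative[OF f] vsmooth_has_derivative[OF sm]])
  have "((\<lambda>x. \<beta> (f x) (g x) (h x)) has_derivative (\<lambda>v. \<Sum>b\<in>B. \<Sum>b'\<in>B.
      coord b (g x) * coord b' (h x) * D (\<lambda>w. \<beta> w b b') (f x) (D f x v)
      + (coord b (g x) * coord b' (D h x v) + coord b (D g x v) * coord b' (h x)) * \<beta> (f x) b b')) (at x)"
    unfolding eq
    by (intro has_derivative_sum has_derivative_mult df bounded_linear.has_derivative[OF B(2)] vsmooth_has_derivative g h)
  from D_eq[OF this]
  have 1: "D (\<lambda>x. \<beta> (f x) (g x) (h x)) x v = (\<Sum>b\<in>B. \<Sum>b'\<in>B.
      coord b (g x) * coord b' (h x) * D (\<lambda>w. \<beta> w b b') (f x) (D f x v))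
      + (\<Sum>b\<in>B. \<Sum>b'\<in>B. coord b (g x) * coord b' (D h x v) * \<beta> (f x) b b')
      + (\<Sum>b\<in>B. \<Sum>b'\<in>B. coord b (D g x v) * coord b' (h x) * \<beta> (f x) b b')"
    by (simp add: sum.distrib distrib_right)
  have 2: "D (\<lambda>w. \<beta> w Y Y') w k = (\<Sum>b\<in>B. \<Sum>b'\<in>B. coord b Y * coord b' Y' * D (\<lambda>w. \<beta> w b b') w k)" for Y Y' w k
  proof -
    have e: "(\<lambda>w. \<beta> w Y Y') = (\<lambda>w. \<Sum>b\<in>B. \<Sum>b'\<in>B. coord b Y * coord b' Y' * \<beta> w b b')"
      by (rule ext) (rule expand)
    have "((\<lambda>w. \<beta> w Y Y') has_derivative (\<lambda>k. \<Sum>b\<in>B. \<Sum>b'\<in>B. coord b Y * coord b' Y' * D (\<lambda>w. \<beta> w b b') w k)) (at w)"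
      unfolding e by (intro has_derivative_sum has_derivative_mult_right vsmooth_has_derivative sm)
    from D_eq[OF this] show ?thesis by simp
  qed
  show "D (\<lambda>x. \<beta> (f x) (g x) (h x)) x v = D (\<lambda>w. \<beta> w (g x) (h x)) (f x) (D f x v)
      + \<beta> (f x) (D g x v) (h x) + \<beta> (f x) (g x) (D h x v)"
    by (simp only: 1 2[of "g x" "h x" "f x" "D f x v"] expand[of "f x" "D g x v" "h x"]
        expand[of "f x" "g x" "D h x v"] ac_simps)
qed

lemma tvec_of_zero: "smooth_manifold M \<Longrightarrow> c \<in> charts_at M p \<Longrightarrow> tvec_of M c p 0 = (\<lambda>_. 0)"
  by (rule ext) (simp add: tvec_of_def linear_0[OF chart_change_linear])

lemma smooth_at_vec_Pair:
  assumes L: "smooth_manifold L" and fv: "findim TYPE('v::real_normed_vector)" and fw: "findim TYPE('w::real_normed_vector)"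
    and f: "smooth_at L vec_mfd (f :: 'a \<Rightarrow> 'v) p" and g: "smooth_at L vec_mfd (g :: 'a \<Rightarrow> 'w) p"
  shows "smooth_at L vec_mfd (\<lambda>x. (f x, g x)) p"
proof -
  note V = vec_mfd_smooth_manifold[OF fv] and W = vec_mfd_smooth_manifold[OF fw]
  obtain b where b: "b \<in> charts_at L p" using ex_chart_at[OF L] smooth_at_charts(1)[OF L V f] by blast
  obtain S where S: "open S" "snd b p \<in> S" "S \<subseteq> cimg b" "smooth_on S (local_rep b vec_chart f)"
    using smooth_atE[OF L V f b] by (metis vec_mfd_simps(3) singletonI)
  obtain T where T: "open T" "snd b p \<in> T" "T \<subseteq> cimg b" "smooth_on T (local_rep b vec_chart g)"
    using smooth_atE[OF L W g b] by (metis vec_mfd_simps(3) singletonI)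
  show ?thesis
  proof (rule smooth_atI[where f="\<lambda>x. (f x, g x)" and d=vec_chart, OF b _ open_Int[OF S(1) T(1)]])
    have "smooth_on (S \<inter> T) (\<lambda>u. (local_rep b vec_chart f u, local_rep b vec_chart g u))"
      by (intro smooth_on_Pair smooth_on_subset[OF S(4)] smooth_on_subset[OF T(4)] open_Int S(1) T(1)) auto
    then show "smooth_on (S \<inter> T) (local_rep b vec_chart (\<lambda>x. (f x, g x)))" by (simp add: comp_def)
  qed (use S T in auto)
qed

text \<open>An open set of \<open>X\<close> is the trace of its preimage under the retraction, so
  the inclusion is a topological embedding.\<close>

lemma topology_eq_subtopology_if_retraction:
  assumes i: "continuous_map X Y id" and r: "continuous_map Y X r" "\<And>x. x \<in> topspace X \<Longrightarrow> r x = x"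
  shows "X = subtopology Y (topspace X)"
  unfolding topology_eq
proof (intro allI iffI)
  have sub: "topspace X \<subseteq> topspace Y" using i by (auto simp: continuous_map_def)
  fix U
  show "openin (subtopology Y (topspace X)) U" if U: "openin X U"
  proof -
    have "U = {y \<in> topspace Y. r y \<in> U} \<inter> topspace X"
      using openin_subset[OF U] sub r(2) by auto
    then show ?thesis using openin_continuous_map_preimage[OF r(1) U] unfolding openin_subtopology by blast
  qed
  show "openin X U" if U: "openin (subtopology Y (topspace X)) U"
  proof -
    obtain T where T: "openin Y T" "U = T \<inter> topspace X"
      using iffD1[OF openin_subtopology U] by (elim exE conjE)
    have "{x \<in> topspace X. id x \<in> T} = T \<inter> topspace X" by auto
    then show ?thesis using openin_continuous_map_preimage[OF i T(1)] unfolding T(2) by (simp only:)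
  qed
qed

lemma dual_separates:
  assumes fd: "findim TYPE('a::real_normed_vector)" and "\<And>f :: 'a \<Rightarrow>\<^sub>L real. blinfun_apply f x = 0"
  shows "x = (0::'a)"
proof -
  obtain B :: "'a set" and coord where B: "finite B" "\<And>b. bounded_linear (coord b)"
    "\<And>x. x = (\<Sum>b\<in>B. coord b x *\<^sub>R b)"
    using findim_coordinates[OF fd] by metis
  have "coord b x = 0" for b
    using assms(2)[of "Blinfun (coord b)"] by (simp add: bounded_linear_Blinfun_apply[OF B(2)])
  then have "(\<Sum>b\<in>B. coord b x *\<^sub>R b) = 0" by simp
  then show ?thesis using B(3)[of x] by (rule trans[rotated])
qed

section \<open>Products of the group with a vector space\<close>

context lie_group_chart
begin

lemmas findim_d = findim_dual[OF findim_e]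

abbreviation GV :: "('g \<times> 'v::real_normed_vector, 'e \<times> 'v) manifold" where
  "GV \<equiv> prod_mfd (mfd G) vec_mfd"

lemma GV_manifold: "findim TYPE('v::real_normed_vector) \<Longrightarrow> smooth_manifold (GV :: ('g \<times> 'v, 'e \<times> 'v) manifold)"
  by (rule prod_smooth_manifold[OF smooth_manifold_G vec_mfd_smooth_manifold])

lemma points_GV: "points GV = carrier G \<times> UNIV"
  by (simp add: points_G)

lemma GV_chart: "c \<in> charts_at (mfd G) g \<Longrightarrow> prod_chart c vec_chart \<in> charts_at GV (g, w)"
  by (rule prod_chart_in_charts_at) simp_all

lemma ex_chart_G: "g \<in> carrier G \<Longrightarrow> \<exists>c. c \<in> charts_at (mfd G) g"
  by (rule ex_chart_at[OF smooth_manifold_G]) (simp add: points_G)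

text \<open>The tangent vector at \<open>(g, w)\<close> with right-trivialized component
  \<open>\<eta>\<close> along the group and ordinary velocity \<open>z\<close> in the fiber. Unlike
  the frames of the two symplectic manifolds, its fiber part contains no bracket terms.\<close>

definition gvec :: "'g \<Rightarrow> 'v::real_normed_vector \<Rightarrow> 'e \<Rightarrow> 'v \<Rightarrow> ('g \<times> 'v, 'e \<times> 'v) tvec" where
  "gvec g w \<eta> z = tvec_pair (mfd G) g w (right_transl G c\<^sub>0 g \<eta>) z"

text \<open>Chart coordinates \<open>(x, z)\<close> correspond to trivialized components with
  \<open>x\<close> replaced by its value under \<open>rho\<close>; all passages between the two
  descriptions go through this equation.\<close>

lemma gvec_rho:
  fixes w :: "'v::real_normed_vector"
  assumes fv: "findim TYPE('v)" and c: "c \<in> charts_at (mfd G) g"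
  shows "gvec g w (rho c (snd c g) x) z = tvec_of GV (prod_chart c vec_chart) (g, w) (x, z)"
proof -
  have r: "right_transl G c\<^sub>0 g (rho c (snd c g) x) = tvec_of (mfd G) c g x" using right_transl_iff_rho[OF c] by blast
  show ?thesis
    unfolding gvec_def r tvec_pair_eq[OF smooth_manifold_G fv tvec_of_in_tangent_space[OF smooth_manifold_G c] c]
      tvec_of_apply[OF smooth_manifold_G c] ..
qed

lemma gvec_in:
  fixes w :: "'v::real_normed_vector"
  assumes fv: "findim TYPE('v)" and g: "g \<in> carrier G"
  shows "gvec g w \<eta> z \<in> tangent_space GV (g, w)"
proof -
  obtain c where c: "c \<in> charts_at (mfd G) g" using ex_chart_G[OF g] by blast
  obtain x where x: "rho c (snd c g) x = \<eta>" using rho_surj[OF c] by metis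
  show ?thesis unfolding x[symmetric] gvec_rho[OF fv c] by (rule tvec_of_in_tangent_space[OF GV_manifold[OF fv] GV_chart[OF c]])
qed

lemma gvec_inj:
  fixes w :: "'v::real_normed_vector"
  assumes fv: "findim TYPE('v)" and g: "g \<in> carrier G" and eq: "gvec g w \<eta> z = gvec g w \<eta>' z'"
  shows "\<eta> = \<eta>' \<and> z = z'"
proof -
  obtain c where c: "c \<in> charts_at (mfd G) g" using ex_chart_G[OF g] by blast
  obtain x where x: "rho c (snd c g) x = \<eta>" using rho_surj[OF c] by metis
  obtain x' where x': "rho c (snd c g) x' = \<eta>'" using rho_surj[OF c] by metis
  have "tvec_of GV (prod_chart c vec_chart) (g, w) (x, z) = tvec_of GV (prod_chart c vec_chart) (g, w) (x', z')"
    using eq unfolding x[symmetric] x'[symmetric] gvec_rho[OF fv c] .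
  then have "(x, z) = (x', z')" using tvec_of_apply[OF GV_manifold[OF fv] GV_chart[OF c]] by metis
  then show ?thesis using x x' by simp
qed

lemma gvecE:
  fixes w :: "'v::real_normed_vector"
  assumes fv: "findim TYPE('v)" and v: "v \<in> tangent_space GV (g, w)" and g: "g \<in> carrier G"
  obtains \<eta> z where "v = gvec g w \<eta> z"
proof -
  obtain c where c: "c \<in> charts_at (mfd G) g" using ex_chart_G[OF g] by blast
  obtain xz where "v = tvec_of GV (prod_chart c vec_chart) (g, w) xz" using tangent_spaceE[OF v GV_chart[OF c]] by metis
  then have "v = gvec g w (rho c (snd c g) (fst xz)) (snd xz)" using gvec_rho[OF fv c, of w "fst xz" "snd xz"] by simp
  then show thesis by (rule that)
qed

lemma GV_local:
  fixes w :: "'v::real_normed_vector"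
  assumes fv: "findim TYPE('v)" and c: "c \<in> atlas (mfd G)" and u: "u \<in> cimg c"
  shows "chart_inv (prod_chart c vec_chart) (u, w) = (chart_inv c u, w)"
  using chart_inv_prod_chart[OF smooth_manifold_G vec_mfd_smooth_manifold[OF fv] c _ u, of vec_chart w] by simp

lemma smooth_at_GV_map:
  fixes A :: "'v::real_normed_vector \<Rightarrow> 'w::real_normed_vector"
  assumes fv: "findim TYPE('v)" and fw: "findim TYPE('w)" and g: "g \<in> carrier G" and A: "vsmooth A w"
  shows "smooth_at GV GV (\<lambda>p. (fst p, A (snd p))) (g, w)"
proof -
  note SM = smooth_manifold_G and V = vec_mfd_smooth_manifold[OF fv] and W = vec_mfd_smooth_manifold[OF fw]
  have p: "(g, w) \<in> points GV" using g by (simp add: points_G)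
  show ?thesis
    by (intro smooth_at_Pair[OF GV_manifold[OF fv] SM W] smooth_at_fst[OF SM V p]
        smooth_at_compose[OF GV_manifold[OF fv] V W smooth_at_snd[OF SM V p]]) (simp add: A)
qed

text \<open>The action, the level embedding and the shift all fix the group component and act on the
  fiber alone, so their tangent maps preserve \<open>\<eta>\<close> and only \<open>D A\<close> has
  to be computed.\<close>

lemma tangent_GV_map:
  fixes A :: "'v::real_normed_vector \<Rightarrow> 'w::real_normed_vector"
  assumes fv: "findim TYPE('v)" and fw: "findim TYPE('w)" and g: "g \<in> carrier G" and A: "vsmooth A w"
  shows "tangent_map GV GV (\<lambda>p. (fst p, A (snd p))) (g, w) (gvec g w \<eta> z) = gvec g (A w) \<eta> (D A w z)"
proof -
  let ?F = "\<lambda>p. (fst p, A (snd p))"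
  obtain c where c: "c \<in> charts_at (mfd G) g" using ex_chart_G[OF g] by blast
  then have at: "c \<in> atlas (mfd G)" "g \<in> fst c" by (auto simp: charts_at_iff)
  obtain x where x: "rho c (snd c g) x = \<eta>" using rho_surj[OF c] by metis
  let ?C = "prod_chart c vec_chart"
  have C': "prod_chart c vec_chart \<in> charts_at GV (?F (g, w))" using GV_chart[OF c] by simp
  have "((\<lambda>p. A (snd p)) has_derivative (\<lambda>y. D A w (snd y))) (at (snd c g, w))"
    by (rule has_derivative_compose[OF has_derivative_snd[OF has_derivative_ident]])
      (unfold snd_conv, rule vsmooth_has_derivative[OF A])
  from has_derivative_Pair[OF has_derivative_fst[OF has_derivative_ident] this]
  have "(local_rep ?C (prod_chart c vec_chart) ?F has_derivative (\<lambda>y. (fst y, D A w (snd y)))) (at (snd c g, w))"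
  proof (rule has_derivative_transform_within_open)
    show "open (cimg c \<times> (UNIV :: 'v set))" by (intro open_Times cimg_open[OF smooth_manifold_G at(1)] open_UNIV)
    show "(snd c g, w) \<in> cimg c \<times> UNIV" using at by simp
    show "(fst y, A (snd y)) = local_rep ?C (prod_chart c vec_chart) ?F y" if "y \<in> cimg c \<times> UNIV" for y
      using that GV_local[OF fv at(1), of "fst y" "snd y"] chart_chart_inv[of "fst y" c] by (cases y) auto
  qed
  then have Dl: "D (local_rep ?C (prod_chart c vec_chart) ?F) (snd c g, w) (x, z) = (x, D A w z)" by (simp add: D_eq)
  have "tangent_map GV GV ?F (g, w) (tvec_of GV ?C (g, w) (x, z)) = tvec_of GV (prod_chart c vec_chart) (g, A w) (x, D A w z)"
    using tangent_map_tvec_of[OF GV_manifold[OF fv] GV_manifold[OF fw] smooth_at_GV_map[OF fv fw g A] GV_chart[OF c] C', of "(x, z)"] Dl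
    by simp
  then show ?thesis
    using gvec_rho[OF fv c, of w x z] gvec_rho[OF fw c, of "A w" x "D A w z"] x by simp
qed

lemma rho_zero: "c \<in> charts_at (mfd G) g \<Longrightarrow> rho c (snd c g) 0 = 0"
  by (intro linear_0 linear_rho) (auto simp: charts_at_iff)

text \<open>The hypothesis \<open>closed\<close> is the Chevalley-Eilenberg form of closedness: the terms
  without a derivative come from the Maurer-Cartan equation.\<close>

lemma right_trivialized_symplectic:
  fixes \<beta> :: "'v::real_normed_vector \<Rightarrow> 'e \<times> 'v \<Rightarrow> 'e \<times> 'v \<Rightarrow> real"
  assumes fv: "findim TYPE('v)"
    and \<Omega>: "\<And>g w \<eta> z \<eta>' z'. g \<in> carrier G \<Longrightarrow> \<Omega> (g, w) (gvec g w \<eta> z) (gvec g w \<eta>' z') = \<beta> w (\<eta>, z) (\<eta>', z')"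
    and bil: "\<And>w. bilinear (\<beta> w)" and alt: "\<And>w Y. \<beta> w Y Y = 0"
    and sm: "\<And>w Y Y'. vsmooth (\<lambda>w. \<beta> w Y Y') w"
    and nondeg: "\<And>w Y. (\<And>Y'. \<beta> w Y Y' = 0) \<Longrightarrow> Y = 0"
    and closed: "\<And>w \<eta>1 z1 \<eta>2 z2 \<eta>3 z3.
      D (\<lambda>w. \<beta> w (\<eta>2, z2) (\<eta>3, z3)) w z1 + D (\<lambda>w. \<beta> w (\<eta>3, z3) (\<eta>1, z1)) w z2 + D (\<lambda>w. \<beta> w (\<eta>1, z1) (\<eta>2, z2)) w z3
      = \<beta> w (br \<eta>1 \<eta>2, 0) (\<eta>3, z3) + \<beta> w (br \<eta>2 \<eta>3, 0) (\<eta>1, z1) + \<beta> w (br \<eta>3 \<eta>1, 0) (\<eta>2, z2)"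
  shows "symplectic_manifold GV \<Omega>"
proof -
  note GVM = GV_manifold[OF fv]
  note f2 = findim_prod[OF findim_e fv]
  have linl: "linear (\<lambda>Y. \<beta> w Y Y')" and linr: "linear (\<beta> w Y)" for w Y Y' using bil[of w] unfolding bilinear_def by blast+
  have skew: "\<beta> w Y Y' = - \<beta> w Y' Y" for w Y Y'
    using alt[of w "Y + Y'"] alt[of w Y] alt[of w Y']
    by (simp add: bilinear_ladd[OF bil] bilinear_radd[OF bil])
  have atE: "\<exists>c. c \<in> atlas (mfd G) \<and> e = prod_chart c vec_chart" if "e \<in> atlas (GV :: ('g \<times> 'v, 'e \<times> 'v) manifold)" for e
  proof -
    have "e \<in> (\<lambda>(c, d). prod_chart c d) ` (atlas (mfd G) \<times> {vec_chart})" using that by simp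
    then show ?thesis by (elim imageE SigmaE) (simp only: prod.case singleton_iff, blast)
  qed
  have img: "cimg (prod_chart c (vec_chart :: ('v, 'v) chart)) = cimg c \<times> UNIV" for c
    unfolding cimg_prod_chart by (simp add: image_id)
  \<comment> \<open>\<open>P\<close> turns chart coordinates into trivialized components. The
    coefficient functions of the form are thus \<open>\<beta>\<close> with the base point and both
    vectors depending on \<open>q\<close>.\<close>
  define P where "P = (\<lambda>c (x :: 'e \<times> 'v) (q :: 'e \<times> 'v). (rho c (fst q) (fst x), snd x))"
  have fc: "form_coords GV \<Omega> (prod_chart c vec_chart) q x y = \<beta> (snd q) (P c x q) (P c y q)"
    if c: "c \<in> atlas (mfd G)" and q: "q \<in> cimg c \<times> UNIV" for c q x y
  proof -
    obtain u w where uw: "q = (u, w)" "u \<in> cimg c" using q by auto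
    have g: "chart_inv c u \<in> carrier G" by (rule chart_inv_carrier[OF c uw(2)])
    have cg: "c \<in> charts_at (mfd G) (chart_inv c u)" using c chart_inv_in[OF uw(2)] by (simp add: charts_at_iff)
    have "tvec_of GV (prod_chart c vec_chart) (chart_inv c u, w) x = gvec (chart_inv c u) w (rho c u (fst x)) (snd x)" for x
      using gvec_rho[OF fv cg, of w "fst x" "snd x"] by (simp add: chart_chart_inv[OF uw(2)])
    then show ?thesis
      unfolding form_coords_def uw(1) GV_local[OF fv c uw(2)] by (simp add: \<Omega>[OF g] P_def)
  qed
  have vP: "vsmooth (P c x) q" if c: "c \<in> atlas (mfd G)" and q: "q \<in> cimg c \<times> UNIV" for c x q
    unfolding P_def
    by (intro vsmooth_Pair vsmooth_const
        vsmooth_compose[OF findim_e vsmooth_fst[OF vsmooth_ident] has_derivative_rho(1)[OF c]]) (use q in auto)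
  have DP: "D (P c x) q v = (D (\<lambda>u. rho c u (fst x)) (fst q) (fst v), 0)" if c: "c \<in> atlas (mfd G)" and q: "q \<in> cimg c \<times> UNIV" for c x q v
  proof -
    have "((\<lambda>q. rho c (fst q) (fst x)) has_derivative (\<lambda>v. D (\<lambda>u. rho c u (fst x)) (fst q) (fst v))) (at q)"
      by (rule has_derivative_compose[OF has_derivative_fst[OF has_derivative_ident] vsmooth_has_derivative[OF has_derivative_rho(1)[OF c]]])
        (use q in auto)
    from D_eq[OF has_derivative_Pair[OF this has_derivative_const[of "snd x"]]] show ?thesis by (simp add: P_def)
  qed
  have Dsnd: "D snd q v = snd v" for q v :: "'e \<times> 'v"
    using D_eq[OF bounded_linear_imp_has_derivative[OF bounded_linear_snd]] by metis
  have vsF: "vsmooth (\<lambda>q. \<beta> (snd q) (P c x q) (P c y q)) q" and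
    DF: "D (\<lambda>q. \<beta> (snd q) (P c x q) (P c y q)) q v
      = D (\<lambda>w. \<beta> w (P c x q) (P c y q)) (snd q) (snd v)
        + \<beta> (snd q) (D (\<lambda>u. rho c u (fst x)) (fst q) (fst v), 0) (P c y q)
        - \<beta> (snd q) (D (\<lambda>u. rho c u (fst y)) (fst q) (fst v), 0) (P c x q)"
    if c: "c \<in> atlas (mfd G)" and q: "q \<in> cimg c \<times> UNIV" for c x y q v
  proof -
    note pb = parametrized_bilinear[OF fv f2 bil sm vsmooth_linear[OF bounded_linear_snd] vP[OF c q] vP[OF c q]]
    show "vsmooth (\<lambda>q. \<beta> (snd q) (P c x q) (P c y q)) q" by (rule pb(1))
    show "D (\<lambda>q. \<beta> (snd q) (P c x q) (P c y q)) q v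
      = D (\<lambda>w. \<beta> w (P c x q) (P c y q)) (snd q) (snd v)
        + \<beta> (snd q) (D (\<lambda>u. rho c u (fst x)) (fst q) (fst v), 0) (P c y q)
        - \<beta> (snd q) (D (\<lambda>u. rho c u (fst y)) (fst q) (fst v), 0) (P c x q)"
      unfolding pb(2) DP[OF c q] Dsnd using skew[of "snd q" "P c x q"] by simp
  qed
  have oC: "open (cimg c \<times> (UNIV :: 'v set))" if "c \<in> atlas (mfd G)" for c
    by (intro open_Times cimg_open[OF smooth_manifold_G that] open_UNIV)
  have "smooth_two_form GV \<Omega>"
    unfolding smooth_two_form_def
  proof (intro ballI conjI allI)
    fix e :: "('g \<times> 'v, 'e \<times> 'v) chart" and q assume e: "e \<in> atlas GV" and q: "q \<in> cimg e"
    obtain c where c: "c \<in> atlas (mfd G)" "e = prod_chart c vec_chart" using atE[OF e] by blast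
    have q': "q \<in> cimg c \<times> UNIV" using q unfolding c(2) img .
    have lP: "linear (\<lambda>x. P c x q)"
      unfolding P_def using linear_rho[OF c(1), of "fst q"] q'
      by (auto intro!: linearI simp: linear_add linear_scale)
    have f: "form_coords GV \<Omega> e q = (\<lambda>x y. \<beta> (snd q) (P c x q) (P c y q))"
      unfolding c(2) by (intro ext fc[OF c(1) q'])
    show "bilinear (form_coords GV \<Omega> e q)"
      unfolding f bilinear_def
      using linear_compose[OF lP linl] linear_compose[OF lP linr] by (simp add: comp_def)
    show "form_coords GV \<Omega> e q x x = 0" for x unfolding f by (rule alt)
  next
    fix e :: "('g \<times> 'v, 'e \<times> 'v) chart" and x y assume e: "e \<in> atlas GV"
    obtain c where c: "c \<in> atlas (mfd G)" "e = prod_chart c vec_chart" using atE[OF e] by blast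
    show "smooth_on (cimg e) (\<lambda>q. form_coords GV \<Omega> e q x y)"
      unfolding c(2) img
    proof (rule smooth_on_cong[OF oC[OF c(1)] _ fc[OF c(1)]])
      show "smooth_on (cimg c \<times> UNIV) (\<lambda>q. \<beta> (snd q) (P c x q) (P c y q))"
        using vsF[OF c(1)] smooth_on_iff_smooth_at[OF oC[OF c(1)]] by blast
    qed
  qed
  moreover have "closed_two_form GV \<Omega>"
    unfolding closed_two_form_def
  proof (intro ballI allI)
    fix e :: "('g \<times> 'v, 'e \<times> 'v) chart" and q x y z assume e: "e \<in> atlas GV" and q: "q \<in> cimg e"
    obtain c where c: "c \<in> atlas (mfd G)" "e = prod_chart c vec_chart" using atE[OF e] by blast
    have q': "q \<in> cimg c \<times> UNIV" using q unfolding c(2) img .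
    then have u: "fst q \<in> cimg c" by auto
    have Dfc: "D (\<lambda>q. form_coords GV \<Omega> e q x y) q = D (\<lambda>q. \<beta> (snd q) (P c x q) (P c y q)) q" for x y
      unfolding c(2) by (rule vsmooth_D_cong[OF vsF[OF c(1) q'] oC[OF c(1)] q' fc[OF c(1)]])
    define R where "R = (\<lambda>(x :: 'e \<times> 'v) (y :: 'e \<times> 'v). D (\<lambda>u. rho c u (fst x)) (fst q) (fst y))"
    have R_eq: "D (\<lambda>u. rho c u (fst x)) (fst q) (fst y) = R x y" for x y by (simp add: R_def)
    define r where "r = (\<lambda>x :: 'e \<times> 'v. rho c (fst q) (fst x))"
    have Px: "P c x q = (r x, snd x)" for x by (simp add: P_def r_def)
    have mc: "(R y x, 0) - (R x y, 0) = - (br (r x) (r y), 0::'v)" for x y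
      using maurer_cartan[OF c(1) u, of "fst y" "fst x"] by (simp add: R_def r_def)
    have mc': "\<beta> (snd q) (R y x, 0) Y - \<beta> (snd q) (R x y, 0) Y = - \<beta> (snd q) (br (r x) (r y), 0) Y" for x y Y
      unfolding linear_diff[OF linl, symmetric] mc by (rule linear_neg[OF linl])
    \<comment> \<open>The six terms with a derivative of \<open>rho\<close> pair into three
      antisymmetric differences, which the Maurer-Cartan equation turns into brackets. What is left
      is the hypothesis \<open>closed\<close>.\<close>
    show "D (\<lambda>q. form_coords GV \<Omega> e q y z) q x + D (\<lambda>q. form_coords GV \<Omega> e q z x) q y
        + D (\<lambda>q. form_coords GV \<Omega> e q x y) q z = 0"
      unfolding Dfc DF[OF c(1) q'] R_eq Px
      using closed[of "r y" "snd y" "r z" "snd z" "snd q" "snd x" "r x"]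
        mc'[of y x "(r z, snd z)"] mc'[of z y "(r x, snd x)"] mc'[of x z "(r y, snd y)"]
      by linarith
  qed
  moreover have "nondegenerate_two_form GV \<Omega>"
    unfolding nondegenerate_two_form_def
  proof (intro ballI impI)
    fix p and v assume p: "p \<in> points GV" and v: "v \<in> tangent_space GV p"
      and 0: "\<forall>v'\<in>tangent_space GV p. \<Omega> p v v' = 0"
    obtain g and w :: 'v where gw: "p = (g, w)" "g \<in> carrier G" using p by (auto simp: points_G)
    obtain c where c: "c \<in> charts_at (mfd G) g" using ex_chart_G[OF gw(2)] by blast
    obtain \<eta> z where vg: "v = gvec g w \<eta> z" using gvecE[OF fv v[unfolded gw(1)] gw(2)] by metis
    have "\<beta> w (\<eta>, z) Y' = 0" for Y'
    proof -
      have "\<Omega> p v (gvec g w (fst Y') (snd Y')) = 0"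
        using 0 gvec_in[OF fv gw(2)] gw(1) by blast
      then show ?thesis by (simp add: gw vg \<Omega>)
    qed
    then have "(\<eta>, z) = 0" by (rule nondeg)
    then have ez: "\<eta> = rho c (snd c g) 0" "z = 0" using rho_zero[OF c] by (auto simp: zero_prod_def)
    have "v = tvec_of GV (prod_chart c vec_chart) (g, w) (0, 0)" unfolding vg ez by (rule gvec_rho[OF fv c])
    then show "v = (\<lambda>_. 0)"
      using tvec_of_zero[OF GVM GV_chart[OF c]] by (simp add: zero_prod_def)
  qed
  ultimately show ?thesis using GVM by (simp add: symplectic_manifold_def)
qed

end

section \<open>The symplectic action and its momentum map\<close>

type_synonym 'v dual = "'v \<Rightarrow>\<^sub>L real"

context lie_group_chart
begin

abbreviation ad :: "'e \<Rightarrow> 'e dual \<Rightarrow> 'e dual" where "ad \<equiv> ad_star G c\<^sub>0"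

lemmas br_simps = bounded_bilinear.add_left[OF bounded_bilinear_br] bounded_bilinear.add_right[OF bounded_bilinear_br]
  bounded_bilinear.diff_left[OF bounded_bilinear_br] bounded_bilinear.diff_right[OF bounded_bilinear_br]
  bounded_bilinear.minus_left[OF bounded_bilinear_br] bounded_bilinear.minus_right[OF bounded_bilinear_br]
  bounded_bilinear.zero_left[OF bounded_bilinear_br] bounded_bilinear.zero_right[OF bounded_bilinear_br]
  bounded_bilinear.scaleR_left[OF bounded_bilinear_br] bounded_bilinear.scaleR_right[OF bounded_bilinear_br]

lemma ad_apply [simp]: "blinfun_apply (ad \<xi> \<mu>) \<eta> = blinfun_apply \<mu> (br \<xi> \<eta>)"
  unfolding ad_star_def
  by (subst bounded_linear_Blinfun_apply)
    (intro bounded_linear_compose[OF blinfun.bounded_linear_right bounded_bilinear.bounded_linear_right[OF bounded_bilinear_br]], simp)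

lemma bounded_bilinear_ad: "bounded_bilinear ad"
  by (rule bilinear_imp_bounded_bilinear[OF findim_e findim_d])
    (auto simp: bilinear_def blinfun.bilinear_simps br_simps intro!: linearI blinfun_eqI)

lemmas ad_simps = bounded_bilinear.add_left[OF bounded_bilinear_ad] bounded_bilinear.add_right[OF bounded_bilinear_ad]
  bounded_bilinear.diff_left[OF bounded_bilinear_ad] bounded_bilinear.diff_right[OF bounded_bilinear_ad]
  bounded_bilinear.zero_left[OF bounded_bilinear_ad] bounded_bilinear.zero_right[OF bounded_bilinear_ad]
  bounded_bilinear.scaleR_left[OF bounded_bilinear_ad]

text \<open>The Jacobi identity with \<open>br \<xi>\<close> acting as a derivation, in the
  orientation that rewrites the nested bracket of \<open>T1_beta\<close>.\<close>

lemma br_jacobi': "br \<xi> (br \<eta> \<eta>') = br (br \<xi> \<eta>) \<eta>' - br (br \<xi> \<eta>') \<eta>"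
proof -
  have "br \<xi> (br \<eta> \<eta>') = - br (br \<eta> \<eta>') \<xi>" "br (br \<xi> \<eta>') \<eta> = - br (br \<eta>' \<xi>) \<eta>"
    using br_antisym[of \<xi> "br \<eta> \<eta>'"] br_antisym[of \<xi> \<eta>'] by (simp_all add: br_simps)
  moreover have "br (br \<xi> \<eta>) \<eta>' + br (br \<eta>' \<xi>) \<eta> = - br (br \<eta> \<eta>') \<xi>"
    unfolding eq_neg_iff_add_eq_0 using br_jacobi[of \<xi> \<eta> \<eta>'] by (simp only: ac_simps)
  ultimately show ?thesis by simp
qed

lemma dual_br_jacobi:
  "blinfun_apply f (br (br x y) z) + blinfun_apply f (br (br y z) x) + blinfun_apply f (br (br z x) y) = 0"
  unfolding blinfun.add_right[symmetric] br_jacobi by simp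

text \<open>The canonical form after solving the frame for its covector component,
  \<open>a - ad \<eta> \<mu>\<close>. The two correction terms turn \<open>\<mu>\<close> of the
  bracket from positive to negative sign.\<close>

fun TG_beta :: "'e dual \<Rightarrow> 'e \<times> 'e dual \<Rightarrow> 'e \<times> 'e dual \<Rightarrow> real" where
  "TG_beta \<mu> (\<eta>, a) (\<eta>', b) = blinfun_apply a \<eta>' - blinfun_apply b \<eta> - blinfun_apply \<mu> (br \<eta> \<eta>')"

text \<open>Frame vectors are \<open>gvec\<close> with a shifted fiber component, so injectivity of
  \<open>gvec\<close> resolves the definite descriptions in the form.\<close>

lemma TG_form_gvec:
  assumes g: "g \<in> carrier G"
  shows "TG_dual_form G c\<^sub>0 (g, \<mu>) (gvec g \<mu> \<eta> a) (gvec g \<mu> \<eta>' b) = TG_beta \<mu> (\<eta>, a) (\<eta>', b)"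
proof -
  have fr: "TG_dual_frame G c\<^sub>0 (\<xi>, \<nu>) (g, \<mu>) = gvec g \<mu> \<xi> (\<nu> + ad \<xi> \<mu>)" for \<xi> \<nu> by (simp add: gvec_def)
  have the: "(THE a'. TG_dual_frame G c\<^sub>0 a' (g, \<mu>) = gvec g \<mu> \<eta> a) = (\<eta>, a - ad \<eta> \<mu>)" for \<eta> a
  proof (rule the_equality)
    show "TG_dual_frame G c\<^sub>0 (\<eta>, a - ad \<eta> \<mu>) (g, \<mu>) = gvec g \<mu> \<eta> a" unfolding fr by simp
    fix a' assume "TG_dual_frame G c\<^sub>0 a' (g, \<mu>) = gvec g \<mu> \<eta> a"
    moreover obtain \<xi> \<nu> where "a' = (\<xi>, \<nu>)" by (cases a')
    ultimately show "a' = (\<eta>, a - ad \<eta> \<mu>)" using gvec_inj[OF findim_d g, of \<mu> \<xi> "\<nu> + ad \<xi> \<mu>" \<eta> a] fr by auto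
  qed
  have "blinfun_apply \<mu> (br \<eta>' \<eta>) = - blinfun_apply \<mu> (br \<eta> \<eta>')"
    unfolding br_antisym[of \<eta>' \<eta>] by (rule blinfun.minus_right)
  then show ?thesis unfolding TG_dual_form_def the by (simp add: blinfun.diff_left)
qed

text \<open>The frame components are eliminated by \<open>\<zeta> = z - br \<xi> \<eta>\<close>,
  \<open>l1 = m - ad \<eta> \<mu> - ad \<zeta> \<nu>\<close> and
  \<open>l2 = n - ad \<eta> \<nu>\<close>; the double bracket arises from the occurrence of
  \<open>\<zeta>\<close> in \<open>l1\<close>.\<close>

fun T1_beta :: "'e \<times> 'e dual \<times> 'e dual \<Rightarrow> 'e \<times> 'e \<times> 'e dual \<times> 'e dual \<Rightarrow>
    'e \<times> 'e \<times> 'e dual \<times> 'e dual \<Rightarrow> real" where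
  "T1_beta (\<xi>, \<mu>, \<nu>) (\<eta>, z, m, n) (\<eta>', z', m', n') =
     blinfun_apply m \<eta>' - blinfun_apply m' \<eta> + blinfun_apply n (z' - br \<xi> \<eta>') - blinfun_apply n' (z - br \<xi> \<eta>)
     - blinfun_apply \<mu> (br \<eta> \<eta>') - blinfun_apply \<nu> (br z \<eta>') + blinfun_apply \<nu> (br z' \<eta>)
     + blinfun_apply \<nu> (br \<xi> (br \<eta> \<eta>'))"

lemmas findim_ed = findim_prod[OF findim_e findim_d]
lemmas findim_edd = findim_prod[OF findim_e findim_prod[OF findim_d findim_d]]

lemma T1_form_gvec:
  assumes g: "g \<in> carrier G"
  shows "T1_form G c\<^sub>0 (g, w) (gvec g w \<eta> z) (gvec g w \<eta>' z') = T1_beta w (\<eta>, z) (\<eta>', z')"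
proof -
  obtain \<xi> \<mu> \<nu> where w: "w = (\<xi>, \<mu>, \<nu>)" by (cases w rule: prod_cases3)
  have fr: "T1_frame G c\<^sub>0 (\<eta>, \<zeta>, l1, l2) (g, \<xi>, \<mu>, \<nu>)
      = gvec g w \<eta> (\<zeta> + br \<xi> \<eta>, l1 + ad \<eta> \<mu> + ad \<zeta> \<nu>, l2 + ad \<eta> \<nu>)" for \<eta> \<zeta> l1 l2
    by (simp add: gvec_def w)
  have the: "(THE a. T1_frame G c\<^sub>0 a (g, \<xi>, \<mu>, \<nu>) = gvec g w \<eta> (z, m, n))
      = (\<eta>, z - br \<xi> \<eta>, m - ad \<eta> \<mu> - ad (z - br \<xi> \<eta>) \<nu>, n - ad \<eta> \<nu>)" for \<eta> z m n
  proof (rule the_equality)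
    show "T1_frame G c\<^sub>0 (\<eta>, z - br \<xi> \<eta>, m - ad \<eta> \<mu> - ad (z - br \<xi> \<eta>) \<nu>, n - ad \<eta> \<nu>) (g, \<xi>, \<mu>, \<nu>) = gvec g w \<eta> (z, m, n)"
      unfolding fr by simp
    fix a assume a: "T1_frame G c\<^sub>0 a (g, \<xi>, \<mu>, \<nu>) = gvec g w \<eta> (z, m, n)"
    obtain \<eta>1 \<zeta> l1 l2 where a': "a = (\<eta>1, \<zeta>, l1, l2)" by (cases a rule: prod_cases4)
    have "\<eta>1 = \<eta> \<and> (\<zeta> + br \<xi> \<eta>1, l1 + ad \<eta>1 \<mu> + ad \<zeta> \<nu>, l2 + ad \<eta>1 \<nu>) = (z, m, n)"
      by (rule gvec_inj[OF findim_edd g]) (use a in \<open>simp only: a' fr\<close>)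
    then show "a = (\<eta>, z - br \<xi> \<eta>, m - ad \<eta> \<mu> - ad (z - br \<xi> \<eta>) \<nu>, n - ad \<eta> \<nu>)"
      unfolding a' by auto
  qed
  obtain z1 m n where z: "z = (z1, m, n)" by (cases z rule: prod_cases3)
  obtain z1' m' n' where z': "z' = (z1', m', n')" by (cases z' rule: prod_cases3)
  have "blinfun_apply \<mu> (br \<eta>' \<eta>) = - blinfun_apply \<mu> (br \<eta> \<eta>')"
    unfolding br_antisym[of \<eta>' \<eta>] by (rule blinfun.minus_right)
  then show ?thesis
    unfolding T1_form_def z z' w the[unfolded w] by (simp add: blinfun.bilinear_simps br_simps br_jacobi')
qed

lemma T1_eq: "T1 G = GV" and TG_eq: "TG_dual G = GV"
  by (simp_all add: T1_def TG_dual_def)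

lemma has_derivative_TG_beta:
  "((\<lambda>\<mu>. TG_beta \<mu> (\<eta>, a) (\<eta>', b)) has_derivative (\<lambda>y. - blinfun_apply y (br \<eta> \<eta>'))) (at \<mu>)"
proof -
  have "((\<lambda>\<mu>. (blinfun_apply a \<eta>' - blinfun_apply b \<eta>) - blinfun_apply \<mu> (br \<eta> \<eta>')) has_derivative
      (\<lambda>y. 0 - blinfun_apply y (br \<eta> \<eta>'))) (at \<mu>)"
    by (intro has_derivative_diff has_derivative_const bounded_linear_imp_has_derivative blinfun.bounded_linear_left)
  then show ?thesis by simp
qed

text \<open>In the closedness condition the fiber derivatives match the terms pairing
  \<open>z1\<close>, \<open>z2\<close>, \<open>z3\<close> with brackets, and the terms in
  \<open>\<mu>\<close> vanish by the Jacobi identity. Nondegeneracy is tested on vectors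
  \<open>(0, f)\<close> and then \<open>(x, 0)\<close>.\<close>

lemma TG_symplectic: "symplectic_manifold (TG_dual G) (TG_dual_form G c\<^sub>0)"
  unfolding TG_eq
proof (rule right_trivialized_symplectic[where \<beta> = TG_beta and \<Omega> = "TG_dual_form G c\<^sub>0", OF findim_d TG_form_gvec])
  fix \<mu> :: "'e dual" and Y Y' :: "'e \<times> 'e dual"
  show "bilinear (TG_beta \<mu>)"
    unfolding bilinear_def
    by (auto intro!: linearI simp: blinfun.bilinear_simps br_simps algebra_simps)
  show "TG_beta \<mu> Y Y = 0" by (cases Y) (simp add: blinfun.zero_right)
  show "vsmooth (\<lambda>\<mu>. TG_beta \<mu> Y Y') \<mu>"
  proof -
    obtain \<eta> a \<eta>' b where Y: "Y = (\<eta>, a)" "Y' = (\<eta>', b)" by (cases Y, cases Y')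
    have "vsmooth (\<lambda>\<mu>. (blinfun_apply a \<eta>' - blinfun_apply b \<eta>) - blinfun_apply \<mu> (br \<eta> \<eta>')) \<mu>"
      by (intro vsmooth_diff vsmooth_const vsmooth_linear blinfun.bounded_linear_left)
    then show ?thesis by (simp add: Y)
  qed
  show "Y = 0" if nd: "\<And>Y'. TG_beta \<mu> Y Y' = 0"
  proof -
    obtain \<eta> a where Y: "Y = (\<eta>, a)" by (cases Y)
    have "blinfun_apply f \<eta> = 0" for f :: "'e dual" using nd[of "(0, f)"] by (simp add: Y blinfun.zero_right br_simps)
    then have \<eta>: "\<eta> = 0" by (rule dual_separates[OF findim_e])
    have "blinfun_apply a x = 0" for x using nd[of "(x, 0)"] by (simp add: Y \<eta> blinfun.zero_right br_simps)
    then have "a = 0" by (intro blinfun_eqI) simp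
    then show ?thesis by (simp add: Y \<eta> zero_prod_def)
  qed
next
  fix \<mu> \<eta>1 \<eta>2 \<eta>3 and z1 z2 z3 :: "'e dual"
  show "D (\<lambda>\<mu>. TG_beta \<mu> (\<eta>2, z2) (\<eta>3, z3)) \<mu> z1 + D (\<lambda>\<mu>. TG_beta \<mu> (\<eta>3, z3) (\<eta>1, z1)) \<mu> z2
      + D (\<lambda>\<mu>. TG_beta \<mu> (\<eta>1, z1) (\<eta>2, z2)) \<mu> z3
      = TG_beta \<mu> (br \<eta>1 \<eta>2, 0) (\<eta>3, z3) + TG_beta \<mu> (br \<eta>2 \<eta>3, 0) (\<eta>1, z1) + TG_beta \<mu> (br \<eta>3 \<eta>1, 0) (\<eta>2, z2)"
    unfolding D_eq[OF has_derivative_TG_beta] using dual_br_jacobi[of \<mu> \<eta>1 \<eta>2 \<eta>3] by simp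
qed

text \<open>Grouped by degree in the base point: a constant part, a linear part, and one quadratic
  term pairing \<open>\<nu>\<close> with a bracket of \<open>\<xi>\<close>. Each group is
  differentiated by its own rule.\<close>

lemma T1_beta_expand:
  "T1_beta w (\<eta>, z, m, n) (\<eta>', z', m', n') =
    (blinfun_apply m \<eta>' - blinfun_apply m' \<eta> + blinfun_apply n z' - blinfun_apply n' z)
    + (- blinfun_apply n (br (fst w) \<eta>') + blinfun_apply n' (br (fst w) \<eta>) - blinfun_apply (fst (snd w)) (br \<eta> \<eta>')
      - blinfun_apply (snd (snd w)) (br z \<eta>') + blinfun_apply (snd (snd w)) (br z' \<eta>))
    + blinfun_apply (snd (snd w)) (br (fst w) (br \<eta> \<eta>'))"
  by (cases w rule: prod_cases3) (simp add: blinfun.bilinear_simps)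

lemma T1_beta_linear_part:
  "bounded_linear (\<lambda>w :: 'e \<times> 'e dual \<times> 'e dual.
     - blinfun_apply n (br (fst w) \<eta>') + blinfun_apply n' (br (fst w) \<eta>) - blinfun_apply (fst (snd w)) k
      - blinfun_apply (snd (snd w)) k' + blinfun_apply (snd (snd w)) k'')"
  by (rule linear_imp_bounded_linear[OF findim_edd], rule linearI)
    (simp_all add: blinfun.bilinear_simps br_simps algebra_simps)

lemma has_derivative_T1_beta:
  "((\<lambda>w. T1_beta w (\<eta>, z, m, n) (\<eta>', z', m', n')) has_derivative (\<lambda>h.
      (- blinfun_apply n (br (fst h) \<eta>') + blinfun_apply n' (br (fst h) \<eta>) - blinfun_apply (fst (snd h)) (br \<eta> \<eta>')
      - blinfun_apply (snd (snd h)) (br z \<eta>') + blinfun_apply (snd (snd h)) (br z' \<eta>))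
      + (blinfun_apply (snd (snd w)) (br (fst h) (br \<eta> \<eta>')) + blinfun_apply (snd (snd h)) (br (fst w) (br \<eta> \<eta>'))))) (at w)"
proof -
  have b: "((\<lambda>w. br (fst w) k) has_derivative (\<lambda>h. br (fst h) k)) (at w)" for k and w :: "'e \<times> 'e dual \<times> 'e dual"
    by (rule bounded_linear_imp_has_derivative
        [OF bounded_linear_compose[OF bounded_bilinear.bounded_linear_left[OF bounded_bilinear_br] bounded_linear_fst]])
  have s: "((\<lambda>w. snd (snd w)) has_derivative (\<lambda>h. snd (snd h))) (at w)" for w :: "'e \<times> 'e dual \<times> 'e dual"
    by (intro has_derivative_snd has_derivative_ident)
  show ?thesis
    unfolding T1_beta_expand
    using has_derivative_add[OF has_derivative_add[OF has_derivative_const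
          bounded_linear_imp_has_derivative[OF T1_beta_linear_part]] blinfun.FDERIV[OF s b]]
    by simp
qed

lemma D_T1_beta:
  "D (\<lambda>w. T1_beta w (\<eta>, z, m, n) (\<eta>', z', m', n')) (\<xi>, \<mu>, \<nu>) (x, y, v)
   = - blinfun_apply n (br x \<eta>') + blinfun_apply n' (br x \<eta>) - blinfun_apply y (br \<eta> \<eta>')
      - blinfun_apply v (br z \<eta>') + blinfun_apply v (br z' \<eta>)
      + blinfun_apply \<nu> (br x (br \<eta> \<eta>')) + blinfun_apply v (br \<xi> (br \<eta> \<eta>'))"
  unfolding D_eq[OF has_derivative_T1_beta] by simp

lemma T1_symplectic: "symplectic_manifold (T1 G) (T1_form G c\<^sub>0)"
  unfolding T1_eq
proof (rule right_trivialized_symplectic[where \<beta> = T1_beta and \<Omega> = "T1_form G c\<^sub>0", OF findim_edd T1_form_gvec])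
  fix w :: "'e \<times> 'e dual \<times> 'e dual" and Y Y' :: "'e \<times> 'e \<times> 'e dual \<times> 'e dual"
  obtain \<xi> \<mu> \<nu> where w: "w = (\<xi>, \<mu>, \<nu>)" by (cases w rule: prod_cases3)
  show "bilinear (T1_beta w)"
    unfolding bilinear_def w
    by (auto intro!: linearI simp: blinfun.bilinear_simps br_simps algebra_simps)
  show "T1_beta w Y Y = 0" by (cases Y rule: prod_cases4) (simp add: w blinfun.zero_right br_simps)
  show "vsmooth (\<lambda>w. T1_beta w Y Y') w"
  proof -
    obtain \<eta> z m n where Y: "Y = (\<eta>, z, m, n)" by (cases Y rule: prod_cases4)
    obtain \<eta>' z' m' n' where Y': "Y' = (\<eta>', z', m', n')" by (cases Y' rule: prod_cases4)
    show ?thesis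
      unfolding Y Y' T1_beta_expand
      by (intro vsmooth_add vsmooth_const vsmooth_linear[OF T1_beta_linear_part]
          vsmooth_bilinear[OF bounded_bilinear_blinfun_apply] vsmooth_bilinear[OF bounded_bilinear_br]
          vsmooth_fst vsmooth_snd vsmooth_ident)
  qed
  \<comment> \<open>The order of the tests matters: covector directions first annihilate
    \<open>\<eta>\<close> and \<open>z\<close>, after which the bracket terms disappear and
    \<open>n\<close> and \<open>m\<close> can be read off.\<close>
  show "Y = 0" if nd: "\<And>Y'. T1_beta w Y Y' = 0"
  proof -
    obtain \<eta> z m n where Y: "Y = (\<eta>, z, m, n)" by (cases Y rule: prod_cases4)
    note simps = Y w blinfun.zero_right blinfun.zero_left br_simps
    have "blinfun_apply f \<eta> = 0" for f :: "'e dual" using nd[of "(0, 0, f, 0)"] by (simp add: simps)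
    then have \<eta>: "\<eta> = 0" by (rule dual_separates[OF findim_e])
    have "blinfun_apply f z = 0" for f :: "'e dual" using nd[of "(0, 0, 0, f)"] by (simp add: simps \<eta>)
    then have z: "z = 0" by (rule dual_separates[OF findim_e])
    have "blinfun_apply n x = 0" for x using nd[of "(0, x, 0, 0)"] by (simp add: simps \<eta> z)
    then have n: "n = 0" by (intro blinfun_eqI) simp
    have "blinfun_apply m x = 0" for x using nd[of "(x, 0, 0, 0)"] by (simp add: simps \<eta> z n)
    then have "m = 0" by (intro blinfun_eqI) simp
    then show ?thesis by (simp add: Y \<eta> z n zero_prod_def)
  qed
next
  fix w :: "'e \<times> 'e dual \<times> 'e dual" and \<eta>1 \<eta>2 \<eta>3 and z1 z2 z3 :: "'e \<times> 'e dual \<times> 'e dual"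
  obtain \<xi> \<mu> \<nu> where w: "w = (\<xi>, \<mu>, \<nu>)" by (cases w rule: prod_cases3)
  obtain x1 m1 n1 where z1: "z1 = (x1, m1, n1)" by (cases z1 rule: prod_cases3)
  obtain x2 m2 n2 where z2: "z2 = (x2, m2, n2)" by (cases z2 rule: prod_cases3)
  obtain x3 m3 n3 where z3: "z3 = (x3, m3, n3)" by (cases z3 rule: prod_cases3)
  \<comment> \<open>The double brackets with \<open>\<xi>\<close> vanish by the Jacobi identity
    paired with the functional \<open>ad \<xi> \<nu>\<close>.\<close>
  have j: "blinfun_apply \<nu> (br \<xi> (br (br \<eta>1 \<eta>2) \<eta>3)) + blinfun_apply \<nu> (br \<xi> (br (br \<eta>2 \<eta>3) \<eta>1))
      + blinfun_apply \<nu> (br \<xi> (br (br \<eta>3 \<eta>1) \<eta>2)) = 0"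
    using dual_br_jacobi[of "ad \<xi> \<nu>" \<eta>1 \<eta>2 \<eta>3] by simp
  show "D (\<lambda>w. T1_beta w (\<eta>2, z2) (\<eta>3, z3)) w z1 + D (\<lambda>w. T1_beta w (\<eta>3, z3) (\<eta>1, z1)) w z2
      + D (\<lambda>w. T1_beta w (\<eta>1, z1) (\<eta>2, z2)) w z3
      = T1_beta w (br \<eta>1 \<eta>2, 0) (\<eta>3, z3) + T1_beta w (br \<eta>2 \<eta>3, 0) (\<eta>1, z1) + T1_beta w (br \<eta>3 \<eta>1, 0) (\<eta>2, z2)"
    unfolding w z1 z2 z3 D_T1_beta zero_prod_def T1_beta.simps
    using dual_br_jacobi[of \<mu> \<eta>1 \<eta>2 \<eta>3] j
    by (simp add: blinfun.zero_left blinfun.zero_right blinfun.minus_right blinfun.diff_right br_simps)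
qed

section \<open>The action, its generators and its momentum map\<close>

definition act_fiber :: "'e \<Rightarrow> 'e \<times> 'e dual \<times> 'e dual \<Rightarrow> 'e \<times> 'e dual \<times> 'e dual" where
  "act_fiber \<kappa> w = (\<kappa> + fst w, fst (snd w) + ad \<kappa> (snd (snd w)), snd (snd w))"

abbreviation act where "act \<equiv> T1_action G c\<^sub>0"

lemma act_eq: "act \<kappa> = (\<lambda>p. (fst p, act_fiber \<kappa> (snd p)))"
  by (auto simp: act_fiber_def)

lemma vsmooth_act_fiber_joint: "vsmooth (\<lambda>q. act_fiber (fst q) (snd q)) q"
  unfolding act_fiber_def
  by (intro vsmooth_Pair vsmooth_add vsmooth_bilinear[OF bounded_bilinear_ad] vsmooth_fst vsmooth_snd vsmooth_ident)

lemma vsmooth_act_fiber: "vsmooth (act_fiber \<kappa>) w"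
  unfolding act_fiber_def[abs_def]
  by (intro vsmooth_Pair vsmooth_add vsmooth_bilinear[OF bounded_bilinear_ad] vsmooth_fst vsmooth_snd vsmooth_ident vsmooth_const)

lemma D_act_fiber: "D (act_fiber \<kappa>) w (z, m, n) = (z, m + ad \<kappa> n, n)"
proof -
  have "((\<lambda>w. (\<kappa> + fst w, fst (snd w) + ad \<kappa> (snd (snd w)), snd (snd w))) has_derivative
      (\<lambda>h. (0 + fst h, fst (snd h) + ad \<kappa> (snd (snd h)), snd (snd h)))) (at w)"
    by (intro has_derivative_Pair has_derivative_add has_derivative_const has_derivative_fst has_derivative_snd has_derivative_ident
        bounded_linear.has_derivative[OF bounded_bilinear.bounded_linear_right[OF bounded_bilinear_ad]])
  from D_eq[OF this] show ?thesis by (simp add: act_fiber_def[abs_def])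
qed

lemma T1_manifold: "smooth_manifold (T1 G)"
  unfolding T1_eq by (rule GV_manifold[OF findim_edd])

lemma TG_manifold: "smooth_manifold (TG_dual G)"
  unfolding TG_eq by (rule GV_manifold[OF findim_d])

lemma T1_symplectic_action: "symplectic_action (T1 G) (T1_form G c\<^sub>0) act"
  unfolding symplectic_action_def
proof (intro conjI allI ballI)
  note V = vec_mfd_smooth_manifold[OF findim_e] and W = vec_mfd_smooth_manifold[OF findim_edd]
    and VW = vec_mfd_smooth_manifold[OF findim_prod[OF findim_e findim_edd]] and SM = smooth_manifold_G
  note L = prod_smooth_manifold[OF V T1_manifold]
  show "smooth_map (prod_mfd vec_mfd (T1 G)) (T1 G) (\<lambda>(\<eta>, p). act \<eta> p)"
    unfolding smooth_map_iff_smooth_at[OF L T1_manifold]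
  proof
    fix q :: "'e \<times> 'g \<times> 'e \<times> 'e dual \<times> 'e dual"
    assume q: "q \<in> points (prod_mfd vec_mfd (T1 G))"
    have q2: "snd q \<in> points (prod_mfd (mfd G) vec_mfd)" using q by (auto simp: T1_eq)
    have s1: "smooth_at (prod_mfd vec_mfd (T1 G)) vec_mfd fst q" by (rule smooth_at_fst[OF V T1_manifold q])
    have s2: "smooth_at (prod_mfd vec_mfd (T1 G)) (T1 G) snd q" by (rule smooth_at_snd[OF V T1_manifold q])
    have s3: "smooth_at (prod_mfd vec_mfd (T1 G)) (mfd G) (\<lambda>q. fst (snd q)) q"
      by (rule smooth_at_compose[OF L T1_manifold SM s2]) (unfold T1_eq, rule smooth_at_fst[OF SM W q2])
    have s4: "smooth_at (prod_mfd vec_mfd (T1 G)) vec_mfd (\<lambda>q. snd (snd q)) q"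
      by (rule smooth_at_compose[OF L T1_manifold W s2]) (unfold T1_eq, rule smooth_at_snd[OF SM W q2])
    have s5: "smooth_at (prod_mfd vec_mfd (T1 G)) vec_mfd (\<lambda>q. act_fiber (fst (fst q, snd (snd q))) (snd (fst q, snd (snd q)))) q"
      by (rule smooth_at_compose[OF L VW W smooth_at_vec_Pair[OF L findim_e findim_edd s1 s4] vsmooth_act_fiber_joint])
    have "smooth_at (prod_mfd vec_mfd (T1 G)) (prod_mfd (mfd G) vec_mfd)
        (\<lambda>q. (fst (snd q), act_fiber (fst (fst q, snd (snd q))) (snd (fst q, snd (snd q))))) q"
      by (rule smooth_at_Pair[OF L SM W s3 s5])
    moreover have "(\<lambda>(\<eta>, p). act \<eta> p) = (\<lambda>q. (fst (snd q), act_fiber (fst (fst q, snd (snd q))) (snd (fst q, snd (snd q)))))"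
      by (auto simp: act_eq)
    ultimately show "smooth_at (prod_mfd vec_mfd (T1 G)) (T1 G) (\<lambda>(\<eta>, p). act \<eta> p) q"
      by (simp only: T1_eq)
  qed
  show "act 0 p = p" for p by (cases p rule: prod_cases4) (simp add: ad_simps)
  show "act (\<eta> + \<zeta>) p = act \<eta> (act \<zeta> p)" for \<eta> \<zeta> p
    by (cases p rule: prod_cases4) (simp add: ad_simps)
  show "pulls_back_to (T1 G) (T1 G) (act \<kappa>) (T1_form G c\<^sub>0) (T1_form G c\<^sub>0)" for \<kappa>
    unfolding pulls_back_to_def T1_eq
  proof (intro ballI)
    fix p v v'
    assume p: "p \<in> points (prod_mfd (mfd G) (vec_mfd :: ('e \<times> 'e dual \<times> 'e dual, _) manifold))"
      and v: "v \<in> tangent_space (prod_mfd (mfd G) vec_mfd) p" and v': "v' \<in> tangent_space (prod_mfd (mfd G) vec_mfd) p"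
    obtain g w where gw: "p = (g, w)" "g \<in> carrier G" using p by (auto simp: points_G)
    obtain \<eta> z where z: "v = gvec g w \<eta> z" using gvecE[OF findim_edd v[unfolded gw(1)] gw(2)] by metis
    obtain \<eta>' z' where z': "v' = gvec g w \<eta>' z'" using gvecE[OF findim_edd v'[unfolded gw(1)] gw(2)] by metis
    obtain \<xi> \<mu> \<nu> where w: "w = (\<xi>, \<mu>, \<nu>)" by (cases w rule: prod_cases3)
    obtain x m n where zc: "z = (x, m, n)" by (cases z rule: prod_cases3)
    obtain x' m' n' where zc': "z' = (x', m', n')" by (cases z' rule: prod_cases3)
    \<comment> \<open>Shifting \<open>\<xi>\<close> by \<open>\<kappa>\<close> adds terms in
      \<open>n\<close>, \<open>n'\<close> and a double bracket in \<open>\<nu>\<close>. The first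
      are cancelled by the \<open>ad \<kappa>\<close> terms in the differential, the last by the
      shift of \<open>\<mu>\<close>.\<close>
    have "T1_beta (act_fiber \<kappa> w) (\<eta>, D (act_fiber \<kappa>) w z) (\<eta>', D (act_fiber \<kappa>) w z') = T1_beta w (\<eta>, z) (\<eta>', z')"
      unfolding zc zc' D_act_fiber w by (simp add: act_fiber_def blinfun.bilinear_simps br_simps)
    then show "T1_form G c\<^sub>0 (act \<kappa> p) (tangent_map GV GV (act \<kappa>) p v) (tangent_map GV GV (act \<kappa>) p v') = T1_form G c\<^sub>0 p v v'"
      unfolding act_eq gw(1) z z' tangent_GV_map[OF findim_edd findim_edd gw(2) vsmooth_act_fiber] fst_conv snd_conv
        T1_form_gvec[OF gw(2)] .
  qed
qed

lemma smooth_at_GV_fiber: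
  fixes A :: "'v::real_normed_vector \<Rightarrow> 'w::real_normed_vector"
  assumes fv: "findim TYPE('v)" and fw: "findim TYPE('w)" and g: "g \<in> carrier G" and A: "vsmooth A w"
  shows "smooth_at GV vec_mfd (\<lambda>p. A (snd p)) (g, w)"
proof -
  have p: "(g, w) \<in> points GV" using g by (simp add: points_G)
  show ?thesis
    by (rule smooth_at_compose[OF GV_manifold[OF fv] vec_mfd_smooth_manifold[OF fv] vec_mfd_smooth_manifold[OF fw]
          smooth_at_snd[OF smooth_manifold_G vec_mfd_smooth_manifold[OF fv] p]]) (simp add: A)
qed

text \<open>In the parameter \<open>t\<close> the orbit is an affine line in the fiber with
  direction \<open>(\<kappa>, ad \<kappa> \<nu>, 0)\<close>, because \<open>ad\<close> is linear in
  its first argument.\<close>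

lemma generator_act:
  assumes g: "g \<in> carrier G"
  shows "generator (T1 G) act \<kappa> (g, \<xi>, \<mu>, \<nu>) = gvec g (\<xi>, \<mu>, \<nu>) 0 (\<kappa>, ad \<kappa> \<nu>, 0)"
proof -
  let ?w = "(\<xi>, \<mu>, \<nu>)" and ?k = "(\<kappa>, ad \<kappa> \<nu>, 0 :: 'e dual)"
  have \<gamma>: "(\<lambda>t. act (t *\<^sub>R \<kappa>) (g, ?w)) = (\<lambda>t. (g, ?w + t *\<^sub>R ?k))" by (auto simp: ad_simps)
  obtain c where c: "c \<in> charts_at (mfd G) g" using ex_chart_G[OF g] by blast
  note V = vec_mfd_smooth_manifold[OF findim_real] and W = vec_mfd_smooth_manifold[OF findim_edd]
  have "vsmooth (\<lambda>t. ?w + t *\<^sub>R ?k) 0"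
    by (intro vsmooth_add vsmooth_const vsmooth_linear_comp[OF bounded_linear_scaleR_left] vsmooth_ident)
  then have sm: "smooth_at vec_mfd GV (\<lambda>t. (g, ?w + t *\<^sub>R ?k)) 0"
    by (intro smooth_at_Pair[OF V smooth_manifold_G W] gsmooth_const[OF findim_real g])
  have C: "prod_chart c vec_chart \<in> charts_at GV (g, ?w + 0 *\<^sub>R ?k)" by (rule GV_chart[OF c])
  have "((\<lambda>t. (snd c g, ?w + t *\<^sub>R ?k)) has_derivative (\<lambda>h. (0, 0 + h *\<^sub>R ?k))) (at 0)"
    by (intro has_derivative_Pair has_derivative_const has_derivative_add
        bounded_linear_imp_has_derivative bounded_linear_scaleR_left)
  then have "((\<lambda>t. (snd c g, ?w + t *\<^sub>R ?k)) has_vector_derivative (0, ?k)) (at 0)"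
    by (simp add: has_vector_derivative_def)
  then have "vector_derivative (snd (prod_chart c vec_chart) \<circ> (\<lambda>t. (g, ?w + t *\<^sub>R ?k))) (at 0) = (0, ?k)"
    by (intro vector_derivative_at) (simp add: comp_def)
  then have "velocity GV (\<lambda>t. (g, ?w + t *\<^sub>R ?k)) 0 = tvec_of GV (prod_chart c vec_chart) (g, ?w) (0, ?k)"
    using velocity_eq[OF GV_manifold[OF findim_edd] sm C] by simp
  also have "\<dots> = gvec g ?w 0 ?k" using gvec_rho[OF findim_edd c, of ?w 0 ?k] rho_zero[OF c] by simp
  finally show ?thesis unfolding generator_def \<gamma> T1_eq .
qed

lemma differential_fiber:
  fixes w :: "'v::real_normed_vector" and L :: "'v \<Rightarrow> real"
  assumes fv: "findim TYPE('v)" and g: "g \<in> carrier G" and L: "bounded_linear L"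
  shows "differential GV (\<lambda>p. L (snd p)) (g, w) (gvec g w \<eta> z) = L z"
proof -
  obtain c where c: "c \<in> charts_at (mfd G) g" using ex_chart_G[OF g] by blast
  then have at: "c \<in> atlas (mfd G)" "g \<in> fst c" by (auto simp: charts_at_iff)
  obtain x where x: "rho c (snd c g) x = \<eta>" using rho_surj[OF c] by metis
  let ?C = "prod_chart c vec_chart"
  note GVM = GV_manifold[OF fv] and R = vec_mfd_smooth_manifold[OF findim_real]
  have v: "gvec g w \<eta> z = tvec_of GV ?C (g, w) (x, z)" using gvec_rho[OF fv c, of w x z] x by simp
  have "((\<lambda>y. L (snd y)) has_derivative (\<lambda>y. L (snd y))) (at (snd c g, w))"
    by (intro bounded_linear.has_derivative[OF L] has_derivative_snd has_derivative_ident)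
  then have "(local_rep ?C vec_chart (\<lambda>p. L (snd p)) has_derivative (\<lambda>y. L (snd y))) (at (snd c g, w))"
  proof (rule has_derivative_transform_within_open)
    show "open (cimg c \<times> (UNIV :: 'v set))" by (intro open_Times cimg_open[OF smooth_manifold_G at(1)] open_UNIV)
    show "(snd c g, w) \<in> cimg c \<times> UNIV" using at by simp
    show "L (snd y) = local_rep ?C vec_chart (\<lambda>p. L (snd p)) y" if "y \<in> cimg c \<times> UNIV" for y
      using that GV_local[OF fv at(1), of "fst y" "snd y"] by (cases y) auto
  qed
  then have Dl: "D (local_rep ?C vec_chart (\<lambda>p. L (snd p))) (snd c g, w) (x, z) = L z" by (simp add: D_eq)
  have vc: "vec_chart \<in> charts_at vec_mfd (L (snd (g, w)))" by simp
  have "tangent_map GV vec_mfd (\<lambda>p. L (snd p)) (g, w) (tvec_of GV ?C (g, w) (x, z)) vec_chart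
      = D (local_rep ?C vec_chart (\<lambda>p. L (snd p))) (snd ?C (g, w)) (tvec_of GV ?C (g, w) (x, z) ?C)"
    by (rule tangent_map_apply[OF GVM R smooth_at_GV_fiber[OF fv findim_real g vsmooth_linear[OF L]]
          tvec_of_in_tangent_space[OF GVM GV_chart[OF c]] GV_chart[OF c] vc])
  then show ?thesis
    unfolding differential_def v tvec_of_apply[OF GVM GV_chart[OF c]] using Dl by simp
qed

lemma T1_momentum_eq: "T1_momentum = (\<lambda>p. snd (snd (snd p)))"
  by auto

lemma vsmooth_snd_snd: "vsmooth (\<lambda>w. snd (snd w)) w"
  by (intro vsmooth_snd vsmooth_ident)

lemma smooth_at_T1_momentum:
  assumes "g \<in> carrier G"
  shows "smooth_at (T1 G) vec_mfd T1_momentum (g, w)"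
  unfolding T1_momentum_eq T1_eq by (rule smooth_at_GV_fiber[OF findim_edd findim_d assms vsmooth_snd_snd])

text \<open>When the generator is paired with a tangent vector, the component
  \<open>ad \<kappa> \<nu>\<close> cancels the term with \<open>\<nu>\<close> of the bracket of
  \<open>\<kappa>\<close>, and only \<open>- n \<kappa>\<close> survives, minus the differential of
  the momentum in direction \<open>\<kappa>\<close>.\<close>

lemma T1_momentum_map: "momentum_map (T1 G) (T1_form G c\<^sub>0) act T1_momentum"
  unfolding momentum_map_def
proof (intro conjI allI ballI)
  show "smooth_map (T1 G) vec_mfd T1_momentum"
    unfolding smooth_map_iff_smooth_at[OF T1_manifold vec_mfd_smooth_manifold[OF findim_d]]
    using smooth_at_T1_momentum by (auto simp: T1_eq points_G)
  show "T1_momentum (act \<eta> p) = T1_momentum p" for \<eta> p by (cases p rule: prod_cases4) simp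
  fix \<kappa> p v assume p: "p \<in> points (T1 G)" and v: "v \<in> tangent_space (T1 G) p"
  obtain g w where gw: "p = (g, w)" "g \<in> carrier G" using p by (auto simp: T1_eq points_G)
  obtain \<xi> \<mu> \<nu> where w: "w = (\<xi>, \<mu>, \<nu>)" by (cases w rule: prod_cases3)
  obtain \<eta> z where z: "v = gvec g w \<eta> z" using gvecE[OF findim_edd _ gw(2)] v unfolding T1_eq gw(1) by metis
  obtain x m n where zc: "z = (x, m, n)" by (cases z rule: prod_cases3)
  have bl: "bounded_linear (\<lambda>w :: 'e \<times> 'e dual \<times> 'e dual. blinfun_apply (snd (snd w)) \<kappa>)"
    by (intro bounded_linear_compose[OF blinfun.bounded_linear_left]
        bounded_linear_compose[OF bounded_linear_snd bounded_linear_snd])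
  have d: "differential (T1 G) (\<lambda>q. blinfun_apply (T1_momentum q) \<kappa>) p v = blinfun_apply n \<kappa>"
    using differential_fiber[OF findim_edd gw(2) bl, of w \<eta> z]
    unfolding T1_eq T1_momentum_eq gw(1) z by (simp add: zc)
  show "T1_form G c\<^sub>0 p (generator (T1 G) act \<kappa> p) v = - differential (T1 G) (\<lambda>q. blinfun_apply (T1_momentum q) \<kappa>) p v"
    unfolding d unfolding gw(1) z zc w generator_act[OF gw(2)] T1_form_gvec[OF gw(2)]
    by (simp add: blinfun.bilinear_simps br_simps)
qed

end

section \<open>The reduced space\<close>

context lie_group_chart
begin

definition level_fiber :: "'e dual \<Rightarrow> 'e \<times> 'e dual \<Rightarrow> 'e \<times> 'e dual \<times> 'e dual" where
  "level_fiber \<nu> w = (fst w, snd w, \<nu>)"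

definition level_map :: "'e dual \<Rightarrow> 'g \<times> 'e \<times> 'e dual \<Rightarrow> 'g \<times> 'e \<times> 'e dual \<times> 'e dual" where
  "level_map \<nu> = (\<lambda>p. (fst p, level_fiber \<nu> (snd p)))"

definition level :: "'e dual \<Rightarrow> ('g \<times> 'e \<times> 'e dual \<times> 'e dual, 'e \<times> 'e \<times> 'e dual) manifold" where
  "level \<nu> = image_mfd (level_map \<nu>) (prod_mfd (mfd G) vec_mfd)"

text \<open>On \<open>J\<^sup>-\<^sup>1(\<nu>)\<close> the map \<open>(g, \<xi>, \<mu>, \<nu>) \<mapsto> (g, \<mu> - ad\<^sup>*\<^sub>\<xi> \<nu>)\<close> is a complete invariant of the orbits.\<close>

definition shift_fiber :: "'e \<times> 'e dual \<times> 'e dual \<Rightarrow> 'e dual" where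
  "shift_fiber w = fst (snd w) - ad (fst w) (snd (snd w))"

definition shift_map :: "'g \<times> 'e \<times> 'e dual \<times> 'e dual \<Rightarrow> 'g \<times> 'e dual" where
  "shift_map = (\<lambda>p. (fst p, shift_fiber (snd p)))"

text \<open>Every orbit in the level set meets the slice \<open>\<xi> = 0\<close> exactly once;
  orbits are labelled by that representative.\<close>

definition orbit_map :: "'e dual \<Rightarrow> 'g \<times> 'e dual \<Rightarrow> ('g \<times> 'e \<times> 'e dual \<times> 'e dual) set" where
  "orbit_map \<nu> p = orbit act (fst p, 0, snd p, \<nu>)"

definition reduced :: "'e dual \<Rightarrow> (('g \<times> 'e \<times> 'e dual \<times> 'e dual) set, 'e \<times> 'e dual) manifold" where
  "reduced \<nu> = image_mfd (orbit_map \<nu>) (TG_dual G)"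

abbreviation orbit_inv where
  "orbit_inv \<nu> \<equiv> inv_into (points (TG_dual G)) (orbit_map \<nu>)"

text \<open>The canonical form pulled back along the labelling of orbits. The symplectomorphism to
  \<open>TG_dual\<close> holds by construction, and the substance lies in the pullback condition of
  the reduction.\<close>

definition reduced_form :: "'e dual \<Rightarrow>
    (('g \<times> 'e \<times> 'e dual \<times> 'e dual) set, 'e \<times> 'e dual) two_form" where
  "reduced_form \<nu> = (\<lambda>q v w. TG_dual_form G c\<^sub>0 (orbit_inv \<nu> q)
     (tangent_map (reduced \<nu>) (TG_dual G) (orbit_inv \<nu>) q v)
     (tangent_map (reduced \<nu>) (TG_dual G) (orbit_inv \<nu>) q w))"

lemmas level_base = GV_manifold[OF findim_ed]

lemma inj_on_level_map: "inj_on (level_map \<nu>) A"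
  by (auto simp: inj_on_def level_map_def level_fiber_def)

lemma level_manifold: "smooth_manifold (level \<nu>)"
  unfolding level_def by (rule image_mfd_smooth_manifold[OF level_base inj_on_level_map])

lemma points_level: "points (level \<nu>) = level_map \<nu> ` (carrier G \<times> UNIV)"
  unfolding level_def points_image_mfd[OF level_base inj_on_level_map] points_GV ..

lemma points_T1: "points (T1 G) = carrier G \<times> UNIV" and points_TG: "points (TG_dual G) = carrier G \<times> UNIV"
  by (simp_all add: T1_eq TG_eq points_G)

lemma points_level_eq: "points (level \<nu>) = {p \<in> points (T1 G). T1_momentum p = \<nu>}"
  unfolding points_level points_T1 level_map_def level_fiber_def by (auto simp: image_iff)

text \<open>A common point of the orbits of two representatives in the slice forces the translation
  between them to be 0, by comparison of the \<open>\<xi>\<close> components.\<close>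

lemma inj_on_orbit_map: "inj_on (orbit_map \<nu>) A"
proof (rule inj_onI)
  fix p p' assume eq: "orbit_map \<nu> p = orbit_map \<nu> p'"
  have "act 0 (fst p, 0, snd p, \<nu>) \<in> orbit_map \<nu> p'" unfolding eq[symmetric] by (auto simp: orbit_map_def orbit_def)
  then obtain \<eta> where "act 0 (fst p, 0, snd p, \<nu>) = act \<eta> (fst p', 0, snd p', \<nu>)" by (auto simp: orbit_map_def orbit_def)
  then have "fst p = fst p'" "\<eta> = 0" "snd p = snd p' + ad \<eta> \<nu>" by (auto simp: ad_simps)
  then show "p = p'" by (simp add: ad_simps prod_eq_iff)
qed

text \<open>Translation by \<open>- \<xi>\<close> moves a point of the level set into the slice and
  changes \<open>\<mu>\<close> to \<open>\<mu> - ad \<xi> \<nu>\<close>.\<close>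

lemma orbit_eq_orbit_map: "T1_momentum p = \<nu> \<Longrightarrow> orbit act p = orbit_map \<nu> (shift_map p)"
proof -
  assume "T1_momentum p = \<nu>"
  then obtain g \<xi> \<mu> where p: "p = (g, \<xi>, \<mu>, \<nu>)" by (cases p rule: prod_cases4) simp
  have a: "act \<eta> p = act (\<eta> + \<xi>) (g, 0, \<mu> - ad \<xi> \<nu>, \<nu>)" for \<eta> by (simp add: p ad_simps)
  have b: "act \<eta> (g, 0, \<mu> - ad \<xi> \<nu>, \<nu>) = act (\<eta> - \<xi>) p" for \<eta> unfolding a by simp
  have "orbit act p = orbit act (g, 0, \<mu> - ad \<xi> \<nu>, \<nu>)"
    unfolding orbit_def using a b by blast
  then show ?thesis by (simp add: orbit_map_def shift_map_def shift_fiber_def p)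
qed

lemma reduced_manifold: "smooth_manifold (reduced \<nu>)"
  unfolding reduced_def by (rule image_mfd_smooth_manifold[OF TG_manifold inj_on_orbit_map])

lemma points_reduced: "points (reduced \<nu>) = orbit_map \<nu> ` (carrier G \<times> UNIV)"
  unfolding reduced_def points_image_mfd[OF TG_manifold inj_on_orbit_map] points_TG ..

lemma vsmooth_level_fiber: "vsmooth (level_fiber \<nu>) w"
  unfolding level_fiber_def[abs_def] by (intro vsmooth_Pair vsmooth_fst vsmooth_snd vsmooth_ident vsmooth_const)

lemma D_level_fiber: "D (level_fiber \<nu>) w (z, m) = (z, m, 0)"
proof -
  have "((\<lambda>w. (fst w, snd w, \<nu>)) has_derivative (\<lambda>h. (fst h, snd h, 0))) (at w)"
    by (intro has_derivative_Pair has_derivative_const has_derivative_fst has_derivative_snd has_derivative_ident)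
  from D_eq[OF this] show ?thesis by (simp add: level_fiber_def[abs_def])
qed

lemma vsmooth_shift_fiber: "vsmooth shift_fiber w"
  unfolding shift_fiber_def[abs_def]
  by (intro vsmooth_diff vsmooth_bilinear[OF bounded_bilinear_ad] vsmooth_fst vsmooth_snd vsmooth_ident)

lemma D_shift_fiber: "D shift_fiber (\<xi>, \<mu>, \<nu>) (z, m, n) = m - ad \<xi> n - ad z \<nu>"
proof -
  have "((\<lambda>w. fst (snd w) - ad (fst w) (snd (snd w))) has_derivative
     (\<lambda>h. fst (snd h) - (ad (fst (\<xi>, \<mu>, \<nu>)) (snd (snd h)) + ad (fst h) (snd (snd (\<xi>, \<mu>, \<nu>)))))) (at (\<xi>, \<mu>, \<nu>))"
    by (intro has_derivative_diff bounded_bilinear.FDERIV[OF bounded_bilinear_ad] has_derivative_fst has_derivative_snd has_derivative_ident)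
  from D_eq[OF this] show ?thesis by (simp add: shift_fiber_def[abs_def] diff_diff_eq)
qed

lemma smooth_at_level_map: "g \<in> carrier G \<Longrightarrow> smooth_at GV (T1 G) (level_map \<nu>) (g, w)"
  unfolding level_map_def T1_eq by (rule smooth_at_GV_map[OF findim_ed findim_edd _ vsmooth_level_fiber])

lemma smooth_at_shift_map: "g \<in> carrier G \<Longrightarrow> smooth_at (T1 G) (TG_dual G) shift_map (g, w)"
  unfolding shift_map_def T1_eq TG_eq by (rule smooth_at_GV_map[OF findim_edd findim_d _ vsmooth_shift_fiber])

abbreviation level_inv where
  "level_inv \<nu> \<equiv> inv_into (points (prod_mfd (mfd G) (vec_mfd :: ('e \<times> 'e dual, 'e \<times> 'e dual) manifold))) (level_map \<nu>)"

lemma smooth_at_level_inv: "g \<in> carrier G \<Longrightarrow> smooth_at (level \<nu>) GV (level_inv \<nu>) (level_map \<nu> (g, w))"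
  unfolding level_def by (rule smooth_at_image_inv[OF level_base inj_on_level_map]) (simp add: points_G)

lemma level_inv_level_map: "g \<in> carrier G \<Longrightarrow> level_inv \<nu> (level_map \<nu> (g, w)) = (g, w)"
  by (rule inv_into_f_f[OF inj_on_level_map]) (simp add: points_G)

lemma points_levelE:
  assumes "p \<in> points (level \<nu>)"
  obtains g w where "p = level_map \<nu> (g, w)" "g \<in> carrier G"
  using assms unfolding points_level by auto

lemma level_map_level_inv: "p \<in> points (level \<nu>) \<Longrightarrow> level_map \<nu> (level_inv \<nu> p) = p"
  by (elim points_levelE) (simp only: level_inv_level_map)

lemma smooth_at_level_inclusion:
  assumes p: "p \<in> points (level \<nu>)"
  shows "smooth_at (level \<nu>) (T1 G) (\<lambda>p. p) p"
proof -
  obtain g w where gw: "p = level_map \<nu> (g, w)" "g \<in> carrier G" using points_levelE[OF p] by metis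
  have "smooth_at (level \<nu>) (T1 G) (\<lambda>p. level_map \<nu> (level_inv \<nu> p)) p"
    unfolding gw(1)
    by (rule smooth_at_compose[OF level_manifold level_base T1_manifold smooth_at_level_inv[OF gw(2)]])
      (unfold level_inv_level_map[OF gw(2)], rule smooth_at_level_map[OF gw(2)])
  then show ?thesis
    by (rule smooth_at_cong[OF level_manifold T1_manifold _ openin_topspace p]) (rule level_map_level_inv[symmetric])
qed

text \<open>Resets the momentum component to \<open>\<nu>\<close>. As a smooth retraction of the
  whole manifold onto the level set it yields both the subspace topology and the injectivity of the
  tangent maps.\<close>

definition retract_map :: "'e dual \<Rightarrow> 'g \<times> 'e \<times> 'e dual \<times> 'e dual \<Rightarrow> 'g \<times> 'e \<times> 'e dual \<times> 'e dual" where
  "retract_map \<nu> p = level_map \<nu> (fst p, (fst (snd p), fst (snd (snd p))))"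

lemma retract_level: "p \<in> points (level \<nu>) \<Longrightarrow> retract_map \<nu> p = p"
  by (elim points_levelE) (simp add: retract_map_def level_map_def level_fiber_def)

lemma smooth_at_into_level:
  assumes L: "smooth_manifold L" and f: "smooth_at L GV f p" and fp: "fst (f p) \<in> carrier G"
  shows "smooth_at L (level \<nu>) (\<lambda>x. level_map \<nu> (f x)) p"
  unfolding level_def
  by (rule smooth_at_compose[OF L level_base image_mfd_smooth_manifold[OF level_base inj_on_level_map] f
        smooth_at_image[OF level_base inj_on_level_map]])
    (use fp in \<open>simp add: points_G mem_Times_iff\<close>)

lemma smooth_at_retract_map:
  assumes g: "g \<in> carrier G"
  shows "smooth_at (T1 G) (level \<nu>) (retract_map \<nu>) (g, w)"
proof -
  have A: "vsmooth (\<lambda>w. (fst w, fst (snd w))) w" by (intro vsmooth_Pair vsmooth_fst vsmooth_snd vsmooth_ident)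
  show ?thesis
    unfolding retract_map_def[abs_def]
    by (rule smooth_at_into_level[OF T1_manifold])
      (unfold T1_eq, rule smooth_at_GV_map[OF findim_edd findim_ed g A], simp add: g)
qed

lemma level_embedded: "embedded_submanifold (T1 G) (level \<nu>)"
  unfolding embedded_submanifold_def
proof (intro conjI ballI)
  show "smooth_manifold (level \<nu>)" by (rule level_manifold)
  show sub: "points (level \<nu>) \<subseteq> points (T1 G)" unfolding points_level_eq by blast
  show incl: "smooth_map (level \<nu>) (T1 G) id"
    unfolding smooth_map_iff_smooth_at[OF level_manifold T1_manifold] id_def using smooth_at_level_inclusion by blast
  have "smooth_map (T1 G) (level \<nu>) (retract_map \<nu>)"
    unfolding smooth_map_iff_smooth_at[OF T1_manifold level_manifold] points_T1 using smooth_at_retract_map by auto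
  then show "mtop (level \<nu>) = subtopology (mtop (T1 G)) (points (level \<nu>))"
    using incl retract_level unfolding smooth_map_def
    by (intro topology_eq_subtopology_if_retraction[where r = "retract_map \<nu>"]) blast+
  fix p assume p: "p \<in> points (level \<nu>)"
  obtain g w where gw: "p = (g, w)" "g \<in> carrier G" using subsetD[OF sub p] points_T1 by auto
  show "inj_on (tangent_map (level \<nu>) (T1 G) id p) (tangent_space (level \<nu>) p)"
    unfolding id_def
    by (rule tangent_map_inj_if_retraction[OF level_manifold T1_manifold smooth_at_level_inclusion[OF p], of "retract_map \<nu>"])
      (unfold gw(1), rule smooth_at_retract_map[OF gw(2)], rule retract_level)
qed

text \<open>Varying only the momentum component is a section of the momentum map through the given
  point.\<close>

lemma momentum_regular_value: "regular_value (T1 G) vec_mfd T1_momentum \<nu>"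
  unfolding regular_value_def
proof (intro ballI impI)
  fix p assume p: "p \<in> points (T1 G)" and \<nu>: "T1_momentum p = \<nu>"
  note V = vec_mfd_smooth_manifold[OF findim_d]
  obtain g \<xi> \<mu> where gw: "p = (g, \<xi>, \<mu>, \<nu>)" "g \<in> carrier G"
    using p \<nu> unfolding points_T1 by (cases p rule: prod_cases4) auto
  have s: "smooth_at vec_mfd (T1 G) (\<lambda>\<nu>. (g, \<xi>, \<mu>, \<nu>)) \<nu>"
    unfolding T1_eq
    by (intro smooth_at_Pair[OF V smooth_manifold_G vec_mfd_smooth_manifold[OF findim_edd]] gsmooth_const[OF findim_d gw(2)]
        vsmooth_Pair vsmooth_const vsmooth_ident)
  have "tangent_map (T1 G) vec_mfd T1_momentum p ` tangent_space (T1 G) p = tangent_space vec_mfd (T1_momentum p)"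
  proof (rule tangent_map_surj_if_section[OF T1_manifold V, where s = "\<lambda>\<nu>. (g, \<xi>, \<mu>, \<nu>)"])
    show "smooth_at (T1 G) vec_mfd T1_momentum p" unfolding gw(1) by (rule smooth_at_T1_momentum[OF gw(2)])
    show "smooth_at vec_mfd (T1 G) (\<lambda>\<nu>. (g, \<xi>, \<mu>, \<nu>)) (T1_momentum p)" unfolding \<nu> by (rule s)
    show "(g, \<xi>, \<mu>, T1_momentum p) = p" by (subst \<nu>) (rule gw(1)[symmetric])
  qed simp
  then show "tangent_map (T1 G) vec_mfd T1_momentum p ` tangent_space (T1 G) p = tangent_space vec_mfd \<nu>"
    by (simp only: \<nu>)
qed

lemma smooth_at_orbit_map: "p \<in> points (TG_dual G) \<Longrightarrow> smooth_at (TG_dual G) (reduced \<nu>) (orbit_map \<nu>) p"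
  unfolding reduced_def by (rule smooth_at_image[OF TG_manifold inj_on_orbit_map])

lemma smooth_at_orbit_inv: "p \<in> points (TG_dual G) \<Longrightarrow> smooth_at (reduced \<nu>) (TG_dual G) (orbit_inv \<nu>) (orbit_map \<nu> p)"
  unfolding reduced_def by (rule smooth_at_image_inv[OF TG_manifold inj_on_orbit_map])

lemma orbit_inv_orbit_map: "p \<in> points (TG_dual G) \<Longrightarrow> orbit_inv \<nu> (orbit_map \<nu> p) = p"
  by (rule inv_into_f_f[OF inj_on_orbit_map])

lemma shift_map_in: "p \<in> points (T1 G) \<Longrightarrow> shift_map p \<in> points (TG_dual G)"
  unfolding points_T1 points_TG by (auto simp: shift_map_def)

lemma level_momentum: "p \<in> points (level \<nu>) \<Longrightarrow> T1_momentum p = \<nu>"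
  and level_in_T1: "p \<in> points (level \<nu>) \<Longrightarrow> p \<in> points (T1 G)"
  unfolding points_level_eq by blast+

lemma smooth_at_shift_level:
  assumes p: "p \<in> points (level \<nu>)"
  shows "smooth_at (level \<nu>) (TG_dual G) shift_map p"
proof -
  obtain g w where gw: "p = (g, w)" "g \<in> carrier G" using level_in_T1[OF p] points_T1 by auto
  show ?thesis
    using smooth_at_compose[OF level_manifold T1_manifold TG_manifold smooth_at_level_inclusion[OF p], of shift_map]
      smooth_at_shift_map[OF gw(2), of w] gw(1) by simp
qed

lemma smooth_at_orbit:
  assumes p: "p \<in> points (level \<nu>)"
  shows "smooth_at (level \<nu>) (reduced \<nu>) (orbit act) p"
proof (rule smooth_at_cong[OF level_manifold reduced_manifold _ openin_topspace p])
  show "smooth_at (level \<nu>) (reduced \<nu>) (\<lambda>p. orbit_map \<nu> (shift_map p)) p"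
    by (rule smooth_at_compose[OF level_manifold TG_manifold reduced_manifold smooth_at_shift_level[OF p]
          smooth_at_orbit_map[OF shift_map_in[OF level_in_T1[OF p]]]])
  show "orbit act q = orbit_map \<nu> (shift_map q)" if "q \<in> points (level \<nu>)" for q
    by (rule orbit_eq_orbit_map[OF level_momentum[OF that]])
qed

lemma points_reduced_eq: "points (reduced \<nu>) = orbit act ` points (level \<nu>)"
proof
  show "orbit act ` points (level \<nu>) \<subseteq> points (reduced \<nu>)"
    using smooth_at_charts(2)[OF level_manifold reduced_manifold smooth_at_orbit] by blast
  show "points (reduced \<nu>) \<subseteq> orbit act ` points (level \<nu>)"
    unfolding points_reduced points_level
  proof safe
    fix g \<mu> assume g: "g \<in> carrier G"
    have "orbit_map \<nu> (g, \<mu>) = orbit act (level_map \<nu> (g, (0, \<mu>)))"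
      by (simp add: orbit_map_def level_map_def level_fiber_def)
    then show "orbit_map \<nu> (g, \<mu>) \<in> orbit act ` level_map \<nu> ` (carrier G \<times> UNIV)" using g by auto
  qed
qed

text \<open>Surjectivity of the tangent map at each point comes from a section of the orbit
  projection through that point.\<close>

lemma orbit_submersion: "submersion (level \<nu>) (reduced \<nu>) (orbit act)"
  unfolding submersion_def
proof (intro conjI ballI)
  show "smooth_map (level \<nu>) (reduced \<nu>) (orbit act)"
    unfolding smooth_map_iff_smooth_at[OF level_manifold reduced_manifold] using smooth_at_orbit by blast
  fix p assume p: "p \<in> points (level \<nu>)"
  obtain g \<xi> \<mu> where gw: "p = (g, \<xi>, \<mu>, \<nu>)" "g \<in> carrier G"
    using level_in_T1[OF p] level_momentum[OF p] unfolding points_T1 by (cases p rule: prod_cases4) auto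
  \<comment> \<open>The section keeps the value \<open>\<xi>\<close> of the given point, instead of
    0 as in the slice, so that it passes through that point.\<close>
  define s where "s = (\<lambda>q. level_map \<nu> (fst (orbit_inv \<nu> q), (\<xi>, snd (orbit_inv \<nu> q) + ad \<xi> \<nu>)))"
  have op: "orbit act p = orbit_map \<nu> (g, \<mu> - ad \<xi> \<nu>)"
    unfolding orbit_eq_orbit_map[OF level_momentum[OF p]] by (simp add: gw shift_map_def shift_fiber_def)
  have inTG: "(h, \<mu>') \<in> points (TG_dual G)" if "h \<in> carrier G" for h \<mu>' using that by (simp add: points_TG)
  have s_orbit: "s (orbit_map \<nu> (h, \<mu>')) = (h, \<xi>, \<mu>' + ad \<xi> \<nu>, \<nu>)" if h: "h \<in> carrier G" for h \<mu>'
    unfolding s_def orbit_inv_orbit_map[OF inTG[OF h]] by (simp add: level_map_def level_fiber_def)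
  show "tangent_map (level \<nu>) (reduced \<nu>) (orbit act) p ` tangent_space (level \<nu>) p = tangent_space (reduced \<nu>) (orbit act p)"
  proof (rule tangent_map_surj_if_section[OF level_manifold reduced_manifold smooth_at_orbit[OF p], where s = s])
    show "s (orbit act p) = p" by (subst op) (simp only: s_orbit[OF gw(2)] gw(1) diff_add_cancel)
    show "orbit act (s q) = q" if qr: "q \<in> points (reduced \<nu>)" for q
    proof -
      obtain h \<mu>' where q: "q = orbit_map \<nu> (h, \<mu>')" "h \<in> carrier G" using qr unfolding points_reduced by auto
      show ?thesis unfolding q(1) s_orbit[OF q(2)]
        by (subst orbit_eq_orbit_map[of _ \<nu>]) (simp_all add: shift_map_def shift_fiber_def)
    qed
    have A: "vsmooth (\<lambda>m. (\<xi>, m + ad \<xi> \<nu>)) (\<mu> - ad \<xi> \<nu>)" by (intro vsmooth_Pair vsmooth_add vsmooth_const vsmooth_ident)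
    have B: "smooth_at (TG_dual G) GV (\<lambda>p. (fst p, (\<xi>, snd p + ad \<xi> \<nu>))) (g, \<mu> - ad \<xi> \<nu>)"
      unfolding TG_eq by (rule smooth_at_GV_map[OF findim_d findim_ed gw(2) A])
    have C: "smooth_at (reduced \<nu>) GV (\<lambda>q. (fst (orbit_inv \<nu> q), (\<xi>, snd (orbit_inv \<nu> q) + ad \<xi> \<nu>))) (orbit_map \<nu> (g, \<mu> - ad \<xi> \<nu>))"
      by (rule smooth_at_compose[OF reduced_manifold TG_manifold level_base smooth_at_orbit_inv[OF inTG[OF gw(2)]]])
        (unfold orbit_inv_orbit_map[OF inTG[OF gw(2)]], rule B)
    show "smooth_at (reduced \<nu>) (level \<nu>) s (orbit act p)"
      unfolding op s_def
      by (rule smooth_at_into_level[OF reduced_manifold C])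
        (unfold orbit_inv_orbit_map[OF inTG[OF gw(2)]], simp add: gw(2))
  qed
qed

text \<open>The inclusion factors through the parametrization \<open>level_map\<close>, whose
  constant momentum component has derivative zero; hence the last component is 0.\<close>

lemma tangent_level_inclusion:
  assumes g: "g \<in> carrier G" and v: "v \<in> tangent_space (level \<nu>) (level_map \<nu> (g, \<xi>, \<mu>))"
  obtains \<eta> z m where "tangent_map (level \<nu>) (T1 G) (\<lambda>p. p) (level_map \<nu> (g, \<xi>, \<mu>)) v = gvec g (\<xi>, \<mu>, \<nu>) \<eta> (z, m, 0)"
proof -
  let ?p = "level_map \<nu> (g, \<xi>, \<mu>)"
  have p: "?p \<in> points (level \<nu>)" unfolding points_level using g by auto
  have "tangent_map (level \<nu>) (T1 G) (\<lambda>p. p) ?p v = tangent_map (level \<nu>) (T1 G) (\<lambda>p. level_map \<nu> (level_inv \<nu> p)) ?p v"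
    by (rule tangent_map_cong[OF level_manifold T1_manifold smooth_at_level_inclusion[OF p] openin_topspace p
          level_map_level_inv[symmetric] v, symmetric])
  also have "\<dots> = tangent_map GV (T1 G) (level_map \<nu>) (level_inv \<nu> ?p) (tangent_map (level \<nu>) GV (level_inv \<nu>) ?p v)"
    by (rule tangent_map_compose[OF level_manifold level_base T1_manifold smooth_at_level_inv[OF g] _ v, symmetric])
      (unfold level_inv_level_map[OF g], rule smooth_at_level_map[OF g])
  finally have 1: "tangent_map (level \<nu>) (T1 G) (\<lambda>p. p) ?p v
    = tangent_map GV (T1 G) (level_map \<nu>) (g, \<xi>, \<mu>) (tangent_map (level \<nu>) GV (level_inv \<nu>) ?p v)"
    unfolding level_inv_level_map[OF g] .
  have "tangent_map (level \<nu>) GV (level_inv \<nu>) ?p v \<in> tangent_space GV (g, \<xi>, \<mu>)"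
    using tangent_map_in_tangent_space[OF level_manifold level_base smooth_at_level_inv[OF g] v]
    unfolding level_inv_level_map[OF g] .
  then obtain \<eta> z where z: "tangent_map (level \<nu>) GV (level_inv \<nu>) ?p v = gvec g (\<xi>, \<mu>) \<eta> z"
    using gvecE[OF findim_ed _ g] by metis
  have "tangent_map GV (T1 G) (level_map \<nu>) (g, \<xi>, \<mu>) (gvec g (\<xi>, \<mu>) \<eta> z) = gvec g (\<xi>, \<mu>, \<nu>) \<eta> (fst z, snd z, 0)"
    unfolding level_map_def T1_eq tangent_GV_map[OF findim_ed findim_edd g vsmooth_level_fiber]
    using D_level_fiber[of \<nu> "(\<xi>, \<mu>)" "fst z" "snd z"] by (simp add: level_fiber_def)
  then show thesis using that 1 z by simp
qed

text \<open>The algebraic core of the reduction. In the shifted covectors \<open>ad z \<nu>\<close>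
  and its counterpart yield the terms with brackets of \<open>z\<close> and \<open>z'\<close>, while
  the shift of the base point by \<open>ad \<xi> \<nu>\<close> yields the double bracket.\<close>

lemma shift_map_beta:
  "TG_beta (shift_fiber (\<xi>, \<mu>, \<nu>)) (\<eta>, D shift_fiber (\<xi>, \<mu>, \<nu>) (z, m, 0)) (\<eta>', D shift_fiber (\<xi>, \<mu>, \<nu>) (z', m', 0))
   = T1_beta (\<xi>, \<mu>, \<nu>) (\<eta>, z, m, 0) (\<eta>', z', m', 0)"
  unfolding D_shift_fiber by (simp add: shift_fiber_def ad_simps blinfun.bilinear_simps)

text \<open>On the level set the projection followed by \<open>orbit_inv\<close> is the shift map.
  By the chain rule the projected vectors are therefore the images under the shift of vectors
  included in the large space, where the two bilinear forms agree.\<close>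

lemma orbit_pulls_back:
  "pulls_back_to (level \<nu>) (reduced \<nu>) (orbit act) (reduced_form \<nu>)
     (\<lambda>p v w. T1_form G c\<^sub>0 p (tangent_map (level \<nu>) (T1 G) id p v) (tangent_map (level \<nu>) (T1 G) id p w))"
  unfolding pulls_back_to_def id_def
proof (intro ballI)
  fix p v v' assume p: "p \<in> points (level \<nu>)" and v: "v \<in> tangent_space (level \<nu>) p" and v': "v' \<in> tangent_space (level \<nu>) p"
  obtain g w where "p = level_map \<nu> (g, w)" and g: "g \<in> carrier G" using points_levelE[OF p] by metis
  then obtain \<xi> \<mu> where pl: "p = level_map \<nu> (g, \<xi>, \<mu>)" by (cases w) auto
  then have pe: "p = (g, \<xi>, \<mu>, \<nu>)" by (simp add: level_map_def level_fiber_def)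
  note op = orbit_eq_orbit_map[OF level_momentum]
  note sp = shift_map_in[OF level_in_T1[OF p]]
  have oi: "orbit_inv \<nu> (orbit act q) = shift_map q" if "q \<in> points (level \<nu>)" for q
    unfolding op[OF that] by (rule orbit_inv_orbit_map[OF shift_map_in[OF level_in_T1[OF that]]])
  have so: "smooth_at (reduced \<nu>) (TG_dual G) (orbit_inv \<nu>) (orbit act p)"
    unfolding op[OF p] by (rule smooth_at_orbit_inv[OF sp])
  have T: "tangent_map (reduced \<nu>) (TG_dual G) (orbit_inv \<nu>) (orbit act p) (tangent_map (level \<nu>) (reduced \<nu>) (orbit act) p v)
     = tangent_map (T1 G) (TG_dual G) shift_map p (tangent_map (level \<nu>) (T1 G) (\<lambda>p. p) p v)"
    if v: "v \<in> tangent_space (level \<nu>) p" for v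
  proof -
    have "tangent_map (reduced \<nu>) (TG_dual G) (orbit_inv \<nu>) (orbit act p) (tangent_map (level \<nu>) (reduced \<nu>) (orbit act) p v)
      = tangent_map (level \<nu>) (TG_dual G) (\<lambda>q. orbit_inv \<nu> (orbit act q)) p v"
      by (rule tangent_map_compose[OF level_manifold reduced_manifold TG_manifold smooth_at_orbit[OF p] so v])
    also have "\<dots> = tangent_map (level \<nu>) (TG_dual G) shift_map p v"
      by (rule tangent_map_cong[OF level_manifold TG_manifold smooth_at_shift_level[OF p] openin_topspace p oi[symmetric] v])
    also have "\<dots> = tangent_map (T1 G) (TG_dual G) shift_map p (tangent_map (level \<nu>) (T1 G) (\<lambda>p. p) p v)"
      by (rule tangent_map_compose[OF level_manifold T1_manifold TG_manifold smooth_at_level_inclusion[OF p] _ v, symmetric])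
        (unfold pe, rule smooth_at_shift_map[OF g])
    finally show ?thesis .
  qed
  obtain \<eta> z m where V: "tangent_map (level \<nu>) (T1 G) (\<lambda>p. p) p v = gvec g (\<xi>, \<mu>, \<nu>) \<eta> (z, m, 0)"
    using tangent_level_inclusion[OF g v[unfolded pl]] unfolding pl by metis
  obtain \<eta>' z' m' where V': "tangent_map (level \<nu>) (T1 G) (\<lambda>p. p) p v' = gvec g (\<xi>, \<mu>, \<nu>) \<eta>' (z', m', 0)"
    using tangent_level_inclusion[OF g v'[unfolded pl]] unfolding pl by metis
  have S: "tangent_map (T1 G) (TG_dual G) shift_map p (gvec g (\<xi>, \<mu>, \<nu>) \<eta> k)
      = gvec g (shift_fiber (\<xi>, \<mu>, \<nu>)) \<eta> (D shift_fiber (\<xi>, \<mu>, \<nu>) k)" for \<eta> k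
    unfolding shift_map_def T1_eq TG_eq pe by (rule tangent_GV_map[OF findim_edd findim_d g vsmooth_shift_fiber])
  have sm: "shift_map p = (g, shift_fiber (\<xi>, \<mu>, \<nu>))" by (simp add: shift_map_def pe)
  show "reduced_form \<nu> (orbit act p) (tangent_map (level \<nu>) (reduced \<nu>) (orbit act) p v) (tangent_map (level \<nu>) (reduced \<nu>) (orbit act) p v')
    = T1_form G c\<^sub>0 p (tangent_map (level \<nu>) (T1 G) (\<lambda>p. p) p v) (tangent_map (level \<nu>) (T1 G) (\<lambda>p. p) p v')"
    unfolding reduced_form_def T[OF v] T[OF v'] oi[OF p] V V' S sm TG_form_gvec[OF g] shift_map_beta
    unfolding pe T1_form_gvec[OF g] ..
qed

lemma reduced_symplectic: "symplectic_manifold (reduced \<nu>) (reduced_form \<nu>)"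
  unfolding reduced_form_def reduced_def
  by (rule image_mfd_symplectic[OF TG_manifold inj_on_orbit_map TG_symplectic])

lemma reduced_symplectomorphic: "symplectomorphic (reduced \<nu>) (reduced_form \<nu>) (TG_dual G) (TG_dual_form G c\<^sub>0)"
  unfolding symplectomorphic_def
proof (intro exI[of _ "orbit_inv \<nu>"] conjI)
  show "diffeomorphism (reduced \<nu>) (TG_dual G) (orbit_inv \<nu>)"
    unfolding reduced_def by (rule image_mfd_diffeomorphism[OF TG_manifold inj_on_orbit_map])
  show "pulls_back_to (reduced \<nu>) (TG_dual G) (orbit_inv \<nu>) (TG_dual_form G c\<^sub>0) (reduced_form \<nu>)"
    unfolding pulls_back_to_def reduced_form_def by blast
qed

lemma T1_reduction:
  "marsden_weinstein_reduction (T1 G) (T1_form G c\<^sub>0) act T1_momentum \<nu> (level \<nu>) (reduced \<nu>) (reduced_form \<nu>)"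
  unfolding marsden_weinstein_reduction_def
  using momentum_regular_value level_embedded points_level_eq reduced_symplectic points_reduced_eq orbit_submersion orbit_pulls_back
  by blast

end

theorem mainTheorem7:
  fixes G :: "('g, 'e::real_normed_vector) lie_group_data"
    and c\<^sub>0 :: "('g, 'e) chart"
  assumes "lie_group G"
    and "c\<^sub>0 \<in> charts_at (mfd G) \<one>\<^bsub>G\<^esub>"
  shows "symplectic_manifold (T1 G) (T1_form G c\<^sub>0) \<and>
         symplectic_action (T1 G) (T1_form G c\<^sub>0) (T1_action G c\<^sub>0) \<and>
         momentum_map (T1 G) (T1_form G c\<^sub>0) (T1_action G c\<^sub>0) T1_momentum \<and>
         (\<forall>\<nu>. \<exists>(N :: ('g \<times> 'e \<times> ('e \<Rightarrow>\<^sub>L real) \<times> ('e \<Rightarrow>\<^sub>L real),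
                  'e \<times> 'e \<times> ('e \<Rightarrow>\<^sub>L real)) manifold)
              (P :: (('g \<times> 'e \<times> ('e \<Rightarrow>\<^sub>L real) \<times> ('e \<Rightarrow>\<^sub>L real)) set,
                  'e \<times> ('e \<Rightarrow>\<^sub>L real)) manifold) \<omega>.
           marsden_weinstein_reduction (T1 G) (T1_form G c\<^sub>0) (T1_action G c\<^sub>0) T1_momentum \<nu> N P \<omega> \<and>
           symplectomorphic P \<omega> (TG_dual G) (TG_dual_form G c\<^sub>0))"
  proof -
  interpret lie_group_chart G c\<^sub>0
  proof (intro lie_group_chart.intro lie_group_chart_axioms.intro assms)
    show "group G" using assms(1) by (simp add: lie_group_def)
  qed
  show ?thesis
    using T1_symplectic T1_symplectic_action T1_momentum_map T1_reduction reduced_symplectomorphic by blast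
qed

end
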